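(* Consider the problem $$-\left(\varphi_p(u')\right)'+q(x)\varphi_p(u)=\lambda m(x)\varphi_p(u)+g(x,u,\lambda),\quad 0<x<T,\qquad u(0)=u(T),\ u'(0)=u'(T),\qquad (B)$$ where $g:[0,T]\times\mathbb{R}^2\to\mathbb{R}$ is continuous, $g(x,s,0)\equiv0$, and $$\lim_{s\to0}\frac{g(x,s,\lambda)}{|s|^{p-1}}=0$$ uniformly for $x\in[0,T]$ and $\lambda$ in bounded sets. Let $\nu\in\{+,-\}$ and let $\mathscr{C}_\nu$ be the bifurcation branch of (B) emanating from $(\lambda_0^\nu,0)$. Then there are two distinct unbounded sub-continua $\mathscr{C}_\nu^+$ and $\mathscr{C}_\nu^-$ of solutions to (B), which together make up $\mathscr{C}_\nu$ (i.e. $\mathscr{C}_\nu=\mathscr{C}_\nu^+\cup\mathscr{C}_\nu^-$), and $$\mathscr{C}_\nu^\sigma\subset K^\sigma\cup\{(\lambda_0^\nu,0)\}\qquad\text{for }\sigma\in\{+,-\}.$$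
   Context: Here $T>0$, $1<p<+\infty$, $\varphi_p(s)=|s|^{p-2}s$ (with $\varphi_p(0)=0$), $q\in C([0,T];[0,+\infty))$ with $q\not\equiv0$, and $m:[0,T]\to\mathbb{R}$ is a continuous sign-changing weight (it takes both positive and negative values). $X=W_T^{1,p}(0,T)=\{u\in W^{1,p}(0,T)\mid u(0)=u(T)\}$ with norm $\|u\|=(\int_0^T(|u'|^p+q|u|^p)\,dx)^{1/p}$. $\lambda_0^+=\inf\{\|u\|^p\mid u\in X,\ \int_0^T m|u|^p\,dx=1\}>0$ and $\lambda_0^-=\max\{-\|u\|^p\mid u\in X,\ \int_0^T -m|u|^p\,dx=1\}<0$ are the smallest positive and the largest negative eigenvalue of $-(\varphi_p(u'))'+q\varphi_p(u)=\lambda m\varphi_p(u)$ with the same periodic boundary conditions. A solution of (B) is a pair $(\lambda,u)\in\mathbb{R}\times X$; it is nontrivial if $u\not\equiv0$. $P^+$ is the set of functions in $X$ that are positive on $[0,T]$, $P^-=-P^+$, $K^\pm=\mathbb{R}\times P^\pm$. A continuum is a closed connected subset of $\mathbb{R}\times X$. The bifurcation branch $\mathscr{C}_\nu$ is the connected component containing $(\lambda_0^\nu,0)$ of the closure in $\mathbb{R}\times X$ of the set of nontrivial solutions of (B). *)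

theory Defs
  imports "HOL-Analysis.Analysis"
begin

definition phi :: "real \<Rightarrow> real \<Rightarrow> real" where
  "phi p s = \<bar>s\<bar> powr (p - 2) * s"

definition Lp_space :: "real \<Rightarrow> real \<Rightarrow> (real \<Rightarrow> real) set" where
  "Lp_space T p = {w. w \<in> borel_measurable (lebesgue_on {0..T}) \<and>
     integrable (lebesgue_on {0..T}) (\<lambda>x. \<bar>w x\<bar> powr p)}"

text \<open>The test functions are the continuously differentiable functions with compact
  support in the open interval.\<close>

definition test_functions :: "real \<Rightarrow> (real \<Rightarrow> real) set" where
  "test_functions T = {f. f C1_differentiable_on UNIV \<and>
     (\<exists>C. compact C \<and> C \<subseteq> {0<..<T} \<and> (\<forall>x. x \<notin> C \<longrightarrow> f x = 0))}"

definition is_weak_deriv :: "real \<Rightarrow> (real \<Rightarrow> real) \<Rightarrow> (real \<Rightarrow> real) \<Rightarrow> bool" where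
  "is_weak_deriv T u w \<longleftrightarrow> (\<forall>f \<in> test_functions T.
     (LINT x|lebesgue_on {0..T}. u x * deriv f x) = - (LINT x|lebesgue_on {0..T}. w x * f x))"

text \<open>An element of the Sobolev space is represented by its continuous representative on
  the closed interval, extended by 0 to the real line. In this way distinct functions are
  distinct elements, and the boundary values are meaningful.\<close>

definition W1p :: "real \<Rightarrow> real \<Rightarrow> (real \<Rightarrow> real) set" where
  "W1p T p = {u. continuous_on {0..T} u \<and> (\<forall>x. x \<notin> {0..T} \<longrightarrow> u x = 0) \<and>
     u \<in> Lp_space T p \<and> (\<exists>w \<in> Lp_space T p. is_weak_deriv T u w)}"

definition X_space :: "real \<Rightarrow> real \<Rightarrow> (real \<Rightarrow> real) set" where
  "X_space T p = {u \<in> W1p T p. u 0 = u T}"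

text \<open>The weak derivative is unique only up to a null set; it is used under integrals only.\<close>

definition weak_deriv :: "real \<Rightarrow> real \<Rightarrow> (real \<Rightarrow> real) \<Rightarrow> real \<Rightarrow> real" where
  "weak_deriv T p u = (SOME w. w \<in> Lp_space T p \<and> is_weak_deriv T u w)"

definition X_norm :: "real \<Rightarrow> real \<Rightarrow> (real \<Rightarrow> real) \<Rightarrow> (real \<Rightarrow> real) \<Rightarrow> real" where
  "X_norm T p q u = (LINT x|lebesgue_on {0..T}.
     \<bar>weak_deriv T p u x\<bar> powr p + q x * \<bar>u x\<bar> powr p) powr (1 / p)"

definition X_dist ::
  "real \<Rightarrow> real \<Rightarrow> (real \<Rightarrow> real) \<Rightarrow> (real \<Rightarrow> real) \<Rightarrow> (real \<Rightarrow> real) \<Rightarrow> real" where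
  "X_dist T p q u v = X_norm T p q (\<lambda>x. u x - v x)"

abbreviation RX_space :: "real \<Rightarrow> real \<Rightarrow> (real \<times> (real \<Rightarrow> real)) set" where
  "RX_space T p \<equiv> UNIV \<times> X_space T p"

abbreviation RX_dist :: "real \<Rightarrow> real \<Rightarrow> (real \<Rightarrow> real) \<Rightarrow>
    real \<times> (real \<Rightarrow> real) \<Rightarrow> real \<times> (real \<Rightarrow> real) \<Rightarrow> real" where
  "RX_dist T p q \<equiv> prod_dist dist (X_dist T p q)"

definition RX_topology ::
  "real \<Rightarrow> real \<Rightarrow> (real \<Rightarrow> real) \<Rightarrow> (real \<times> (real \<Rightarrow> real)) topology" where
  "RX_topology T p q = Metric_space.mtopology (RX_space T p) (RX_dist T p q)"

definition RX_bounded ::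
  "real \<Rightarrow> real \<Rightarrow> (real \<Rightarrow> real) \<Rightarrow> (real \<times> (real \<Rightarrow> real)) set \<Rightarrow> bool" where
  "RX_bounded T p q = Metric_space.mbounded (RX_space T p) (RX_dist T p q)"

datatype sign = Plus | Minus

text \<open>The second clause is a maximum, hence \<open>GREATEST\<close> and not \<open>Sup\<close>.\<close>

fun lambda0 :: "real \<Rightarrow> real \<Rightarrow> (real \<Rightarrow> real) \<Rightarrow> (real \<Rightarrow> real) \<Rightarrow> sign \<Rightarrow> real" where
  "lambda0 T p q m Plus = Inf {X_norm T p q u powr p | u.
     u \<in> X_space T p \<and> (LINT x|lebesgue_on {0..T}. m x * \<bar>u x\<bar> powr p) = 1}"
| "lambda0 T p q m Minus = (GREATEST l. l \<in> {- (X_norm T p q u powr p) | u.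
     u \<in> X_space T p \<and> (LINT x|lebesgue_on {0..T}. - m x * \<bar>u x\<bar> powr p) = 1})"

definition positive_functions :: "real \<Rightarrow> real \<Rightarrow> (real \<Rightarrow> real) set" where
  "positive_functions T p = {u \<in> X_space T p. \<forall>x \<in> {0..T}. u x > 0}"

fun P_cone :: "real \<Rightarrow> real \<Rightarrow> sign \<Rightarrow> (real \<Rightarrow> real) set" where
  "P_cone T p Plus = positive_functions T p"
| "P_cone T p Minus = {(\<lambda>x. - u x) | u. u \<in> positive_functions T p}"

definition K_cone :: "real \<Rightarrow> real \<Rightarrow> sign \<Rightarrow> (real \<times> (real \<Rightarrow> real)) set" where
  "K_cone T p \<sigma> = UNIV \<times> P_cone T p \<sigma>"

text \<open>Here \<open>v\<close> is the classical derivative of \<open>u\<close>, one-sided at the end points.\<close>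

definition solutions :: "real \<Rightarrow> real \<Rightarrow> (real \<Rightarrow> real) \<Rightarrow> (real \<Rightarrow> real) \<Rightarrow>
    (real \<Rightarrow> real \<Rightarrow> real \<Rightarrow> real) \<Rightarrow> (real \<times> (real \<Rightarrow> real)) set" where
  "solutions T p q m g = {(l, u). u \<in> X_space T p \<and>
     (\<exists>v. (\<forall>x \<in> {0..T}. (u has_real_derivative v x) (at x within {0..T})) \<and>
          u 0 = u T \<and> v 0 = v T \<and>
          (\<forall>x \<in> {0<..<T}. \<exists>D. ((\<lambda>y. phi p (v y)) has_real_derivative D) (at x) \<and>
             - D + q x * phi p (u x) = l * m x * phi p (u x) + g x (u x) l))}"

definition nontrivial_solutions :: "real \<Rightarrow> real \<Rightarrow> (real \<Rightarrow> real) \<Rightarrow> (real \<Rightarrow> real) \<Rightarrow>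
    (real \<Rightarrow> real \<Rightarrow> real \<Rightarrow> real) \<Rightarrow> (real \<times> (real \<Rightarrow> real)) set" where
  "nontrivial_solutions T p q m g = {(l, u) \<in> solutions T p q m g. u \<noteq> (\<lambda>_. 0)}"

definition branch :: "real \<Rightarrow> real \<Rightarrow> (real \<Rightarrow> real) \<Rightarrow> (real \<Rightarrow> real) \<Rightarrow>
    (real \<Rightarrow> real \<Rightarrow> real \<Rightarrow> real) \<Rightarrow> sign \<Rightarrow> (real \<times> (real \<Rightarrow> real)) set" where
  "branch T p q m g \<nu> = connected_component_of_set
     (subtopology (RX_topology T p q)
        (RX_topology T p q closure_of nontrivial_solutions T p q m g))
     (lambda0 T p q m \<nu>, \<lambda>_. 0)"

definition continuum :: "real \<Rightarrow> real \<Rightarrow> (real \<Rightarrow> real) \<Rightarrow> (real \<times> (real \<Rightarrow> real)) set \<Rightarrow> bool" where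
  "continuum T p q C \<longleftrightarrow> closedin (RX_topology T p q) C \<and> connectedin (RX_topology T p q) C"

end

theory Submission
  imports Defs "HOL-Complex_Analysis.Great_Picard"
begin

text \<open>No degree theory is used: the signed branches are obtained from Schauder's theorem.
  Write the equation as a first-order system for \<open>u\<close> and the flux \<open>phi p u'\<close>. The principal eigenvalue
  \<open>\<mu>\<close> is found as a limit of positive solutions of perturbed problems, and Picone's identity shows that
  it is simple, is the only eigenvalue \<open>\<ge> 0\<close> with a positive eigenfunction, and equals \<open>lambda0\<close>.
  Hence the set \<open>P\<close> consisting of \<open>(\<mu>, 0)\<close> and the positive solutions with \<open>l > 0\<close> is closed; there is
  no nontrivial solution with \<open>l = 0\<close>.

  Suppose the component of \<open>(\<mu>, 0)\<close> in \<open>P\<close> is bounded. Bounded sets of solutions being relatively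
  compact, \<open>P\<close> splits into a bounded piece containing \<open>(\<mu>, 0)\<close> and a closed rest. Let \<open>\<tau>\<close> be a large
  constant \<open>\<Lambda>\<close> on this piece and on \<open>[0, \<mu>] \<times> {0}\<close>, and \<open>0\<close> on the rest and for large \<open>u\<close>. By Schauder's
  theorem the problem with \<open>l = \<tau> (l, u)\<close>, truncated and perturbed by a small positive constant, has
  positive solutions. Their limit is a solution lying neither in the piece, nor in the rest, nor on
  the trivial line: at \<open>u = 0\<close> Picone's identity forces \<open>l \<le> \<mu>\<close>, where \<open>\<tau> = \<Lambda> > \<mu>\<close>.

  The negative solutions are the positive ones for \<open>- g x (- s) l\<close>. All other nontrivial solutions stay
  away from both sets, so these two sets carry the whole branch, and they meet only in \<open>(\<mu>, 0)\<close>.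
  The case of \<open>lambda0 Minus\<close> follows by the substitution \<open>l \<mapsto> - l\<close>, \<open>m \<mapsto> - m\<close>.\<close>

section \<open>The power function and its inverse\<close>

text \<open>The equation is homogeneous of degree p - 1 at 0 but not linear, so linearising at
  \<open>(\<mu>, 0)\<close> is no option; Picone's identity, which needs only that one solution is
  positive, takes the place of the linear theory. Degree is replaced by making the parameter an
  unknown of the fixed point problem, tied to \<open>u\<close> by \<open>l = \<tau> (l, u)\<close>.
  Such a coupled problem is solvable for every continuous bounded \<open>\<tau>\<close>, so a
  well-chosen \<open>\<tau>\<close> refutes a bounded component: on the piece \<open>l\<close> would
  be \<open>\<Lambda>\<close>, above every parameter value found there; on the rest it would be 0,
  where \<open>g\<close> vanishes and \<open>q\<close> admits only the zero solution. The zero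
  function solves the unperturbed equation for every \<open>l\<close>. The small constant pushes the
  approximations off it, and it enters Picone's identity with the favourable sign, so upper bounds
  for \<open>l\<close> pass to the limit. The same device, with a linear right-hand side and a
  \<open>\<tau>\<close> that decreases in the norm of \<open>u\<close>, produces
  \<open>\<mu>\<close> itself; the upper bound for \<open>l\<close> that it needs comes from
  Picone's identity on an interval where \<open>m > 0\<close>.\<close>

definition conj_exp :: "real \<Rightarrow> real" where
  "conj_exp p = p / (p - 1)"

lemma conj_exp_gt_1: "p > 1 \<Longrightarrow> conj_exp p > 1"
  by (simp add: conj_exp_def)

lemma conj_exp_minus_1: "p > 1 \<Longrightarrow> conj_exp p - 1 = 1 / (p - 1)"
  by (simp add: conj_exp_def field_simps)

lemma conj_exp_conj_exp: "p > 1 \<Longrightarrow> conj_exp (conj_exp p) = p"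
  by (simp add: conj_exp_def field_simps)

text \<open>Here the exponent is positive as soon as \<open>p > 1\<close>, whereas the factor with
  exponent \<open>p - 2\<close> in the definition is unbounded near 0 when \<open>p < 2\<close>.
  Continuity and estimates at 0 are read off from this form.\<close>

lemma phi_eq_sgn: "phi p s = sgn s * \<bar>s\<bar> powr (p - 1)"
proof (cases "s = 0")
  case False
  have "\<bar>s\<bar> powr (p - 1) = \<bar>s\<bar> powr (p - 2) * \<bar>s\<bar>"
    using False powr_add[of "\<bar>s\<bar>" "p - 2" 1] by simp
  then show ?thesis
    by (simp add: phi_def mult.assoc mult.commute[of "sgn s"] mult_sgn_abs abs_mult_sgn)
qed (simp add: phi_def)

lemma phi_0 [simp]: "phi p 0 = 0"
  by (simp add: phi_def)

lemma phi_minus [simp]: "phi p (- s) = - phi p s"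
  by (simp add: phi_def)

lemma phi_nonneg_eq: "s \<ge> 0 \<Longrightarrow> phi p s = s powr (p - 1)"
  by (cases "s = 0") (auto simp: phi_eq_sgn)

lemma abs_phi: "\<bar>phi p s\<bar> = \<bar>s\<bar> powr (p - 1)"
  by (cases "s = 0") (auto simp: phi_eq_sgn abs_mult)

lemma sgn_phi [simp]: "sgn (phi p s) = sgn s"
  by (cases "s = 0") (auto simp: phi_eq_sgn sgn_mult)

lemma phi_eq_0_iff [simp]: "phi p s = 0 \<longleftrightarrow> s = 0"
  by (metis sgn_phi sgn_zero_iff)

lemma phi_pos_iff [simp]: "phi p s > 0 \<longleftrightarrow> s > 0"
  by (metis sgn_phi sgn_1_pos)

lemma phi_neg_iff [simp]: "phi p s < 0 \<longleftrightarrow> s < 0"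
  by (metis sgn_phi sgn_1_neg)

lemma phi_nonneg_iff [simp]: "phi p s \<ge> 0 \<longleftrightarrow> s \<ge> 0"
  by (meson not_less phi_neg_iff)

lemma phi_mult: "phi p (a * b) = phi p a * phi p b"
  by (simp add: phi_eq_sgn sgn_mult abs_mult powr_mult algebra_simps)

lemma phi_inverse: "phi p (inverse a) = inverse (phi p a)"
  by (cases "a = 0") (auto simp: phi_eq_sgn powr_minus inverse_powr sgn_if)

lemma phi_divide: "phi p (a / b) = phi p a / phi p b"
  by (simp add: divide_inverse phi_mult phi_inverse)

lemma phi_mult_self: "phi p s * s = \<bar>s\<bar> powr p"
proof (cases "s = 0")
  case False
  have "phi p s * s = \<bar>s\<bar> powr (p - 1) * \<bar>s\<bar>"
    by (simp add: phi_eq_sgn sgn_if)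
  also have "\<dots> = \<bar>s\<bar> powr p"
    using False powr_add[of "\<bar>s\<bar>" "p - 1" 1] by simp
  finally show ?thesis .
qed simp

text \<open>Lets the flux \<open>V = phi p u'\<close> be solved for \<open>u'\<close>, which is how
  the second-order equation becomes a first-order system.\<close>

lemma phi_conj_phi [simp]:
  assumes "p > 1"
  shows "phi (conj_exp p) (phi p s) = s"
proof (cases "s = 0")
  case False
  then show ?thesis
    using assms
    by (subst phi_eq_sgn) (simp add: abs_phi powr_powr conj_exp_minus_1 sgn_mult_abs)
qed simp

lemma phi_phi_conj [simp]:
  assumes "p > 1"
  shows "phi p (phi (conj_exp p) s) = s"
  by (metis assms conj_exp_conj_exp conj_exp_gt_1 phi_conj_phi)

lemma phi_strict_mono:
  assumes "p > 1" "a < b"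
  shows "phi p a < phi p b"
proof -
  consider "0 \<le> a" | "a < 0" "0 \<le> b" | "b < 0"
    using assms by linarith
  then show ?thesis
  proof cases
    case 1
    then show ?thesis
      using assms by (simp add: phi_nonneg_eq powr_less_mono2)
  next
    case 2
    then show ?thesis
      by (meson less_le_trans phi_neg_iff phi_nonneg_iff)
  next
    case 3
    then have "phi p (- b) < phi p (- a)"
      using assms by (simp only: phi_nonneg_eq powr_less_mono2)
    then show ?thesis
      by simp
  qed
qed

lemma abs_phi_mono: "p > 1 \<Longrightarrow> \<bar>a\<bar> \<le> b \<Longrightarrow> \<bar>phi p a\<bar> \<le> phi p b"
  by (simp add: abs_phi phi_nonneg_eq powr_mono2)

lemma continuous_on_phi_UNIV:
  assumes "p > 1"
  shows "continuous_on UNIV (phi p)"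
proof -
  have "isCont (phi p) s" for s
  proof (cases "s = 0")
    case True
    have "isCont (\<lambda>s::real. \<bar>s\<bar> powr (p - 1)) 0"
      using assms by (intro continuous_intros) auto
    then have "((\<lambda>s. \<bar>phi p s\<bar>) \<longlongrightarrow> 0) (at 0)"
      using assms by (simp add: abs_phi isCont_def)
    then show ?thesis
      using True by (simp add: isCont_def tendsto_rabs_zero_iff)
  next
    case False
    then show ?thesis
      unfolding phi_def by (intro continuous_intros) auto
  qed
  then show ?thesis
    by (simp add: continuous_at_imp_continuous_on)
qed

lemma continuous_on_phi [continuous_intros]:
  assumes "p > 1" "continuous_on S f"
  shows "continuous_on S (\<lambda>x. phi p (f x))"
  using continuous_on_compose2[OF continuous_on_phi_UNIV[OF assms(1)] assms(2)] by simp

lemma tendsto_phi [tendsto_intros]: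
  assumes "p > 1" "(f \<longlongrightarrow> l) F"
  shows "((\<lambda>x. phi p (f x)) \<longlongrightarrow> phi p l) F"
  using continuous_on_tendsto_compose[OF continuous_on_phi_UNIV[OF assms(1)] assms(2)] by simp

lemma continuous_on_abs_powr [continuous_intros]:
  fixes f :: "'a::topological_space \<Rightarrow> real"
  assumes "a > 0" "continuous_on S f"
  shows "continuous_on S (\<lambda>x. \<bar>f x\<bar> powr a)"
  using assms by (intro continuous_on_powr' continuous_intros) auto

lemma DERIV_abs_powr:
  assumes "p > 1"
  shows "((\<lambda>s. \<bar>s\<bar> powr p) has_real_derivative p * phi p s) (at s)"
proof -
  consider "s > 0" | "s < 0" | "s = 0" by linarith
  then show ?thesis
  proof cases
    case 1
    have "((\<lambda>s. s powr p) has_real_derivative p * s powr (p - 1)) (at s)"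
      using 1 by (auto intro!: derivative_eq_intros)
    then have "((\<lambda>s. \<bar>s\<bar> powr p) has_real_derivative p * s powr (p - 1)) (at s)"
      by (rule DERIV_cong_ev[THEN iffD1, rotated 3])
        (use 1 in \<open>auto intro!: eventually_mono[OF order_tendstoD(1)[OF tendsto_ident_at, of 0 s]]
           simp: eventually_nhds_conv_at\<close>)
    then show ?thesis
      using 1 by (simp add: phi_nonneg_eq)
  next
    case 2
    have "((\<lambda>s. (- s) powr p) has_real_derivative - p * (- s) powr (p - 1)) (at s)"
      using 2 by (auto intro!: derivative_eq_intros)
    then have "((\<lambda>s. \<bar>s\<bar> powr p) has_real_derivative - p * (- s) powr (p - 1)) (at s)"
      by (rule DERIV_cong_ev[THEN iffD1, rotated 3])
        (use 2 in \<open>auto intro!: eventually_mono[OF order_tendstoD(2)[OF tendsto_ident_at, of s 0]]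
           simp: eventually_nhds_conv_at\<close>)
    then show ?thesis
      using 2 by (simp add: phi_eq_sgn)
  next
    case 3
    have "((\<lambda>h. \<bar>h\<bar> powr p / h) \<longlongrightarrow> 0) (at 0)"
    proof (rule Lim_transform_eventually)
      show "((\<lambda>h. phi p h) \<longlongrightarrow> 0) (at 0)"
        using tendsto_phi[OF assms tendsto_ident_at, of 0] by simp
      show "\<forall>\<^sub>F x in at 0. phi p x = \<bar>x\<bar> powr p / x"
        by (auto simp: eventually_at_filter phi_mult_self[symmetric])
    qed
    then show ?thesis
      using 3 by (simp add: has_field_derivative_iff)
  qed
qed

lemma DERIV_abs_powr_chain [derivative_intros]:
  assumes "p > 1" "(f has_real_derivative f') (at x within S)"
  shows "((\<lambda>x. \<bar>f x\<bar> powr p) has_real_derivative p * phi p (f x) * f') (at x within S)"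
  using DERIV_chain2[OF DERIV_abs_powr[OF assms(1)] assms(2)] by simp

text \<open>Strict convexity of the p-th power: the mean value theorem produces \<open>phi p\<close>
  at a point strictly between \<open>a\<close> and \<open>b\<close>, and \<open>phi p\<close> is
  strictly increasing. The strictness becomes the equality case of Picone's identity.\<close>

lemma abs_powr_tangent_less:
  fixes a b :: real
  assumes "p > 1" "a \<noteq> b"
  shows "\<bar>b\<bar> powr p + p * phi p b * (a - b) < \<bar>a\<bar> powr p"
proof -
  have "\<exists>z. min a b < z \<and> z < max a b \<and>
      \<bar>a\<bar> powr p - \<bar>b\<bar> powr p = (a - b) * (p * phi p z)"
  proof (cases "a < b")
    case True
    then obtain z where "a < z" "z < b"
        "\<bar>b\<bar> powr p - \<bar>a\<bar> powr p = (b - a) * (p * phi p z)"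
      using MVT2[OF True DERIV_abs_powr[OF assms(1)]] by blast
    then show ?thesis
      using True by (intro exI[of _ z]) (auto simp: algebra_simps)
  next
    case False
    then have "b < a" using assms by simp
    then obtain z where "b < z" "z < a"
        "\<bar>a\<bar> powr p - \<bar>b\<bar> powr p = (a - b) * (p * phi p z)"
      using MVT2[OF \<open>b < a\<close> DERIV_abs_powr[OF assms(1)]] by blast
    then show ?thesis
      using \<open>b < a\<close> by (intro exI[of _ z]) (auto simp: algebra_simps)
  qed
  then obtain z where z: "min a b < z" "z < max a b"
    and eq: "\<bar>a\<bar> powr p - \<bar>b\<bar> powr p = (a - b) * (p * phi p z)"
    by blast
  have "(a - b) * (p * phi p z) > (a - b) * (p * phi p b)"
  proof (cases "a < b")
    case True
    then show ?thesis
      using z assms phi_strict_mono[of p z b] by (auto simp: mult_less_cancel_left_disj)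
  next
    case False
    then show ?thesis
      using z assms phi_strict_mono[of p b z] by (auto simp: mult_less_cancel_left_disj)
  qed
  with eq show ?thesis
    by (simp add: algebra_simps)
qed

lemma abs_powr_tangent_le:
  fixes a b :: real
  assumes "p > 1"
  shows "\<bar>b\<bar> powr p + p * phi p b * (a - b) \<le> \<bar>a\<bar> powr p"
  using abs_powr_tangent_less[OF assms, of a b] by (cases "a = b") auto

text \<open>The tangent inequalities at the convex combination \<open>c\<close> are averaged with
  weights \<open>t\<close> and \<open>1 - t\<close>; the linear terms cancel.\<close>

lemma abs_powr_convex:
  fixes a b :: real
  assumes "p > 1" "0 \<le> t" "t \<le> 1"
  shows "\<bar>t * a + (1 - t) * b\<bar> powr p \<le> t * \<bar>a\<bar> powr p + (1 - t) * \<bar>b\<bar> powr p"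
proof -
  define c where "c = t * a + (1 - t) * b"
  have "t * (\<bar>c\<bar> powr p + p * phi p c * (a - c)) + (1 - t) * (\<bar>c\<bar> powr p + p * phi p c * (b - c))
      \<le> t * \<bar>a\<bar> powr p + (1 - t) * \<bar>b\<bar> powr p"
    using assms by (intro add_mono mult_left_mono abs_powr_tangent_le) auto
  moreover have "t * (\<bar>c\<bar> powr p + p * phi p c * (a - c)) + (1 - t) * (\<bar>c\<bar> powr p + p * phi p c * (b - c))
      = \<bar>c\<bar> powr p"
    by (simp add: c_def algebra_simps)
  ultimately show ?thesis
    by (simp add: c_def)
qed

section \<open>Schauder's fixed point theorem\<close>

lemma norm_convex_combination_diff_le:
  fixes a b :: "nat \<Rightarrow> real" and z :: "nat \<Rightarrow> 'a::real_normed_vector"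
  assumes "\<And>i. i < n \<Longrightarrow> \<bar>a i - b i\<bar> \<le> d" "\<And>i. i < n \<Longrightarrow> norm (z i) \<le> B"
  shows "norm ((\<Sum>i<n. a i *\<^sub>R z i) - (\<Sum>i<n. b i *\<^sub>R z i)) \<le> real n * (d * B)"
proof -
  have "norm ((\<Sum>i<n. a i *\<^sub>R z i) - (\<Sum>i<n. b i *\<^sub>R z i)) = norm (\<Sum>i<n. (a i - b i) *\<^sub>R z i)"
    by (simp add: sum_subtractf scaleR_diff_left)
  also have "\<dots> \<le> (\<Sum>i<n. d * B)"
    using assms by (intro sum_norm_le) (auto intro!: mult_mono intro: order_trans[OF abs_ge_zero])
  finally show ?thesis
    by simp
qed

text \<open>Kuhn's lemma, applied to the labels \<open>[f\<^sub>i(x) < x\<^sub>i]\<close> on a grid of mesh \<open>1/k\<close>, gives a cell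
  on which every component of \<open>f(x) - x\<close> changes sign.\<close>

lemma cube_approximate_fixpoint:
  fixes f :: "(nat \<Rightarrow> real) \<Rightarrow> nat \<Rightarrow> real"
  assumes f01: "\<And>x i. (\<forall>i<n. 0 \<le> x i \<and> x i \<le> 1) \<Longrightarrow> i < n \<Longrightarrow> 0 \<le> f x i \<and> f x i \<le> 1"
    and uc: "\<And>e. e > 0 \<Longrightarrow> \<exists>d>0. \<forall>x y. (\<forall>i<n. 0 \<le> x i \<and> x i \<le> 1) \<longrightarrow> (\<forall>i<n. 0 \<le> y i \<and> y i \<le> 1)
        \<longrightarrow> (\<forall>i<n. \<bar>x i - y i\<bar> \<le> d) \<longrightarrow> (\<forall>i<n. \<bar>f x i - f y i\<bar> \<le> e)"
    and "e > 0"
  obtains x where "\<forall>i<n. 0 \<le> x i \<and> x i \<le> 1" "\<forall>i<n. \<bar>f x i - x i\<bar> \<le> e"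
proof -
  obtain d where "d > 0" and d: "\<And>x y. \<forall>i<n. 0 \<le> x i \<and> x i \<le> 1 \<Longrightarrow> \<forall>i<n. 0 \<le> y i \<and> y i \<le> 1
        \<Longrightarrow> \<forall>i<n. \<bar>x i - y i\<bar> \<le> d \<Longrightarrow> \<forall>i<n. \<bar>f x i - f y i\<bar> \<le> e / 2"
    using uc[of "e / 2"] \<open>e > 0\<close> by (metis half_gt_zero)
  \<comment> \<open>One step of the grid changes \<open>f\<close> by at most e/2 (through
    \<open>d\<close>) and the point itself by less than e/2, hence f(x) - x by at most e.\<close>
  obtain k :: nat where k: "1 / real k < min d (e / 2)" "k > 0"
  proof -
    obtain k where "inverse (real (Suc k)) < min d (e / 2)"
      using reals_Archimedean[of "min d (e / 2)"] \<open>d > 0\<close> \<open>e > 0\<close> by auto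
    then show ?thesis
      using that[of "Suc k"] by (simp add: inverse_eq_divide)
  qed
  define pt :: "(nat \<Rightarrow> nat) \<Rightarrow> nat \<Rightarrow> real" where "pt x = (\<lambda>i. real (x i) / real k)" for x
  \<comment> \<open>On the faces the label is forced, as Kuhn's lemma requires. It still has the
    right meaning there: where a coordinate is 0 or 1, \<open>f01\<close> alone gives the sign of
    f(x) - x that the label stands for.\<close>
  define lab :: "(nat \<Rightarrow> nat) \<Rightarrow> nat \<Rightarrow> nat"
    where "lab x i = (if x i = 0 then 0 else if x i = k then 1 else if f (pt x) i < pt x i then 1 else 0)" for x i
  have pt01: "\<forall>i<n. 0 \<le> pt x i \<and> pt x i \<le> 1" if "\<forall>i<n. x i \<le> k" for x
    using that k by (auto simp: pt_def)
  obtain c where c: "\<forall>i<n. c i < k"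
    and cc: "\<forall>i<n. \<exists>r s. (\<forall>j<n. c j \<le> r j \<and> r j \<le> c j + 1) \<and>
      (\<forall>j<n. c j \<le> s j \<and> s j \<le> c j + 1) \<and> lab r i \<noteq> lab s i"
    by (rule kuhn_lemma[of k n lab]) (use k in \<open>auto simp: lab_def\<close>)
  have c01: "\<forall>i<n. 0 \<le> pt c i \<and> pt c i \<le> 1"
    using pt01 c by (auto simp: less_imp_le)
  have "\<bar>f (pt c) i - pt c i\<bar> \<le> e" if "i < n" for i
  proof -
    have near: "f (pt r) i - pt r i \<le> (f (pt c) i - pt c i) + e \<and>
        (f (pt c) i - pt c i) \<le> f (pt r) i - pt r i + e"
      if r: "\<forall>j<n. c j \<le> r j \<and> r j \<le> c j + 1" for r
    proof -
      have "\<forall>j<n. r j \<le> k"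
        using r c by (metis Suc_eq_plus1 Suc_leI le_trans)
      moreover have step: "\<bar>pt r j - pt c j\<bar> \<le> 1 / real k" if "j < n" for j
      proof -
        have "c j \<le> r j" "r j \<le> c j + 1"
          using r that by auto
        then have "\<bar>real (r j) - real (c j)\<bar> \<le> 1"
          by linarith
        then show ?thesis
          using k by (simp add: pt_def divide_right_mono flip: diff_divide_distrib)
      qed
      ultimately have "\<bar>f (pt r) i - f (pt c) i\<bar> \<le> e / 2"
        using d[OF pt01[of r] c01] \<open>i < n\<close> k by fastforce
      with step[OF \<open>i < n\<close>] k show ?thesis
        by linarith
    qed
    have lab1: "f (pt r) i - pt r i \<le> 0" if "lab r i = 1" "\<forall>j<n. r j \<le> k" for r
      using that f01[OF pt01, of r i] \<open>i < n\<close> k by (auto simp: lab_def pt_def split: if_splits)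
    have lab0: "f (pt r) i - pt r i \<ge> 0" if "lab r i = 0" "\<forall>j<n. r j \<le> k" for r
      using that f01[OF pt01, of r i] \<open>i < n\<close> k by (auto simp: lab_def pt_def split: if_splits)
    have bd: "\<forall>j<n. r j \<le> k" if "\<forall>j<n. c j \<le> r j \<and> r j \<le> c j + 1" for r
      using that c by (metis Suc_eq_plus1 Suc_leI le_trans)
    obtain r s where r: "\<forall>j<n. c j \<le> r j \<and> r j \<le> c j + 1" and s: "\<forall>j<n. c j \<le> s j \<and> s j \<le> c j + 1"
      and ne: "lab r i \<noteq> lab s i"
      using cc \<open>i < n\<close> by blast
    have "lab r i = 0 \<and> lab s i = 1 \<or> lab r i = 1 \<and> lab s i = 0"
      using ne by (auto simp: lab_def split: if_splits)
    then show ?thesis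
      using near[OF r] near[OF s] lab0[of r] lab0[of s] lab1[of r] lab1[of s] bd[OF r] bd[OF s]
      by auto
  qed
  then show ?thesis
    using that c01 by blast
qed

text \<open>By compactness approximate fixed points suffice, since \<open>dist (f x) x\<close>
  attains its minimum on \<open>K\<close>. Hat functions on a finite net turn points of
  \<open>K\<close> into weight vectors, and barycentres turn weight vectors back into points of
  \<open>K\<close>. The composite with \<open>f\<close> acts on a finite-dimensional cube, where
  \<open>cube_approximate_fixpoint\<close> applies.\<close>

theorem schauder_fixpoint:
  fixes f :: "'a::real_normed_vector \<Rightarrow> 'a"
  assumes K: "compact K" "convex K" "K \<noteq> {}"
    and f: "continuous_on K f" "f ` K \<subseteq> K"
  obtains x where "x \<in> K" "f x = x"
proof -
  have approx: "\<exists>x\<in>K. dist (f x) x \<le> 3 * e" if "e > 0" for e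
  proof -
    obtain N where N: "finite N" "N \<subseteq> K" "K \<subseteq> (\<Union>x\<in>N. ball x e)"
    proof -
      have "K \<subseteq> (\<Union>x\<in>K. ball x e)"
        using \<open>e > 0\<close> by auto
      then show ?thesis
        using compactE_image[OF K(1), of K "\<lambda>x. ball x e"] that by (metis open_ball)
    qed
    obtain z n where zn: "N = z ` {i::nat. i < n}" "inj_on z {i. i < n}"
      using finite_imp_nat_seg_image_inj_on[OF N(1)] by blast
    have zK: "z i \<in> K" if "i < n" for i
      using that zn N by auto
    have "n > 0"
      using zn N K by (cases n) auto
    obtain B where "B > 0" and B: "\<And>x. x \<in> K \<Longrightarrow> norm x \<le> B"
      using compact_imp_bounded[OF K(1)] by (auto simp: bounded_pos)
    define h where "h i y = max 0 (e - dist y (z i))" for i y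
    define S where "S y = (\<Sum>i<n. h i y)" for y
    define b where "b y i = h i y / S y" for y i
    have h0: "h i y \<ge> 0" for i y
      by (simp add: h_def)
    have Spos: "S y > 0" if "y \<in> K" for y
    proof -
      obtain i where "i < n" "dist (z i) y < e"
        using subsetD[OF N(3) \<open>y \<in> K\<close>] zn by auto
      then have "h i y > 0"
        by (simp add: h_def dist_commute)
      then show ?thesis
        unfolding S_def using \<open>i < n\<close> h0 by (intro sum_pos2[of _ i]) auto
    qed
    have b0: "b y i \<ge> 0" if "y \<in> K" for y i
      using Spos[OF that] h0 by (simp add: b_def)
    have b1: "(\<Sum>i<n. b y i) = 1" if "y \<in> K" for y
      using Spos[OF that] by (simp add: b_def S_def flip: sum_divide_distrib)
    have b_le_1: "b y i \<le> 1" if "y \<in> K" "i < n" for y i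
      using b1[OF that(1)] b0[OF that(1)] that(2)
      by (metis finite_lessThan lessThan_iff member_le_sum)
    have near: "norm ((\<Sum>i<n. b y i *\<^sub>R z i) - y) \<le> e" if "y \<in> K" for y
    proof -
      have "(\<Sum>i<n. b y i *\<^sub>R z i) - y = (\<Sum>i<n. b y i *\<^sub>R (z i - y))"
        using b1[OF that] by (simp add: scaleR_diff_right sum_subtractf flip: scaleR_left.sum)
      also have "norm \<dots> \<le> (\<Sum>i<n. b y i * e)"
      proof (intro sum_norm_le)
        fix i assume "i \<in> {..<n}"
        have "b y i * norm (z i - y) \<le> b y i * e"
        proof (cases "dist y (z i) < e")
          case True
          then show ?thesis
            using b0[OF that] by (intro mult_left_mono) (auto simp: dist_norm norm_minus_commute)
        next
          case False
          then show ?thesis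
            by (simp add: b_def h_def)
        qed
        then show "norm (b y i *\<^sub>R (z i - y)) \<le> b y i * e"
          using b0[OF that] by simp
      qed
      also have "\<dots> = e"
        using b1[OF that] by (simp flip: sum_distrib_right)
      finally show ?thesis .
    qed
    text \<open>A retraction of the cube onto the simplex of weights, followed by the barycentric map.\<close>
    define tot where "tot t = (\<Sum>i<n. t i)" for t :: "nat \<Rightarrow> real"
    define w where "w t i = (t i + (if i = 0 then max 0 (1 - tot t) else 0)) / max 1 (tot t)" for t i
    define P where "P t = (\<Sum>i<n. w t i *\<^sub>R z i)" for t
    have wsum: "(\<Sum>i<n. w t i) = 1" for t
    proof -
      have "(\<Sum>i<n. t i + (if i = 0 then max 0 (1 - tot t) else 0)) = tot t + max 0 (1 - tot t)"
        using \<open>n > 0\<close> by (simp add: sum.distrib tot_def sum.delta)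
      then show ?thesis
        unfolding w_def by (simp add: max_def flip: sum_divide_distrib)
    qed
    have PK: "P t \<in> K" if "\<forall>i<n. 0 \<le> t i \<and> t i \<le> 1" for t
      unfolding P_def using that wsum zK
      by (intro convex_sum[OF _ K(2)]) (auto simp: w_def)
    have cb: "continuous_on K (\<lambda>y. b y i)" for i
      unfolding b_def S_def h_def using Spos
      by (intro continuous_intros) (auto simp: S_def h_def less_imp_neq[THEN not_sym])
    have ucb: "\<exists>d>0. \<forall>i<n. \<forall>y\<in>K. \<forall>y'\<in>K. dist y y' < d \<longrightarrow> \<bar>b (f y) i - b (f y') i\<bar> \<le> r"
      if "r > 0" for r
    proof -
      have "uniformly_continuous_on K (\<lambda>y. b (f y) i)" for i
        using continuous_on_compose2[OF cb f(1) f(2)] K(1) compact_uniformly_continuous by blast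
      then have "\<forall>i. \<exists>d>0. \<forall>y\<in>K. \<forall>y'\<in>K. dist y' y < d \<longrightarrow> dist (b (f y') i) (b (f y) i) < r"
        using that unfolding uniformly_continuous_on_def by blast
      then obtain d where d: "\<And>i. d i > 0"
        "\<And>i y y'. y \<in> K \<Longrightarrow> y' \<in> K \<Longrightarrow> dist y' y < d i \<Longrightarrow> dist (b (f y') i) (b (f y) i) < r"
        by metis
      have "Min (d ` {..<n}) > 0"
        using d(1) \<open>n > 0\<close> by (subst Min_gr_iff) auto
      moreover have "\<bar>b (f y) i - b (f y') i\<bar> \<le> r"
        if "i < n" "y \<in> K" "y' \<in> K" "dist y y' < Min (d ` {..<n})" for i y y'
      proof -
        have "dist y y' < d i"
          using that by (meson Min_le finite_imageI finite_lessThan imageI lessThan_iff less_le_trans)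
        then show ?thesis
          using d(2)[of y' y i] that by (simp add: dist_real_def)
      qed
      ultimately show ?thesis
        by blast
    qed
    \<comment> \<open>The numerators of \<open>w\<close> move by at most d + n d and the
      denominators by at most n d, while the quotient \<open>a' / c'\<close> is at most 2. The total
      stays below d (2 + 3 n).\<close>
    have Plip: "dist (P s) (P t) \<le> real n * (d * (2 + 3 * real n) * B)"
      if s: "\<forall>i<n. 0 \<le> s i \<and> s i \<le> 1" and t: "\<forall>i<n. 0 \<le> t i \<and> t i \<le> 1"
        and d: "\<forall>i<n. \<bar>s i - t i\<bar> \<le> d" "d \<ge> 0" for s t d
    proof -
      have tot: "\<bar>tot s - tot t\<bar> \<le> real n * d"
      proof -
        have "\<bar>tot s - tot t\<bar> \<le> (\<Sum>i<n. \<bar>s i - t i\<bar>)"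
          unfolding tot_def by (simp add: sum_subtractf[symmetric] sum_abs)
        also have "\<dots> \<le> (\<Sum>i<n. d)"
          using d by (intro sum_mono) auto
        finally show ?thesis by simp
      qed
      have "\<bar>w s i - w t i\<bar> \<le> d * (2 + 3 * real n)" if "i < n" for i
      proof -
        define a where "a = s i + (if i = 0 then max 0 (1 - tot s) else 0)"
        define a' where "a' = t i + (if i = 0 then max 0 (1 - tot t) else 0)"
        define c where "c = max 1 (tot s)"
        define c' where "c' = max 1 (tot t)"
        have tot0: "tot s \<ge> 0" "tot t \<ge> 0"
          using s t by (auto simp: tot_def intro!: sum_nonneg)
        have "0 \<le> t i" "t i \<le> 1" "\<bar>s i - t i\<bar> \<le> d"
          using that t d by auto
        moreover have "real n * d \<ge> 0"
          using d(2) by simp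
        moreover from this have
          "\<bar>(if i = 0 then max 0 (1 - tot s) else 0) - (if i = 0 then max 0 (1 - tot t) else 0)\<bar> \<le> real n * d"
        proof (cases "i = 0")
          case True
          have "\<bar>max 0 (1 - tot s) - max 0 (1 - tot t)\<bar> \<le> real n * d"
            using tot by linarith
          then show ?thesis
            using True by simp
        qed simp
        ultimately have "\<bar>a - a'\<bar> \<le> d + real n * d"
          unfolding a_def a'_def by linarith
        moreover have "0 \<le> a'" "a' \<le> 2"
          unfolding a'_def using tot0 \<open>0 \<le> t i\<close> \<open>t i \<le> 1\<close> by auto
        moreover have "\<bar>c - c'\<bar> \<le> real n * d" "c \<ge> 1" "c' \<ge> 1"
          unfolding c_def c'_def using tot by linarith+
        ultimately have "\<bar>a - a'\<bar> \<le> d + real n * d" "0 \<le> a'" "a' \<le> 2" "\<bar>c - c'\<bar> \<le> real n * d" "c \<ge> 1" "c' \<ge> 1"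
          by auto
        note * = this
        have "a / c - a' / c' = (a - a') / c + a' / c' * ((c' - c) / c)"
          using * by (simp add: field_simps)
        moreover have "\<bar>(a - a') / c\<bar> \<le> d + real n * d"
        proof -
          have "\<bar>a - a'\<bar> / c \<le> \<bar>a - a'\<bar>"
            using * by (simp add: divide_le_eq mult_right_le_one_le mult_le_cancel_left1)
          then show ?thesis using * by (simp add: abs_divide)
        qed
        moreover have "\<bar>a' / c' * ((c' - c) / c)\<bar> \<le> 2 * (real n * d)"
        proof -
          have "a' / c' \<le> 2"
            using * by (simp add: divide_le_eq)
          moreover have "\<bar>(c' - c) / c\<bar> \<le> real n * d"
          proof -
            have "\<bar>c' - c\<bar> / c \<le> \<bar>c' - c\<bar>"
              using * by (simp add: divide_le_eq mult_le_cancel_left1)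
            then show ?thesis using * by (simp add: abs_divide abs_minus_commute)
          qed
          ultimately show ?thesis
            unfolding abs_mult using * by (intro mult_mono) auto
        qed
        ultimately have "\<bar>a / c - a' / c'\<bar> \<le> d + real n * d + 2 * (real n * d)"
          by linarith
        also have "\<dots> \<le> d * (2 + 3 * real n)"
          using d(2) by (simp add: algebra_simps)
        finally show ?thesis
          by (simp add: w_def a_def a'_def c_def c'_def)
      qed
      then show ?thesis
        unfolding P_def dist_norm mult.assoc[of d]
        using norm_convex_combination_diff_le[of n "w s" "w t" "d * (2 + 3 * real n)" z B] B zK
        by (simp add: mult.assoc)
    qed
    \<comment> \<open>Chosen so that \<open>Plip\<close> with
      \<open>d = r / (2 + 3 * real n)\<close> gives exactly \<open>e\<close>.\<close>
    define r where "r = e / (real n * B)"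
    have "r > 0"
      using \<open>e > 0\<close> \<open>n > 0\<close> \<open>B > 0\<close> by (simp add: r_def)
    obtain t where t: "\<forall>i<n. 0 \<le> t i \<and> t i \<le> 1" "\<forall>i<n. \<bar>b (f (P t)) i - t i\<bar> \<le> r / (2 + 3 * real n)"
    proof (rule cube_approximate_fixpoint[of n "\<lambda>t. b (f (P t))" "r / (2 + 3 * real n)"])
      show "0 \<le> b (f (P x)) i \<and> b (f (P x)) i \<le> 1" if "\<forall>i<n. 0 \<le> x i \<and> x i \<le> 1" "i < n" for x i
        using PK[OF that(1)] f(2) b0 b_le_1 that(2) by blast
      show "\<exists>d>0. \<forall>x y. (\<forall>i<n. 0 \<le> x i \<and> x i \<le> 1) \<longrightarrow> (\<forall>i<n. 0 \<le> y i \<and> y i \<le> 1) \<longrightarrow>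
          (\<forall>i<n. \<bar>x i - y i\<bar> \<le> d) \<longrightarrow> (\<forall>i<n. \<bar>b (f (P x)) i - b (f (P y)) i\<bar> \<le> e')"
        if "e' > 0" for e'
      proof -
        obtain d where "d > 0"
          and d: "\<And>i y y'. i < n \<Longrightarrow> y \<in> K \<Longrightarrow> y' \<in> K \<Longrightarrow> dist y y' < d \<Longrightarrow> \<bar>b (f y) i - b (f y') i\<bar> \<le> e'"
          using ucb[OF \<open>e' > 0\<close>] by blast
        define d' where "d' = d / 2 / (real n * ((2 + 3 * real n) * B))"
        have pos: "real n * ((2 + 3 * real n) * B) > 0"
          using \<open>n > 0\<close> \<open>B > 0\<close> by (intro mult_pos_pos) auto
        then have "d' > 0"
          unfolding d'_def using \<open>d > 0\<close> by (intro divide_pos_pos) auto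
        have "real n * (d' * (2 + 3 * real n) * B) = d' * (real n * ((2 + 3 * real n) * B))"
          by (simp only: ac_simps)
        also have "\<dots> = d / 2"
          unfolding d'_def using pos by (metis less_irrefl nonzero_eq_divide_eq)
        finally have "dist (P x) (P y) < d"
          if "\<forall>i<n. 0 \<le> x i \<and> x i \<le> 1" "\<forall>i<n. 0 \<le> y i \<and> y i \<le> 1" "\<forall>i<n. \<bar>x i - y i\<bar> \<le> d'" for x y
          using Plip[OF that] \<open>d' > 0\<close> \<open>d > 0\<close> by simp
        then show ?thesis
          using d PK \<open>d' > 0\<close> by (intro exI[of _ d']) simp
      qed
      show "0 < r / (2 + 3 * real n)"
        using \<open>r > 0\<close> by (intro divide_pos_pos) auto
    qed
    have fP: "f (P t) \<in> K"
      using PK[OF t(1)] f(2) by blast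
    define s where "s = b (f (P t))"
    have s01: "\<forall>i<n. 0 \<le> s i \<and> s i \<le> 1"
      using b0[OF fP] b_le_1[OF fP] by (simp add: s_def)
    \<comment> \<open>Genuine weights are fixed by the retraction, so \<open>P s\<close> is the net
      approximation of \<open>f (P t)\<close>. The final error has two parts of size
      \<open>e\<close>, one from this approximation and one from \<open>Plip\<close>.\<close>
    have "tot s = 1"
      using b1[OF fP] by (simp add: tot_def s_def)
    then have "w s i = s i" for i
      by (simp add: w_def)
    then have "P s = (\<Sum>i<n. s i *\<^sub>R z i)"
      by (simp add: P_def)
    then have Ps: "P s = (\<Sum>i<n. b (f (P t)) i *\<^sub>R z i)"
      by (simp add: s_def)
    have "\<forall>i<n. \<bar>s i - t i\<bar> \<le> r / (2 + 3 * real n)"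
      using t(2) by (simp add: s_def)
    moreover have "real n * (r / (2 + 3 * real n) * (2 + 3 * real n) * B) = e"
      using \<open>n > 0\<close> \<open>B > 0\<close> by (simp add: r_def)
    ultimately have "dist (P s) (P t) \<le> e"
      using Plip[OF s01 t(1), of "r / (2 + 3 * real n)"] \<open>r > 0\<close> by simp
    moreover have "dist (P s) (f (P t)) \<le> e"
      using near[OF fP] by (simp add: Ps dist_norm)
    ultimately have "dist (f (P t)) (P t) \<le> 3 * e"
      using dist_triangle2[of "f (P t)" "P t" "P s"] \<open>e > 0\<close> by (simp add: dist_commute)
    then show ?thesis
      using PK[OF t(1)] by blast
  qed
  have "continuous_on K (\<lambda>x. dist (f x) x)"
    by (intro continuous_intros f)
  then obtain x where x: "x \<in> K" "\<forall>y\<in>K. dist (f x) x \<le> dist (f y) y"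
    using continuous_attains_inf[OF K(1) K(3)] by blast
  have "dist (f x) x \<le> 3 * e" if "e > 0" for e
    using approx[OF that] x by force
  then have "dist (f x) x \<le> 0 + e" if "e > 0" for e
    using that by (metis add_0 mult.commute nonzero_mult_div_cancel_right times_divide_eq_left
      zero_less_divide_iff zero_less_numeral zero_neq_numeral)
  then have "dist (f x) x \<le> 0"
    by (rule field_le_epsilon)
  then show ?thesis
    using that x(1) by simp
qed

section \<open>Periodic solutions of first-order systems\<close>

text \<open>Here \<open>V\<close> is the flux \<open>phi p u'\<close>, so that this is the equation \<open>(phi p u')' = h\<close>.\<close>

definition psys :: "real \<Rightarrow> real \<Rightarrow> (real \<Rightarrow> real) \<Rightarrow> (real \<Rightarrow> real) \<Rightarrow> (real \<Rightarrow> real) \<Rightarrow> bool" where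
  "psys T p h u V \<longleftrightarrow>
     (\<forall>x\<in>{0..T}. (u has_real_derivative phi (conj_exp p) (V x)) (at x within {0..T})) \<and>
     (\<forall>x\<in>{0..T}. (V has_real_derivative h x) (at x within {0..T})) \<and> u 0 = u T \<and> V 0 = V T"

lemma psysD:
  assumes "psys T p h u V"
  shows "x \<in> {0..T} \<Longrightarrow> (u has_real_derivative phi (conj_exp p) (V x)) (at x within {0..T})"
    and "x \<in> {0..T} \<Longrightarrow> (V has_real_derivative h x) (at x within {0..T})"
    and "u 0 = u T" "V 0 = V T"
    and "continuous_on {0..T} u" "continuous_on {0..T} V"
  using assms by (auto simp: psys_def intro: DERIV_continuous_on)

lemma psys_cong:
  assumes "psys T p h u V" "\<And>x. x \<in> {0..T} \<Longrightarrow> h x = h' x"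
  shows "psys T p h' u V"
  using assms by (simp add: psys_def)

section \<open>Limits and compactness for the first-order system\<close>

lemma has_real_derivative_uniform_limit:
  fixes f :: "nat \<Rightarrow> real \<Rightarrow> real"
  assumes f: "\<And>n x. x \<in> {a..b} \<Longrightarrow> (f n has_real_derivative f' n x) (at x within {a..b})"
    and f': "uniform_limit {a..b} f' g' sequentially"
    and g: "\<And>x. x \<in> {a..b} \<Longrightarrow> (\<lambda>n. f n x) \<longlonglongrightarrow> g x"
    and x: "x \<in> {a..b}"
  shows "(g has_real_derivative g' x) (at x within {a..b})"
proof -
  have "\<exists>G. \<forall>x\<in>{a..b}. (\<lambda>n. f n x) \<longlonglongrightarrow> G x \<and> (G has_derivative (*) (g' x)) (at x within {a..b})"
  proof (rule has_derivative_sequence[where f' = "\<lambda>n x. (*) (f' n x)"])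
    show "x \<in> {a..b}" "(\<lambda>n. f n x) \<longlonglongrightarrow> g x"
      using x g by auto
    show "(f n has_derivative (*) (f' n x)) (at x within {a..b})" if "x \<in> {a..b}" for n x
      using f[OF that] by (simp add: has_field_derivative_def)
    show "\<forall>\<^sub>F n in sequentially. \<forall>x\<in>{a..b}. \<forall>h. norm (f' n x * h - g' x * h) \<le> e * norm h" if "e > 0" for e
      using uniform_limitD[OF f' that]
      by eventually_elim
        (auto simp: dist_real_def abs_mult simp flip: left_diff_distrib
          intro!: mult_right_mono intro: less_imp_le)
  qed simp
  then obtain G where G: "\<And>x. x \<in> {a..b} \<Longrightarrow> (\<lambda>n. f n x) \<longlonglongrightarrow> G x"
    "\<And>x. x \<in> {a..b} \<Longrightarrow> (G has_derivative (*) (g' x)) (at x within {a..b})"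
    by blast
  have "G y = g y" if "y \<in> {a..b}" for y
    using LIMSEQ_unique[OF G(1)[OF that] g[OF that]] .
  then show ?thesis
    using G(2)[OF x] x has_derivative_transform[of x "{a..b}" g G]
    by (simp add: has_field_derivative_def)
qed

text \<open>For \<open>p > 2\<close> the function \<open>phi p\<close> is not uniformly continuous
  on the line; it is so on a bounded interval that contains all values from some index on.\<close>

lemma uniform_limit_phi:
  assumes "p > 1" "uniform_limit {a..b::real} f g sequentially" "continuous_on {a..b} g"
  shows "uniform_limit {a..b} (\<lambda>n x. phi p (f n x)) (\<lambda>x. phi p (g x)) sequentially"
proof -
  have "bounded (g ` {a..b})"
    using assms(3) by (intro compact_imp_bounded compact_continuous_image) auto
  then obtain B where "\<forall>x\<in>{a..b}. \<bar>g x\<bar> \<le> B"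
    unfolding bounded_iff by auto
  then have B: "\<And>x. x \<in> {a..b} \<Longrightarrow> \<bar>g x\<bar> \<le> B"
    by blast
  have "\<forall>\<^sub>F n in sequentially. \<forall>x\<in>{a..b}. f n x \<in> {-(B+1)..B+1}"
    using uniform_limitD[OF assms(2) zero_less_one]
  proof eventually_elim
    case (elim n)
    have "f n x \<in> {-(B+1)..B+1}" if "x \<in> {a..b}" for x
    proof -
      have "\<bar>f n x - g x\<bar> < 1" "\<bar>g x\<bar> \<le> B"
        using elim B that by (auto simp: dist_real_def)
      then show ?thesis by auto
    qed
    then show ?case by blast
  qed
  moreover have "uniformly_continuous_on {-(B+1)..B+1} (phi p)"
    using continuous_on_phi[OF assms(1) continuous_on_id]
    by (intro compact_uniformly_continuous) auto
  ultimately show ?thesis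
    using uniform_limit_compose_uniformly_continuous_on[OF assms(2) _ _ closed_atLeastAtMost] by blast
qed

lemma psys_limit:
  assumes "p > 1" "\<And>n. psys T p (h n) (u n) (V n)"
    and u: "uniform_limit {0..T} u u' sequentially"
    and V: "uniform_limit {0..T} V V' sequentially"
    and h: "uniform_limit {0..T} h h' sequentially"
    and "0 \<le> T"
  shows "psys T p h' u' V'"
proof -
  have V': "continuous_on {0..T} V'"
    using uniform_limit_theorem[OF _ V] psysD(6)[OF assms(2)] by auto
  have "uniform_limit {0..T} (\<lambda>n x. phi (conj_exp p) (V n x)) (\<lambda>x. phi (conj_exp p) (V' x)) sequentially"
    using assms(1) by (intro uniform_limit_phi V V' conj_exp_gt_1)
  then have 1: "(u' has_real_derivative phi (conj_exp p) (V' x)) (at x within {0..T})" if "x \<in> {0..T}" for x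
    using that psysD(1)[OF assms(2)] tendsto_uniform_limitI[OF u]
    by (intro has_real_derivative_uniform_limit[where f = u]) auto
  have 2: "(V' has_real_derivative h' x) (at x within {0..T})" if "x \<in> {0..T}" for x
    using that psysD(2)[OF assms(2)] tendsto_uniform_limitI[OF V] h
    by (intro has_real_derivative_uniform_limit[where f = V]) auto
  have 0: "0 \<in> {0..T}" "T \<in> {0..T}"
    using \<open>0 \<le> T\<close> by auto
  have "u' 0 = u' T"
    using tendsto_uniform_limitI[OF u 0(1)] tendsto_uniform_limitI[OF u 0(2)]
    unfolding psysD(3)[OF assms(2)] by (rule LIMSEQ_unique)
  moreover have "V' 0 = V' T"
    using tendsto_uniform_limitI[OF V 0(1)] tendsto_uniform_limitI[OF V 0(2)]
    unfolding psysD(4)[OF assms(2)] by (rule LIMSEQ_unique)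
  ultimately show ?thesis
    using 1 2 by (auto simp: psys_def)
qed

lemma lipschitz_sequence_uniform_limit:
  fixes f :: "nat \<Rightarrow> real \<Rightarrow> real"
  assumes "\<And>n x. x \<in> {a..b} \<Longrightarrow> \<bar>f n x\<bar> \<le> B"
    and L: "\<And>n x y. x \<in> {a..b} \<Longrightarrow> y \<in> {a..b} \<Longrightarrow> \<bar>f n x - f n y\<bar> \<le> L * \<bar>x - y\<bar>"
  obtains g r where "continuous_on {a..b} g" "strict_mono (r :: nat \<Rightarrow> nat)"
    "uniform_limit {a..b} (\<lambda>n. f (r n)) g sequentially"
proof (rule Arzela_Ascoli[of "{a..b}" f B])
  show "\<exists>d>0. \<forall>n y. y \<in> {a..b} \<and> norm (x - y) < d \<longrightarrow> norm (f n x - f n y) < e"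
    if "x \<in> {a..b}" "e > 0" for x e
  proof (intro exI[of _ "e / (\<bar>L\<bar> + 1)"] conjI allI impI)
    show "e / (\<bar>L\<bar> + 1) > 0"
      using \<open>e > 0\<close> by (intro divide_pos_pos) auto
    fix n y assume y: "y \<in> {a..b} \<and> norm (x - y) < e / (\<bar>L\<bar> + 1)"
    then have "(\<bar>L\<bar> + 1) * \<bar>x - y\<bar> < e"
      by (simp add: pos_less_divide_eq mult.commute)
    moreover have "\<bar>f n x - f n y\<bar> \<le> (\<bar>L\<bar> + 1) * \<bar>x - y\<bar>"
    proof (rule order_trans)
      show "\<bar>f n x - f n y\<bar> \<le> L * \<bar>x - y\<bar>"
        using L that(1) y by blast
      show "L * \<bar>x - y\<bar> \<le> (\<bar>L\<bar> + 1) * \<bar>x - y\<bar>"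
        by (intro mult_right_mono) auto
    qed
    ultimately show "norm (f n x - f n y) < e"
      by simp
  qed
next
  fix g k assume gk: "continuous_on {a..b} g" "strict_mono (k :: nat \<Rightarrow> nat)"
    "\<And>e. 0 < e \<Longrightarrow> \<exists>N. \<forall>n x. n \<ge> N \<and> x \<in> {a..b} \<longrightarrow> norm (f (k n) x - g x) < e"
  have "uniform_limit {a..b} (\<lambda>n. f (k n)) g sequentially"
    unfolding uniform_limit_sequentially_iff dist_norm using gk(3) by metis
  then show thesis
    using that gk by blast
qed (use assms in auto)

lemma DERIV_bound_lipschitz:
  fixes f :: "real \<Rightarrow> real"
  assumes "\<And>x. x \<in> {a..b} \<Longrightarrow> (f has_real_derivative f' x) (at x within {a..b})"
    and "\<And>x. x \<in> {a..b} \<Longrightarrow> \<bar>f' x\<bar> \<le> B" "x \<in> {a..b}" "y \<in> {a..b}"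
  shows "\<bar>f x - f y\<bar> \<le> B * \<bar>x - y\<bar>"
  using field_differentiable_bound[of "{a..b}" f f' B x y] assms by auto

text \<open>By Rolle's theorem the flux \<open>V\<close> vanishes somewhere, hence it is controlled by its derivative.\<close>

lemma psys_bounds:
  assumes "p > 1" "T > 0" and S: "psys T p h u V" and h: "\<And>x. x \<in> {0..T} \<Longrightarrow> \<bar>h x\<bar> \<le> M"
  shows "x \<in> {0..T} \<Longrightarrow> \<bar>V x\<bar> \<le> M * T"
    and "x \<in> {0..T} \<Longrightarrow> y \<in> {0..T} \<Longrightarrow> \<bar>V x - V y\<bar> \<le> M * \<bar>x - y\<bar>"
    and "x \<in> {0..T} \<Longrightarrow> y \<in> {0..T} \<Longrightarrow> \<bar>u x - u y\<bar> \<le> phi (conj_exp p) (M * T) * \<bar>x - y\<bar>"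
proof -
  have M0: "M \<ge> 0"
    using h[of 0] \<open>T > 0\<close> by auto
  show L: "\<bar>V x - V y\<bar> \<le> M * \<bar>x - y\<bar>" if "x \<in> {0..T}" "y \<in> {0..T}" for x y
    using DERIV_bound_lipschitz[OF psysD(2)[OF S] h that] .
  have "\<exists>z>0. z < T \<and> (\<lambda>h. phi (conj_exp p) (V z) * h) = (\<lambda>h. 0)"
  proof (rule Rolle_deriv[where f = u])
    show "(u has_derivative (*) (phi (conj_exp p) (V x))) (at x)" if "0 < x" "x < T" for x
      using psysD(1)[OF S, of x] that by (simp add: has_field_derivative_def at_within_Icc_at)
  qed (use psysD[OF S] \<open>T > 0\<close> in auto)
  then obtain z where z: "0 < z" "z < T" "V z = 0"
    by (metis mult.right_neutral phi_eq_0_iff)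
  show bd: "\<bar>V x\<bar> \<le> M * T" if "x \<in> {0..T}" for x
  proof -
    have "\<bar>V x - V z\<bar> \<le> M * \<bar>x - z\<bar>"
      using L[OF that, of z] z by auto
    also have "\<dots> \<le> M * T"
      using M0 that z by (intro mult_left_mono) auto
    finally show ?thesis
      using z by simp
  qed
  show "\<bar>u x - u y\<bar> \<le> phi (conj_exp p) (M * T) * \<bar>x - y\<bar>" if "x \<in> {0..T}" "y \<in> {0..T}"
    using DERIV_bound_lipschitz[OF psysD(1)[OF S] _ that, of "phi (conj_exp p) (M * T)"]
      abs_phi_mono[OF conj_exp_gt_1[OF \<open>p > 1\<close>] bd] by auto
qed

text \<open>The flux is bounded through its zero and both Lipschitz constants come from the bound on
  \<open>h\<close>. Only \<open>u\<close> needs a bound of its own, because adding a constant to it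
  leaves the system unchanged.\<close>

lemma psys_subsequence:
  assumes "p > 1" "T > 0" and S: "\<And>n. psys T p (h n) (u n) (V n)"
    and h: "\<And>n x. x \<in> {0..T} \<Longrightarrow> \<bar>h n x\<bar> \<le> M" and u: "\<And>n x. x \<in> {0..T} \<Longrightarrow> \<bar>u n x\<bar> \<le> B"
  obtains u' V' r where "strict_mono (r :: nat \<Rightarrow> nat)"
    "continuous_on {0..T} u'" "uniform_limit {0..T} (\<lambda>n. u (r n)) u' sequentially"
    "continuous_on {0..T} V'" "uniform_limit {0..T} (\<lambda>n. V (r n)) V' sequentially"
proof -
  note bds = psys_bounds[OF assms(1,2) S h]
  obtain u' r where r: "continuous_on {0..T} u'" "strict_mono r"
    "uniform_limit {0..T} (\<lambda>n. u (r n)) u' sequentially"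
    using lipschitz_sequence_uniform_limit[of 0 T u B] u bds(3) by blast
  obtain V' s where s: "continuous_on {0..T} V'" "strict_mono s"
    "uniform_limit {0..T} (\<lambda>n. V (r (s n))) V' sequentially"
    using lipschitz_sequence_uniform_limit[of 0 T "\<lambda>n. V (r n)" "M * T" M] bds(1,2) by blast
  have "uniform_limit {0..T} (\<lambda>n. u (r (s n))) u' sequentially"
    using filterlim_compose[OF r(3) filterlim_subseq[OF s(2)]] .
  then show ?thesis
    using that[of "r \<circ> s" u' V'] r(1) s strict_mono_o[OF r(2) s(2)] by (simp add: o_def)
qed

section \<open>Functions on \<open>{0..T}\<close> inside the Banach space of bounded continuous
  functions\<close>

definition clp :: "real \<Rightarrow> real \<Rightarrow> real" where
  "clp T x = max 0 (min T x)"

lemma clp_in: "0 \<le> T \<Longrightarrow> clp T x \<in> {0..T}"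
  by (auto simp: clp_def)

lemma clp_id: "x \<in> {0..T} \<Longrightarrow> clp T x = x"
  by (auto simp: clp_def)

lemma clp_lipschitz: "\<bar>clp T x - clp T y\<bar> \<le> \<bar>x - y\<bar>"
  unfolding clp_def by linarith

lemma continuous_on_clp: "continuous_on UNIV (clp T)"
  unfolding clp_def by (intro continuous_intros)

text \<open>Schauder's theorem asks for a normed space that is a type. Functions on
  \<open>{0..T}\<close> enter the type of bounded continuous functions as their constant extensions
  beyond both end points.\<close>

definition ext :: "real \<Rightarrow> (real \<Rightarrow> real) \<Rightarrow> real \<Rightarrow>\<^sub>C real" where
  "ext T f = Bcontfun (\<lambda>x. f (clp T x))"

lemma ext_apply:
  assumes "0 \<le> T" "continuous_on {0..T} f"
  shows "ext T f x = f (clp T x)"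
proof -
  have "continuous_on UNIV (\<lambda>x. f (clp T x))"
    using clp_in[OF assms(1)]
    by (intro continuous_on_compose2[OF assms(2) continuous_on_clp]) blast
  moreover have "bounded (range (\<lambda>x. f (clp T x)))"
  proof (rule bounded_subset)
    show "bounded (f ` {0..T})"
      using assms(2) by (intro compact_imp_bounded compact_continuous_image) auto
  qed (use clp_in[OF assms(1)] in auto)
  ultimately show ?thesis
    unfolding ext_def by (subst Bcontfun_inverse) (auto simp: bcontfun_def)
qed

lemma ext_apply_in:
  assumes "0 \<le> T" "continuous_on {0..T} f" "x \<in> {0..T}"
  shows "ext T f x = f x"
  using assms by (simp add: ext_apply clp_id)

lemma ext_cong:
  assumes "0 \<le> T" "\<And>x. x \<in> {0..T} \<Longrightarrow> f x = g x"
  shows "ext T f = ext T g"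
  unfolding ext_def using assms clp_in[OF assms(1)] by simp

lemma ext_LIMSEQ:
  assumes "0 \<le> T" "\<And>n. continuous_on {0..T} (f n)" "continuous_on {0..T} g"
    and "uniform_limit {0..T} f g sequentially"
  shows "(\<lambda>n. ext T (f n)) \<longlonglongrightarrow> ext T g"
proof (rule uniform_limit_tendsto_bcontfun)
  have "uniform_limit UNIV (\<lambda>n x. f n (clp T x)) (\<lambda>x. g (clp T x)) sequentially"
    by (rule uniform_limit_compose'[OF assms(4)]) (use clp_in[OF assms(1)] in auto)
  then show "uniform_limit UNIV (\<lambda>n. apply_bcontfun (ext T (f n))) (apply_bcontfun (ext T g)) sequentially"
    unfolding ext_apply[OF assms(1,3), abs_def] ext_apply[OF assms(1,2), abs_def] .
qed

lemma LIMSEQ_bcontfun_uniform_limit: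
  fixes f :: "nat \<Rightarrow> real \<Rightarrow>\<^sub>C real"
  assumes "f \<longlonglongrightarrow> g"
  shows "uniform_limit A (\<lambda>n x. f n x) (\<lambda>x. g x) sequentially"
  using uniform_limit_on_subset[OF tendsto_bcontfun_uniform_limit[OF assms]] by simp

text \<open>The first condition selects the constant extensions. Bounded Lipschitz functions on the
  whole line are in general not compact in the sup norm, since translates escape; these are, by
  Arzela-Ascoli on \<open>{0..T}\<close>.\<close>

definition lip_ball :: "real \<Rightarrow> real \<Rightarrow> real \<Rightarrow> (real \<Rightarrow>\<^sub>C real) set" where
  "lip_ball T B L = {f :: real \<Rightarrow>\<^sub>C real. (\<forall>x. f (clp T x) = f x) \<and> (\<forall>x. \<bar>f x\<bar> \<le> B) \<and>
     (\<forall>x y. \<bar>f x - f y\<bar> \<le> L * \<bar>x - y\<bar>)}"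

lemma ext_in_lip_ball:
  assumes "0 \<le> T" "0 \<le> L" "\<And>x. x \<in> {0..T} \<Longrightarrow> \<bar>f x\<bar> \<le> B"
    "\<And>x y. x \<in> {0..T} \<Longrightarrow> y \<in> {0..T} \<Longrightarrow> \<bar>f x - f y\<bar> \<le> L * \<bar>x - y\<bar>"
  shows "ext T f \<in> lip_ball T B L" "continuous_on {0..T} f"
proof -
  show c: "continuous_on {0..T} f"
    by (rule lipschitz_on_continuous_on[of L])
      (use assms in \<open>auto simp: lipschitz_on_def dist_real_def\<close>)
  have "\<bar>f (clp T x) - f (clp T y)\<bar> \<le> L * \<bar>x - y\<bar>" for x y
    using assms(4)[OF clp_in[OF assms(1)] clp_in[OF assms(1)]] mult_left_mono[OF clp_lipschitz assms(2)]
    by (rule order_trans)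
  then show "ext T f \<in> lip_ball T B L"
    using assms clp_in[OF assms(1)] clp_id[OF clp_in[OF assms(1)]]
    by (auto simp: lip_ball_def ext_apply[OF assms(1) c])
qed

lemma compact_lip_ball:
  assumes "0 \<le> T" "0 \<le> L"
  shows "compact (lip_ball T B L)"
  unfolding compact_eq_seq_compact_metric seq_compact_def
proof (intro allI impI)
  fix f :: "nat \<Rightarrow> real \<Rightarrow>\<^sub>C real" assume f: "\<forall>n. f n \<in> lip_ball T B L"
  obtain g r where g: "continuous_on {0..T} g" "strict_mono (r :: nat \<Rightarrow> nat)"
    "uniform_limit {0..T} (\<lambda>n x. f (r n) x) g sequentially"
    using lipschitz_sequence_uniform_limit[of 0 T "\<lambda>n x. f n x" B L] f by (auto simp: lip_ball_def)
  have lim: "(\<lambda>n. f (r n) x) \<longlonglongrightarrow> g x" if "x \<in> {0..T}" for x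
    using tendsto_uniform_limitI[OF g(3) that] .
  have gB: "\<bar>g x\<bar> \<le> B" if "x \<in> {0..T}" for x
    by (rule LIMSEQ_le_const2[OF tendsto_rabs[OF lim[OF that]]]) (use f in \<open>auto simp: lip_ball_def\<close>)
  have gL: "\<bar>g x - g y\<bar> \<le> L * \<bar>x - y\<bar>" if "x \<in> {0..T}" "y \<in> {0..T}" for x y
    by (rule LIMSEQ_le_const2[OF tendsto_rabs[OF tendsto_diff[OF lim[OF that(1)] lim[OF that(2)]]]])
      (use f in \<open>auto simp: lip_ball_def\<close>)
  have "ext T g \<in> lip_ball T B L"
    using ext_in_lip_ball[OF assms gB gL] by blast
  moreover have "(\<lambda>n. ext T (f (r n))) \<longlonglongrightarrow> ext T g"
    using g by (intro ext_LIMSEQ assms) auto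
  moreover have "ext T (f n) = f n" for n
    using f assms by (auto intro!: bcontfun_eqI simp: ext_apply lip_ball_def)
  ultimately show "\<exists>l\<in>lip_ball T B L. \<exists>r. strict_mono r \<and> (f \<circ> r) \<longlonglongrightarrow> l"
    using g(2) by (auto simp: o_def)
qed

lemma convex_lip_ball: "convex (lip_ball T B L)"
proof (rule convexI)
  fix f g :: "real \<Rightarrow>\<^sub>C real" and u v :: real
  assume fg: "f \<in> lip_ball T B L" "g \<in> lip_ball T B L" and uv: "0 \<le> u" "0 \<le> v" "u + v = 1"
  have 1: "\<bar>u * f x + v * g x\<bar> \<le> B" for x
  proof -
    have "\<bar>u * f x + v * g x\<bar> \<le> u * \<bar>f x\<bar> + v * \<bar>g x\<bar>"
      using uv by (intro order_trans[OF abs_triangle_ineq]) (simp add: abs_mult)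
    also have "\<dots> \<le> u * B + v * B"
      using fg uv by (intro add_mono mult_left_mono) (auto simp: lip_ball_def)
    also have "\<dots> = B"
      using uv by (simp flip: distrib_right)
    finally show ?thesis .
  qed
  have 2: "\<bar>u * f x + v * g x - (u * f y + v * g y)\<bar> \<le> L * \<bar>x - y\<bar>" for x y
  proof -
    have "\<bar>u * f x + v * g x - (u * f y + v * g y)\<bar> = \<bar>u * (f x - f y) + v * (g x - g y)\<bar>"
      by (simp add: algebra_simps)
    also have "\<dots> \<le> u * \<bar>f x - f y\<bar> + v * \<bar>g x - g y\<bar>"
      using uv by (intro order_trans[OF abs_triangle_ineq]) (simp add: abs_mult)
    also have "\<dots> \<le> u * (L * \<bar>x - y\<bar>) + v * (L * \<bar>x - y\<bar>)"
      using fg uv by (intro add_mono mult_left_mono) (auto simp: lip_ball_def)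
    also have "\<dots> = L * \<bar>x - y\<bar>"
      using uv by (simp flip: distrib_right)
    finally show ?thesis .
  qed
  have 3: "f (clp T x) = f x" "g (clp T x) = g x" for x
    using fg by (auto simp: lip_ball_def)
  show "u *\<^sub>R f + v *\<^sub>R g \<in> lip_ball T B L"
    using 1 2 3 by (simp add: lip_ball_def)
qed

section \<open>Primitives and superposition operators under uniform convergence\<close>

lemma integral_0_lipschitz:
  fixes f :: "real \<Rightarrow> real"
  assumes "continuous_on {0..T} f" "\<And>x. x \<in> {0..T} \<Longrightarrow> \<bar>f x\<bar> \<le> B" "x \<in> {0..T}" "y \<in> {0..T}"
  shows "\<bar>integral {0..x} f - integral {0..y} f\<bar> \<le> B * \<bar>x - y\<bar>"
  using DERIV_bound_lipschitz[OF integral_has_real_derivative[OF assms(1)] assms(2-4)] .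

lemma integral_0_bound:
  fixes f :: "real \<Rightarrow> real"
  assumes "continuous_on {0..T} f" "\<And>x. x \<in> {0..T} \<Longrightarrow> \<bar>f x\<bar> \<le> B" "x \<in> {0..T}"
  shows "\<bar>integral {0..x} f\<bar> \<le> B * T"
proof -
  have "B \<ge> 0"
    using assms(2)[OF assms(3)] by linarith
  have "\<bar>integral {0..x} f\<bar> \<le> B * x"
    using integral_0_lipschitz[OF assms(1,2,3), of 0] assms(3) by auto
  also have "\<dots> \<le> B * T"
    using \<open>B \<ge> 0\<close> assms(3) by (intro mult_left_mono) auto
  finally show ?thesis .
qed

lemma uniform_limit_integral_0:
  fixes f :: "nat \<Rightarrow> real \<Rightarrow> real"
  assumes "0 \<le> T" "\<And>n. continuous_on {0..T} (f n)" "continuous_on {0..T} g"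
    and lim: "uniform_limit {0..T} f g sequentially"
  shows "uniform_limit {0..T} (\<lambda>n x. integral {0..x} (f n)) (\<lambda>x. integral {0..x} g) sequentially"
proof (rule uniform_limitI)
  fix e :: real assume "e > 0"
  then have "e / (T + 1) > 0"
    using \<open>0 \<le> T\<close> by simp
  from uniform_limitD[OF lim this]
  show "\<forall>\<^sub>F n in sequentially. \<forall>x\<in>{0..T}. dist (integral {0..x} (f n)) (integral {0..x} g) < e"
  proof eventually_elim
    case (elim n)
    show ?case
    proof
      fix x assume x: "x \<in> {0..T}"
      have "f n integrable_on {0..x}" "g integrable_on {0..x}"
        using x by (auto intro!: integrable_continuous_real continuous_on_subset[OF assms(2)]
            continuous_on_subset[OF assms(3)])
      then have "dist (integral {0..x} (f n)) (integral {0..x} g) = \<bar>integral {0..x} (\<lambda>x. f n x - g x)\<bar>"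
        by (simp add: dist_real_def integral_diff)
      also have "\<dots> \<le> e / (T + 1) * T"
        using elim x assms(2,3)
        by (intro integral_0_bound) (auto simp: dist_real_def intro!: continuous_intros intro: less_imp_le)
      also have "\<dots> < e"
        using \<open>e > 0\<close> \<open>0 \<le> T\<close> by (simp add: divide_less_eq)
      finally show "dist (integral {0..x} (f n)) (integral {0..x} g) < e" .
    qed
  qed
qed

text \<open>From some index on all triples lie in one compact box, and \<open>N\<close> is uniformly
  continuous there.\<close>

lemma uniform_limit_Nemytskii:
  fixes N :: "real \<Rightarrow> real \<Rightarrow> real \<Rightarrow> real"
  assumes N: "continuous_on ({0..T} \<times> UNIV \<times> I) (\<lambda>(x, s, l). N x s l)" and "compact I"
    and "\<And>n. l n \<in> I" "l \<longlonglongrightarrow> l'" and u': "continuous_on {0..T} u'"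
    and u: "uniform_limit {0..T} u u' sequentially"
  shows "uniform_limit {0..T} (\<lambda>n x. N x (u n x) (l n)) (\<lambda>x. N x (u' x) l') sequentially"
proof -
  have "bounded (u' ` {0..T})"
    using u' by (intro compact_imp_bounded compact_continuous_image) auto
  then obtain B where "\<forall>x\<in>{0..T}. \<bar>u' x\<bar> \<le> B"
    unfolding bounded_iff by auto
  then have B: "\<And>x. x \<in> {0..T} \<Longrightarrow> \<bar>u' x\<bar> \<le> B"
    by blast
  define Q where "Q = {0..T} \<times> {-(B+1)..B+1} \<times> I"
  have Q: "compact Q"
    using \<open>compact I\<close> by (auto simp: Q_def intro!: compact_Times)
  have "uniformly_continuous_on Q (\<lambda>(x, s, l). N x s l)"
    using continuous_on_subset[OF N, of Q] Q
    by (intro compact_uniformly_continuous) (auto simp: Q_def)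
  moreover have "\<forall>\<^sub>F n in sequentially. \<forall>x\<in>{0..T}. (x, u n x, l n) \<in> Q"
    using uniform_limitD[OF u zero_less_one]
  proof eventually_elim
    case (elim n)
    have "(x, u n x, l n) \<in> Q" if "x \<in> {0..T}" for x
    proof -
      have "\<bar>u n x - u' x\<bar> < 1" "\<bar>u' x\<bar> \<le> B"
        using elim B that by (auto simp: dist_real_def)
      then show ?thesis
        using that assms(3) by (auto simp: Q_def)
    qed
    then show ?case by blast
  qed
  moreover have "uniform_limit {0..T} (\<lambda>n x. (x, u n x, l n)) (\<lambda>x. (x, u' x, l')) sequentially"
  proof (rule uniform_limitI)
    fix e :: real assume "e > 0"
    have "\<forall>\<^sub>F n in sequentially. dist (l n) l' < e / 2"
      using \<open>e > 0\<close> assms(4) by (intro tendstoD) auto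
    moreover have "\<forall>\<^sub>F n in sequentially. \<forall>x\<in>{0..T}. dist (u n x) (u' x) < e / 2"
      using \<open>e > 0\<close> u by (intro uniform_limitD) auto
    ultimately show "\<forall>\<^sub>F n in sequentially. \<forall>x\<in>{0..T}. dist (x, u n x, l n) (x, u' x, l') < e"
    proof eventually_elim
      case (elim n)
      have "dist (x, u n x, l n) (x, u' x, l') \<le> dist (u n x) (u' x) + dist (l n) l'" for x
        by (simp add: dist_Pair_Pair sqrt_sum_squares_le_sum)
      then show ?case
        using elim by (smt (verit, best) field_sum_of_halves)
    qed
  qed
  ultimately show ?thesis
    using uniform_limit_compose_uniformly_continuous_on[where f = "\<lambda>(x, s, l). N x s l"
        and g' = "\<lambda>x. (x, u' x, l')" and g = "\<lambda>n x. (x, u n x, l n)" and B = Q]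
      compact_imp_closed[OF Q] by simp
qed

lemma has_field_derivative_transform:
  assumes "x \<in> S" "(f has_field_derivative D) (at x within S)" "\<And>y. y \<in> S \<Longrightarrow> g y = f y"
  shows "(g has_field_derivative D) (at x within S)"
  using has_field_derivative_transform_within[OF assms(2) zero_less_one assms(1)] assms(3) by simp

text \<open>When the clipping is active, \<open>z\<close> is an end point and \<open>z - d\<close>
  lies beyond it, which fixes the sign of \<open>d\<close>.\<close>

lemma clip_fixpoint:
  fixes z d A :: real
  assumes "max (- A) (min A (z - d)) = z" "A > 0"
  shows "d = 0 \<or> z = A \<and> d < 0 \<or> z = - A \<and> d > 0"
  using assms by (auto simp: max_def min_def split: if_splits)

lemma integral_0_pos:
  fixes f :: "real \<Rightarrow> real"
  assumes "T > 0" "continuous_on {0..T} f" "\<And>x. x \<in> {0..T} \<Longrightarrow> f x > 0"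
  shows "integral {0..T} f > 0"
proof -
  have "integral {0..T} f \<ge> 0"
    using assms(3) by (intro Henstock_Kurzweil_Integration.integral_nonneg integrable_continuous_real assms(2)) (auto intro: less_imp_le)
  moreover have "integral {0..T} f \<noteq> 0"
  proof
    assume 0: "integral {0..T} f = 0"
    have "\<forall>x\<in>{0..T}. 0 \<le> f x"
      using assms(3) less_imp_le by blast
    then have "f 0 = 0"
      using integral_eq_0_iff[OF assms(2) assms(1)] 0 \<open>T > 0\<close> by simp
    then show False
      using assms(3)[of 0] \<open>T > 0\<close> by simp
  qed
  ultimately show ?thesis
    by linarith
qed

text \<open>The two unknown initial values are corrected by the defects of the two
  periodicity conditions, truncated so that Schauder's theorem applies. At a fixed point the
  truncation is inactive, since a defect at the boundary of the truncation points inwards.\<close>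

lemma periodic_system_exists:
  fixes N :: "real \<Rightarrow> real \<Rightarrow> real \<Rightarrow> real" and \<tau> :: "real \<times> (real \<Rightarrow>\<^sub>C real) \<Rightarrow> real"
  assumes "p > 1" "T > 0" "\<Lambda> \<ge> 0" "S \<ge> 0"
    and N: "continuous_on ({0..T} \<times> UNIV \<times> {0..\<Lambda>}) (\<lambda>(x, s, l). N x s l)"
    and M: "\<And>x s l. x \<in> {0..T} \<Longrightarrow> l \<in> {0..\<Lambda>} \<Longrightarrow> \<bar>N x s l\<bar> \<le> M"
    and pos: "\<And>x s l. x \<in> {0..T} \<Longrightarrow> l \<in> {0..\<Lambda>} \<Longrightarrow> S \<le> s \<Longrightarrow> N x s l > 0"
    and neg: "\<And>x s l. x \<in> {0..T} \<Longrightarrow> l \<in> {0..\<Lambda>} \<Longrightarrow> s \<le> - S \<Longrightarrow> N x s l < 0"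
    and \<tau>: "continuous_on UNIV \<tau>" "\<And>z. \<tau> z \<in> {0..\<Lambda>}"
  obtains l u V where "l \<in> {0..\<Lambda>}" "l = \<tau> (l, ext T u)" "psys T p (\<lambda>x. N x (u x) l) u V"
    "\<And>x. x \<in> {0..T} \<Longrightarrow> \<bar>u x\<bar> \<le> S + 2 * (phi (conj_exp p) (2 * M * T + 1) * T) + 1"
proof -
  define P where "P = phi (conj_exp p)"
  \<comment> \<open>\<open>2 * M * T + 1\<close> equals \<open>B + M * T\<close>, the bound for
    \<open>v\<close> in \<open>K\<close>, so \<open>L\<close> bounds the slope of \<open>u\<close>.
    Both \<open>A\<close> and \<open>B\<close> contain a margin of 1 over the variation along one
    period: starting at \<open>A\<close> or \<open>- A\<close> the function \<open>u\<close> stays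
    beyond \<open>S\<close>, and starting at \<open>B\<close> or \<open>- B\<close> the function
    \<open>v\<close> keeps its sign.\<close>
  define L where "L = P (2 * M * T + 1)"
  define A where "A = S + L * T + 1"
  define B where "B = M * T + 1"
  define cl :: "real \<Rightarrow> real \<Rightarrow> real" where "cl C x = max (- C) (min C x)" for C x
  have p': "conj_exp p > 1"
    using \<open>p > 1\<close> by (rule conj_exp_gt_1)
  have T0: "0 \<le> T" "0 \<in> {0..T}" "T \<in> {0..T}"
    using \<open>T > 0\<close> by auto
  have "M \<ge> 0"
    using M[of 0 0 0] T0 \<open>\<Lambda> \<ge> 0\<close> by auto
  then have "L \<ge> 0" "A > 0" "B > 0"
    using T0 \<open>S \<ge> 0\<close> by (auto simp: L_def P_def A_def B_def intro!: add_nonneg_pos)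
  \<comment> \<open>The corrections are crossed: \<open>u\<close> governs the sign of
    \<open>N\<close> and \<open>v\<close> that of \<open>P (v x)\<close>, so the periodicity defect
    of \<open>v\<close> adjusts the start of \<open>u\<close>, and conversely.\<close>
  define U where "U l u v x = cl A (u 0 - integral {0..T} (\<lambda>x. N x (u x) l)) + integral {0..x} (\<lambda>x. P (v x))"
    for l x and u v :: "real \<Rightarrow>\<^sub>C real"
  define W where "W l u v x = cl B (v 0 - integral {0..T} (\<lambda>x. P (v x))) + integral {0..x} (\<lambda>x. N x (u x) l)"
    for l x and u v :: "real \<Rightarrow>\<^sub>C real"
  define K where "K = {0..\<Lambda>} \<times> lip_ball T (A + L * T) L \<times> lip_ball T (B + M * T) M"
  define \<Phi> where "\<Phi> = (\<lambda>(l, u :: real \<Rightarrow>\<^sub>C real, v :: real \<Rightarrow>\<^sub>C real). (\<tau> (l, u), ext T (U l u v), ext T (W l u v)))"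
  have cN: "continuous_on {0..T} (\<lambda>x. N x (u x) l)" if "l \<in> {0..\<Lambda>}" for l and u :: "real \<Rightarrow>\<^sub>C real"
  proof -
    have "continuous_on {0..T} (\<lambda>x. (x, u x, l))"
      by (intro continuous_intros) auto
    moreover have "(\<lambda>x. (x, u x, l)) ` {0..T} \<subseteq> {0..T} \<times> UNIV \<times> {0..\<Lambda>}"
      using that by auto
    ultimately show ?thesis
      using continuous_on_compose2[OF N, of "{0..T}" "\<lambda>x. (x, u x, l)"] by simp
  qed
  have cP: "continuous_on {0..T} (\<lambda>x. P (v x))" for v :: "real \<Rightarrow>\<^sub>C real"
    unfolding P_def by (intro continuous_intros p') auto
  have cl_bd: "\<bar>cl C x\<bar> \<le> C" if "C > 0" for C x
    using that by (auto simp: cl_def)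
  have lips: "(l, u, v) \<in> K \<Longrightarrow> x \<in> {0..T} \<Longrightarrow> \<bar>P (v x)\<bar> \<le> L" for l u v x
    unfolding P_def L_def
    by (intro abs_phi_mono p') (auto simp: K_def lip_ball_def B_def algebra_simps)
  have Uball: "ext T (U l u v) \<in> lip_ball T (A + L * T) L \<and> continuous_on {0..T} (U l u v)"
    if K: "(l, u, v) \<in> K" for l u v
  proof -
    have "\<bar>U l u v x\<bar> \<le> A + L * T" if "x \<in> {0..T}" for x
      using cl_bd[OF \<open>A > 0\<close>, of "u 0 - integral {0..T} (\<lambda>x. N x (u x) l)"]
        integral_0_bound[OF cP lips[OF K] that] unfolding U_def by linarith
    moreover have "\<bar>U l u v x - U l u v y\<bar> \<le> L * \<bar>x - y\<bar>" if "x \<in> {0..T}" "y \<in> {0..T}" for x y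
      using integral_0_lipschitz[OF cP lips[OF K] that] unfolding U_def by simp
    ultimately show ?thesis
      using ext_in_lip_ball[OF T0(1) \<open>L \<ge> 0\<close>] by blast
  qed
  have Wball: "ext T (W l u v) \<in> lip_ball T (B + M * T) M \<and> continuous_on {0..T} (W l u v)"
    if K: "(l, u, v) \<in> K" for l u v
  proof -
    have l: "l \<in> {0..\<Lambda>}"
      using K by (auto simp: K_def)
    have "\<bar>W l u v x\<bar> \<le> B + M * T" if "x \<in> {0..T}" for x
      using cl_bd[OF \<open>B > 0\<close>, of "v 0 - integral {0..T} (\<lambda>x. P (v x))"]
        integral_0_bound[OF cN[OF l] M[OF _ l] that, of u] unfolding W_def by linarith
    moreover have "\<bar>W l u v x - W l u v y\<bar> \<le> M * \<bar>x - y\<bar>" if "x \<in> {0..T}" "y \<in> {0..T}" for x y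
      using integral_0_lipschitz[OF cN[OF l] M[OF _ l] that] unfolding W_def by simp
    ultimately show ?thesis
      using ext_in_lip_ball[OF T0(1) \<open>M \<ge> 0\<close>] by blast
  qed
  obtain z where z: "z \<in> K" "\<Phi> z = z"
  proof (rule schauder_fixpoint[of K \<Phi>])
    show "compact K" "convex K"
      unfolding K_def using T0 \<open>L \<ge> 0\<close> \<open>M \<ge> 0\<close>
      by (auto intro!: compact_Times compact_lip_ball convex_Times convex_lip_ball)
    have "(0, 0, 0) \<in> K"
      using \<open>\<Lambda> \<ge> 0\<close> \<open>A > 0\<close> \<open>B > 0\<close> \<open>L \<ge> 0\<close> \<open>M \<ge> 0\<close> T0
      by (auto simp: K_def lip_ball_def intro!: add_nonneg_nonneg)
    then show "K \<noteq> {}"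
      by blast
    show "\<Phi> ` K \<subseteq> K"
      using Uball Wball \<tau>(2) by (fastforce simp: \<Phi>_def K_def)
    show "continuous_on K \<Phi>"
      unfolding continuous_on_sequentially
    proof (intro allI ballI impI; elim conjE)
      fix zs z assume z: "z \<in> K" and zs: "\<forall>n. zs n \<in> K" "zs \<longlonglongrightarrow> z"
      obtain l u v where luv: "z = (l, u, v)"
        using prod_cases3 by blast
      define ls us vs where "ls n = fst (zs n)" and "us n = fst (snd (zs n))" and "vs n = snd (snd (zs n))" for n
      have zs_eq: "zs n = (ls n, us n, vs n)" for n
        by (simp add: ls_def us_def vs_def)
      have lim: "ls \<longlonglongrightarrow> l" "us \<longlonglongrightarrow> u" "vs \<longlonglongrightarrow> v"
        using zs(2) luv tendsto_fst[OF zs(2)] tendsto_snd[OF zs(2)]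
          tendsto_fst[OF tendsto_snd[OF zs(2)]] tendsto_snd[OF tendsto_snd[OF zs(2)]]
        unfolding ls_def[abs_def] us_def[abs_def] vs_def[abs_def] by auto
      have K: "(ls n, us n, vs n) \<in> K" "ls n \<in> {0..\<Lambda>}" for n
        using zs(1) unfolding zs_eq by (auto simp: K_def)
      have Kl: "(l, u, v) \<in> K" "l \<in> {0..\<Lambda>}"
        using z luv by (auto simp: K_def)
      have uN: "uniform_limit {0..T} (\<lambda>n x. N x (us n x) (ls n)) (\<lambda>x. N x (u x) l) sequentially"
        using K lim by (intro uniform_limit_Nemytskii[OF N] LIMSEQ_bcontfun_uniform_limit) auto
      have uP: "uniform_limit {0..T} (\<lambda>n x. P (vs n x)) (\<lambda>x. P (v x)) sequentially"
        unfolding P_def using lim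
        by (intro uniform_limit_phi p' LIMSEQ_bcontfun_uniform_limit) auto
      note IN = uniform_limit_integral_0[OF T0(1) cN[OF K(2)] cN[OF Kl(2)] uN]
      note IP = uniform_limit_integral_0[OF T0(1) cP cP uP]
      have at0: "(\<lambda>n. us n 0) \<longlonglongrightarrow> u 0" "(\<lambda>n. vs n 0) \<longlonglongrightarrow> v 0"
        using tendsto_uniform_limitI[OF LIMSEQ_bcontfun_uniform_limit[OF lim(2)] UNIV_I]
          tendsto_uniform_limitI[OF LIMSEQ_bcontfun_uniform_limit[OF lim(3)] UNIV_I] by auto
      have c1: "(\<lambda>n. cl A (us n 0 - integral {0..T} (\<lambda>x. N x (us n x) (ls n))))
          \<longlonglongrightarrow> cl A (u 0 - integral {0..T} (\<lambda>x. N x (u x) l))"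
        unfolding cl_def
        by (intro tendsto_intros at0 tendsto_max tendsto_min tendsto_uniform_limitI[OF IN] T0)
      have c2: "(\<lambda>n. cl B (vs n 0 - integral {0..T} (\<lambda>x. P (vs n x))))
          \<longlonglongrightarrow> cl B (v 0 - integral {0..T} (\<lambda>x. P (v x)))"
        unfolding cl_def
        by (intro tendsto_intros at0 tendsto_max tendsto_min tendsto_uniform_limitI[OF IP] T0)
      have const: "uniform_limit {0..T} (\<lambda>n x. c n) (\<lambda>x. c') sequentially" if "c \<longlonglongrightarrow> c'" for c and c' :: real
        using that by (auto simp: uniform_limit_iff tendsto_iff elim: eventually_mono)
      have "uniform_limit {0..T} (\<lambda>n. U (ls n) (us n) (vs n)) (U l u v) sequentially"
        unfolding U_def[abs_def] by (intro uniform_limit_add const c1 IP)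
      then have "(\<lambda>n. ext T (U (ls n) (us n) (vs n))) \<longlonglongrightarrow> ext T (U l u v)"
        using Uball K Kl T0 by (intro ext_LIMSEQ) auto
      moreover have "uniform_limit {0..T} (\<lambda>n. W (ls n) (us n) (vs n)) (W l u v) sequentially"
        unfolding W_def[abs_def] by (intro uniform_limit_add const c2 IN)
      then have "(\<lambda>n. ext T (W (ls n) (us n) (vs n))) \<longlonglongrightarrow> ext T (W l u v)"
        using Wball K Kl T0 by (intro ext_LIMSEQ) auto
      moreover have "(\<lambda>n. \<tau> (ls n, us n)) \<longlonglongrightarrow> \<tau> (l, u)"
        using lim by (intro continuous_on_tendsto_compose[OF \<tau>(1)] tendsto_Pair) auto
      ultimately show "(\<Phi> \<circ> zs) \<longlonglongrightarrow> \<Phi> z"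
        by (simp add: o_def zs_eq luv \<Phi>_def tendsto_Pair)
    qed
  qed
  obtain l u v where luv: "z = (l, u, v)"
    using prod_cases3 by blast
  have K: "(l, u, v) \<in> K" "l \<in> {0..\<Lambda>}"
    using z luv by (auto simp: K_def)
  have fix_eq: "\<tau> (l, u) = l" "ext T (U l u v) = u" "ext T (W l u v) = v"
    using z(2) by (auto simp: luv \<Phi>_def)
  have u_eq: "u x = U l u v x" if "x \<in> {0..T}" for x
    using ext_apply_in[OF T0(1) _ that, of "U l u v"] Uball[OF K(1)] fix_eq(2) by simp
  have v_eq: "v x = W l u v x" if "x \<in> {0..T}" for x
    using ext_apply_in[OF T0(1) _ that, of "W l u v"] Wball[OF K(1)] fix_eq(3) by simp
  define IN where "IN = integral {0..T} (\<lambda>x. N x (u x) l)"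
  define IP where "IP = integral {0..T} (\<lambda>x. P (v x))"
  have u0: "cl A (u 0 - IN) = u 0" and v0: "cl B (v 0 - IP) = v 0"
    using u_eq[OF T0(2)] v_eq[OF T0(2)] unfolding U_def W_def IN_def IP_def by simp_all
  have du: "(u has_real_derivative P (v x)) (at x within {0..T})" if "x \<in> {0..T}" for x
  proof (rule has_field_derivative_transform[OF that])
    show "(U l u v has_real_derivative P (v x)) (at x within {0..T})"
      unfolding U_def[abs_def]
      using integral_has_real_derivative[OF cP that] by (auto intro!: derivative_eq_intros)
  qed (use u_eq in auto)
  have dv: "(v has_real_derivative N x (u x) l) (at x within {0..T})" if "x \<in> {0..T}" for x
  proof (rule has_field_derivative_transform[OF that])
    show "(W l u v has_real_derivative N x (u x) l) (at x within {0..T})"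
      unfolding W_def[abs_def]
      using integral_has_real_derivative[OF cN[OF K(2)] that] by (auto intro!: derivative_eq_intros)
  qed (use v_eq in auto)
  have uL: "\<bar>u x - u 0\<bar> \<le> L * T" if "x \<in> {0..T}" for x
  proof -
    have "u x - u 0 = integral {0..x} (\<lambda>x. P (v x))"
      using u_eq[OF that] u_eq[OF T0(2)] unfolding U_def by simp
    then show ?thesis
      using integral_0_bound[OF cP lips[OF K(1)] that] by simp
  qed
  have vM: "\<bar>v x - v 0\<bar> \<le> M * T" if "x \<in> {0..T}" for x
  proof -
    have "v x - v 0 = integral {0..x} (\<lambda>x. N x (u x) l)"
      using v_eq[OF that] v_eq[OF T0(2)] unfolding W_def by simp
    then show ?thesis
      using integral_0_bound[OF cN[OF K(2)] M[OF _ K(2)] that, of u] by simp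
  qed
  have "IN = 0"
    using clip_fixpoint[OF u0[unfolded cl_def] \<open>A > 0\<close>]
  proof (elim disjE conjE)
    assume "u 0 = A" "IN < 0"
    then have "N x (u x) l > 0" if "x \<in> {0..T}" for x
      using uL[OF that] that by (intro pos K(2)) (auto simp: A_def)
    then have "IN > 0"
      unfolding IN_def by (intro integral_0_pos \<open>T > 0\<close> cN K(2))
    with \<open>IN < 0\<close> show ?thesis by simp
  next
    assume "u 0 = - A" "IN > 0"
    then have "N x (u x) l < 0" if "x \<in> {0..T}" for x
      using uL[OF that] that by (intro neg K(2)) (auto simp: A_def)
    then have "integral {0..T} (\<lambda>x. - N x (u x) l) > 0"
      by (intro integral_0_pos \<open>T > 0\<close> continuous_intros cN K(2)) auto
    with \<open>IN > 0\<close> show ?thesis by (simp add: IN_def)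
  qed
  have "IP = 0"
    using clip_fixpoint[OF v0[unfolded cl_def] \<open>B > 0\<close>]
  proof (elim disjE conjE)
    assume "v 0 = B" "IP < 0"
    then have "P (v x) > 0" if "x \<in> {0..T}" for x
      using vM[OF that] that by (auto simp: B_def P_def)
    then have "IP > 0"
      unfolding IP_def by (intro integral_0_pos \<open>T > 0\<close> cP)
    with \<open>IP < 0\<close> show ?thesis by simp
  next
    assume "v 0 = - B" "IP > 0"
    then have "- P (v x) > 0" if "x \<in> {0..T}" for x
      using vM[OF that] that by (auto simp: B_def P_def)
    then have "integral {0..T} (\<lambda>x. - P (v x)) > 0"
      by (intro integral_0_pos \<open>T > 0\<close> continuous_intros cP) auto
    with \<open>IP > 0\<close> show ?thesis by (simp add: IP_def)
  qed
  have "u 0 = u T" "v 0 = v T"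
  proof -
    have "u T = cl A (u 0 - IN) + IP" "v T = cl B (v 0 - IP) + IN"
      using u_eq[OF T0(3)] v_eq[OF T0(3)] unfolding U_def W_def IN_def IP_def .
    then show "u 0 = u T" "v 0 = v T"
      using u0 v0 \<open>IN = 0\<close> \<open>IP = 0\<close> by auto
  qed
  then have "psys T p (\<lambda>x. N x (u x) l) u v"
    using du dv by (auto simp: psys_def P_def)
  moreover have "ext T u = u"
    using K(1) T0 by (auto intro!: bcontfun_eqI simp: ext_apply K_def lip_ball_def)
  moreover have "\<bar>u x\<bar> \<le> S + 2 * (phi (conj_exp p) (2 * M * T + 1) * T) + 1" for x
    using K(1) by (auto simp: K_def lip_ball_def A_def L_def P_def algebra_simps)
  ultimately show ?thesis
    using that[of l u v] K(2) fix_eq(1) by auto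
qed

section \<open>Minimum principle, unique continuation and Picone's identity\<close>

lemma psys_mvt:
  assumes S: "psys T p h u V" and ab: "0 \<le> a" "a < b" "b \<le> T"
  obtains z where "a < z" "z < b" "u b - u a = (b - a) * phi (conj_exp p) (V z)"
proof -
  have "continuous_on {a..b} u"
    using psysD(5)[OF S] ab by (auto intro: continuous_on_subset)
  moreover have "(u has_derivative (*) (phi (conj_exp p) (V x))) (at x)" if "a < x" "x < b" for x
    using psysD(1)[OF S, of x] that ab by (simp add: has_field_derivative_def at_within_Icc_at)
  ultimately show ?thesis
    using mvt[OF \<open>a < b\<close>, of u "\<lambda>x. (*) (phi (conj_exp p) (V x))"] that by (auto simp: mult.commute)
qed

text \<open>At an end point the one-sided derivative gives only one inequality for the flux. A
  minimum at one end is a minimum at the other because \<open>u 0 = u T\<close>, and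
  \<open>V 0 = V T\<close> joins the two inequalities.\<close>

lemma psys_flux_at_min:
  assumes "p > 1" "T > 0" and S: "psys T p h u V" and x0: "x0 \<in> {0..T}"
    and min: "\<And>x. x \<in> {0..T} \<Longrightarrow> u x0 \<le> u x"
  shows "V x0 = 0"
proof -
  have right: "\<not> V y < 0" if y: "y \<in> {0..<T}" "\<And>x. x \<in> {0..T} \<Longrightarrow> u y \<le> u x" for y
  proof
    assume "V y < 0"
    then have "phi (conj_exp p) (V y) < 0"
      by simp
    then obtain d where d: "d > 0" "\<forall>k>0. y + k \<in> {0..T} \<longrightarrow> k < d \<longrightarrow> u (y + k) < u y"
      using has_real_derivative_neg_dec_right[OF psysD(1)[OF S, of y]] y(1) by auto
    define k where "k = min (d / 2) ((T - y) / 2)"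
    have "k > 0" "k < d" "y + k \<in> {0..T}"
      using d(1) y(1) by (auto simp: k_def min_def field_simps)
    then show False
      using d(2) y(2)[of "y + k"] by fastforce
  qed
  have left: "\<not> V y > 0" if y: "y \<in> {0<..T}" "\<And>x. x \<in> {0..T} \<Longrightarrow> u y \<le> u x" for y
  proof
    assume "V y > 0"
    then have "phi (conj_exp p) (V y) > 0"
      by simp
    then obtain d where d: "d > 0" "\<forall>k>0. y - k \<in> {0..T} \<longrightarrow> k < d \<longrightarrow> u (y - k) < u y"
      using has_real_derivative_pos_inc_left[OF psysD(1)[OF S, of y]] y(1) by auto
    define k where "k = min (d / 2) (y / 2)"
    have "k > 0" "k < d" "y - k \<in> {0..T}"
      using d(1) y(1) by (auto simp: k_def min_def field_simps)
    then show False
      using d(2) y(2)[of "y - k"] by fastforce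
  qed
  consider "x0 \<in> {0<..<T}" | "x0 = 0 \<or> x0 = T"
    using x0 by fastforce
  then show ?thesis
  proof cases
    case 1
    then show ?thesis
      using left[of x0] right[of x0] min by fastforce
  next
    case 2
    then have "u 0 \<le> u x" "u T \<le> u x" if "x \<in> {0..T}" for x
      using min[OF that] psysD(3)[OF S] by auto
    then have "V 0 = 0"
      using left[of T] right[of 0] psysD(4)[OF S] \<open>T > 0\<close> by fastforce
    then show ?thesis
      using 2 psysD(4)[OF S] by auto
  qed
qed

text \<open>If \<open>h\<close> were negative at a minimum, the flux, being 0 there, would turn
  negative to the right and \<open>u\<close> would fall below its minimum.\<close>

lemma psys_min_principle:
  assumes "p > 1" "T > 0" and S: "psys T p h u V"
  obtains x0 where "x0 \<in> {0..T}" "\<And>x. x \<in> {0..T} \<Longrightarrow> u x0 \<le> u x" "h x0 \<ge> 0"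
proof -
  obtain x1 where x1: "x1 \<in> {0..T}" "\<And>x. x \<in> {0..T} \<Longrightarrow> u x1 \<le> u x"
    using continuous_attains_inf[of "{0..T}" u] psysD(5)[OF S] \<open>T > 0\<close> by auto
  \<comment> \<open>A minimum at \<open>T\<close> is moved to 0 by periodicity, which leaves room on
    the right.\<close>
  define x0 where "x0 = (if x1 = T then 0 else x1)"
  have x0: "x0 \<in> {0..<T}" "u x0 = u x1"
    using x1(1) \<open>T > 0\<close> psysD(3)[OF S] by (auto simp: x0_def)
  then have min: "u x0 \<le> u x" if "x \<in> {0..T}" for x
    using x1(2)[OF that] by simp
  have x0T: "x0 \<in> {0..T}"
    using x0 by auto
  have "V x0 = 0"
    using psys_flux_at_min[OF assms x0T min] .
  have "h x0 \<ge> 0"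
  proof (rule ccontr)
    assume "\<not> h x0 \<ge> 0"
    then obtain d where d: "d > 0" "\<forall>k>0. x0 + k \<in> {0..T} \<longrightarrow> k < d \<longrightarrow> V (x0 + k) < V x0"
      using has_real_derivative_neg_dec_right[OF psysD(2)[OF S x0T]] by auto
    define k where "k = min (d / 2) ((T - x0) / 2)"
    have k: "k > 0" "k < d" "x0 + k \<in> {0..T}"
      using d(1) x0(1) by (auto simp: k_def min_def field_simps)
    obtain z where z: "x0 < z" "z < x0 + k" "u (x0 + k) - u x0 = (x0 + k - x0) * phi (conj_exp p) (V z)"
      using psys_mvt[OF S, of x0 "x0 + k"] x0T k by auto
    have "V z < 0"
      using d(2)[rule_format, of "z - x0"] z k x0T \<open>V x0 = 0\<close> by auto
    then have "u (x0 + k) - u x0 < 0"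
      unfolding z(3) using k by (intro mult_pos_neg) auto
    then show False
      using min[OF k(3)] by simp
  qed
  then show ?thesis
    using that x0T min by blast
qed


section \<open>Unique continuation from double zeros\<close>

lemma abs_powr_minus_1:
  assumes "p > 1"
  shows "phi (conj_exp p) (c * \<bar>s\<bar> powr (p - 1)) = phi (conj_exp p) c * \<bar>s\<bar>"
proof -
  have "\<bar>s\<bar> powr (p - 1) = phi p \<bar>s\<bar>"
    by (simp add: phi_nonneg_eq)
  then show ?thesis
    using assms by (simp add: phi_mult)
qed

text \<open>On an interval of length \<open>\<delta>\<close> around a double zero one has
  \<open>max |u| \<le> \<delta> (C \<delta>)\<^bsup>1/(p-1)\<^esup> max |u|\<close>, so \<open>u\<close> vanishes there for small \<open>\<delta>\<close>.\<close>

lemma psys_double_zero: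
  assumes "p > 1" "T > 0" and S: "psys T p h u V"
    and h: "\<And>x. x \<in> {0..T} \<Longrightarrow> \<bar>h x\<bar> \<le> C * \<bar>u x\<bar> powr (p - 1)"
    and x0: "x0 \<in> {0..T}" "u x0 = 0" "V x0 = 0" and x: "x \<in> {0..T}"
  shows "u x = 0 \<and> V x = 0"
proof -
  define C' where "C' = \<bar>C\<bar> + 1"
  have C': "C' > 0" "C \<le> C'"
    by (auto simp: C'_def)
  \<comment> \<open>The bound 1 lets the length of the interval be dropped from the flux estimate;
    the other bound makes the factor in the estimate of \<open>u\<close> at most 1/2. Neither
    depends on the point, so the local argument can be repeated along the whole interval.\<close>
  define \<delta> where "\<delta> = min 1 (1 / (2 * phi (conj_exp p) C'))"
  have P: "phi (conj_exp p) C' > 0"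
    using C' by simp
  then have \<delta>: "0 < \<delta>" "\<delta> \<le> 1" "phi (conj_exp p) C' * \<delta> \<le> 1 / 2"
  proof -
    have "phi (conj_exp p) C' * \<delta> \<le> phi (conj_exp p) C' * (1 / (2 * phi (conj_exp p) C'))"
      using P by (intro mult_left_mono) (auto simp: \<delta>_def)
    then show "phi (conj_exp p) C' * \<delta> \<le> 1 / 2"
      using P by simp
  qed (use P in \<open>auto simp: \<delta>_def\<close>)
  have local: "u z = 0 \<and> V z = 0"
    if y: "y \<in> {0..T}" "u y = 0" "V y = 0" and z: "z \<in> {0..T}" "\<bar>z - y\<bar> \<le> \<delta>" for y z
  proof -
    define a b where "a = max 0 (y - \<delta>)" and "b = min T (y + \<delta>)"
    have ab: "a \<le> b" "{a..b} \<subseteq> {0..T}" "y \<in> {a..b}" "z \<in> {a..b}"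
      using y z \<delta> by (auto simp: a_def b_def)
    have near: "\<bar>t - y\<bar> \<le> \<delta>" if "t \<in> {a..b}" for t
      using that by (auto simp: a_def b_def)
    have "continuous_on {a..b} (\<lambda>x. \<bar>u x\<bar>)"
      using psysD(5)[OF S] ab by (auto intro!: continuous_intros intro: continuous_on_subset)
    then obtain s where s: "s \<in> {a..b}" "\<And>t. t \<in> {a..b} \<Longrightarrow> \<bar>u t\<bar> \<le> \<bar>u s\<bar>"
      using continuous_attains_sup[of "{a..b}" "\<lambda>x. \<bar>u x\<bar>"] ab(1) by auto
    define K where "K = C' * \<bar>u s\<bar> powr (p - 1)"
    have "K \<ge> 0"
      using C' by (simp add: K_def)
    have hK: "\<bar>h t\<bar> \<le> K" if "t \<in> {a..b}" for t
    proof -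
      have "\<bar>h t\<bar> \<le> C * \<bar>u t\<bar> powr (p - 1)"
        using h ab that by auto
      also have "\<dots> \<le> C' * \<bar>u s\<bar> powr (p - 1)"
        using C' s(2)[OF that] \<open>p > 1\<close> by (intro mult_mono powr_mono2) auto
      finally show ?thesis by (simp add: K_def)
    qed
    have VK: "\<bar>V t\<bar> \<le> K" if "t \<in> {a..b}" for t
    proof -
      have "\<bar>V t - V y\<bar> \<le> K * \<bar>t - y\<bar>"
        using ab that
        by (intro DERIV_bound_lipschitz[where f' = h and a = a and b = b] hK)
          (auto intro!: has_field_derivative_subset[OF psysD(2)[OF S]])
      also have "\<dots> \<le> K * 1"
        using near[OF that] \<delta> \<open>K \<ge> 0\<close> by (intro mult_left_mono) auto
      finally show ?thesis
        using y by simp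
    qed
    have "\<bar>u s - u y\<bar> \<le> phi (conj_exp p) K * \<bar>s - y\<bar>"
    proof (rule DERIV_bound_lipschitz[where a = a and b = b])
      show "\<bar>phi (conj_exp p) (V t)\<bar> \<le> phi (conj_exp p) K" if "t \<in> {a..b}" for t
        using VK[OF that] \<open>p > 1\<close> by (intro abs_phi_mono conj_exp_gt_1)
    qed (use ab s in \<open>auto intro!: has_field_derivative_subset[OF psysD(1)[OF S]]\<close>)
    also have "\<dots> \<le> phi (conj_exp p) K * \<delta>"
      using near[OF s(1)] \<open>K \<ge> 0\<close> by (intro mult_left_mono) auto
    also have "phi (conj_exp p) K = phi (conj_exp p) C' * \<bar>u s\<bar>"
      unfolding K_def using \<open>p > 1\<close> by (rule abs_powr_minus_1)
    also have "phi (conj_exp p) C' * \<bar>u s\<bar> * \<delta> = phi (conj_exp p) C' * \<delta> * \<bar>u s\<bar>"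
      by simp
    also have "\<dots> \<le> 1 / 2 * \<bar>u s\<bar>"
      using \<delta> by (intro mult_right_mono) auto
    finally have "u s = 0"
      using y by simp
    then have "K = 0"
      by (simp add: K_def)
    then show ?thesis
      using s(2)[OF ab(4)] VK[OF ab(4)] \<open>u s = 0\<close> by simp
  qed
  have "\<forall>x\<in>{0..T}. \<bar>x - x0\<bar> \<le> real n * \<delta> \<longrightarrow> u x = 0 \<and> V x = 0" for n
  proof (induction n)
    case 0
    then show ?case
      using x0 by auto
  next
    case (Suc n)
    show ?case
    proof (intro ballI impI)
      fix x assume x: "x \<in> {0..T}" "\<bar>x - x0\<bar> \<le> real (Suc n) * \<delta>"
      \<comment> \<open>The point \<open>y\<close> below divides the segment from \<open>x0\<close>
        to \<open>x\<close> in the ratio n to 1: it is within reach of the induction hypothesis and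
        at most \<open>\<delta>\<close> away from \<open>x\<close>.\<close>
      define r where "r = real n / real (Suc n)"
      have r: "0 \<le> r" "r \<le> 1" "real (Suc n) * r = real n" "real (Suc n) * (1 - r) = 1"
        by (auto simp: r_def field_simps)
      define y where "y = x0 + r * (x - x0)"
      have "y = (1 - r) * x0 + r * x"
        by (simp add: y_def algebra_simps)
      then have "y \<in> {0..T}"
        using convexD[of "{0..T}" x0 x "1 - r" r] x0 x r by simp
      moreover have "\<bar>y - x0\<bar> \<le> real n * \<delta>"
      proof -
        have "\<bar>y - x0\<bar> = r * \<bar>x - x0\<bar>"
          using r by (simp add: y_def abs_mult)
        also have "\<dots> \<le> r * (real (Suc n) * \<delta>)"
          using x r by (intro mult_left_mono)
        also have "\<dots> = real n * \<delta>"
          using r(3) by (metis mult.assoc mult.commute)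
        finally show ?thesis .
      qed
      ultimately have y: "y \<in> {0..T}" "u y = 0" "V y = 0"
        using Suc.IH by auto
      have "\<bar>x - y\<bar> = (1 - r) * \<bar>x - x0\<bar>"
      proof -
        have "x - y = (1 - r) * (x - x0)"
          by (simp add: y_def algebra_simps)
        then show ?thesis
          using r by (simp add: abs_mult)
      qed
      also have "\<dots> \<le> (1 - r) * (real (Suc n) * \<delta>)"
        using x r by (intro mult_left_mono) auto
      also have "\<dots> = \<delta>"
        using r(4) by (metis mult.assoc mult.commute mult_1)
      finally show "u x = 0 \<and> V x = 0"
        using local[OF y x(1)] by blast
    qed
  qed
  moreover obtain n where "\<bar>x - x0\<bar> \<le> real n * \<delta>"
    using reals_Archimedean3[OF \<open>0 < \<delta>\<close>] less_imp_le by blast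
  ultimately show ?thesis
    using x by blast
qed

text \<open>A zero of a nonnegative solution is a minimum, so the flux vanishes there as well and
  the zero is a double one.\<close>

lemma psys_nonneg_dichotomy:
  assumes "p > 1" "T > 0" and S: "psys T p h u V"
    and h: "\<And>x. x \<in> {0..T} \<Longrightarrow> \<bar>h x\<bar> \<le> C * \<bar>u x\<bar> powr (p - 1)"
    and nonneg: "\<And>x. x \<in> {0..T} \<Longrightarrow> u x \<ge> 0"
  shows "(\<forall>x\<in>{0..T}. u x > 0) \<or> (\<forall>x\<in>{0..T}. u x = 0)"
proof (cases "\<forall>x\<in>{0..T}. u x > 0")
  case False
  then obtain x0 where x0: "x0 \<in> {0..T}" "u x0 = 0"
    using nonneg by (metis order_le_less)
  then have "V x0 = 0"
    using nonneg by (intro psys_flux_at_min[OF assms(1-3)]) auto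
  then show ?thesis
    using psys_double_zero[OF assms(1-3) h x0] by blast
qed simp

section \<open>Energy identity and Picone's identity\<close>

lemma psys_energy:
  assumes "p > 1" "T > 0" and S: "psys T p h u V" and h: "continuous_on {0..T} h"
  shows "integral {0..T} (\<lambda>x. \<bar>phi (conj_exp p) (V x)\<bar> powr p + h x * u x) = 0"
proof -
  have "((\<lambda>x. \<bar>phi (conj_exp p) (V x)\<bar> powr p + h x * u x) has_integral (V T * u T - V 0 * u 0)) {0..T}"
  proof (rule fundamental_theorem_of_calculus)
    fix x assume x: "x \<in> {0..T}"
    have "((\<lambda>x. V x * u x) has_real_derivative V x * phi (conj_exp p) (V x) + h x * u x) (at x within {0..T})"
      using psysD(1,2)[OF S x] by (auto intro!: derivative_eq_intros)
    moreover have "V x * phi (conj_exp p) (V x) = \<bar>phi (conj_exp p) (V x)\<bar> powr p"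
      using phi_mult_self[of p "phi (conj_exp p) (V x)"] \<open>p > 1\<close> by simp
    ultimately show "((\<lambda>x. V x * u x) has_vector_derivative
        \<bar>phi (conj_exp p) (V x)\<bar> powr p + h x * u x) (at x within {0..T})"
      by (simp add: has_real_derivative_iff_has_vector_derivative)
  qed (use \<open>T > 0\<close> in simp)
  then show ?thesis
    using psysD(3,4)[OF S] by (simp add: integral_unique)
qed

lemma integral_0_eq_0D:
  fixes f :: "real \<Rightarrow> real"
  assumes "a < b" "continuous_on {a..b} f" "\<And>x. x \<in> {a..b} \<Longrightarrow> f x \<ge> 0" "integral {a..b} f = 0"
    and "x \<in> {a..b}"
  shows "f x = 0"
  using integral_eq_0_iff[OF assms(2,1)] assms(3-5) by blast

text \<open>Both terms of the energy identity are nonnegative, so each vanishes pointwise, and the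
  first of them is the p-th power of the derivative.\<close>

lemma psys_monotone_const:
  assumes "p > 1" "T > 0" and S: "psys T p h u V" and h: "continuous_on {0..T} h"
    and mono: "\<And>x. x \<in> {0..T} \<Longrightarrow> h x * u x \<ge> 0" and x: "x \<in> {0..T}"
  shows "h x * u x = 0" "u x = u 0"
proof -
  have c: "continuous_on {0..T} (\<lambda>x. \<bar>phi (conj_exp p) (V x)\<bar> powr p + h x * u x)"
    using psysD(5,6)[OF S] h \<open>p > 1\<close>
    by (intro continuous_intros conj_exp_gt_1) auto
  have z: "\<bar>phi (conj_exp p) (V x)\<bar> powr p + h x * u x = 0" if "x \<in> {0..T}" for x
    using integral_0_eq_0D[OF \<open>T > 0\<close> c _ psys_energy[OF assms(1-4)] that] mono by simp
  have "h x * u x = 0 \<and> phi (conj_exp p) (V x) = 0" if "x \<in> {0..T}" for x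
    using z[OF that] mono[OF that] powr_ge_zero[of "\<bar>phi (conj_exp p) (V x)\<bar>" p]
    by (smt (verit) powr_eq_0_iff abs_eq_0_iff)
  note * = this
  show "h x * u x = 0"
    using *[OF x] by simp
  have "\<bar>u x - u 0\<bar> \<le> 0 * \<bar>x - 0\<bar>"
    by (rule DERIV_bound_lipschitz[OF psysD(1)[OF S]]) (use * x \<open>T > 0\<close> in auto)
  then show "u x = u 0"
    by simp
qed

text \<open>The gap between the p-th power at \<open>a\<close> and its tangent at \<open>b\<close>,
  a Bregman distance. With a = z' and b = z u'/u it is the remainder in Picone's identity.\<close>

definition picone_defect :: "real \<Rightarrow> real \<Rightarrow> real \<Rightarrow> real" where
  "picone_defect p a b = \<bar>a\<bar> powr p - (\<bar>b\<bar> powr p + p * phi p b * (a - b))"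

lemma picone_defect_nonneg: "p > 1 \<Longrightarrow> picone_defect p a b \<ge> 0"
  using abs_powr_tangent_le[of p b a] by (simp add: picone_defect_def)

lemma picone_defect_eq_0D: "p > 1 \<Longrightarrow> picone_defect p a b = 0 \<Longrightarrow> a = b"
  using abs_powr_tangent_less[of p a b] by (cases "a = b") (auto simp: picone_defect_def)

text \<open>\<open>\<Theta>\<close> is the flux of \<open>u\<close> paired with the test function
  |z|^p / u^(p-1). By the product rule its derivative is the \<open>h\<close> term plus p phi(c) z'
  - (p-1) |c|^p with c = z u'/u, and the latter is |z'|^p minus the defect. The boundary values of
  \<open>\<Theta>\<close> are kept because the identity is also used on subintervals.\<close>

lemma picone_identity:
  fixes u V h z z' :: "real \<Rightarrow> real"
  assumes "p > 1" "a \<le> b" and upos: "\<And>x. x \<in> {a..b} \<Longrightarrow> u x > 0"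
    and u: "\<And>x. x \<in> {a..b} \<Longrightarrow> (u has_real_derivative phi (conj_exp p) (V x)) (at x within {a..b})"
    and V: "\<And>x. x \<in> {a..b} \<Longrightarrow> (V has_real_derivative h x) (at x within {a..b})"
    and z: "\<And>x. x \<in> {a..b} \<Longrightarrow> (z has_real_derivative z' x) (at x within {a..b})"
    and cz': "continuous_on {a..b} z'" and ch: "continuous_on {a..b} h"
  defines "\<Theta> \<equiv> \<lambda>x. V x * (\<bar>z x\<bar> powr p * u x powr (1 - p))"
    and "D \<equiv> \<lambda>x. picone_defect p (z' x) (z x * phi (conj_exp p) (V x) / u x)"
  shows "integral {a..b} (\<lambda>x. \<bar>z' x\<bar> powr p + h x * (\<bar>z x\<bar> powr p * u x powr (1 - p)))
      = \<Theta> b - \<Theta> a + integral {a..b} D"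
    and "continuous_on {a..b} D"
proof -
  have cu: "continuous_on {a..b} u" and cV: "continuous_on {a..b} V" and cz: "continuous_on {a..b} z"
    using DERIV_continuous_on[OF u] DERIV_continuous_on[OF V] DERIV_continuous_on[OF z] by auto
  show cD: "continuous_on {a..b} D"
    unfolding D_def picone_defect_def using \<open>p > 1\<close> upos
    by (intro continuous_intros cz' cz cV cu conj_exp_gt_1) (auto simp: less_imp_neq[THEN not_sym])
  define G where "G x = \<bar>z' x\<bar> powr p + h x * (\<bar>z x\<bar> powr p * u x powr (1 - p)) - D x" for x
  have "(G has_integral (\<Theta> b - \<Theta> a)) {a..b}"
  proof (rule fundamental_theorem_of_calculus[OF \<open>a \<le> b\<close>])
    fix x assume x: "x \<in> {a..b}"
    define w where "w = phi (conj_exp p) (V x)"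
    have Vw: "V x = phi p w"
      using \<open>p > 1\<close> by (simp add: w_def)
    define c where "c = z x * w / u x"
    have phic: "phi p c = phi p (z x) * V x * u x powr (1 - p)"
    proof -
      have "phi p c = phi p (z x) * phi p w / u x powr (p - 1)"
        using upos[OF x] by (simp add: c_def phi_mult phi_divide phi_nonneg_eq del: phi_phi_conj)
      moreover have "u x powr (1 - p) = inverse (u x powr (p - 1))"
        using powr_minus[of "u x" "p - 1"] by simp
      ultimately show ?thesis
        by (simp add: Vw divide_inverse)
    qed
    have cp: "\<bar>c\<bar> powr p = \<bar>z x\<bar> powr p * V x * u x powr (- p) * w"
    proof -
      have "\<bar>c\<bar> powr p = phi p c * c"
        by (simp add: phi_mult_self)
      also have "\<dots> = (phi p (z x) * z x) * V x * (u x powr (1 - p) / u x) * w"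
        unfolding phic by (simp add: c_def)
      also have "u x powr (1 - p) / u x = u x powr (- p)"
        using upos[OF x] by (simp add: powr_diff powr_minus_divide)
      finally show ?thesis
        by (simp add: phi_mult_self)
    qed
    have du: "((\<lambda>x. u x powr (1 - p)) has_real_derivative (1 - p) * u x powr (- p) * w) (at x within {a..b})"
      using u[OF x] upos[OF x] by (auto intro!: derivative_eq_intros simp: w_def)
    have "(\<Theta> has_real_derivative
        h x * (\<bar>z x\<bar> powr p * u x powr (1 - p)) +
        V x * (p * phi p (z x) * z' x * u x powr (1 - p) + \<bar>z x\<bar> powr p * ((1 - p) * u x powr (- p) * w)))
        (at x within {a..b})"
      unfolding \<Theta>_def
      using DERIV_mult[OF V[OF x] DERIV_mult[OF DERIV_abs_powr_chain[OF \<open>p > 1\<close> z[OF x]] du]]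
      by (rule DERIV_cong) (simp add: algebra_simps)
    also have "h x * (\<bar>z x\<bar> powr p * u x powr (1 - p)) +
        V x * (p * phi p (z x) * z' x * u x powr (1 - p) + \<bar>z x\<bar> powr p * ((1 - p) * u x powr (- p) * w))
      = h x * (\<bar>z x\<bar> powr p * u x powr (1 - p)) + p * phi p c * z' x + (1 - p) * \<bar>c\<bar> powr p"
      unfolding phic cp by (simp add: algebra_simps)
    also have "\<dots> = G x"
      unfolding G_def D_def picone_defect_def w_def[symmetric] c_def[symmetric]
      using phi_mult_self[of p c] by (simp add: algebra_simps)
    finally show "(\<Theta> has_vector_derivative G x) (at x within {a..b})"
      by (simp add: has_real_derivative_iff_has_vector_derivative)
  qed
  moreover have "(D has_integral integral {a..b} D) {a..b}"
    using cD by (intro integrable_integral integrable_continuous_real)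
  ultimately have "((\<lambda>x. G x + D x) has_integral (\<Theta> b - \<Theta> a + integral {a..b} D)) {a..b}"
    by (rule has_integral_add)
  then show "integral {a..b} (\<lambda>x. \<bar>z' x\<bar> powr p + h x * (\<bar>z x\<bar> powr p * u x powr (1 - p)))
      = \<Theta> b - \<Theta> a + integral {a..b} D"
    by (simp add: G_def integral_unique)
qed

section \<open>The perturbed problem and its limit\<close>

text \<open>A bounded restoring term: zero on \<open>[0, R]\<close>, with the sign of
  \<open>s\<close> elsewhere. Unlike a linear penalty it keeps the right-hand side bounded, as
  \<open>periodic_system_exists\<close> demands.\<close>

definition excess :: "real \<Rightarrow> real \<Rightarrow> real" where
  "excess R s = max (- 1) (min 1 (s - clp R s))"

lemma excess_eq_0: "s \<in> {0..R} \<Longrightarrow> excess R s = 0"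
  by (simp add: excess_def clp_id)

lemma excess_nonpos: "s \<le> 0 \<Longrightarrow> excess R s \<le> 0"
  by (simp add: excess_def clp_def)

lemma excess_mult_nonneg: "R \<ge> 0 \<Longrightarrow> excess R s * s \<ge> 0"
  by (cases "s \<ge> 0") (auto simp: excess_def clp_def intro: mult_nonpos_nonpos)

lemma uniform_limit_const_LIMSEQ:
  fixes c :: "nat \<Rightarrow> real"
  assumes "c \<longlonglongrightarrow> c'"
  shows "uniform_limit A (\<lambda>n x. c n) (\<lambda>x. c') sequentially"
  using assms by (auto simp: uniform_limit_iff tendsto_iff elim: eventually_mono)

text \<open>The excess term confines the solutions to \<open>[0, R]\<close> up to a bounded error and the constant
  \<open>es n\<close> excludes the zero solution, so that the minimum principle makes \<open>us n\<close> positive.\<close>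

lemma perturbed_problem_limit:
  fixes F :: "real \<Rightarrow> real \<Rightarrow> real \<Rightarrow> real" and \<tau> :: "real \<times> (real \<Rightarrow>\<^sub>C real) \<Rightarrow> real"
  assumes "p > 1" "T > 0" "\<Lambda> \<ge> 0" "R > 0"
    and F: "continuous_on ({0..T} \<times> UNIV \<times> UNIV) (\<lambda>(x, s, l). F x s l)"
    and F0: "\<And>x l. x \<in> {0..T} \<Longrightarrow> F x 0 l = 0"
    and \<tau>: "continuous_on UNIV \<tau>" "\<And>z. \<tau> z \<in> {0..\<Lambda>}"
  obtains C l u V ls us Vs es where "C > 0" "\<And>n::nat. es n > 0" "es \<longlonglongrightarrow> 0"
    "\<And>n. ls n \<in> {0..\<Lambda>}" "ls \<longlonglongrightarrow> l" "l \<in> {0..\<Lambda>}" "l = \<tau> (l, ext T u)"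
    "\<And>n. psys T p (\<lambda>x. C * excess R (us n x) - F x (clp R (us n x)) (ls n) - es n) (us n) (Vs n)"
    "\<And>n x. x \<in> {0..T} \<Longrightarrow> us n x > 0" "uniform_limit {0..T} us u sequentially"
    "psys T p (\<lambda>x. C * excess R (u x) - F x (clp R (u x)) l) u V"
    "\<And>x. x \<in> {0..T} \<Longrightarrow> u x \<ge> 0"
proof -
  have cF: "continuous_on ({0..T} \<times> UNIV \<times> {0..\<Lambda>}) (\<lambda>z. F (fst z) (clp R (fst (snd z))) (snd (snd z)))"
  proof -
    have "continuous_on ({0..T} \<times> UNIV \<times> {0..\<Lambda>}) (\<lambda>z. (fst z, clp R (fst (snd z)), snd (snd z)))"
      unfolding clp_def by (intro continuous_intros)
    moreover have "(\<lambda>z. (fst z, clp R (fst (snd z)), snd (snd z))) ` ({0..T} \<times> UNIV \<times> {0..\<Lambda>})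
        \<subseteq> {0..T} \<times> UNIV \<times> UNIV"
      by auto
    ultimately show ?thesis
      using continuous_on_compose2[OF F] by fastforce
  qed
  define Q where "Q = {0..T} \<times> {0..R} \<times> {0..\<Lambda>}"
  have "bounded ((\<lambda>(x, s, l). F x s l) ` Q)"
    unfolding Q_def
    by (intro compact_imp_bounded compact_continuous_image compact_Times continuous_on_subset[OF F]) auto
  then obtain B where B: "\<forall>z\<in>Q. \<bar>(\<lambda>(x, s, l). F x s l) z\<bar> \<le> B"
    unfolding bounded_iff by auto
  have FB: "\<bar>F x (clp R s) l\<bar> \<le> B" if "x \<in> {0..T}" "l \<in> {0..\<Lambda>}" for x s l
    using B that clp_in[of R s] \<open>R > 0\<close> by (auto simp: Q_def)
  \<comment> \<open>Beyond \<open>R + 1\<close> the excess is 1, and \<open>C\<close> outweighs the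
    bound \<open>B\<close> for the truncated \<open>F\<close> together with the perturbation, which
    is at most 1.\<close>
  define C where "C = B + 2"
  have "B \<ge> 0"
    using FB[of 0 0 0] \<open>T > 0\<close> \<open>\<Lambda> \<ge> 0\<close> by auto
  then have "C > 0"
    by (simp add: C_def)
  define N0 where "N0 x s l = C * excess R s - F x (clp R s) l" for x s l
  define N where "N e x s l = N0 x s l - e" for e x s l
  have cN0: "continuous_on ({0..T} \<times> UNIV \<times> {0..\<Lambda>}) (\<lambda>(x, s, l). N0 x s l)"
    unfolding N0_def excess_def split_beta
    by (intro continuous_intros cF) (auto simp: clp_def intro!: continuous_intros)
  have cN: "continuous_on ({0..T} \<times> UNIV \<times> {0..\<Lambda>}) (\<lambda>(x, s, l). N e x s l)" for e
    using cN0 unfolding N_def split_beta by (intro continuous_intros)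
  have NM: "\<bar>N e x s l\<bar> \<le> C + B + 1" if "0 < e" "e \<le> 1" "x \<in> {0..T}" "l \<in> {0..\<Lambda>}" for e x s l
  proof -
    have "\<bar>excess R s\<bar> \<le> 1"
      by (auto simp: excess_def)
    then have "\<bar>C * excess R s\<bar> \<le> C * 1"
      unfolding abs_mult using \<open>C > 0\<close> by (intro mult_mono) auto
    then show ?thesis
      using FB[OF that(3,4), of s] that unfolding N_def N0_def by linarith
  qed
  have Npos: "N e x s l > 0" if "0 < e" "e \<le> 1" "x \<in> {0..T}" "l \<in> {0..\<Lambda>}" "R + 1 \<le> s" for e x s l
  proof -
    have "excess R s = 1"
      using that \<open>R > 0\<close> by (auto simp: excess_def clp_def)
    then show ?thesis
      using FB[OF that(3,4), of s] that unfolding N_def N0_def C_def by simp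
  qed
  \<comment> \<open>For \<open>s \<le> 0\<close> the truncated \<open>F\<close> vanishes and the
    excess is not positive, so the perturbation alone makes the sign strict. This later excludes a
    minimum \<open>\<le> 0\<close>.\<close>
  have Nneg': "N e x s l < 0" if "0 < e" "x \<in> {0..T}" "s \<le> 0" for e x s l
  proof -
    have "clp R s = 0"
      using that \<open>R > 0\<close> by (auto simp: clp_def)
    moreover have "C * excess R s \<le> 0"
      using excess_nonpos[OF that(3)] \<open>C > 0\<close> by (simp add: mult_le_0_iff)
    ultimately show ?thesis
      using F0[OF that(2)] that unfolding N_def N0_def by simp
  qed
  define D where "D = R + 1 + 2 * (phi (conj_exp p) (2 * (C + B + 1) * T + 1) * T) + 1"
  have ex: "\<exists>l u V. l \<in> {0..\<Lambda>} \<and> l = \<tau> (l, ext T u) \<and> psys T p (\<lambda>x. N e x (u x) l) u V \<and>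
      (\<forall>x\<in>{0..T}. \<bar>u x\<bar> \<le> D)" if e: "0 < e" "e \<le> 1" for e
  proof -
    have neg: "N e x s l < 0" if "x \<in> {0..T}" "l \<in> {0..\<Lambda>}" "s \<le> - (R + 1)" for x s l
      using Nneg'[OF e(1) that(1)] that(3) \<open>R > 0\<close> by simp
    have "R + 1 \<ge> 0"
      using \<open>R > 0\<close> by simp
    show ?thesis
      by (rule periodic_system_exists[OF assms(1-3) \<open>R + 1 \<ge> 0\<close> cN NM[OF e] Npos[OF e] neg \<tau>])
        (unfold D_def, blast+)
  qed
  define es where "es n = inverse (real (Suc n))" for n
  have es: "es n > 0" "es n \<le> 1" for n
    by (auto simp: es_def inverse_eq_divide)
  obtain ls0 us0 Vs0 where s0: "\<And>n. ls0 n \<in> {0..\<Lambda>}" "\<And>n. ls0 n = \<tau> (ls0 n, ext T (us0 n))"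
    "\<And>n. psys T p (\<lambda>x. N (es n) x (us0 n x) (ls0 n)) (us0 n) (Vs0 n)"
    "\<And>n x. x \<in> {0..T} \<Longrightarrow> \<bar>us0 n x\<bar> \<le> D"
    using ex[OF es] by metis
  obtain l r0 where r0: "l \<in> {0..\<Lambda>}" "strict_mono (r0 :: nat \<Rightarrow> nat)" "(ls0 \<circ> r0) \<longlonglongrightarrow> l"
    using compact_imp_seq_compact[OF compact_Icc] s0(1) unfolding seq_compact_def by metis
  obtain u V r1 where r1: "strict_mono (r1 :: nat \<Rightarrow> nat)" "continuous_on {0..T} u"
    "uniform_limit {0..T} (\<lambda>n. us0 (r0 (r1 n))) u sequentially"
    "uniform_limit {0..T} (\<lambda>n. Vs0 (r0 (r1 n))) V sequentially"
    using psys_subsequence[OF assms(1,2) s0(3) NM[OF es _ s0(1)] s0(4), of "r0"] by metis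
  define r where "r = r0 \<circ> r1"
  have r: "strict_mono r"
    unfolding r_def using r0 r1 strict_mono_o by blast
  have ls: "(\<lambda>n. ls0 (r n)) \<longlonglongrightarrow> l"
    using LIMSEQ_subseq_LIMSEQ[OF r0(3) r1(1)] by (simp add: r_def o_def)
  have us: "uniform_limit {0..T} (\<lambda>n. us0 (r n)) u sequentially"
    using r1 by (simp add: r_def)
  have "es \<longlonglongrightarrow> 0"
    unfolding es_def by (rule LIMSEQ_inverse_real_of_nat)
  then have er: "(\<lambda>n. es (r n)) \<longlonglongrightarrow> 0"
    using LIMSEQ_subseq_LIMSEQ[OF _ r] by (auto simp: o_def)
  have pos: "us0 n x > 0" if x: "x \<in> {0..T}" for n x
  proof -
    obtain x0 where x0: "x0 \<in> {0..T}" "\<And>x. x \<in> {0..T} \<Longrightarrow> us0 n x0 \<le> us0 n x"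
      "N (es n) x0 (us0 n x0) (ls0 n) \<ge> 0"
      using psys_min_principle[OF assms(1,2) s0(3)] by metis
    then have "us0 n x0 > 0"
      using Nneg'[OF es(1) x0(1)] by (meson not_le)
    then show ?thesis
      using x0(2)[OF x] by linarith
  qed
  have "psys T p (\<lambda>x. N0 x (u x) l - 0) u V"
  proof (rule psys_limit[OF \<open>p > 1\<close> s0(3) us])
    show "uniform_limit {0..T} (\<lambda>n. Vs0 (r n)) V sequentially"
      using r1 by (simp add: r_def)
    show "uniform_limit {0..T} (\<lambda>n x. N (es (r n)) x (us0 (r n) x) (ls0 (r n))) (\<lambda>x. N0 x (u x) l - 0) sequentially"
      unfolding N_def
      by (intro uniform_limit_minus uniform_limit_Nemytskii[OF cN0] compact_Icc s0(1) ls r1(2) us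
          uniform_limit_const_LIMSEQ er)
  qed (use \<open>T > 0\<close> in simp)
  then have lim: "psys T p (\<lambda>x. C * excess R (u x) - F x (clp R (u x)) l) u V"
    by (simp add: N0_def)
  have "(\<lambda>n. \<tau> (ls0 (r n), ext T (us0 (r n)))) \<longlonglongrightarrow> \<tau> (l, ext T u)"
    using \<open>T > 0\<close> psysD(5)[OF s0(3)] r1(2) us ls
    by (intro continuous_on_tendsto_compose[OF \<tau>(1)] tendsto_Pair ext_LIMSEQ) auto
  then have "l = \<tau> (l, ext T u)"
    using ls s0(2) LIMSEQ_unique by (metis (no_types, lifting) ext)
  moreover have "u x \<ge> 0" if "x \<in> {0..T}" for x
    by (rule LIMSEQ_le_const[OF tendsto_uniform_limitI[OF us that]]) (use pos that in \<open>auto intro: less_imp_le\<close>)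
  ultimately show ?thesis
    using that[of C "\<lambda>n. es (r n)" "\<lambda>n. ls0 (r n)" l u "\<lambda>n. us0 (r n)" "\<lambda>n. Vs0 (r n)" V]
      \<open>C > 0\<close> es(1) er s0(1) ls r0(1) s0(3)[of "r _", unfolded N_def N0_def] pos us lim by blast
qed

section \<open>The principal eigenvalue\<close>

lemma phi_mult_powr:
  assumes "s > 0"
  shows "phi p s * s powr (1 - p) = 1"
  using assms by (simp add: phi_nonneg_eq flip: powr_add)

lemma integral_linear_combination:
  fixes f g :: "real \<Rightarrow> real"
  assumes "continuous_on {a..b} f" "continuous_on {a..b} g"
  shows "integral {a..b} (\<lambda>x. f x + c * g x) = integral {a..b} f + c * integral {a..b} g"
proof -
  have "f integrable_on {a..b}" "(\<lambda>x. c * g x) integrable_on {a..b}"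
    using assms by (auto intro!: integrable_continuous_real continuous_intros)
  then show ?thesis
    by (simp add: integral_add)
qed

lemma integral_pos_continuous:
  fixes f :: "real \<Rightarrow> real"
  assumes "a < b" "continuous_on {a..b} f" "\<And>x. x \<in> {a..b} \<Longrightarrow> f x \<ge> 0" "x \<in> {a..b}" "f x \<noteq> 0"
  shows "integral {a..b} f > 0"
proof -
  have "integral {a..b} f \<ge> 0"
    using assms by (intro Henstock_Kurzweil_Integration.integral_nonneg integrable_continuous_real) auto
  moreover have "integral {a..b} f \<noteq> 0"
    using integral_0_eq_0D[OF assms(1-3) _ assms(4)] assms(5) by blast
  ultimately show ?thesis
    by linarith
qed

lemma picone_periodic:
  assumes "p > 1" "T > 0" and S: "psys T p h u V" and h: "continuous_on {0..T} h"
    and u: "\<And>x. x \<in> {0..T} \<Longrightarrow> u x > 0"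
    and z: "\<And>x. x \<in> {0..T} \<Longrightarrow> (z has_real_derivative z' x) (at x within {0..T})"
    and z': "continuous_on {0..T} z'" "z 0 = z T"
  shows "integral {0..T} (\<lambda>x. \<bar>z' x\<bar> powr p + h x * (\<bar>z x\<bar> powr p * u x powr (1 - p)))
      = integral {0..T} (\<lambda>x. picone_defect p (z' x) (z x * phi (conj_exp p) (V x) / u x))"
    "continuous_on {0..T} (\<lambda>x. picone_defect p (z' x) (z x * phi (conj_exp p) (V x) / u x))"
    "integral {0..T} (\<lambda>x. \<bar>z' x\<bar> powr p + h x * (\<bar>z x\<bar> powr p * u x powr (1 - p))) \<ge> 0"
proof -
  have T: "0 \<le> T"
    using assms by simp
  note P = picone_identity[OF \<open>p > 1\<close> T u psysD(1)[OF S] psysD(2)[OF S] z z'(1) h]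
  show 1: "integral {0..T} (\<lambda>x. \<bar>z' x\<bar> powr p + h x * (\<bar>z x\<bar> powr p * u x powr (1 - p)))
      = integral {0..T} (\<lambda>x. picone_defect p (z' x) (z x * phi (conj_exp p) (V x) / u x))"
    using P(1) psysD(3,4)[OF S] z'(2) by simp
  show 2: "continuous_on {0..T} (\<lambda>x. picone_defect p (z' x) (z x * phi (conj_exp p) (V x) / u x))"
    using P(2) .
  show "integral {0..T} (\<lambda>x. \<bar>z' x\<bar> powr p + h x * (\<bar>z x\<bar> powr p * u x powr (1 - p))) \<ge> 0"
    unfolding 1 using 2 \<open>p > 1\<close>
    by (intro Henstock_Kurzweil_Integration.integral_nonneg integrable_continuous_real picone_defect_nonneg)
qed

locale weighted_problem =
  fixes T p :: real and q m :: "real \<Rightarrow> real"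
  assumes T_pos: "T > 0" and p_gt_1: "p > 1"
    and q_cont: "continuous_on {0..T} q" and q_nonneg: "x \<in> {0..T} \<Longrightarrow> q x \<ge> 0"
    and q_nonzero: "\<exists>x\<in>{0..T}. q x \<noteq> 0"
    and m_cont: "continuous_on {0..T} m" and m_pos: "\<exists>x\<in>{0..T}. m x > 0"
begin

section \<open>Positive eigenfunctions: comparison, simplicity, upper bounds\<close>

definition eigen :: "real \<Rightarrow> (real \<Rightarrow> real) \<Rightarrow> (real \<Rightarrow> real) \<Rightarrow> bool" where
  "eigen l w W \<longleftrightarrow> psys T p (\<lambda>x. (q x - l * m x) * phi p (w x)) w W"

definition mass :: "(real \<Rightarrow> real) \<Rightarrow> real" where
  "mass z = integral {0..T} (\<lambda>x. m x * \<bar>z x\<bar> powr p)"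

definition energy :: "(real \<Rightarrow> real) \<Rightarrow> (real \<Rightarrow> real) \<Rightarrow> real" where
  "energy z z' = integral {0..T} (\<lambda>x. \<bar>z' x\<bar> powr p + q x * \<bar>z x\<bar> powr p)"

lemma continuous_on_mq_powr:
  assumes "continuous_on {0..T} z"
  shows "continuous_on {0..T} (\<lambda>x. m x * \<bar>z x\<bar> powr p)" "continuous_on {0..T} (\<lambda>x. q x * \<bar>z x\<bar> powr p)"
    "continuous_on {0..T} (\<lambda>x. \<bar>z x\<bar> powr p)"
  using assms p_gt_1 by (auto intro!: continuous_intros m_cont q_cont)

lemma integral_energy_mass:
  assumes "continuous_on {0..T} z" "continuous_on {0..T} z'"
  shows "integral {0..T} (\<lambda>x. \<bar>z' x\<bar> powr p + (q x - l * m x) * \<bar>z x\<bar> powr p) = energy z z' - l * mass z"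
proof -
  have "integral {0..T} (\<lambda>x. (\<bar>z' x\<bar> powr p + q x * \<bar>z x\<bar> powr p) + (- l) * (m x * \<bar>z x\<bar> powr p))
      = energy z z' + (- l) * mass z"
    unfolding energy_def mass_def
    by (intro integral_linear_combination continuous_on_add continuous_on_mq_powr assms)
  then show ?thesis
    by (simp add: algebra_simps)
qed

lemma eigen_continuous:
  assumes "eigen l w W"
  shows "continuous_on {0..T} w" "continuous_on {0..T} W" "continuous_on {0..T} (\<lambda>x. phi (conj_exp p) (W x))"
    "continuous_on {0..T} (\<lambda>x. (q x - l * m x) * phi p (w x))"
  using psysD(5,6)[OF assms[unfolded eigen_def]] p_gt_1
  by (auto intro!: continuous_intros conj_exp_gt_1 m_cont q_cont)

lemma eigen_energy:
  assumes "eigen l w W"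
  shows "energy w (\<lambda>x. phi (conj_exp p) (W x)) = l * mass w"
proof -
  have "integral {0..T} (\<lambda>x. \<bar>phi (conj_exp p) (W x)\<bar> powr p + (q x - l * m x) * phi p (w x) * w x) = 0"
    using psys_energy[OF p_gt_1 T_pos assms[unfolded eigen_def] eigen_continuous(4)[OF assms]] .
  then show ?thesis
    using integral_energy_mass[OF eigen_continuous(1,3)[OF assms], of l]
    by (simp add: mult.assoc phi_mult_self)
qed

text \<open>With \<open>l = 0\<close> the energy identity has only nonnegative terms:
  \<open>w\<close> is constant, and it vanishes where \<open>q\<close> does not.\<close>

lemma eigen_at_0:
  assumes "eigen 0 w W" "x \<in> {0..T}"
  shows "w x = 0"
proof -
  have S: "psys T p (\<lambda>x. q x * phi p (w x)) w W" and c: "continuous_on {0..T} (\<lambda>x. q x * phi p (w x))"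
    using assms(1) eigen_continuous(4)[OF assms(1)] by (simp_all add: eigen_def)
  have nn: "0 \<le> q x * phi p (w x) * w x" if "x \<in> {0..T}" for x
    using q_nonneg[OF that] by (simp add: mult.assoc phi_mult_self)
  note const = psys_monotone_const[OF p_gt_1 T_pos S c nn]
  obtain y where "y \<in> {0..T}" "q y \<noteq> 0"
    using q_nonzero by blast
  then have "w y = 0"
    using const(1)[of y] by (auto simp: mult.assoc)
  then show ?thesis
    using const(2)[of y] const(2)[of x] \<open>y \<in> {0..T}\<close> assms(2) by simp
qed

lemma positive_energy:
  assumes "continuous_on {0..T} w" "continuous_on {0..T} w'" "\<And>x. x \<in> {0..T} \<Longrightarrow> w x > 0"
  shows "energy w w' > 0"
proof -
  obtain y where y: "y \<in> {0..T}" "q y \<noteq> 0"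
    using q_nonzero by blast
  show ?thesis
    unfolding energy_def
  proof (rule integral_pos_continuous[OF T_pos _ _ y(1)])
    show "continuous_on {0..T} (\<lambda>x. \<bar>w' x\<bar> powr p + q x * \<bar>w x\<bar> powr p)"
      by (intro continuous_on_add continuous_on_mq_powr assms)
    have "q y * \<bar>w y\<bar> powr p > 0"
      using assms(3)[OF y(1)] q_nonneg[OF y(1)] y(2) by simp
    then show "\<bar>w' y\<bar> powr p + q y * \<bar>w y\<bar> powr p \<noteq> 0"
      using powr_ge_zero[of "\<bar>w' y\<bar>" p] by linarith
  qed (use q_nonneg in auto)
qed

lemma eigen_mass_pos:
  assumes "eigen l w W" "\<And>x. x \<in> {0..T} \<Longrightarrow> w x > 0" "l > 0"
  shows "mass w > 0"
  using positive_energy[OF eigen_continuous(1,3)[OF assms(1)] assms(2)] eigen_energy[OF assms(1)] assms(3)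
  by (simp add: zero_less_mult_iff)

text \<open>Since \<open>phi p (w x) * w x powr (1 - p) = 1\<close>, the eigenfunction drops out of
  the left-hand side of Picone's identity, which becomes a statement about \<open>z\<close> alone.
  For \<open>z\<close> of positive mass it bounds the Rayleigh quotient from below by
  \<open>l\<close>.\<close>

lemma picone_eigen:
  assumes w: "eigen l w W" "\<And>x. x \<in> {0..T} \<Longrightarrow> w x > 0"
    and z: "\<And>x. x \<in> {0..T} \<Longrightarrow> (z has_real_derivative z' x) (at x within {0..T})"
    and z': "continuous_on {0..T} z'" "z 0 = z T"
  shows "energy z z' - l * mass z
      = integral {0..T} (\<lambda>x. picone_defect p (z' x) (z x * phi (conj_exp p) (W x) / w x))"
    "l * mass z \<le> energy z z'"
proof -
  have cz: "continuous_on {0..T} z"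
    using DERIV_continuous_on[OF z] .
  note P = picone_periodic[OF p_gt_1 T_pos w(1)[unfolded eigen_def] eigen_continuous(4)[OF w(1)] w(2) z z']
  have "integral {0..T} (\<lambda>x. \<bar>z' x\<bar> powr p + (q x - l * m x) * phi p (w x) * (\<bar>z x\<bar> powr p * w x powr (1 - p)))
      = integral {0..T} (\<lambda>x. \<bar>z' x\<bar> powr p + (q x - l * m x) * \<bar>z x\<bar> powr p)"
  proof (rule integral_cong)
    fix x assume "x \<in> {0..T}"
    then have "phi p (w x) * w x powr (1 - p) = 1"
      using w(2) by (intro phi_mult_powr)
    then have "(q x - l * m x) * phi p (w x) * (\<bar>z x\<bar> powr p * w x powr (1 - p))
        = (q x - l * m x) * \<bar>z x\<bar> powr p"
      by (metis (no_types, opaque_lifting) mult.assoc mult.commute mult.right_neutral)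
    then show "\<bar>z' x\<bar> powr p + (q x - l * m x) * phi p (w x) * (\<bar>z x\<bar> powr p * w x powr (1 - p))
      = \<bar>z' x\<bar> powr p + (q x - l * m x) * \<bar>z x\<bar> powr p"
      by simp
  qed
  then show "energy z z' - l * mass z
      = integral {0..T} (\<lambda>x. picone_defect p (z' x) (z x * phi (conj_exp p) (W x) / w x))"
    "l * mass z \<le> energy z z'"
    using P(1,3) integral_energy_mass[OF cz z'(1), of l] by auto
qed

text \<open>Picone's inequality for \<open>u\<close> is tested with \<open>w\<close>, whose energy
  is \<open>\<mu> * mass w\<close>. Used in both directions it leaves room for only one positive
  eigenvalue with a positive eigenfunction.\<close>

lemma eigenvalue_le:
  assumes u: "eigen l u U" "\<And>x. x \<in> {0..T} \<Longrightarrow> u x > 0"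
    and w: "eigen \<mu> w W" "\<And>x. x \<in> {0..T} \<Longrightarrow> w x > 0" "\<mu> > 0"
  shows "l \<le> \<mu>"
proof -
  note S = psysD[OF w(1)[unfolded eigen_def]]
  have "l * mass w \<le> \<mu> * mass w"
    using picone_eigen(2)[OF u S(1) eigen_continuous(3)[OF w(1)] S(3)] eigen_energy[OF w(1)] by simp
  then show ?thesis
    using eigen_mass_pos[OF w] by simp
qed

text \<open>Both eigenfunctions belong to the same \<open>l\<close>, so the Picone defect integrates
  to 0 and vanishes pointwise. Its equality case reads u' = u w'/w, hence \<open>u / w\<close> has
  derivative 0.\<close>

lemma eigen_simple:
  assumes w: "eigen l w W" "\<And>x. x \<in> {0..T} \<Longrightarrow> w x > 0" and u: "eigen l u U"
  obtains c where "\<And>x. x \<in> {0..T} \<Longrightarrow> u x = c * w x"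
proof -
  note S = psysD[OF u[unfolded eigen_def]] and SW = psysD[OF w(1)[unfolded eigen_def]]
  let ?P = "phi (conj_exp p)"
  note P = picone_eigen[OF w S(1) eigen_continuous(3)[OF u] S(3)]
  have 0: "integral {0..T} (\<lambda>x. picone_defect p (?P (U x)) (u x * ?P (W x) / w x)) = 0"
    using P(1) eigen_energy[OF u] by simp
  have c: "continuous_on {0..T} (\<lambda>x. picone_defect p (?P (U x)) (u x * ?P (W x) / w x))"
    using picone_periodic(2)[OF p_gt_1 T_pos w(1)[unfolded eigen_def] eigen_continuous(4)[OF w(1)] w(2)
        S(1) eigen_continuous(3)[OF u] S(3)] .
  have eq: "?P (U x) = u x * ?P (W x) / w x" if "x \<in> {0..T}" for x
    by (rule picone_defect_eq_0D[OF p_gt_1 integral_0_eq_0D[OF T_pos c picone_defect_nonneg[OF p_gt_1] 0 that]])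
  have "((\<lambda>x. u x / w x) has_real_derivative 0) (at x within {0..T})" if x: "x \<in> {0..T}" for x
    using S(1)[OF x] SW(1)[OF x] w(2)[OF x] eq[OF x]
    by (auto intro!: derivative_eq_intros simp: field_simps)
  note der = this
  have "u x = u 0 / w 0 * w x" if x: "x \<in> {0..T}" for x
  proof -
    have "\<bar>u x / w x - u 0 / w 0\<bar> \<le> 0 * \<bar>x - 0\<bar>"
      by (rule DERIV_bound_lipschitz[OF der]) (use x T_pos in auto)
    then have "u x / w x = u 0 / w 0"
      by simp
    then show ?thesis
      using w(2)[OF x] by (simp only: divide_eq_eq)
  qed
  then show ?thesis
    using that by blast
qed

text \<open>By Picone's identity for \<open>u\<close> and \<open>w\<close>. Small positive solutions thus have \<open>l\<close> at most slightly above \<open>\<mu>\<close>.\<close>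

lemma perturbed_upper_bound:
  assumes w: "eigen \<mu> w W" "\<And>x. x \<in> {0..T} \<Longrightarrow> w x > 0"
    and S: "psys T p (\<lambda>x. (q x - l * m x) * phi p (u x) - G x - e) u V"
    and u: "\<And>x. x \<in> {0..T} \<Longrightarrow> u x > 0" and "e \<ge> 0" and G: "continuous_on {0..T} G"
    and GN: "\<And>x. x \<in> {0..T} \<Longrightarrow> \<bar>G x\<bar> \<le> \<eta> * phi p (u x)"
  shows "(l - \<mu>) * mass w \<le> \<eta> * integral {0..T} (\<lambda>x. \<bar>w x\<bar> powr p)"
proof -
  note SW = psysD[OF w(1)[unfolded eigen_def]] and c = eigen_continuous[OF w(1)]
  have cu: "continuous_on {0..T} u"
    using psysD(5)[OF S] .
  let ?w' = "\<lambda>x. phi (conj_exp p) (W x)"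
  let ?h = "\<lambda>x. (q x - l * m x) * phi p (u x) - G x - e"
  have ch: "continuous_on {0..T} ?h"
    using cu p_gt_1 by (intro continuous_intros q_cont m_cont G)
  have "0 \<le> integral {0..T} (\<lambda>x. \<bar>?w' x\<bar> powr p + ?h x * (\<bar>w x\<bar> powr p * u x powr (1 - p)))"
    using picone_periodic(3)[OF p_gt_1 T_pos S ch u SW(1) c(3) SW(3)] .
  also have "\<dots> \<le> integral {0..T} (\<lambda>x. (\<bar>?w' x\<bar> powr p + (q x - l * m x) * \<bar>w x\<bar> powr p) + \<eta> * \<bar>w x\<bar> powr p)"
  proof (rule integral_le)
    show "(\<lambda>x. \<bar>?w' x\<bar> powr p + ?h x * (\<bar>w x\<bar> powr p * u x powr (1 - p))) integrable_on {0..T}"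
      using u by (intro integrable_continuous_real continuous_on_add continuous_on_mult ch
          continuous_on_mq_powr c continuous_on_powr cu continuous_on_const) (auto simp: less_imp_neq[THEN not_sym])
    show "(\<lambda>x. (\<bar>?w' x\<bar> powr p + (q x - l * m x) * \<bar>w x\<bar> powr p) + \<eta> * \<bar>w x\<bar> powr p) integrable_on {0..T}"
      by (intro integrable_continuous_real continuous_intros continuous_on_mq_powr c q_cont m_cont)
    fix x assume x: "x \<in> {0..T}"
    have ux: "phi p (u x) * u x powr (1 - p) = 1"
      using u[OF x] by (rule phi_mult_powr)
    have "?h x \<le> (q x - l * m x + \<eta>) * phi p (u x)"
      using GN[OF x] \<open>e \<ge> 0\<close> by (simp add: algebra_simps abs_le_iff)
    then have "?h x * (\<bar>w x\<bar> powr p * u x powr (1 - p))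
        \<le> (q x - l * m x + \<eta>) * phi p (u x) * (\<bar>w x\<bar> powr p * u x powr (1 - p))"
      by (intro mult_right_mono) auto
    also have "\<dots> = (q x - l * m x + \<eta>) * \<bar>w x\<bar> powr p * (phi p (u x) * u x powr (1 - p))"
      by (simp only: ac_simps)
    finally show "\<bar>?w' x\<bar> powr p + ?h x * (\<bar>w x\<bar> powr p * u x powr (1 - p))
      \<le> (\<bar>?w' x\<bar> powr p + (q x - l * m x) * \<bar>w x\<bar> powr p) + \<eta> * \<bar>w x\<bar> powr p"
      unfolding ux by (simp add: algebra_simps)
  qed
  also have "\<dots> = energy w ?w' - l * mass w + \<eta> * integral {0..T} (\<lambda>x. \<bar>w x\<bar> powr p)"
    unfolding integral_energy_mass[OF c(1,3), symmetric]
    by (intro integral_linear_combination continuous_intros continuous_on_mq_powr c q_cont m_cont)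
  finally show ?thesis
    using eigen_energy[OF w(1)] by (simp add: algebra_simps)
qed

text \<open>Works before any eigenfunction is known: Picone's identity is localised to an interval
  where \<open>m > 0\<close>, with a test function that vanishes at its ends, so the unknown flux of
  \<open>u\<close> at the ends does not enter.\<close>

lemma local_upper_bound:
  obtains L where "L > 0"
    "\<And>l u V e. \<lbrakk>psys T p (\<lambda>x. (q x - l * m x) * phi p (u x) - e) u V; e \<ge> 0; \<And>x. x \<in> {0..T} \<Longrightarrow> u x > 0\<rbrakk> \<Longrightarrow> l < L"
proof -
  obtain y where y: "y \<in> {0..T}" "m y > 0"
    using m_pos by blast
  obtain d where d: "d > 0" "\<And>x. x \<in> {0..T} \<Longrightarrow> dist x y < d \<Longrightarrow> dist (m x) (m y) < m y"
    using m_cont[unfolded continuous_on_iff, rule_format, OF y] by blast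
  define a b where "a = max 0 (y - d / 2)" and "b = min T (y + d / 2)"
  have ab: "a < b" "{a..b} \<subseteq> {0..T}"
    using y d(1) T_pos by (auto simp: a_def b_def)
  have mab: "m x > 0" if "x \<in> {a..b}" for x
    using d(2)[of x] that d(1) by (auto simp: a_def b_def dist_real_def abs_less_iff)
  define z where "z x = (x - a) * (b - x)" for x
  define z' where "z' x = a + b - 2 * x" for x
  have z: "(z has_real_derivative z' x) (at x within {a..b})" for x
    unfolding z_def[abs_def] z'_def by (auto intro!: derivative_eq_intros)
  have cz: "continuous_on {a..b} z" "continuous_on {a..b} z'"
    unfolding z_def[abs_def] z'_def[abs_def] by (intro continuous_intros)+
  have cm: "continuous_on {a..b} m" and cq: "continuous_on {a..b} q"
    using ab m_cont q_cont by (auto intro: continuous_on_subset)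
  define M where "M = integral {a..b} (\<lambda>x. m x * \<bar>z x\<bar> powr p)"
  define Q where "Q = integral {a..b} (\<lambda>x. \<bar>z' x\<bar> powr p + q x * \<bar>z x\<bar> powr p)"
  have cM: "continuous_on {a..b} (\<lambda>x. m x * \<bar>z x\<bar> powr p)"
    using p_gt_1 by (intro continuous_intros cm cz) auto
  have cQ: "continuous_on {a..b} (\<lambda>x. \<bar>z' x\<bar> powr p + q x * \<bar>z x\<bar> powr p)"
    using p_gt_1 by (intro continuous_intros cq cz) auto
  have "M > 0"
    unfolding M_def
  proof (rule integral_pos_continuous[OF ab(1) cM])
    show "(a + b) / 2 \<in> {a..b}"
      using ab(1) by auto
    then show "m ((a + b) / 2) * \<bar>z ((a + b) / 2)\<bar> powr p \<noteq> 0"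
      using mab[of "(a + b) / 2"] ab(1) by (auto simp: z_def)
  qed (use mab in \<open>simp add: less_imp_le\<close>)
  show thesis
  proof (rule that)
    show "\<bar>Q\<bar> / M + 1 > 0"
      using \<open>M > 0\<close> by (intro add_nonneg_pos) auto
    fix l u V e
    assume S: "psys T p (\<lambda>x. (q x - l * m x) * phi p (u x) - e) u V" and "e \<ge> 0"
      and u: "\<And>x. x \<in> {0..T} \<Longrightarrow> u x > 0"
    let ?h = "\<lambda>x. (q x - l * m x) * phi p (u x) - e"
    have cu: "continuous_on {a..b} u"
      using psysD(5)[OF S] ab(2) by (rule continuous_on_subset)
    have ch: "continuous_on {a..b} ?h"
      using p_gt_1 by (intro continuous_intros cq cm cu)
    have uab: "u x > 0" if "x \<in> {a..b}" for x
      using u that ab by auto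
    note P = picone_identity[OF p_gt_1 less_imp_le[OF ab(1)] uab
        has_field_derivative_subset[OF psysD(1)[OF S] ab(2)]
        has_field_derivative_subset[OF psysD(2)[OF S] ab(2)] z cz(2) ch]
    have "0 \<le> integral {a..b} (\<lambda>x. picone_defect p (z' x) (z x * phi (conj_exp p) (V x) / u x))"
      using P(2) ab(2) p_gt_1
      by (intro Henstock_Kurzweil_Integration.integral_nonneg integrable_continuous_real picone_defect_nonneg) auto
    then have "0 \<le> integral {a..b} (\<lambda>x. \<bar>z' x\<bar> powr p + ?h x * (\<bar>z x\<bar> powr p * u x powr (1 - p)))"
      using P(1) ab(2) by (auto simp: z_def)
    also have "\<dots> \<le> integral {a..b} (\<lambda>x. (\<bar>z' x\<bar> powr p + q x * \<bar>z x\<bar> powr p) + (- l) * (m x * \<bar>z x\<bar> powr p))"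
    proof (rule integral_le)
      show "(\<lambda>x. \<bar>z' x\<bar> powr p + ?h x * (\<bar>z x\<bar> powr p * u x powr (1 - p))) integrable_on {a..b}"
        using uab p_gt_1 by (intro integrable_continuous_real continuous_on_add continuous_on_mult ch
            continuous_on_abs_powr cz continuous_on_powr cu continuous_on_const) (auto simp: less_imp_neq[THEN not_sym])
      show "(\<lambda>x. (\<bar>z' x\<bar> powr p + q x * \<bar>z x\<bar> powr p) + (- l) * (m x * \<bar>z x\<bar> powr p)) integrable_on {a..b}"
        by (intro integrable_continuous_real continuous_on_add continuous_on_mult cQ cM continuous_on_const)
      fix x assume x: "x \<in> {a..b}"
      have ux: "phi p (u x) * u x powr (1 - p) = 1"
        using uab[OF x] by (rule phi_mult_powr)
      have "?h x * (\<bar>z x\<bar> powr p * u x powr (1 - p))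
          \<le> (q x - l * m x) * phi p (u x) * (\<bar>z x\<bar> powr p * u x powr (1 - p))"
        using \<open>e \<ge> 0\<close> by (intro mult_right_mono) auto
      also have "\<dots> = (q x - l * m x) * \<bar>z x\<bar> powr p * (phi p (u x) * u x powr (1 - p))"
        by (simp only: ac_simps)
      finally show "\<bar>z' x\<bar> powr p + ?h x * (\<bar>z x\<bar> powr p * u x powr (1 - p))
        \<le> (\<bar>z' x\<bar> powr p + q x * \<bar>z x\<bar> powr p) + (- l) * (m x * \<bar>z x\<bar> powr p)"
        unfolding ux by (simp add: algebra_simps)
    qed
    also have "\<dots> = Q + (- l) * M"
      unfolding Q_def M_def by (intro integral_linear_combination cQ cM)
    finally have "l * M \<le> \<bar>Q\<bar>"
      by simp
    then have "l \<le> \<bar>Q\<bar> / M"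
      using \<open>M > 0\<close> by (simp add: pos_le_divide_eq)
    then show "l < \<bar>Q\<bar> / M + 1"
      by simp
  qed
qed

section \<open>Existence of the principal eigenvalue\<close>

lemma linear_bound:
  obtains C where "\<And>x s l. x \<in> {0..T} \<Longrightarrow> \<bar>l\<bar> \<le> \<Lambda> \<Longrightarrow> \<bar>(q x - l * m x) * phi p s\<bar> \<le> C * \<bar>s\<bar> powr (p - 1)"
proof -
  have "bounded (q ` {0..T})" "bounded (m ` {0..T})"
    using q_cont m_cont by (auto intro!: compact_imp_bounded compact_continuous_image)
  then obtain A B where A: "\<forall>x\<in>{0..T}. \<bar>q x\<bar> \<le> A" and B: "\<forall>x\<in>{0..T}. \<bar>m x\<bar> \<le> B"
    unfolding bounded_iff by auto
  show thesis
  proof (rule that)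
    fix x s l assume x: "x \<in> {0..T}" and l: "\<bar>l\<bar> \<le> \<Lambda>"
    have "\<bar>l * m x\<bar> \<le> \<Lambda> * B"
      unfolding abs_mult using l B x by (intro mult_mono) auto
    then have "\<bar>q x - l * m x\<bar> \<le> A + \<Lambda> * B"
      using A x by (smt (verit, best))
    then show "\<bar>(q x - l * m x) * phi p s\<bar> \<le> (A + \<Lambda> * B) * \<bar>s\<bar> powr (p - 1)"
      unfolding abs_mult abs_phi by (intro mult_right_mono) auto
  qed
qed

text \<open>The right-hand side has the sign of \<open>u\<close>, so
  \<open>psys_monotone_const\<close> makes \<open>u\<close> constant; clipping keeps positive values
  positive, so a point with \<open>q\<close> nonzero forces the constant to be 0.\<close>

lemma truncated_solution_at_0:
  assumes S: "psys T p (\<lambda>x. C * excess R (u x) + q x * phi p (clp R (u x))) u V" and "C > 0" "R > 0"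
    and nonneg: "\<And>x. x \<in> {0..T} \<Longrightarrow> u x \<ge> 0" and x: "x \<in> {0..T}"
  shows "u x = 0"
proof -
  let ?h = "\<lambda>x. C * excess R (u x) + q x * phi p (clp R (u x))"
  have c: "continuous_on {0..T} ?h"
    unfolding excess_def clp_def using p_gt_1 psysD(5)[OF S] by (intro continuous_intros q_cont)
  have ex: "C * (excess R (u x) * u x) \<ge> 0" for x
    using \<open>C > 0\<close> excess_mult_nonneg[of R "u x"] \<open>R > 0\<close> by simp
  have nn: "?h x * u x \<ge> 0" if "x \<in> {0..T}" for x
  proof -
    have "clp R (u x) \<ge> 0"
      by (simp add: clp_def)
    then have "q x * phi p (clp R (u x)) * u x \<ge> 0"
      using q_nonneg[OF that] nonneg[OF that] by simp
    then show ?thesis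
      using ex[of x] by (simp add: algebra_simps)
  qed
  note const = psys_monotone_const[OF p_gt_1 T_pos S c nn]
  obtain y where y: "y \<in> {0..T}" "q y \<noteq> 0"
    using q_nonzero by blast
  have "u y = 0"
  proof (rule ccontr)
    assume "u y \<noteq> 0"
    then have "u y > 0"
      using nonneg[OF y(1)] by simp
    then have "q y * phi p (clp R (u y)) * u y > 0"
      using q_nonneg[OF y(1)] y(2) \<open>R > 0\<close> by (simp add: clp_def)
    then show False
      using const(1)[of y] y(1) ex[of y] by (simp add: algebra_simps)
  qed
  then show ?thesis
    using const(2)[of y] const(2)[of x] y(1) x by simp
qed

text \<open>\<open>\<tau>\<close> falls from \<open>\<Lambda>\<close> at \<open>u = 0\<close> to 0
  at norm 1. A limit of norm at least 1 would have \<open>l = 0\<close> and therefore vanish. A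
  vanishing limit would have \<open>l = \<Lambda>\<close>, although its approximations, eventually
  in the region where no truncation acts, satisfy the upper bound. Between the two lies an
  eigenfunction with \<open>l > 0\<close>.\<close>

lemma principal_eigen_exists:
  obtains \<mu> w W where "\<mu> > 0" "eigen \<mu> w W" "\<And>x. x \<in> {0..T} \<Longrightarrow> w x > 0"
proof -
  \<comment> \<open>The upper bound is doubled so that it stays strictly below
    \<open>\<Lambda>\<close> after passing to the limit.\<close>
  obtain \<Lambda> where "\<Lambda> > 0" and \<Lambda>: "\<And>l u V e. psys T p (\<lambda>x. (q x - l * m x) * phi p (u x) - e) u V \<Longrightarrow>
      e \<ge> 0 \<Longrightarrow> (\<And>x. x \<in> {0..T} \<Longrightarrow> u x > 0) \<Longrightarrow> l < \<Lambda> / 2"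
  proof (rule local_upper_bound)
    fix L assume "L > 0" and "\<And>l u V e. \<lbrakk>psys T p (\<lambda>x. (q x - l * m x) * phi p (u x) - e) u V; e \<ge> 0;
        \<And>x. x \<in> {0..T} \<Longrightarrow> u x > 0\<rbrakk> \<Longrightarrow> l < L"
    then show thesis
      using that[of "2 * L"] by simp
  qed
  define F where "F x s l = (l * m x - q x) * phi p s" for x s l
  define \<tau> :: "real \<times> (real \<Rightarrow>\<^sub>C real) \<Rightarrow> real" where "\<tau> z = \<Lambda> * max 0 (1 - norm (snd z))" for z
  have cF: "continuous_on ({0..T} \<times> UNIV \<times> UNIV) (\<lambda>(x, s, l). F x s l)"
    unfolding F_def split_beta using p_gt_1
    by (intro continuous_intros continuous_on_compose2[OF m_cont] continuous_on_compose2[OF q_cont]) auto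
  have c\<tau>: "continuous_on UNIV \<tau>"
    unfolding \<tau>_def[abs_def] by (intro continuous_intros)
  have \<tau>01: "\<tau> z \<in> {0..\<Lambda>}" for z
  proof -
    have "\<Lambda> * max 0 (1 - norm (snd z)) \<le> \<Lambda> * 1"
      using \<open>\<Lambda> > 0\<close> by (intro mult_left_mono) auto
    then show ?thesis
      using \<open>\<Lambda> > 0\<close> by (auto simp: \<tau>_def)
  qed
  obtain C l u V ls us Vs es where C: "C > 0" and es: "\<And>n::nat. es n > 0" "es \<longlonglongrightarrow> 0"
    and ls: "\<And>n. ls n \<in> {0..\<Lambda>}" "ls \<longlonglongrightarrow> l" "l \<in> {0..\<Lambda>}" and l: "l = \<tau> (l, ext T u)"
    and Sn: "\<And>n. psys T p (\<lambda>x. C * excess 1 (us n x) - F x (clp 1 (us n x)) (ls n) - es n) (us n) (Vs n)"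
    and pos: "\<And>n x. x \<in> {0..T} \<Longrightarrow> us n x > 0" and lim: "uniform_limit {0..T} us u sequentially"
    and S: "psys T p (\<lambda>x. C * excess 1 (u x) - F x (clp 1 (u x)) l) u V"
    and nonneg: "\<And>x. x \<in> {0..T} \<Longrightarrow> u x \<ge> 0"
    by (rule perturbed_problem_limit[OF p_gt_1 T_pos less_imp_le[OF \<open>\<Lambda> > 0\<close>] zero_less_one cF _ c\<tau> \<tau>01])
      (simp add: F_def, blast)
  have cu: "continuous_on {0..T} u"
    using psysD(5)[OF S] .
  have norm_ge: "u x \<le> norm (ext T u)" if "x \<in> {0..T}" for x
    using norm_bounded[of "ext T u" x] ext_apply_in[OF less_imp_le[OF T_pos] cu that] by simp
  have "norm (ext T u) < 1"
  proof (rule ccontr)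
    assume *: "\<not> norm (ext T u) < 1"
    then have "l = 0"
      using l by (simp add: \<tau>_def)
    then have S0: "psys T p (\<lambda>x. C * excess 1 (u x) + q x * phi p (clp 1 (u x))) u V"
      using S by (simp add: F_def)
    have "u x = 0" if "x \<in> {0..T}" for x
      using truncated_solution_at_0[OF S0 C zero_less_one nonneg that] .
    then have "norm (ext T u) \<le> 0"
      using T_pos clp_in[of T] by (intro norm_bound) (simp add: ext_apply[OF _ cu])
    then show False
      using * by simp
  qed
  then have u1: "u x \<in> {0..1}" if "x \<in> {0..T}" for x
    using norm_ge[OF that] nonneg[OF that] by simp
  have "l > 0"
    using l \<open>norm (ext T u) < 1\<close> \<open>\<Lambda> > 0\<close> by (simp add: \<tau>_def)
  have E: "eigen l u V"
    unfolding eigen_def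
    by (rule psys_cong[OF S]) (use u1 in \<open>auto simp: F_def excess_eq_0 clp_id algebra_simps\<close>)
  obtain K where K: "\<And>x s l. x \<in> {0..T} \<Longrightarrow> \<bar>l\<bar> \<le> \<Lambda> \<Longrightarrow> \<bar>(q x - l * m x) * phi p s\<bar> \<le> K * \<bar>s\<bar> powr (p - 1)"
    using linear_bound[of \<Lambda>] by blast
  have "(\<forall>x\<in>{0..T}. u x > 0) \<or> (\<forall>x\<in>{0..T}. u x = 0)"
    using ls(3) by (intro psys_nonneg_dichotomy[OF p_gt_1 T_pos E[unfolded eigen_def] K nonneg]) auto
  moreover have False if 0: "\<forall>x\<in>{0..T}. u x = 0"
  proof -
    have "ext T u = 0"
      using T_pos clp_in[of T] 0 by (intro bcontfun_eqI) (simp add: ext_apply[OF _ cu])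
    then have "l = \<Lambda>"
      using l by (simp add: \<tau>_def)
    have "\<forall>\<^sub>F n in sequentially. \<forall>x\<in>{0..T}. dist (us n x) (u x) < 1"
      using uniform_limitD[OF lim zero_less_one] .
    then have "\<forall>\<^sub>F n in sequentially. ls n \<le> \<Lambda> / 2"
    proof eventually_elim
      case (elim n)
      have "us n x \<in> {0..1}" if "x \<in> {0..T}" for x
      proof -
        have "dist (us n x) (u x) < 1"
          using elim that by blast
        then show ?thesis
          using 0 pos[OF that, of n] that by (simp add: dist_real_def)
      qed
      then have "psys T p (\<lambda>x. (q x - ls n * m x) * phi p (us n x) - es n) (us n) (Vs n)"
        by (intro psys_cong[OF Sn]) (simp add: F_def excess_eq_0 clp_id algebra_simps)
      from \<Lambda>[OF this less_imp_le[OF es(1)] pos] show ?case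
        by simp
    qed
    then have "l \<le> \<Lambda> / 2"
      using ls(2) by (intro tendsto_upperbound) auto
    then show False
      using \<open>l = \<Lambda>\<close> \<open>\<Lambda> > 0\<close> by simp
  qed
  ultimately show ?thesis
    using that E \<open>l > 0\<close> by blast
qed

end

section \<open>Weak derivatives\<close>

definition tent :: "real \<Rightarrow> real" where
  "tent x = max 0 x - 2 * max 0 (x - 1) + max 0 (x - 2)"

text \<open>The primitive of \<open>tent\<close>, a hat of integral 1 supported on
  \<open>[0, 2]\<close>: a step from 0 to 1 of class C^1. Test functions are only required to be
  C^1, so this piecewise quadratic is smooth enough.\<close>

definition ramp :: "real \<Rightarrow> real" where
  "ramp x = ((max 0 x)\<^sup>2 - 2 * (max 0 (x - 1))\<^sup>2 + (max 0 (x - 2))\<^sup>2) / 2"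

lemma tent_nonneg: "tent x \<ge> 0"
  by (auto simp: tent_def max_def)

lemma tent_eq_0: "x \<le> 0 \<or> 2 \<le> x \<Longrightarrow> tent x = 0"
  by (auto simp: tent_def max_def)

lemma ramp_eq_0: "x \<le> 0 \<Longrightarrow> ramp x = 0"
  by (simp add: ramp_def)

lemma ramp_eq_1: "2 \<le> x \<Longrightarrow> ramp x = 1"
  by (simp add: ramp_def max_def power2_eq_square algebra_simps)

lemma continuous_on_tent [continuous_intros]:
  "continuous_on S f \<Longrightarrow> continuous_on S (\<lambda>x. tent (f x))"
  unfolding tent_def by (intro continuous_intros)

lemma DERIV_max_0_squared: "((\<lambda>x::real. (max 0 x)\<^sup>2) has_real_derivative 2 * max 0 x) (at x)"
proof -
  consider "x > 0" | "x < 0" | "x = 0" by linarith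
  then show ?thesis
  proof cases
    case 1
    have "((\<lambda>x. x\<^sup>2) has_real_derivative 2 * max 0 x) (at x)"
      using 1 by (auto intro!: derivative_eq_intros)
    then show ?thesis
      by (rule has_field_derivative_transform_within_open[where S = "{0<..}"]) (use 1 in auto)
  next
    case 2
    have "((\<lambda>x. 0) has_real_derivative 2 * max 0 x) (at x)"
      using 2 by (auto intro!: derivative_eq_intros)
    then show ?thesis
      by (rule has_field_derivative_transform_within_open[where S = "{..<0}"]) (use 2 in auto)
  next
    case 3
    have "((\<lambda>h::real. (max 0 h)\<^sup>2 / h) \<longlongrightarrow> 0) (at 0)"
    proof (rule tendsto_0_le[where K = 1 and f = "\<lambda>h. h"])
      show "\<forall>\<^sub>F h::real in at 0. norm ((max 0 h)\<^sup>2 / h) \<le> norm h * 1"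
        by (auto simp: max_def power2_eq_square)
    qed (rule tendsto_ident_at)
    then show ?thesis
      using 3 by (simp add: has_field_derivative_iff)
  qed
qed

lemma DERIV_ramp: "(ramp has_real_derivative tent x) (at x)"
proof -
  have "((\<lambda>x. (max 0 (x - c))\<^sup>2) has_real_derivative 2 * max 0 (x - c) * 1) (at x)" for c :: real
    by (rule DERIV_chain2[OF DERIV_max_0_squared]) (auto intro!: derivative_eq_intros)
  note d = this
  show ?thesis
    unfolding ramp_def[abs_def] tent_def
    by (rule DERIV_cong[OF DERIV_cdivide[OF DERIV_add[OF DERIV_diff[OF d[of 0, simplified] DERIV_cmult[OF d[of 1]]] d[of 2]]]])
      simp
qed

lemma DERIV_ramp_chain [derivative_intros]:
  "(f has_real_derivative f') (at x within S) \<Longrightarrow> ((\<lambda>x. ramp (f x)) has_real_derivative tent (f x) * f') (at x within S)"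
  by (rule DERIV_chain2[OF DERIV_ramp])

lemma ramp_mono: "x \<le> y \<Longrightarrow> ramp x \<le> ramp y"
  by (rule DERIV_nonneg_imp_nondecreasing) (use DERIV_ramp tent_nonneg in blast)+

lemma ramp_01: "0 \<le> ramp x" "ramp x \<le> 1"
proof -
  show "0 \<le> ramp x"
    using ramp_mono[of "min x 0" x] ramp_eq_0[of "min x 0"] by simp
  show "ramp x \<le> 1"
    using ramp_mono[of x "max x 2"] ramp_eq_1[of "max x 2"] by simp
qed

lemma continuous_on_ramp [continuous_intros]:
  "continuous_on S f \<Longrightarrow> continuous_on S (\<lambda>x. ramp (f x))"
  unfolding ramp_def by (intro continuous_intros) auto

lemma eventually_linear_ge:
  assumes "(k::real) > 0"
  shows "\<forall>\<^sub>F n in sequentially. real n * k \<ge> C"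
proof -
  obtain N where "C \<le> real N * k"
    using reals_Archimedean3[OF assms] less_imp_le by blast
  then have "C \<le> real n * k" if "n \<ge> N" for n
    using that assms by (meson less_imp_le mult_right_mono of_nat_le_iff order_trans)
  then show ?thesis
    unfolding eventually_sequentially by blast
qed

text \<open>An approximate identity at \<open>c\<close> of width 2/n. The shift \<open>s\<close> can
  place the support on one side of \<open>c\<close>, which admits the end points of the interval as
  \<open>c\<close>; \<open>ev\<close> says that eventually the whole mass lies in
  \<open>{0..T}\<close>.\<close>

lemma kernel_LIMSEQ:
  fixes u :: "real \<Rightarrow> real"
  assumes "T > 0" and u: "continuous_on {0..T} u" and c: "c \<in> {0..T}"
    and ev: "\<forall>\<^sub>F n in sequentially. ramp (real n * (T - c) + s) = 1 \<and> ramp (real n * (0 - c) + s) = 0"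
  shows "(\<lambda>n. integral {0..T} (\<lambda>x. u x * (real n * tent (real n * (x - c) + s)))) \<longlonglongrightarrow> u c"
proof (rule LIMSEQ_I)
  fix e :: real assume "e > 0"
  define k where "k n x = real n * tent (real n * (x - c) + s)" for n x
  obtain d where d: "d > 0" "\<And>x. x \<in> {0..T} \<Longrightarrow> dist x c < d \<Longrightarrow> dist (u x) (u c) < e / 2"
    using u[unfolded continuous_on_iff, rule_format, OF c, of "e / 2"] \<open>e > 0\<close> by auto
  have "\<forall>\<^sub>F n in sequentially. real n * d \<ge> 3 + \<bar>s\<bar>"
    using d(1) by (rule eventually_linear_ge)
  then have "\<forall>\<^sub>F n in sequentially. \<bar>integral {0..T} (\<lambda>x. u x * k n x) - u c\<bar> < e"
    using ev
  proof eventually_elim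
    case (elim n)
    have ck: "continuous_on {0..T} (k n)"
      unfolding k_def by (intro continuous_intros)
    have "(k n has_integral (ramp (real n * (T - c) + s) - ramp (real n * (0 - c) + s))) {0..T}"
    proof (rule fundamental_theorem_of_calculus)
      show "((\<lambda>x. ramp (real n * (x - c) + s)) has_vector_derivative k n x) (at x within {0..T})" for x
        unfolding has_real_derivative_iff_has_vector_derivative[symmetric] k_def
        by (auto intro!: derivative_eq_intros)
    qed (use \<open>T > 0\<close> in simp)
    then have k1: "(k n has_integral 1) {0..T}"
      using elim by simp
    have "integral {0..T} (\<lambda>x. u x * k n x) - u c = integral {0..T} (\<lambda>x. u x * k n x) - integral {0..T} (\<lambda>x. u c * k n x)"
      using integral_unique[OF k1] by simp
    also have "\<dots> = integral {0..T} (\<lambda>x. u x * k n x - u c * k n x)"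
      by (intro integral_diff[symmetric] integrable_continuous_real continuous_intros u ck)
    finally have eq: "integral {0..T} (\<lambda>x. u x * k n x) - u c = integral {0..T} (\<lambda>x. u x * k n x - u c * k n x)" .
    have "norm (integral {0..T} (\<lambda>x. u x * k n x - u c * k n x)) \<le> integral {0..T} (\<lambda>x. e / 2 * k n x)"
    proof (rule integral_norm_bound_integral)
      show "(\<lambda>x. u x * k n x - u c * k n x) integrable_on {0..T}" "(\<lambda>x. e / 2 * k n x) integrable_on {0..T}"
        by (intro integrable_continuous_real continuous_intros u ck)+
      fix x assume x: "x \<in> {0..T}"
      have k0: "k n x \<ge> 0"
        by (simp add: k_def tent_nonneg)
      have "norm (u x * k n x - u c * k n x) = \<bar>u x - u c\<bar> * k n x"
        using k0 by (simp add: abs_mult flip: left_diff_distrib)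
      also have "\<dots> \<le> e / 2 * k n x"
      proof (cases "k n x = 0")
        case False
        then have "\<not> (real n * (x - c) + s \<le> 0 \<or> 2 \<le> real n * (x - c) + s)"
          using tent_eq_0[of "real n * (x - c) + s"] by (auto simp: k_def)
        then have "\<bar>real n * (x - c)\<bar> < real n * d"
          using elim(1) by linarith
        then have "\<bar>x - c\<bar> < d"
          by (simp add: abs_mult mult_less_cancel_left)
        then have "\<bar>u x - u c\<bar> < e / 2"
          using d(2)[OF x] by (simp add: dist_real_def)
        then show ?thesis
          using k0 by (intro mult_right_mono) auto
      qed simp
      finally show "norm (u x * k n x - u c * k n x) \<le> e / 2 * k n x" .
    qed
    also have "\<dots> = e / 2"
      using integral_unique[OF k1] by simp
    finally show ?case
      unfolding eq using \<open>e > 0\<close> by simp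
  qed
  then show "\<exists>N. \<forall>n\<ge>N. norm (integral {0..T} (\<lambda>x. u x * (real n * tent (real n * (x - c) + s))) - u c) < e"
    by (simp add: eventually_sequentially k_def)
qed

text \<open>The shifts -1 and 3 put the rise on \<open>[a + 1/n, a + 3/n]\<close> and the fall on
  \<open>[b - 3/n, b - 1/n]\<close>, so the support stays inside the open interval even for
  \<open>a = 0\<close> or \<open>b = T\<close>. The lower bound on \<open>n\<close> says that the
  fall does not begin before the rise.\<close>

lemma trapezoid_test_function:
  assumes "0 \<le> a" "b \<le> T" "4 \<le> real n * (b - a)" "n > 0"
  shows "(\<lambda>x. ramp (real n * (x - a) - 1) - ramp (real n * (x - b) + 3)) \<in> test_functions T"
    (is "?f \<in> _")
  unfolding test_functions_def
proof (intro CollectI conjI exI[of _ "{a + 1 / real n..b - 1 / real n}"] allI impI)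
  have "(?f has_vector_derivative tent (real n * (x - a) - 1) * real n - tent (real n * (x - b) + 3) * real n) (at x)" for x
    unfolding has_real_derivative_iff_has_vector_derivative[symmetric] by (auto intro!: derivative_eq_intros)
  moreover have "continuous_on UNIV (\<lambda>x. tent (real n * (x - a) - 1) * real n - tent (real n * (x - b) + 3) * real n)"
    by (intro continuous_intros)
  ultimately show "?f C1_differentiable_on UNIV"
    unfolding C1_differentiable_on_def
    by (intro exI[of _ "\<lambda>x. tent (real n * (x - a) - 1) * real n - tent (real n * (x - b) + 3) * real n"]) simp
  show "compact {a + 1 / real n..b - 1 / real n}"
    by simp
  show "{a + 1 / real n..b - 1 / real n} \<subseteq> {0<..<T}"
  proof
    fix x assume "x \<in> {a + 1 / real n..b - 1 / real n}"
    moreover have "1 / real n > 0"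
      using \<open>n > 0\<close> by simp
    ultimately have "0 < x" "x < T"
      using assms(1,2) unfolding atLeastAtMost_iff by linarith+
    then show "x \<in> {0<..<T}"
      by simp
  qed
  fix x assume "x \<notin> {a + 1 / real n..b - 1 / real n}"
  then consider "x < a + 1 / real n" | "b - 1 / real n < x"
    by fastforce
  then show "?f x = 0"
  proof cases
    case 1
    then have "real n * x < real n * (a + 1 / real n)"
      using \<open>n > 0\<close> by (intro mult_strict_left_mono) auto
    then have "real n * (x - a) - 1 \<le> 0" "real n * (x - b) + 3 \<le> 0"
      using \<open>n > 0\<close> assms(3) by (auto simp: algebra_simps)
    then show ?thesis
      by (simp add: ramp_eq_0)
  next
    case 2
    then have "real n * (b - 1 / real n) < real n * x"
      using \<open>n > 0\<close> by (intro mult_strict_left_mono) auto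
    then have "real n * (x - a) - 1 \<ge> 2" "real n * (x - b) + 3 \<ge> 2"
      using \<open>n > 0\<close> assms(3) by (auto simp: algebra_simps)
    then show ?thesis
      by (simp add: ramp_eq_1)
  qed
qed

lemma trapezoid_LIMSEQ:
  assumes "a < b"
  shows "(\<lambda>n. ramp (real n * (x - a) - 1) - ramp (real n * (x - b) + 3)) \<longlonglongrightarrow> indicator {a<..<b} x"
proof -
  have "\<forall>\<^sub>F n in sequentially. ramp (real n * (x - a) - 1) - ramp (real n * (x - b) + 3) = indicator {a<..<b} x"
  proof -
    consider "x \<le> a" | "a < x" "x < b" | "b \<le> x" by linarith
    then show ?thesis
    proof cases
      case 1
      then have "b - x > 0"
        using assms by simp
      from eventually_linear_ge[OF this, of 3] show ?thesis
      proof eventually_elim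
        case (elim n)
        have "real n * (x - a) \<le> 0"
          using 1 by (simp add: mult_le_0_iff)
        then show ?case
          using elim 1 by (auto simp: ramp_eq_0 algebra_simps)
      qed
    next
      case 2
      then have "b - x > 0" "x - a > 0"
        by auto
      from eventually_linear_ge[OF this(1), of 3] eventually_linear_ge[OF this(2), of 3] show ?thesis
        by eventually_elim (use 2 in \<open>auto simp: ramp_eq_0 ramp_eq_1 algebra_simps\<close>)
    next
      case 3
      then have "x - a > 0"
        using assms by simp
      from eventually_linear_ge[OF this, of 3] show ?thesis
      proof eventually_elim
        case (elim n)
        have "real n * (x - b) \<ge> 0"
          using 3 by simp
        then show ?case
          using elim 3 by (auto simp: ramp_eq_1 algebra_simps)
      qed
    qed
  qed
  then show ?thesis
    by (rule tendsto_eventually)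
qed

section \<open>From weak derivatives to increments\<close>

lemma continuous_on_measurable_lebesgue_on:
  fixes f :: "real \<Rightarrow> real"
  shows "continuous_on {a..b} f \<Longrightarrow> f \<in> borel_measurable (lebesgue_on {a..b})"
  by (intro continuous_imp_measurable_on_sets_lebesgue) auto

lemma LINT_lebesgue_on_continuous:
  fixes f :: "real \<Rightarrow> real"
  assumes "continuous_on {a..b} f"
  shows "(LINT x|lebesgue_on {a..b}. f x) = integral {a..b} f"
  using lebesgue_integral_eq_integral[OF continuous_imp_integrable_real[OF assms]] by simp

text \<open>The du Bois-Reymond lemma: test with smoothed indicator functions of \<open>(a, b)\<close>.\<close>

lemma weak_deriv_increment:
  assumes "T > 0" and u: "continuous_on {0..T} u" and w: "integrable (lebesgue_on {0..T}) w"
    and uw: "is_weak_deriv T u w" and ab: "0 \<le> a" "a \<le> b" "b \<le> T"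
  shows "u b - u a = (LINT x|lebesgue_on {0..T}. w x * indicator {a<..<b} x)"
proof (cases "a = b")
  case False
  then have "a < b"
    using ab by simp
  define f where "f n x = ramp (real n * (x - a) - 1) - ramp (real n * (x - b) + 3)" for n x
  have cf: "continuous_on S (f n)" for n S
    unfolding f_def by (intro continuous_intros)
  have "(\<lambda>n. LINT x|lebesgue_on {0..T}. w x * f n x) \<longlonglongrightarrow> (LINT x|lebesgue_on {0..T}. w x * indicator {a<..<b} x)"
  proof (rule integral_dominated_convergence[where w = "\<lambda>x. \<bar>w x\<bar>"])
    show "(\<lambda>x. w x * indicator {a<..<b} x) \<in> borel_measurable (lebesgue_on {0..T})"
      using w ab
      by (intro borel_measurable_times borel_measurable_indicator)
        (auto simp: sets_restrict_space image_iff intro!: bexI[of _ "{a<..<b}"])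
    show "(\<lambda>x. w x * f n x) \<in> borel_measurable (lebesgue_on {0..T})" for n
      using w continuous_on_measurable_lebesgue_on[OF cf] by (intro borel_measurable_times) auto
    show "AE x in lebesgue_on {0..T}. (\<lambda>n. w x * f n x) \<longlonglongrightarrow> w x * indicator {a<..<b} x"
      unfolding f_def using trapezoid_LIMSEQ[OF \<open>a < b\<close>] by (intro AE_I2 tendsto_mult tendsto_const)
    show "AE x in lebesgue_on {0..T}. norm (w x * f n x) \<le> \<bar>w x\<bar>" for n
    proof (intro AE_I2)
      fix x
      have "\<bar>f n x\<bar> \<le> 1"
        using ramp_01[of "real n * (x - a) - 1"] ramp_01[of "real n * (x - b) + 3"] by (auto simp: f_def)
      then show "norm (w x * f n x) \<le> \<bar>w x\<bar>"
        by (simp add: abs_mult mult_left_le)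
    qed
  qed (use w in auto)
  moreover have "(\<lambda>n. LINT x|lebesgue_on {0..T}. w x * f n x) \<longlonglongrightarrow> u b - u a"
  proof (rule Lim_transform_eventually)
    let ?k = "\<lambda>n c s x. u x * (real n * tent (real n * (x - c) + s))"
    show "(\<lambda>n. integral {0..T} (?k n b 3) - integral {0..T} (?k n a (-1))) \<longlonglongrightarrow> u b - u a"
    proof (intro tendsto_diff kernel_LIMSEQ \<open>T > 0\<close> u)
      have "b > 0"
        using ab \<open>a < b\<close> by simp
      from eventually_linear_ge[OF this, of 3]
      show "\<forall>\<^sub>F n in sequentially. ramp (real n * (T - b) + 3) = 1 \<and> ramp (real n * (0 - b) + 3) = 0"
        by eventually_elim (use ab in \<open>auto intro!: ramp_eq_1 ramp_eq_0 simp: add_increasing\<close>)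
      have "T - a > 0"
        using ab \<open>a < b\<close> by simp
      from eventually_linear_ge[OF this, of 3]
      show "\<forall>\<^sub>F n in sequentially. ramp (real n * (T - a) + - 1) = 1 \<and> ramp (real n * (0 - a) + - 1) = 0"
      proof eventually_elim
        case (elim n)
        have "real n * (0 - a) \<le> 0"
          using ab by simp
        then show ?case
          using elim by (auto intro!: ramp_eq_1 ramp_eq_0)
      qed
    qed (use ab in auto)
    have "b - a > 0"
      using \<open>a < b\<close> by simp
    from eventually_linear_ge[OF this, of 4]
    show "\<forall>\<^sub>F n in sequentially. integral {0..T} (?k n b 3) - integral {0..T} (?k n a (-1))
        = (LINT x|lebesgue_on {0..T}. w x * f n x)"
    proof eventually_elim
      case (elim n)
      have "n > 0"
        using elim by (cases n) auto
      have d: "deriv (f n) x = real n * tent (real n * (x - a) + - 1) - real n * tent (real n * (x - b) + 3)" for x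
        unfolding f_def by (intro DERIV_imp_deriv) (auto intro!: derivative_eq_intros)
      have ck: "continuous_on {0..T} (?k n c s)" for c s
        by (intro continuous_intros u)
      have "f n \<in> test_functions T"
        unfolding f_def using trapezoid_test_function[OF ab(1,3) elim \<open>n > 0\<close>] .
      then have "(LINT x|lebesgue_on {0..T}. u x * deriv (f n) x) = - (LINT x|lebesgue_on {0..T}. w x * f n x)"
        using uw unfolding is_weak_deriv_def by blast
      also have "(LINT x|lebesgue_on {0..T}. u x * deriv (f n) x)
          = (LINT x|lebesgue_on {0..T}. ?k n a (-1) x - ?k n b 3 x)"
        by (intro Bochner_Integration.integral_cong) (auto simp: d algebra_simps)
      also have "\<dots> = integral {0..T} (\<lambda>x. ?k n a (-1) x - ?k n b 3 x)"
        by (intro LINT_lebesgue_on_continuous continuous_on_diff ck)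
      also have "\<dots> = integral {0..T} (?k n a (-1)) - integral {0..T} (?k n b 3)"
        by (intro integral_diff integrable_continuous_real ck)
      finally show ?case
        by simp
    qed
  qed
  ultimately show ?thesis
    using LIMSEQ_unique by blast
qed simp

text \<open>Extended by 0, the function has zero integral over all bounded open intervals, then over
  Borel sets by induction on their generation, then over Lebesgue sets modulo null sets; a density
  is determined by these integrals.\<close>

lemma AE_eq_0_if_integrals_eq_0:
  fixes w :: "real \<Rightarrow> real"
  assumes w: "integrable (lebesgue_on {0..T}) w"
    and zero: "\<And>a b. 0 \<le> a \<Longrightarrow> a \<le> b \<Longrightarrow> b \<le> T \<Longrightarrow> (LINT x|lebesgue_on {0..T}. w x * indicator {a<..<b} x) = 0"
    and "T > 0"
  shows "AE x in lebesgue_on {0..T}. w x = 0"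
proof -
  let ?M = "lebesgue_on {0..T}"
  define v where "v x = indicator {0..T} x * w x" for x
  have v: "integrable lebesgue v"
    using w unfolding v_def by (subst (asm) integrable_restrict_space) auto
  have v_eq: "(LINT x|lebesgue. v x * indicator A x) = (LINT x|?M. w x * indicator A x)" for A
    by (subst integral_restrict_space) (auto simp: v_def mult.assoc)
  have int0: "(LINT x|lebesgue. v x * indicator {a<..<b} x) = 0" for a b
  proof (cases "max 0 a \<le> min T b")
    case True
    have "(LINT x|lebesgue. v x * indicator {a<..<b} x) = (LINT x|lebesgue. v x * indicator {max 0 a<..<min T b} x)"
    proof (rule integral_cong_AE)
      have "AE x in lebesgue. x \<notin> {0, T}"
        by (intro AE_not_in) (auto simp: null_sets_completionI finite_imp_null_set_lborel)
      then show "AE x in lebesgue. v x * indicator {a<..<b} x = v x * indicator {max 0 a<..<min T b} x"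
        by eventually_elim (auto simp: v_def indicator_def)
    qed (intro borel_measurable_integrable integrable_real_mult_indicator v; simp)+
    also have "\<dots> = 0"
      unfolding v_eq using True by (intro zero) auto
    finally show ?thesis .
  next
    case False
    then have "v x * indicator {a<..<b} x = 0" for x
      by (auto simp: v_def indicator_def)
    then show ?thesis
      by (metis (no_types, lifting) Bochner_Integration.integral_cong integral_zero)
  qed
  have bor: "(LINT x|lebesgue. v x * indicator A x) = 0" if "A \<in> sets borel" for A
  proof -
    have ind: "integrable lebesgue (\<lambda>x. v x * indicator A x)" if "A \<in> sets borel" for A
      using that v by (intro integrable_real_mult_indicator) auto
    have total: "(LINT x|lebesgue. v x) = 0"
    proof -
      have "(\<lambda>x. v x * indicator {- 1<..<T + 1} x) = v"
        by (auto simp: v_def indicator_def fun_eq_iff)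
      then show ?thesis
        using int0[of "- 1" "T + 1"] by simp
    qed
    show ?thesis
      using that
    proof (induction rule: borel_set_induct)
      case empty
      then show ?case
        by simp
    next
      case (interval a b)
      have "(LINT x|lebesgue. v x * indicator {a..b} x) = (LINT x|lebesgue. v x * indicator {a<..<b} x)"
      proof (rule integral_cong_AE)
        have "AE x in lebesgue. x \<notin> {a, b}"
          by (intro AE_not_in) (auto simp: null_sets_completionI finite_imp_null_set_lborel)
        then show "AE x in lebesgue. v x * indicator {a..b} x = v x * indicator {a<..<b} x"
          by eventually_elim (auto simp: indicator_def)
      qed (intro borel_measurable_integrable integrable_real_mult_indicator v; simp)+
      then show ?case
        using int0 by simp
    next
      case (compl A)
      have "(\<lambda>x. v x * indicator (- A) x) = (\<lambda>x. v x - v x * indicator A x)"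
        by (auto simp: indicator_def)
      then show ?case
        using compl.IH total Bochner_Integration.integral_diff[OF v ind[OF compl.hyps]] by simp
    next
      case (union A)
      have "set_integrable lebesgue (\<Union>i. A i) v"
        unfolding set_integrable_def using ind[of "\<Union>i. A i"] union.hyps by (auto simp: mult.commute)
      then have "(LINT x:(\<Union>i. A i)|lebesgue. v x) = (\<Sum>i. (LINT x:(A i)|lebesgue. v x))"
        using union.hyps by (intro lebesgue_integral_countable_add) (auto simp: disjoint_family_on_def)
      then show ?case
        using union.IH by (simp add: set_lebesgue_integral_def mult.commute)
    qed
  qed
  have "AE x in lebesgue. v x = 0"
  proof (rule density_unique_real[OF v])
    fix A :: "real set" assume "A \<in> sets lebesgue"
    then obtain S N N' where SN: "A = S \<union> N" "N \<subseteq> N'" "N' \<in> null_sets lborel" "S \<in> sets lborel"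
      by (rule sets_completionE)
    have "(LINT x|lebesgue. v x * indicator A x) = (LINT x|lebesgue. v x * indicator S x)"
    proof (rule integral_cong_AE)
      have "AE x in lebesgue. x \<notin> N'"
        using SN by (intro AE_not_in) (auto simp: null_sets_completionI)
      then show "AE x in lebesgue. v x * indicator A x = v x * indicator S x"
        by eventually_elim (use SN in \<open>auto simp: indicator_def\<close>)
    qed (intro borel_measurable_integrable integrable_real_mult_indicator v;
        use \<open>A \<in> sets lebesgue\<close> SN in simp)+
    then show "(LINT x:A|lebesgue. v x) = (LINT x:A|lebesgue. 0)"
      using bor[of S] SN by (simp add: set_lebesgue_integral_def mult.commute)
  qed simp
  then show ?thesis
    by (subst AE_restrict_space_iff) (auto simp: v_def elim!: eventually_mono)
qed

section \<open>The Sobolev norm\<close>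

lemma Lp_spaceD:
  assumes "p > 1" "w \<in> Lp_space T p"
  shows "w \<in> borel_measurable (lebesgue_on {0..T})" "integrable (lebesgue_on {0..T}) (\<lambda>x. \<bar>w x\<bar> powr p)"
    "integrable (lebesgue_on {0..T}) w"
proof -
  show m: "w \<in> borel_measurable (lebesgue_on {0..T})"
    and i: "integrable (lebesgue_on {0..T}) (\<lambda>x. \<bar>w x\<bar> powr p)"
    using assms(2) by (auto simp: Lp_space_def)
  show "integrable (lebesgue_on {0..T}) w"
  proof (rule Bochner_Integration.integrable_bound[OF _ m])
    show "integrable (lebesgue_on {0..T}) (\<lambda>x. 1 + \<bar>w x\<bar> powr p)"
      using i by auto
    show "AE x in lebesgue_on {0..T}. norm (w x) \<le> norm (1 + \<bar>w x\<bar> powr p)"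
    proof (intro AE_I2)
      fix x
      show "norm (w x) \<le> norm (1 + \<bar>w x\<bar> powr p)"
      proof (cases "\<bar>w x\<bar> \<le> 1")
        case True
        then show ?thesis
          unfolding real_norm_def using powr_ge_zero[of "\<bar>w x\<bar>" p] by linarith
      next
        case False
        then have "\<bar>w x\<bar> powr 1 \<le> \<bar>w x\<bar> powr p"
          using assms(1) by (intro powr_mono) auto
        then show ?thesis
          using False by simp
      qed
    qed
  qed
qed

lemma Lp_spaceI_continuous:
  assumes "p > 1" "continuous_on {0..T} w"
  shows "w \<in> Lp_space T p"
  using assms continuous_on_abs_powr[of p "{0..T}" w]
  by (auto simp: Lp_space_def intro!: continuous_on_measurable_lebesgue_on continuous_imp_integrable_real)

lemma Lp_space_linear:
  assumes "p > 1" "v \<in> Lp_space T p" "w \<in> Lp_space T p"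
  shows "(\<lambda>x. a * v x + b * w x) \<in> Lp_space T p"
  unfolding Lp_space_def
proof (intro CollectI conjI)
  note v = Lp_spaceD[OF assms(1,2)] and w = Lp_spaceD[OF assms(1,3)]
  show m: "(\<lambda>x. a * v x + b * w x) \<in> borel_measurable (lebesgue_on {0..T})"
    using v(1) w(1) by measurable
  show "integrable (lebesgue_on {0..T}) (\<lambda>x. \<bar>a * v x + b * w x\<bar> powr p)"
  proof (rule Bochner_Integration.integrable_bound)
    show "integrable (lebesgue_on {0..T})
        (\<lambda>x. 1 / 2 * (\<bar>2 * a\<bar> powr p * \<bar>v x\<bar> powr p) + 1 / 2 * (\<bar>2 * b\<bar> powr p * \<bar>w x\<bar> powr p))"
      using v(2) w(2) by (intro Bochner_Integration.integrable_add integrable_mult_right)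
    show "(\<lambda>x. \<bar>a * v x + b * w x\<bar> powr p) \<in> borel_measurable (lebesgue_on {0..T})"
      using m by measurable
    show "AE x in lebesgue_on {0..T}. norm (\<bar>a * v x + b * w x\<bar> powr p)
        \<le> norm (1 / 2 * (\<bar>2 * a\<bar> powr p * \<bar>v x\<bar> powr p) + 1 / 2 * (\<bar>2 * b\<bar> powr p * \<bar>w x\<bar> powr p))"
    proof (intro AE_I2)
      fix x
      show "norm (\<bar>a * v x + b * w x\<bar> powr p)
        \<le> norm (1 / 2 * (\<bar>2 * a\<bar> powr p * \<bar>v x\<bar> powr p) + 1 / 2 * (\<bar>2 * b\<bar> powr p * \<bar>w x\<bar> powr p))"
        using abs_powr_convex[OF assms(1), of "1 / 2" "2 * a * v x" "2 * b * w x"]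
        by (simp add: abs_mult powr_mult)
    qed
  qed
qed

section \<open>Linearity and uniqueness of weak derivatives\<close>

lemma integrable_mult_continuous:
  fixes w f :: "real \<Rightarrow> real"
  assumes w: "integrable (lebesgue_on {0..T}) w" and f: "continuous_on {0..T} f"
  shows "integrable (lebesgue_on {0..T}) (\<lambda>x. w x * f x)"
proof -
  have "bounded (f ` {0..T})"
    using f by (intro compact_imp_bounded compact_continuous_image) auto
  then obtain B where B: "\<forall>x\<in>{0..T}. \<bar>f x\<bar> \<le> B"
    unfolding bounded_iff by auto
  show ?thesis
  proof (rule Bochner_Integration.integrable_bound)
    show "integrable (lebesgue_on {0..T}) (\<lambda>x. B * w x)"
      using w by simp
    show "(\<lambda>x. w x * f x) \<in> borel_measurable (lebesgue_on {0..T})"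
      using w continuous_on_measurable_lebesgue_on[OF f] by (intro borel_measurable_times) auto
    show "AE x in lebesgue_on {0..T}. norm (w x * f x) \<le> norm (B * w x)"
    proof (intro AE_I2)
      fix x assume "x \<in> space (lebesgue_on {0..T})"
      then have "x \<in> {0..T}"
        by simp
      with B have "\<bar>f x\<bar> \<le> \<bar>B\<bar>"
        using abs_ge_self[of B] order_trans by blast
      then show "norm (w x * f x) \<le> norm (B * w x)"
        by (simp add: abs_mult mult.commute mult_right_mono)
    qed
  qed
qed

lemma test_functionsD:
  assumes "f \<in> test_functions T" "T > 0"
  shows "(f has_real_derivative deriv f x) (at x within S)" "continuous_on S f" "continuous_on S (deriv f)"
    "f 0 = 0" "f T = 0"
proof -
  obtain D where D: "\<And>x. (f has_real_derivative D x) (at x)" "continuous_on UNIV D"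
    using assms(1) unfolding test_functions_def C1_differentiable_on_def
    by (auto simp: has_real_derivative_iff_has_vector_derivative)
  have eq: "deriv f = D"
    using DERIV_imp_deriv[OF D(1)] by auto
  show "(f has_real_derivative deriv f x) (at x within S)"
    unfolding eq using D(1) by (rule DERIV_subset) simp
  show "continuous_on S f"
    using D(1) by (intro DERIV_continuous_on[where D = D]) (auto intro: DERIV_subset)
  show "continuous_on S (deriv f)"
    unfolding eq using D(2) continuous_on_subset by blast
  obtain C where "C \<subseteq> {0<..<T}" "\<And>x. x \<notin> C \<Longrightarrow> f x = 0"
    using assms(1) unfolding test_functions_def by blast
  then show "f 0 = 0" "f T = 0"
    using assms(2) by force+
qed

lemma is_weak_deriv_linear:
  assumes "T > 0" and u: "continuous_on {0..T} u" "integrable (lebesgue_on {0..T}) w" "is_weak_deriv T u w"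
    and u': "continuous_on {0..T} u'" "integrable (lebesgue_on {0..T}) w'" "is_weak_deriv T u' w'"
  shows "is_weak_deriv T (\<lambda>x. a * u x + b * u' x) (\<lambda>x. a * w x + b * w' x)"
  unfolding is_weak_deriv_def
proof
  fix f assume f: "f \<in> test_functions T"
  note F = test_functionsD[OF f \<open>T > 0\<close>]
  have i: "integrable (lebesgue_on {0..T}) (\<lambda>x. u x * deriv f x)"
    "integrable (lebesgue_on {0..T}) (\<lambda>x. u' x * deriv f x)"
    "integrable (lebesgue_on {0..T}) (\<lambda>x. w x * f x)" "integrable (lebesgue_on {0..T}) (\<lambda>x. w' x * f x)"
    by (intro continuous_imp_integrable_real continuous_on_mult u u' F integrable_mult_continuous)+
  have "(LINT x|lebesgue_on {0..T}. (a * u x + b * u' x) * deriv f x)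
      = (LINT x|lebesgue_on {0..T}. a * (u x * deriv f x) + b * (u' x * deriv f x))"
    by (simp add: algebra_simps)
  also have "\<dots> = a * (LINT x|lebesgue_on {0..T}. u x * deriv f x) + b * (LINT x|lebesgue_on {0..T}. u' x * deriv f x)"
    using i by simp
  also have "\<dots> = - (a * (LINT x|lebesgue_on {0..T}. w x * f x) + b * (LINT x|lebesgue_on {0..T}. w' x * f x))"
    using u(3) u'(3) f by (simp add: is_weak_deriv_def)
  also have "\<dots> = - (LINT x|lebesgue_on {0..T}. a * (w x * f x) + b * (w' x * f x))"
    using i by simp
  also have "\<dots> = - (LINT x|lebesgue_on {0..T}. (a * w x + b * w' x) * f x)"
    by (simp add: algebra_simps)
  finally show "(LINT x|lebesgue_on {0..T}. (a * u x + b * u' x) * deriv f x)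
      = - (LINT x|lebesgue_on {0..T}. (a * w x + b * w' x) * f x)" .
qed

lemma classical_is_weak_deriv:
  assumes "T > 0" and u: "\<And>x. x \<in> {0..T} \<Longrightarrow> (u has_real_derivative v x) (at x within {0..T})"
    and v: "continuous_on {0..T} v"
  shows "is_weak_deriv T u v"
  unfolding is_weak_deriv_def
proof
  fix f assume f: "f \<in> test_functions T"
  note F = test_functionsD[OF f \<open>T > 0\<close>]
  have cu: "continuous_on {0..T} u"
    using DERIV_continuous_on[OF u] .
  have c: "continuous_on {0..T} (\<lambda>x. u x * deriv f x)" "continuous_on {0..T} (\<lambda>x. v x * f x)"
    by (intro continuous_intros cu v F)+
  have "((\<lambda>x. u x * deriv f x + v x * f x) has_integral (u T * f T - u 0 * f 0)) {0..T}"
  proof (rule fundamental_theorem_of_calculus)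
    fix x assume "x \<in> {0..T}"
    then show "((\<lambda>x. u x * f x) has_vector_derivative u x * deriv f x + v x * f x) (at x within {0..T})"
      unfolding has_real_derivative_iff_has_vector_derivative[symmetric]
      using DERIV_mult[OF u F(1)] by (simp add: algebra_simps)
  qed (use \<open>T > 0\<close> in simp)
  then have "integral {0..T} (\<lambda>x. u x * deriv f x + 1 * (v x * f x)) = 0"
    using F by (simp add: integral_unique)
  then have "integral {0..T} (\<lambda>x. u x * deriv f x) + 1 * integral {0..T} (\<lambda>x. v x * f x) = 0"
    using integral_linear_combination[OF c, of 1] by simp
  then show "(LINT x|lebesgue_on {0..T}. u x * deriv f x) = - (LINT x|lebesgue_on {0..T}. v x * f x)"
    using LINT_lebesgue_on_continuous[OF c(1)] LINT_lebesgue_on_continuous[OF c(2)] by simp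
qed

lemma W1pD:
  assumes "u \<in> W1p T p"
  shows "continuous_on {0..T} u" "\<And>x. x \<notin> {0..T} \<Longrightarrow> u x = 0"
    "weak_deriv T p u \<in> Lp_space T p" "is_weak_deriv T u (weak_deriv T p u)"
proof -
  show "continuous_on {0..T} u" "\<And>x. x \<notin> {0..T} \<Longrightarrow> u x = 0"
    using assms by (auto simp: W1p_def)
  have "\<exists>w. w \<in> Lp_space T p \<and> is_weak_deriv T u w"
    using assms by (auto simp: W1p_def)
  from someI_ex[OF this] show "weak_deriv T p u \<in> Lp_space T p" "is_weak_deriv T u (weak_deriv T p u)"
    by (auto simp: weak_deriv_def)
qed

lemma W1pI:
  assumes "p > 1" "continuous_on {0..T} u" "\<And>x. x \<notin> {0..T} \<Longrightarrow> u x = 0" "w \<in> Lp_space T p" "is_weak_deriv T u w"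
  shows "u \<in> W1p T p"
  using assms Lp_spaceI_continuous[OF assms(1,2)] by (auto simp: W1p_def)

lemma W1p_linear:
  assumes "p > 1" "T > 0" "u \<in> W1p T p" "v \<in> W1p T p"
  shows "(\<lambda>x. a * u x + b * v x) \<in> W1p T p"
    "is_weak_deriv T (\<lambda>x. a * u x + b * v x) (\<lambda>x. a * weak_deriv T p u x + b * weak_deriv T p v x)"
proof -
  note U = W1pD[OF assms(3)] and V = W1pD[OF assms(4)]
  show w: "is_weak_deriv T (\<lambda>x. a * u x + b * v x) (\<lambda>x. a * weak_deriv T p u x + b * weak_deriv T p v x)"
    using U V Lp_spaceD(3)[OF assms(1)] by (intro is_weak_deriv_linear assms(2)) auto
  show "(\<lambda>x. a * u x + b * v x) \<in> W1p T p"
    by (rule W1pI[OF assms(1) _ _ Lp_space_linear[OF assms(1) U(3) V(3)] w])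
      (auto intro!: continuous_intros U(1) V(1) simp: U(2) V(2))
qed

lemma X_space_linear:
  assumes "p > 1" "T > 0" "u \<in> X_space T p" "v \<in> X_space T p"
  shows "(\<lambda>x. a * u x + b * v x) \<in> X_space T p"
  using assms W1p_linear(1)[of p T u v a b] by (auto simp: X_space_def)

lemma zero_in_X_space:
  assumes "p > 1" "T > 0"
  shows "(\<lambda>_. 0) \<in> X_space T p"
proof -
  have "is_weak_deriv T (\<lambda>_. 0) (\<lambda>_. 0)"
    using assms by (intro classical_is_weak_deriv) auto
  moreover have "(\<lambda>_. 0) \<in> Lp_space T p"
    by (rule Lp_spaceI_continuous[OF assms(1) continuous_on_const])
  ultimately show ?thesis
    using assms by (auto simp: X_space_def intro!: W1pI[where w = "\<lambda>_. 0"])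
qed

lemma X_space_diff:
  assumes "p > 1" "T > 0" "u \<in> X_space T p" "v \<in> X_space T p"
  shows "(\<lambda>x. u x - v x) \<in> X_space T p"
  using X_space_linear[OF assms, of 1 "-1"] by simp

text \<open>The difference is a weak derivative of 0, so by \<open>weak_deriv_increment\<close> its
  integral over every subinterval vanishes.\<close>

lemma weak_deriv_unique:
  assumes "p > 1" "T > 0" "v \<in> Lp_space T p" "is_weak_deriv T u v"
    and "w \<in> Lp_space T p" "is_weak_deriv T u w"
  shows "AE x in lebesgue_on {0..T}. v x = w x"
proof -
  have iv: "integrable (lebesgue_on {0..T}) v" and iw: "integrable (lebesgue_on {0..T}) w"
    using Lp_spaceD(3) assms by auto
  have i: "integrable (lebesgue_on {0..T}) (\<lambda>x. v x - w x)"
    using iv iw by simp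
  have 0: "is_weak_deriv T (\<lambda>_. 0) (\<lambda>x. v x - w x)"
    unfolding is_weak_deriv_def
  proof
    fix f assume f: "f \<in> test_functions T"
    note F = test_functionsD[OF f \<open>T > 0\<close>]
    have "(LINT x|lebesgue_on {0..T}. (v x - w x) * f x)
        = (LINT x|lebesgue_on {0..T}. v x * f x) - (LINT x|lebesgue_on {0..T}. w x * f x)"
      unfolding left_diff_distrib
      by (intro Bochner_Integration.integral_diff integrable_mult_continuous iv iw F)
    also have "\<dots> = 0"
      using assms(4,6) f by (simp add: is_weak_deriv_def)
    finally show "(LINT x|lebesgue_on {0..T}. 0 * deriv f x) = - (LINT x|lebesgue_on {0..T}. (v x - w x) * f x)"
      by simp
  qed
  have "AE x in lebesgue_on {0..T}. v x - w x = 0"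
    using weak_deriv_increment[OF assms(2) continuous_on_const i 0]
    by (intro AE_eq_0_if_integrals_eq_0[OF i _ assms(2)]) simp
  then show ?thesis
    by eventually_elim simp
qed

context weighted_problem
begin

section \<open>The norm of \<open>X\<close> and its metric\<close>

lemma integrable_norm_integrand:
  assumes "w \<in> Lp_space T p" "continuous_on {0..T} u"
  shows "integrable (lebesgue_on {0..T}) (\<lambda>x. \<bar>w x\<bar> powr p + q x * \<bar>u x\<bar> powr p)"
  using Lp_spaceD(2)[OF p_gt_1 assms(1)] continuous_imp_integrable_real[OF continuous_on_mq_powr(2)[OF assms(2)]]
  by simp

text \<open>Frees the norm from the representative that \<open>SOME\<close> happens to pick.\<close>

lemma X_norm_eq:
  assumes "u \<in> W1p T p" "w \<in> Lp_space T p" "is_weak_deriv T u w"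
  shows "X_norm T p q u = (LINT x|lebesgue_on {0..T}. \<bar>w x\<bar> powr p + q x * \<bar>u x\<bar> powr p) powr (1 / p)"
proof -
  note U = W1pD[OF assms(1)]
  have "(LINT x|lebesgue_on {0..T}. \<bar>weak_deriv T p u x\<bar> powr p + q x * \<bar>u x\<bar> powr p)
      = (LINT x|lebesgue_on {0..T}. \<bar>w x\<bar> powr p + q x * \<bar>u x\<bar> powr p)"
    by (rule integral_cong_AE[OF borel_measurable_integrable[OF integrable_norm_integrand[OF U(3,1)]]
        borel_measurable_integrable[OF integrable_norm_integrand[OF assms(2) U(1)]]])
      (use weak_deriv_unique[OF p_gt_1 T_pos U(3,4) assms(2,3)] in \<open>eventually_elim; simp\<close>)
  then show ?thesis
    by (simp add: X_norm_def)
qed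

lemma norm_integral_nonneg:
  "(LINT x|lebesgue_on {0..T}. \<bar>w x\<bar> powr p + q x * \<bar>u x\<bar> powr p) \<ge> 0"
  by (intro integral_nonneg_AE AE_I2 add_nonneg_nonneg mult_nonneg_nonneg) (auto intro: q_nonneg)

lemma X_norm_powr:
  assumes "u \<in> W1p T p" "w \<in> Lp_space T p" "is_weak_deriv T u w"
  shows "X_norm T p q u powr p = (LINT x|lebesgue_on {0..T}. \<bar>w x\<bar> powr p + q x * \<bar>u x\<bar> powr p)"
  using X_norm_eq[OF assms] norm_integral_nonneg[of w u] p_gt_1 by (simp add: powr_powr)

lemma X_norm_nonneg: "X_norm T p q u \<ge> 0"
  by (simp add: X_norm_def)

lemma X_norm_classical:
  assumes "\<And>x. x \<in> {0..T} \<Longrightarrow> (u has_real_derivative v x) (at x within {0..T})"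
    and v: "continuous_on {0..T} v" and "\<And>x. x \<notin> {0..T} \<Longrightarrow> u x = 0"
  shows "u \<in> W1p T p" "X_norm T p q u = energy u v powr (1 / p)" "X_norm T p q u powr p = energy u v"
proof -
  have cu: "continuous_on {0..T} u"
    using DERIV_continuous_on[OF assms(1)] .
  have w: "is_weak_deriv T u v" "v \<in> Lp_space T p"
    using classical_is_weak_deriv[OF T_pos assms(1) v] Lp_spaceI_continuous[OF p_gt_1 v] by auto
  show W: "u \<in> W1p T p"
    using W1pI[OF p_gt_1 cu assms(3) w(2,1)] .
  have "(LINT x|lebesgue_on {0..T}. \<bar>v x\<bar> powr p + q x * \<bar>u x\<bar> powr p) = energy u v"
    unfolding energy_def
    by (intro LINT_lebesgue_on_continuous continuous_on_add continuous_on_mq_powr cu v)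
  then show "X_norm T p q u = energy u v powr (1 / p)" "X_norm T p q u powr p = energy u v"
    using X_norm_eq[OF W w(2,1)] X_norm_powr[OF W w(2,1)] by auto
qed

text \<open>Jensen's inequality, by integrating the tangent inequality for the \<open>p\<close>-th power.\<close>

lemma difference_quotient_le:
  assumes u: "continuous_on {0..T} u" and w: "w \<in> Lp_space T p" "is_weak_deriv T u w"
    and ab: "0 \<le> a" "a < b" "b \<le> T"
  shows "\<bar>(u b - u a) / (b - a)\<bar> powr p * (b - a) \<le> (LINT x|lebesgue_on {0..T}. \<bar>w x\<bar> powr p * indicator {a<..<b} x)"
proof -
  \<comment> \<open>The tangent is taken at the mean slope, so that its linear term integrates to
    0.\<close>
  define s where "s = (u b - u a) / (b - a)"
  note W = Lp_spaceD[OF p_gt_1 w(1)]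
  have set: "{a<..<b} \<in> sets (lebesgue_on {0..T})"
    using ab by (auto simp: sets_restrict_space image_iff intro!: bexI[of _ "{a<..<b}"])
  have meas: "(LINT x|lebesgue_on {0..T}. indicator {a<..<b} x) = b - a"
  proof -
    have "{a<..<b} \<subseteq> {0..T}"
      using ab by auto
    then show ?thesis
      using ab by (simp add: measure_restrict_space Int_absorb2)
  qed
  have int1: "integrable (lebesgue_on {0..T}) (indicator {a<..<b} :: real \<Rightarrow> real)"
    using integrable_real_mult_indicator[OF set, of "\<lambda>_. 1"] by simp
  have "(LINT x|lebesgue_on {0..T}. (\<bar>s\<bar> powr p - p * phi p s * s) * indicator {a<..<b} x
      + p * phi p s * (w x * indicator {a<..<b} x)) \<le> (LINT x|lebesgue_on {0..T}. \<bar>w x\<bar> powr p * indicator {a<..<b} x)"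
  proof (rule integral_mono)
    show "integrable (lebesgue_on {0..T}) (\<lambda>x. (\<bar>s\<bar> powr p - p * phi p s * s) * indicator {a<..<b} x
      + p * phi p s * (w x * indicator {a<..<b} x))"
      by (intro Bochner_Integration.integrable_add integrable_mult_right int1 integrable_real_mult_indicator set W)
    show "integrable (lebesgue_on {0..T}) (\<lambda>x. \<bar>w x\<bar> powr p * indicator {a<..<b} x)"
      by (intro integrable_real_mult_indicator set W)
    fix x
    show "(\<bar>s\<bar> powr p - p * phi p s * s) * indicator {a<..<b} x + p * phi p s * (w x * indicator {a<..<b} x)
        \<le> \<bar>w x\<bar> powr p * indicator {a<..<b} x"
      using abs_powr_tangent_le[OF p_gt_1, of s "w x"] by (auto simp: indicator_def algebra_simps)
  qed
  also have "(LINT x|lebesgue_on {0..T}. (\<bar>s\<bar> powr p - p * phi p s * s) * indicator {a<..<b} x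
      + p * phi p s * (w x * indicator {a<..<b} x))
      = (\<bar>s\<bar> powr p - p * phi p s * s) * (b - a) + p * phi p s * (u b - u a)"
    using ab int1 set W meas weak_deriv_increment[OF T_pos u W(3) w(2), of a b]
    by (subst Bochner_Integration.integral_add) (auto intro!: integrable_real_mult_indicator)
  also have "u b - u a = s * (b - a)"
    using ab by (simp add: s_def)
  finally show ?thesis
    by (simp add: s_def[symmetric] algebra_simps)
qed

text \<open>Where |u| is smallest, the \<open>q\<close> term of the norm controls it; the
  oscillation of \<open>u\<close> is controlled by the derivative term through
  \<open>difference_quotient_le\<close>. The two summands of the constant are these two parts. The
  first is where \<open>q\<close> being nonzero turns a seminorm into a norm.\<close>

lemma X_norm_bounds_sup:
  obtains C where "C > 0" "\<And>u x. u \<in> W1p T p \<Longrightarrow> x \<in> {0..T} \<Longrightarrow> \<bar>u x\<bar> \<le> C * X_norm T p q u"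
proof -
  define Q where "Q = integral {0..T} q"
  obtain y0 where "y0 \<in> {0..T}" "q y0 \<noteq> 0"
    using q_nonzero by blast
  then have "Q > 0"
    unfolding Q_def by (intro integral_pos_continuous[OF T_pos q_cont q_nonneg])
  define C where "C = (1 / Q) powr (1 / p) + T powr (1 - 1 / p)"
  have "(1 / Q) powr (1 / p) > 0"
    using \<open>Q > 0\<close> by simp
  then have "C > 0"
    unfolding C_def using powr_ge_zero[of T "1 - 1 / p"] by linarith
  moreover have "\<bar>u x\<bar> \<le> C * X_norm T p q u" if u: "u \<in> W1p T p" and x: "x \<in> {0..T}" for u x
  proof -
    note U = W1pD[OF u]
    define w where "w = weak_deriv T p u"
    note W = Lp_spaceD[OF p_gt_1 U(3), folded w_def]
    define N where "N = X_norm T p q u"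
    have N: "N \<ge> 0" "N powr p = (LINT x|lebesgue_on {0..T}. \<bar>w x\<bar> powr p + q x * \<bar>u x\<bar> powr p)"
      using X_norm_nonneg X_norm_powr[OF u U(3,4)] by (auto simp: N_def w_def)
    have iq: "integrable (lebesgue_on {0..T}) (\<lambda>x. q x * \<bar>u x\<bar> powr p)"
      by (intro continuous_imp_integrable_real continuous_on_mq_powr U)
    have split: "N powr p = (LINT x|lebesgue_on {0..T}. \<bar>w x\<bar> powr p) + (LINT x|lebesgue_on {0..T}. q x * \<bar>u x\<bar> powr p)"
      unfolding N(2) using W(2) iq by (rule Bochner_Integration.integral_add)
    have "(LINT x|lebesgue_on {0..T}. \<bar>w x\<bar> powr p) \<ge> 0" "(LINT x|lebesgue_on {0..T}. q x * \<bar>u x\<bar> powr p) \<ge> 0"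
      by (intro integral_nonneg_AE AE_I2; auto intro!: q_nonneg mult_nonneg_nonneg)+
    with split have parts: "(LINT x|lebesgue_on {0..T}. \<bar>w x\<bar> powr p) \<le> N powr p"
      "(LINT x|lebesgue_on {0..T}. q x * \<bar>u x\<bar> powr p) \<le> N powr p"
      by auto
    have root: "c powr (1 / p) \<le> c' powr (1 / p)" if "0 \<le> c" "c \<le> c'" for c c' :: real
      using that p_gt_1 by (intro powr_mono2) auto
    have incr: "\<bar>u b - u a\<bar> \<le> T powr (1 - 1 / p) * N" if ab: "0 \<le> a" "a < b" "b \<le> T" for a b
    proof -
      define s where "s = (u b - u a) / (b - a)"
      have "{a<..<b} \<in> sets (lebesgue_on {0..T})"
        using ab by (auto simp: sets_restrict_space image_iff intro!: bexI[of _ "{a<..<b}"])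
      then have "(LINT x|lebesgue_on {0..T}. \<bar>w x\<bar> powr p * indicator {a<..<b} x) \<le> (LINT x|lebesgue_on {0..T}. \<bar>w x\<bar> powr p)"
        using W(2) by (intro integral_mono integrable_real_mult_indicator) (auto simp: indicator_def)
      then have "\<bar>s\<bar> powr p * (b - a) \<le> N powr p"
        using difference_quotient_le[OF U(1,3,4) ab] parts(1) unfolding s_def w_def by linarith
      then have "(\<bar>s\<bar> powr p * (b - a)) powr (1 / p) \<le> (N powr p) powr (1 / p)"
        using ab by (intro root) auto
      then have *: "\<bar>s\<bar> * (b - a) powr (1 / p) \<le> N"
        using N(1) ab p_gt_1 by (simp add: powr_mult powr_powr)
      have "\<bar>u b - u a\<bar> = \<bar>s\<bar> * (b - a)"
        using ab by (simp add: s_def abs_divide)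
      also have "b - a = (b - a) powr (1 / p) * (b - a) powr (1 - 1 / p)"
        using ab by (simp flip: powr_add)
      also have "\<bar>s\<bar> * ((b - a) powr (1 / p) * (b - a) powr (1 - 1 / p)) = \<bar>s\<bar> * (b - a) powr (1 / p) * (b - a) powr (1 - 1 / p)"
        by simp
      also have "\<dots> \<le> N * T powr (1 - 1 / p)"
        using * ab N p_gt_1 by (intro mult_mono powr_mono2) auto
      finally show ?thesis
        by (simp add: mult.commute)
    qed
    have "\<exists>y\<in>{0..T}. \<forall>x\<in>{0..T}. \<bar>u y\<bar> \<le> \<bar>u x\<bar>"
      using T_pos U(1) by (intro continuous_attains_inf continuous_on_rabs) auto
    then obtain y where y: "y \<in> {0..T}" "\<And>x. x \<in> {0..T} \<Longrightarrow> \<bar>u y\<bar> \<le> \<bar>u x\<bar>"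
      by blast
    have "Q * \<bar>u y\<bar> powr p = integral {0..T} (\<lambda>x. q x * \<bar>u y\<bar> powr p)"
      by (simp add: Q_def)
    also have "\<dots> \<le> integral {0..T} (\<lambda>x. q x * \<bar>u x\<bar> powr p)"
      using y(2) p_gt_1 q_nonneg
      by (intro integral_le integrable_continuous_real continuous_on_mq_powr U continuous_intros q_cont
          mult_left_mono powr_mono2) auto
    also have "\<dots> = (LINT x|lebesgue_on {0..T}. q x * \<bar>u x\<bar> powr p)"
      by (intro LINT_lebesgue_on_continuous[symmetric] continuous_on_mq_powr U)
    finally have "\<bar>u y\<bar> powr p \<le> 1 / Q * N powr p"
      using parts(2) \<open>Q > 0\<close> by (simp add: field_simps)
    then have "(\<bar>u y\<bar> powr p) powr (1 / p) \<le> (1 / Q * N powr p) powr (1 / p)"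
      by (intro root) auto
    then have "\<bar>u y\<bar> \<le> (1 / Q) powr (1 / p) * N"
      using N(1) \<open>Q > 0\<close> p_gt_1 by (simp add: powr_mult powr_powr powr_divide)
    moreover have "\<bar>u x - u y\<bar> \<le> T powr (1 - 1 / p) * N"
    proof -
      consider "x < y" | "y < x" | "x = y" by linarith
      then show ?thesis
        using incr[of x y] incr[of y x] x y(1) N(1) by cases (auto simp: abs_minus_commute)
    qed
    ultimately have "\<bar>u x\<bar> \<le> (1 / Q) powr (1 / p) * N + T powr (1 - 1 / p) * N"
      by linarith
    then show ?thesis
      by (simp add: C_def N_def algebra_simps)
  qed
  ultimately show ?thesis
    using that by blast
qed

lemma X_norm_eq_0D:
  assumes "u \<in> W1p T p" "X_norm T p q u = 0"
  shows "u = (\<lambda>_. 0)"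
proof
  fix x
  show "u x = 0"
    using X_norm_bounds_sup W1pD(2)[OF assms(1)] assms
    by (metis abs_le_zero_iff mult_zero_right)
qed

text \<open>Minkowski's inequality from convexity alone: u + v is the convex combination of u/t and
  v/(1-t), and \<open>t = A / (A + B)\<close> is chosen so that both of these have norm
  \<open>A + B\<close>.\<close>

lemma X_norm_triangle:
  assumes u: "u \<in> W1p T p" and v: "v \<in> W1p T p"
  shows "X_norm T p q (\<lambda>x. u x + v x) \<le> X_norm T p q u + X_norm T p q v"
proof -
  define A where "A = X_norm T p q u"
  define B where "B = X_norm T p q v"
  have AB: "A \<ge> 0" "B \<ge> 0"
    by (auto simp: A_def B_def X_norm_nonneg)
  consider "A = 0" | "B = 0" | "A > 0" "B > 0"
    using AB by linarith
  then show ?thesis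
  proof cases
    case 1
    then have "u = (\<lambda>_. 0)"
      using X_norm_eq_0D[OF u] by (simp add: A_def)
    then show ?thesis
      using X_norm_nonneg by simp
  next
    case 2
    then have "v = (\<lambda>_. 0)"
      using X_norm_eq_0D[OF v] by (simp add: B_def)
    then show ?thesis
      using X_norm_nonneg by simp
  next
    case 3
    note U = W1pD[OF u] and V = W1pD[OF v]
    define w where "w = weak_deriv T p u"
    define w' where "w' = weak_deriv T p v"
    define t where "t = A / (A + B)"
    have t: "0 < t" "t < 1" "1 - t = B / (A + B)"
      using 3 by (auto simp: t_def field_simps)
    have conv: "\<bar>a + b\<bar> powr p \<le> t * (1 / t) powr p * \<bar>a\<bar> powr p + (1 - t) * (1 / (1 - t)) powr p * \<bar>b\<bar> powr p" for a b
    proof -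
      have "\<bar>t * (a / t) + (1 - t) * (b / (1 - t))\<bar> powr p \<le> t * \<bar>a / t\<bar> powr p + (1 - t) * \<bar>b / (1 - t)\<bar> powr p"
        using t by (intro abs_powr_convex p_gt_1) auto
      moreover have "t * (a / t) + (1 - t) * (b / (1 - t)) = a + b"
        using t(1,2) by simp
      moreover have "\<bar>a / t\<bar> powr p = (1 / t) powr p * \<bar>a\<bar> powr p" "\<bar>b / (1 - t)\<bar> powr p = (1 / (1 - t)) powr p * \<bar>b\<bar> powr p"
        using t(1,2) by (simp_all add: abs_divide powr_divide)
      ultimately show ?thesis
        by (simp add: mult.assoc)
    qed
    have W: "(\<lambda>x. u x + v x) \<in> W1p T p" "is_weak_deriv T (\<lambda>x. u x + v x) (\<lambda>x. w x + w' x)" "(\<lambda>x. w x + w' x) \<in> Lp_space T p"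
      using W1p_linear[OF p_gt_1 T_pos u v, of 1 1] Lp_space_linear[OF p_gt_1 U(3) V(3), of 1 1]
      by (auto simp: w_def w'_def)
    define c where "c = t * (1 / t) powr p"
    define d where "d = (1 - t) * (1 / (1 - t)) powr p"
    have cd: "c \<ge> 0" "d \<ge> 0"
      using t(1,2) by (auto simp: c_def d_def)
    have iu: "integrable (lebesgue_on {0..T}) (\<lambda>x. \<bar>w x\<bar> powr p + q x * \<bar>u x\<bar> powr p)"
      and iv: "integrable (lebesgue_on {0..T}) (\<lambda>x. \<bar>w' x\<bar> powr p + q x * \<bar>v x\<bar> powr p)"
      using integrable_norm_integrand U V by (auto simp: w_def w'_def)
    have "X_norm T p q (\<lambda>x. u x + v x) powr p
        = (LINT x|lebesgue_on {0..T}. \<bar>w x + w' x\<bar> powr p + q x * \<bar>u x + v x\<bar> powr p)"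
      using X_norm_powr[OF W(1,3,2)] .
    also have "\<dots> \<le> (LINT x|lebesgue_on {0..T}. c * (\<bar>w x\<bar> powr p + q x * \<bar>u x\<bar> powr p)
        + d * (\<bar>w' x\<bar> powr p + q x * \<bar>v x\<bar> powr p))"
    proof (rule integral_mono)
      show "integrable (lebesgue_on {0..T}) (\<lambda>x. \<bar>w x + w' x\<bar> powr p + q x * \<bar>u x + v x\<bar> powr p)"
        using integrable_norm_integrand[OF W(3) W1pD(1)[OF W(1)]] .
      show "integrable (lebesgue_on {0..T}) (\<lambda>x. c * (\<bar>w x\<bar> powr p + q x * \<bar>u x\<bar> powr p)
        + d * (\<bar>w' x\<bar> powr p + q x * \<bar>v x\<bar> powr p))"
        by (rule Bochner_Integration.integrable_add; rule integrable_mult_right; rule iu iv)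
      fix x assume "x \<in> space (lebesgue_on {0..T})"
      then have "q x * \<bar>u x + v x\<bar> powr p \<le> q x * (c * \<bar>u x\<bar> powr p + d * \<bar>v x\<bar> powr p)"
        using conv[of "u x" "v x"] q_nonneg[of x] unfolding c_def d_def by (intro mult_left_mono) auto
      moreover have "\<bar>w x + w' x\<bar> powr p \<le> c * \<bar>w x\<bar> powr p + d * \<bar>w' x\<bar> powr p"
        using conv unfolding c_def d_def .
      ultimately show "\<bar>w x + w' x\<bar> powr p + q x * \<bar>u x + v x\<bar> powr p
          \<le> c * (\<bar>w x\<bar> powr p + q x * \<bar>u x\<bar> powr p) + d * (\<bar>w' x\<bar> powr p + q x * \<bar>v x\<bar> powr p)"
        by (simp add: algebra_simps)
    qed
    also have "\<dots> = c * A powr p + d * B powr p"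
      using Bochner_Integration.integral_add[OF integrable_mult_right[OF iu, of c] integrable_mult_right[OF iv, of d]]
        X_norm_powr[OF u U(3,4)] X_norm_powr[OF v V(3,4)]
      by (simp add: A_def B_def w_def w'_def del: Bochner_Integration.integral_add)
    also have "c * A powr p = t * (A + B) powr p"
    proof -
      have "(1 / t) powr p * A powr p = (1 / t * A) powr p"
        using t AB by (simp only: powr_mult)
      also have "1 / t * A = A + B"
        using 3 by (simp add: t_def)
      finally show ?thesis
        by (simp add: c_def mult.assoc)
    qed
    also have "d * B powr p = (1 - t) * (A + B) powr p"
    proof -
      have "(1 / (1 - t)) powr p * B powr p = (1 / (1 - t) * B) powr p"
        using t AB by (simp only: powr_mult)
      also have "1 / (1 - t) * B = A + B"
        using 3 by (simp add: t(3))
      finally show ?thesis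
        by (simp add: d_def mult.assoc)
    qed
    also have "t * (A + B) powr p + (1 - t) * (A + B) powr p = (A + B) powr p"
      by (simp add: algebra_simps)
    finally have "X_norm T p q (\<lambda>x. u x + v x) powr p \<le> (A + B) powr p" .
    then show ?thesis
      using AB p_gt_1 X_norm_nonneg powr_less_mono2[of p "A + B" "X_norm T p q (\<lambda>x. u x + v x)"]
      by (simp add: A_def[symmetric] B_def[symmetric] not_less[symmetric]) (metis add_nonneg_nonneg less_le_trans less_trans not_le zero_less_one)
  qed
qed

text \<open>Holds for arbitrary functions because \<open>Metric_space\<close> asks for symmetry of
  the distance on the whole type. If there is no weak derivative, both \<open>SOME\<close> terms
  choose from the same empty predicate and coincide.\<close>

lemma X_norm_minus: "X_norm T p q (\<lambda>x. - u x) = X_norm T p q u"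
proof (cases "\<exists>w. w \<in> Lp_space T p \<and> is_weak_deriv T u w")
  case False
  have "is_weak_deriv T (\<lambda>x. - f x) (\<lambda>x. - w x)" if "is_weak_deriv T f w" for f w
    using that by (simp add: is_weak_deriv_def)
  moreover have "(\<lambda>x. - w x) \<in> Lp_space T p" if "w \<in> Lp_space T p" for w
    using Lp_space_linear[OF p_gt_1 that that, of "-1" 0] by simp
  ultimately have "\<nexists>w. w \<in> Lp_space T p \<and> is_weak_deriv T (\<lambda>x. - u x) w"
    using False by (metis (no_types, lifting) ext add.inverse_inverse)
  then have "weak_deriv T p (\<lambda>x. - u x) = weak_deriv T p u"
    using False unfolding weak_deriv_def by (metis (mono_tags, lifting))
  then show ?thesis
    by (simp add: X_norm_def)
next
  case True
  define w where "w = weak_deriv T p u"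
  define w' where "w' = weak_deriv T p (\<lambda>x. - u x)"
  have w: "w \<in> Lp_space T p" "is_weak_deriv T u w"
    unfolding w_def weak_deriv_def using someI_ex[OF True] by auto
  have mw: "(\<lambda>x. - w x) \<in> Lp_space T p" "is_weak_deriv T (\<lambda>x. - u x) (\<lambda>x. - w x)"
    using Lp_space_linear[OF p_gt_1 w(1) w(1), of "-1" 0] w(2) by (simp_all add: is_weak_deriv_def)
  then have "\<exists>w'. w' \<in> Lp_space T p \<and> is_weak_deriv T (\<lambda>x. - u x) w'"
    by blast
  from someI_ex[OF this] have w': "w' \<in> Lp_space T p" "is_weak_deriv T (\<lambda>x. - u x) w'"
    unfolding w'_def weak_deriv_def by auto
  have AE: "AE x in lebesgue_on {0..T}. w' x = - w x"
    using weak_deriv_unique[OF p_gt_1 T_pos w' mw] .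
  let ?f = "\<lambda>x. \<bar>w x\<bar> powr p + q x * \<bar>u x\<bar> powr p"
  let ?g = "\<lambda>x. \<bar>w' x\<bar> powr p + q x * \<bar>u x\<bar> powr p"
  have m: "(\<lambda>x. \<bar>w x\<bar> powr p) \<in> borel_measurable (lebesgue_on {0..T})"
    "(\<lambda>x. \<bar>w' x\<bar> powr p) \<in> borel_measurable (lebesgue_on {0..T})"
    using Lp_spaceD(2)[OF p_gt_1] w w' by auto
  have "integral\<^sup>L (lebesgue_on {0..T}) ?g = integral\<^sup>L (lebesgue_on {0..T}) ?f"
  proof (cases "(\<lambda>x. q x * \<bar>u x\<bar> powr p) \<in> borel_measurable (lebesgue_on {0..T})")
    case True
    then show ?thesis
      using m by (intro integral_cong_AE borel_measurable_add) (use AE in \<open>auto elim: eventually_mono\<close>)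
  next
    case False
    \<comment> \<open>Here \<open>u\<close> is an arbitrary function; if the second summand is not
      measurable, neither integrand is integrable and both integrals have the default value
      0.\<close>
    have "?f \<notin> borel_measurable (lebesgue_on {0..T})"
      using borel_measurable_diff[OF _ m(1), of ?f] False by auto
    moreover have "?g \<notin> borel_measurable (lebesgue_on {0..T})"
      using borel_measurable_diff[OF _ m(2), of ?g] False by auto
    ultimately have "\<not> integrable (lebesgue_on {0..T}) ?f" and n: "\<not> integrable (lebesgue_on {0..T}) ?g"
      using borel_measurable_integrable by blast+
    from trans[OF not_integrable_integral_eq[OF n] not_integrable_integral_eq[OF this(1), symmetric]]
    show ?thesis .
  qed
  then show ?thesis
    by (simp add: X_norm_def w_def w'_def)
qed

lemma Metric_space_X: "Metric_space (X_space T p) (X_dist T p q)"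
proof
  fix u v :: "real \<Rightarrow> real"
  show "0 \<le> X_dist T p q u v"
    by (simp add: X_dist_def X_norm_nonneg)
  show "X_dist T p q u v = X_dist T p q v u"
    using X_norm_minus[of "\<lambda>x. u x - v x"] by (simp add: X_dist_def)
  assume u: "u \<in> X_space T p" and v: "v \<in> X_space T p"
  have d: "(\<lambda>x. u x - v x) \<in> W1p T p"
    using X_space_diff[OF p_gt_1 T_pos u v] by (simp add: X_space_def)
  show "X_dist T p q u v = 0 \<longleftrightarrow> u = v"
  proof
    assume "X_dist T p q u v = 0"
    then have "(\<lambda>x. u x - v x) = (\<lambda>_. 0)"
      using X_norm_eq_0D[OF d] by (simp add: X_dist_def)
    then show "u = v"
      by (auto simp: fun_eq_iff)
  next
    assume "u = v"
    moreover have "X_norm T p q (\<lambda>_. 0) = 0"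
      using X_norm_classical(2)[of "\<lambda>_. 0" "\<lambda>_. 0"] by (simp add: energy_def)
    ultimately show "X_dist T p q u v = 0"
      by (simp add: X_dist_def)
  qed
  fix w assume w: "w \<in> X_space T p"
  have "(\<lambda>x. v x - w x) \<in> W1p T p"
    using X_space_diff[OF p_gt_1 T_pos v w] by (simp add: X_space_def)
  from X_norm_triangle[OF d this] show "X_dist T p q u w \<le> X_dist T p q u v + X_dist T p q v w"
    by (simp add: X_dist_def)
qed

end

context weighted_problem
begin

section \<open>Variational characterisation of the principal eigenvalue\<close>

lemma LINT_mass:
  assumes "continuous_on {0..T} u"
  shows "(LINT x|lebesgue_on {0..T}. m x * \<bar>u x\<bar> powr p) = mass u"
  unfolding mass_def using assms by (intro LINT_lebesgue_on_continuous continuous_on_mq_powr)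

text \<open>Picone's identity is applied to the piecewise linear interpolants of \<open>u\<close>; by Jensen's
  inequality interpolation does not increase the \<open>p\<close>-norm of the derivative.\<close>

lemma weak_energy_ge:
  assumes w: "eigen \<mu> w W" "\<And>x. x \<in> {0..T} \<Longrightarrow> w x > 0" and u: "u \<in> X_space T p"
  shows "\<mu> * mass u \<le> X_norm T p q u powr p"
proof -
  have uW: "u \<in> W1p T p" "u 0 = u T"
    using u by (auto simp: X_space_def)
  note U = W1pD[OF uW(1)] and SW = psysD[OF w(1)[unfolded eigen_def]]
  define v where "v = weak_deriv T p u"
  have V: "v \<in> Lp_space T p" "is_weak_deriv T u v"
    using U by (auto simp: v_def)
  note iv = Lp_spaceD(2)[OF p_gt_1 V(1)]
  define c where "c x = q x - \<mu> * m x" for x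
  have cc: "continuous_on {0..T} c"
    unfolding c_def[abs_def] by (intro continuous_intros q_cont m_cont)
  define f where "f x = c x * \<bar>u x\<bar> powr p" for x
  have cf: "continuous_on {0..T} f"
    unfolding f_def[abs_def] by (intro continuous_intros cc continuous_on_mq_powr U)
  have "bounded (c ` {0..T})" "bounded (u ` {0..T})"
    using cc U(1) by (auto intro!: compact_imp_bounded compact_continuous_image)
  then obtain Cc Cu where Cc: "\<forall>x\<in>{0..T}. \<bar>c x\<bar> \<le> Cc" and Cu: "\<forall>x\<in>{0..T}. \<bar>u x\<bar> \<le> Cu"
    unfolding bounded_iff by auto
  have "Cc \<ge> 0"
    using Cc T_pos by fastforce
  \<comment> \<open>The boundary term of Picone's identity, written with \<open>u\<close>: the
    interpolant agrees with \<open>u\<close> at the nodes, so the contributions of the cells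
    telescope, and periodicity cancels what is left.\<close>
  define \<Theta> where "\<Theta> x = W x * (\<bar>u x\<bar> powr p * w x powr (1 - p))" for x
  have ind_set: "{a<..<b} \<in> sets (lebesgue_on {0..T})" if "0 \<le> a" "b \<le> T" for a b
    using that by (auto simp: sets_restrict_space image_iff intro!: bexI[of _ "{a<..<b}"])
  define J where "J a b = (LINT x|lebesgue_on {0..T}. \<bar>v x\<bar> powr p * indicator {a<..<b} x)" for a b
  have approx: "\<mu> * mass u \<le> X_norm T p q u powr p + e * T" if "e > 0" for e
  proof -
    have "uniformly_continuous_on {- (Cu + 1)..Cu + 1} (\<lambda>s. \<bar>s\<bar> powr p)"
      using p_gt_1 by (intro compact_uniformly_continuous continuous_intros) auto
    moreover have "e / (Cc + 1) > 0"
      using that \<open>Cc \<ge> 0\<close> by simp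
    ultimately obtain d1 where d1: "d1 > 0" "\<And>s t. s \<in> {- (Cu + 1)..Cu + 1} \<Longrightarrow> t \<in> {- (Cu + 1)..Cu + 1} \<Longrightarrow>
        dist t s < d1 \<Longrightarrow> dist (\<bar>t\<bar> powr p) (\<bar>s\<bar> powr p) < e / (Cc + 1)"
      unfolding uniformly_continuous_on_def by meson
    \<comment> \<open>On a cell the interpolant differs from \<open>u\<close> by less than
      \<open>2 * d\<close>, which keeps its values in the enlarged interval and within the modulus
      \<open>d1\<close> of the p-th power.\<close>
    define d where "d = min d1 1 / 2"
    have d: "d > 0" "2 * d \<le> d1" "2 * d \<le> 1"
      using d1(1) by (auto simp: d_def)
    have "uniformly_continuous_on {0..T} u"
      using U(1) by (intro compact_uniformly_continuous) auto
    then obtain h where h: "h > 0" "\<And>x y. x \<in> {0..T} \<Longrightarrow> y \<in> {0..T} \<Longrightarrow> dist y x < h \<Longrightarrow> dist (u y) (u x) < d"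
      unfolding uniformly_continuous_on_def using d(1) by meson
    obtain n where n: "T / h < real n"
      using reals_Archimedean2 by blast
    then have n0: "real n > 0"
      using T_pos h(1) by (meson divide_pos_pos less_trans)
    have Tn: "T / real n < h"
      using n n0 h(1) T_pos by (simp add: field_simps)
    define X where "X k = real k * (T / real n)" for k
    have X_range: "X k \<in> {0..T}" if "k \<le> n" for k
    proof -
      have "X k \<le> real n * (T / real n)"
        unfolding X_def using that T_pos by (intro mult_right_mono) auto
      then show ?thesis
        using n0 T_pos by (simp add: X_def)
    qed
    have X_Suc: "X (Suc k) = X k + T / real n" for k
      unfolding X_def of_nat_Suc by (simp only: distrib_right mult_1 add.commute)
    have cell: "\<Theta> (X (Suc k)) - \<Theta> (X k) \<le> J (X k) (X (Suc k)) + e * (X (Suc k) - X k) + integral {X k..X (Suc k)} f"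
      if k: "Suc k \<le> n" for k
    proof -
      define a b where "a = X k" and "b = X (Suc k)"
      have ab: "0 \<le> a" "a < b" "b \<le> T" "b - a < h"
        using X_range[of k] X_range[of "Suc k"] k X_Suc[of k] Tn T_pos n0 by (auto simp: a_def b_def)
      have sub: "{a..b} \<subseteq> {0..T}"
        using ab by auto
      define s where "s = (u b - u a) / (b - a)"
      define z where "z x = u a + s * (x - a)" for x
      have zab: "z a = u a" "z b = u b"
        using ab by (auto simp: z_def s_def)
      have dz: "(z has_real_derivative s) (at x within {a..b})" for x
        unfolding z_def[abs_def] by (auto intro!: derivative_eq_intros)
      have cz: "continuous_on {a..b} z"
        unfolding z_def[abs_def] by (intro continuous_intros)
      have pw: "c x * \<bar>z x\<bar> powr p \<le> f x + e" if x: "x \<in> {a..b}" for x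
      proof -
        have x0: "x \<in> {0..T}" and a0: "a \<in> {0..T}" and b0: "b \<in> {0..T}"
          using x sub ab by auto
        have 1: "\<bar>u x - u a\<bar> < d"
          using h(2)[OF a0 x0] x ab by (simp add: dist_real_def)
        have 2: "\<bar>u b - u a\<bar> < d"
          using h(2)[OF a0 b0] ab by (simp add: dist_real_def)
        have "\<bar>s * (x - a)\<bar> = \<bar>u b - u a\<bar> * ((x - a) / (b - a))"
          using x ab by (simp add: s_def abs_mult abs_divide)
        also have "\<dots> \<le> \<bar>u b - u a\<bar> * 1"
          using x ab by (intro mult_left_mono) auto
        finally have "\<bar>s * (x - a)\<bar> < d"
          using 2 by simp
        then have 3: "\<bar>z x - u x\<bar> < 2 * d"
          using 1 by (simp add: z_def)
        have 4: "\<bar>u x\<bar> \<le> Cu"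
          using Cu x0 by blast
        have "\<bar>\<bar>z x\<bar> powr p - \<bar>u x\<bar> powr p\<bar> < e / (Cc + 1)"
        proof -
          have "u x \<in> {- (Cu + 1)..Cu + 1}" "z x \<in> {- (Cu + 1)..Cu + 1}" "dist (z x) (u x) < d1"
            using 3 4 d unfolding dist_real_def atLeastAtMost_iff by linarith+
          from d1(2)[OF this] show ?thesis
            by (simp add: dist_real_def)
        qed
        then have "c x * (\<bar>z x\<bar> powr p - \<bar>u x\<bar> powr p) \<le> Cc * (e / (Cc + 1))"
        proof -
          have "c x * (\<bar>z x\<bar> powr p - \<bar>u x\<bar> powr p) \<le> \<bar>c x\<bar> * \<bar>\<bar>z x\<bar> powr p - \<bar>u x\<bar> powr p\<bar>"
            unfolding abs_mult[symmetric] by (rule abs_ge_self)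
          also assume "\<bar>\<bar>z x\<bar> powr p - \<bar>u x\<bar> powr p\<bar> < e / (Cc + 1)"
          then have "\<bar>c x\<bar> * \<bar>\<bar>z x\<bar> powr p - \<bar>u x\<bar> powr p\<bar> \<le> Cc * (e / (Cc + 1))"
            using Cc x0 \<open>Cc \<ge> 0\<close> by (intro mult_mono) auto
          finally show ?thesis .
        qed
        also have "\<dots> \<le> e"
          using \<open>Cc \<ge> 0\<close> \<open>e > 0\<close> by (simp add: field_simps)
        finally show ?thesis
          by (simp add: f_def algebra_simps)
      qed
      have ch: "continuous_on {a..b} (\<lambda>x. c x * phi p (w x))"
        using continuous_on_subset[OF eigen_continuous(4)[OF w(1)] sub] by (simp add: c_def)
      have wab: "w x > 0" if "x \<in> {a..b}" for x
        using w(2) sub that by blast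
      note P = picone_identity[OF p_gt_1 less_imp_le[OF ab(2)] wab
          has_field_derivative_subset[OF SW(1) sub]
          has_field_derivative_subset[OF SW(2)[folded c_def] sub] dz continuous_on_const ch]
      have D0: "0 \<le> integral {a..b} (\<lambda>x. picone_defect p s (z x * phi (conj_exp p) (W x) / w x))"
        using P(2) sub p_gt_1
        by (intro Henstock_Kurzweil_Integration.integral_nonneg integrable_continuous_real picone_defect_nonneg) auto
      have "\<Theta> b - \<Theta> a \<le> integral {a..b} (\<lambda>x. \<bar>s\<bar> powr p + c x * phi p (w x) * (\<bar>z x\<bar> powr p * w x powr (1 - p)))"
        using P(1) sub D0 by (auto simp: \<Theta>_def zab)
      also have "\<dots> = integral {a..b} (\<lambda>x. \<bar>s\<bar> powr p + c x * \<bar>z x\<bar> powr p)"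
      proof (rule integral_cong)
        fix x assume "x \<in> {a..b}"
        then have "phi p (w x) * w x powr (1 - p) = 1"
          using wab by (intro phi_mult_powr)
        then have "c x * phi p (w x) * (\<bar>z x\<bar> powr p * w x powr (1 - p)) = c x * \<bar>z x\<bar> powr p"
          by (metis (no_types, opaque_lifting) mult.assoc mult.commute mult.right_neutral)
        then show "\<bar>s\<bar> powr p + c x * phi p (w x) * (\<bar>z x\<bar> powr p * w x powr (1 - p)) = \<bar>s\<bar> powr p + c x * \<bar>z x\<bar> powr p"
          by simp
      qed
      also have "\<dots> \<le> integral {a..b} (\<lambda>x. (\<bar>s\<bar> powr p + e) + 1 * f x)"
      proof (rule integral_le)
        show "(\<lambda>x. \<bar>s\<bar> powr p + c x * \<bar>z x\<bar> powr p) integrable_on {a..b}"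
          using p_gt_1 by (intro integrable_continuous_real continuous_intros cz continuous_on_subset[OF cc sub]) auto
        show "(\<lambda>x. (\<bar>s\<bar> powr p + e) + 1 * f x) integrable_on {a..b}"
          by (intro integrable_continuous_real continuous_intros continuous_on_subset[OF cf sub])
        show "\<bar>s\<bar> powr p + c x * \<bar>z x\<bar> powr p \<le> (\<bar>s\<bar> powr p + e) + 1 * f x" if "x \<in> {a..b}" for x
          using pw[OF that] by simp
      qed
      also have "\<dots> = (\<bar>s\<bar> powr p + e) * (b - a) + integral {a..b} f"
        using ab by (subst integral_linear_combination[OF continuous_on_const continuous_on_subset[OF cf sub]]) (simp add: mult.commute)
      also have "\<dots> = \<bar>s\<bar> powr p * (b - a) + e * (b - a) + integral {a..b} f"
        by (simp add: algebra_simps)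
      finally have "\<Theta> b - \<Theta> a \<le> \<bar>s\<bar> powr p * (b - a) + e * (b - a) + integral {a..b} f" .
      moreover have "\<bar>s\<bar> powr p * (b - a) \<le> J a b"
        unfolding s_def J_def using difference_quotient_le[OF U(1) V ab(1-3)] .
      ultimately show ?thesis
        unfolding a_def[symmetric] b_def[symmetric] by linarith
    qed
    have "\<Theta> (X k) - \<Theta> (X 0) \<le> J 0 (X k) + e * X k + integral {0..X k} f" if "k \<le> n" for k
      using that
    proof (induction k)
      case 0
      have "J 0 (X 0) \<ge> 0"
        unfolding J_def by (intro integral_nonneg_AE AE_I2) auto
      then show ?case
        by (simp add: X_def)
    next
      case (Suc k)
      have r: "X k \<in> {0..T}" "X (Suc k) \<in> {0..T}" "X k \<le> X (Suc k)"
        using X_range[of k] X_range[of "Suc k"] Suc.prems X_Suc[of k] T_pos n0 by auto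
      have "J 0 (X k) + J (X k) (X (Suc k))
          = (LINT x|lebesgue_on {0..T}. \<bar>v x\<bar> powr p * indicator {0<..<X k} x + \<bar>v x\<bar> powr p * indicator {X k<..<X (Suc k)} x)"
        unfolding J_def using r
        by (intro Bochner_Integration.integral_add[symmetric] integrable_real_mult_indicator iv ind_set) auto
      also have "\<dots> \<le> J 0 (X (Suc k))"
        unfolding J_def using r
        by (intro integral_mono Bochner_Integration.integrable_add integrable_real_mult_indicator iv ind_set)
          (auto simp: indicator_def)
      finally have "J 0 (X k) + J (X k) (X (Suc k)) \<le> J 0 (X (Suc k))" .
      moreover have "integral {0..X k} f + integral {X k..X (Suc k)} f = integral {0..X (Suc k)} f"
        using r by (intro Henstock_Kurzweil_Integration.integral_combine integrable_continuous_real continuous_on_subset[OF cf]) auto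
      ultimately show ?case
        using Suc.IH Suc.prems cell[OF Suc.prems] by (simp add: algebra_simps)
    qed
    from this[of n] have "0 \<le> J 0 T + e * T + integral {0..T} f"
      using n0 SW(3,4) uW(2) by (simp add: X_def \<Theta>_def)
    also have "J 0 T \<le> (LINT x|lebesgue_on {0..T}. \<bar>v x\<bar> powr p)"
      unfolding J_def by (intro integral_mono integrable_real_mult_indicator iv ind_set) (auto simp: indicator_def)
    also have "integral {0..T} f = integral {0..T} (\<lambda>x. q x * \<bar>u x\<bar> powr p + (- \<mu>) * (m x * \<bar>u x\<bar> powr p))"
      by (rule integral_cong) (simp add: f_def c_def algebra_simps)
    also have "\<dots> = integral {0..T} (\<lambda>x. q x * \<bar>u x\<bar> powr p) + (- \<mu>) * mass u"
      unfolding mass_def by (intro integral_linear_combination continuous_on_mq_powr U)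
    also have "integral {0..T} (\<lambda>x. q x * \<bar>u x\<bar> powr p) = (LINT x|lebesgue_on {0..T}. q x * \<bar>u x\<bar> powr p)"
      by (intro LINT_lebesgue_on_continuous[symmetric] continuous_on_mq_powr U)
    finally have "\<mu> * mass u \<le> (LINT x|lebesgue_on {0..T}. \<bar>v x\<bar> powr p) + (LINT x|lebesgue_on {0..T}. q x * \<bar>u x\<bar> powr p) + e * T"
      by simp
    also have "(LINT x|lebesgue_on {0..T}. \<bar>v x\<bar> powr p) + (LINT x|lebesgue_on {0..T}. q x * \<bar>u x\<bar> powr p) = X_norm T p q u powr p"
      unfolding X_norm_powr[OF uW(1) V]
      by (intro Bochner_Integration.integral_add[symmetric] iv continuous_imp_integrable_real continuous_on_mq_powr U)
    finally show ?thesis .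
  qed
  have "\<mu> * mass u \<le> X_norm T p q u powr p + e" if "e > 0" for e
    using approx[of "e / T"] that T_pos by simp
  then show ?thesis
    by (rule field_le_epsilon)
qed

text \<open>The lower bound is \<open>weak_energy_ge\<close>, and the eigenfunction scaled to mass 1
  attains it. That it is attained is recorded separately, because \<open>lambda0\<close> for
  \<open>Minus\<close> is a \<open>GREATEST\<close>.\<close>

lemma lambda0_eq:
  assumes w: "eigen \<mu> w W" "\<And>x. x \<in> {0..T} \<Longrightarrow> w x > 0" and "\<mu> > 0"
  shows "lambda0 T p q m Plus = \<mu>"
    "\<exists>u\<in>X_space T p. mass u = 1 \<and> X_norm T p q u powr p = \<mu>"
    "\<And>u. u \<in> X_space T p \<Longrightarrow> mass u = 1 \<Longrightarrow> \<mu> \<le> X_norm T p q u powr p"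
proof -
  note SW = psysD[OF w(1)[unfolded eigen_def]]
  have M: "mass w > 0"
    using eigen_mass_pos[OF w \<open>\<mu> > 0\<close>] .
  define k where "k = (1 / mass w) powr (1 / p)"
  have k: "k > 0" "k powr p = 1 / mass w"
    using M p_gt_1 by (auto simp: k_def powr_powr)
  define u where "u x = (if x \<in> {0..T} then k * w x else 0)" for x
  define v where "v x = k * phi (conj_exp p) (W x)" for x
  have du: "(u has_real_derivative v x) (at x within {0..T})" if "x \<in> {0..T}" for x
  proof (rule has_field_derivative_transform[OF that])
    show "((\<lambda>x. k * w x) has_real_derivative v x) (at x within {0..T})"
      unfolding v_def using SW(1)[OF that] by (rule DERIV_cmult)
  qed (simp add: u_def)
  have cv: "continuous_on {0..T} v"
    unfolding v_def[abs_def] by (intro continuous_intros eigen_continuous(3)[OF w(1)])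
  have out: "u x = 0" if "x \<notin> {0..T}" for x
    unfolding u_def using that by (rule if_not_P)
  note X = X_norm_classical[OF du cv out]
  have uW: "u \<in> W1p T p" and E: "X_norm T p q u powr p = energy u v"
    using X by auto
  have uX: "u \<in> X_space T p"
    using uW SW(3) T_pos by (simp add: X_space_def u_def)
  have abs_k: "\<bar>k * s\<bar> powr p = \<bar>s\<bar> powr p / mass w" for s
    using k by (simp add: abs_mult powr_mult)
  have "mass u = integral {0..T} (\<lambda>x. m x * \<bar>w x\<bar> powr p / mass w)"
    unfolding mass_def by (rule integral_cong) (simp add: u_def abs_k mass_def)
  also have "\<dots> = mass w / mass w"
    unfolding mass_def by (rule integral_divide)
  finally have mass_u: "mass u = 1"
    using M by simp
  have "energy u v = integral {0..T} (\<lambda>x. (\<bar>phi (conj_exp p) (W x)\<bar> powr p + q x * \<bar>w x\<bar> powr p) / mass w)"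
    unfolding energy_def by (rule integral_cong) (simp add: u_def v_def abs_k add_divide_distrib)
  also have "\<dots> = energy w (\<lambda>x. phi (conj_exp p) (W x)) / mass w"
    unfolding energy_def by (rule integral_divide)
  also have "\<dots> = \<mu>"
    using eigen_energy[OF w(1)] M by simp
  finally have E\<mu>: "X_norm T p q u powr p = \<mu>"
    using E by simp
  show attained: "\<exists>u\<in>X_space T p. mass u = 1 \<and> X_norm T p q u powr p = \<mu>"
    using uX mass_u E\<mu> by blast
  show lower: "\<mu> \<le> X_norm T p q u powr p" if "u \<in> X_space T p" "mass u = 1" for u
    using weak_energy_ge[OF w that(1)] that(2) by simp
  have eq: "(LINT x|lebesgue_on {0..T}. m x * \<bar>u x\<bar> powr p) = mass u" if "u \<in> X_space T p" for u
    using that W1pD(1) by (auto simp: X_space_def intro!: LINT_mass)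
  have "Inf {X_norm T p q u powr p | u. u \<in> X_space T p \<and> (LINT x|lebesgue_on {0..T}. m x * \<bar>u x\<bar> powr p) = 1} = \<mu>"
  proof (rule cInf_eq_minimum)
    show "\<mu> \<in> {X_norm T p q u powr p | u. u \<in> X_space T p \<and> (LINT x|lebesgue_on {0..T}. m x * \<bar>u x\<bar> powr p) = 1}"
      using attained eq by force
  qed (use lower eq in auto)
  then show "lambda0 T p q m Plus = \<mu>"
    by simp
qed

end

section \<open>Solutions\<close>

locale bifurcation_problem = weighted_problem +
  fixes g :: "real \<Rightarrow> real \<Rightarrow> real \<Rightarrow> real"
  assumes g_cont: "continuous_on ({0..T} \<times> UNIV \<times> UNIV) (\<lambda>(x, s, l). g x s l)"
    and g_at_0: "x \<in> {0..T} \<Longrightarrow> g x s 0 = 0"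
    and g_small: "bounded L \<Longrightarrow>
      uniform_limit ({0..T} \<times> L) (\<lambda>s (x, l). g x s l / \<bar>s\<bar> powr (p - 1)) (\<lambda>_. 0) (at 0)"
begin

text \<open>The smallness hypothesis sees only \<open>s \<noteq> 0\<close>; continuity of
  \<open>g\<close> carries it over to \<open>s = 0\<close>.\<close>

lemma g_zero:
  assumes x: "x \<in> {0..T}"
  shows "g x 0 l = 0"
proof -
  have "continuous_on UNIV (\<lambda>s. (x, s, l))"
    by (intro continuous_intros)
  moreover have "range (\<lambda>s. (x, s, l)) \<subseteq> {0..T} \<times> UNIV \<times> UNIV"
    using x by auto
  ultimately have "continuous_on UNIV (\<lambda>s. g x s l)"
    using continuous_on_compose2[OF g_cont, of UNIV "\<lambda>s. (x, s, l)"] by simp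
  then have 1: "(\<lambda>s. g x s l) \<midarrow>0\<rightarrow> g x 0 l"
    by (simp add: continuous_on_eq_continuous_at isCont_def)
  have "((\<lambda>s. g x s l / \<bar>s\<bar> powr (p - 1)) \<longlongrightarrow> 0) (at 0)"
    using tendsto_uniform_limitI[OF g_small[of "{l}"], of "(x, l)"] x by simp
  moreover have "((\<lambda>s. \<bar>s\<bar> powr (p - 1)) \<longlongrightarrow> 0) (at (0::real))"
  proof -
    have "isCont (\<lambda>s::real. \<bar>s\<bar> powr (p - 1)) 0"
      using p_gt_1 by (intro continuous_intros) auto
    then show ?thesis
      using p_gt_1 by (simp add: isCont_def)
  qed
  ultimately have "((\<lambda>s. g x s l / \<bar>s\<bar> powr (p - 1) * \<bar>s\<bar> powr (p - 1)) \<longlongrightarrow> 0 * 0) (at 0)"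
    by (rule tendsto_mult)
  moreover have "\<forall>\<^sub>F s in at (0::real). g x s l / \<bar>s\<bar> powr (p - 1) * \<bar>s\<bar> powr (p - 1) = g x s l"
    by (simp add: eventually_at_filter)
  ultimately have "((\<lambda>s. g x s l) \<longlongrightarrow> 0 * 0) (at 0)"
    by (rule Lim_transform_eventually)
  then have "((\<lambda>s. g x s l) \<longlongrightarrow> 0) (at 0)"
    by simp
  then show ?thesis
    using 1 LIM_unique by blast
qed

lemma g_small_bound:
  assumes "\<eta> > 0"
  obtains \<delta> where "\<delta> > 0"
    "\<And>x s l. x \<in> {0..T} \<Longrightarrow> \<bar>l\<bar> \<le> \<Lambda> \<Longrightarrow> \<bar>s\<bar> < \<delta> \<Longrightarrow> \<bar>g x s l\<bar> \<le> \<eta> * \<bar>s\<bar> powr (p - 1)"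
proof -
  have "bounded {- \<Lambda>..\<Lambda>}"
    by simp
  from uniform_limitD[OF g_small[OF this] assms] obtain \<delta> where \<delta>: "\<delta> > 0"
    "\<And>s. s \<noteq> 0 \<Longrightarrow> dist s 0 < \<delta> \<Longrightarrow> \<forall>z\<in>{0..T} \<times> {- \<Lambda>..\<Lambda>}. dist (case z of (x, l) \<Rightarrow> g x s l / \<bar>s\<bar> powr (p - 1)) 0 < \<eta>"
    unfolding eventually_at by auto
  show ?thesis
  proof (rule that[OF \<delta>(1)])
    fix x s l assume x: "x \<in> {0..T}" and l: "\<bar>l\<bar> \<le> \<Lambda>" and s: "\<bar>s\<bar> < \<delta>"
    show "\<bar>g x s l\<bar> \<le> \<eta> * \<bar>s\<bar> powr (p - 1)"
    proof (cases "s = 0")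
      case True
      then show ?thesis
        using g_zero[OF x] by simp
    next
      case False
      then have "\<bar>g x s l / \<bar>s\<bar> powr (p - 1)\<bar> < \<eta>"
        using \<delta>(2)[of s] x l s by (fastforce simp: abs_le_iff)
      then show ?thesis
        using False by (simp add: abs_divide pos_divide_less_eq)
    qed
  qed
qed

text \<open>Near \<open>s = 0\<close> this is the smallness hypothesis, elsewhere compactness. The
  homogeneous form is what unique continuation needs for the nonlinear equation.\<close>

lemma g_power_bound:
  obtains C where "C \<ge> 0" "\<And>x s l. x \<in> {0..T} \<Longrightarrow> \<bar>l\<bar> \<le> \<Lambda> \<Longrightarrow> \<bar>s\<bar> \<le> R \<Longrightarrow> \<bar>g x s l\<bar> \<le> C * \<bar>s\<bar> powr (p - 1)"
proof -
  obtain \<delta> where \<delta>: "\<delta> > 0"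
    "\<And>x s l. x \<in> {0..T} \<Longrightarrow> \<bar>l\<bar> \<le> \<Lambda> \<Longrightarrow> \<bar>s\<bar> < \<delta> \<Longrightarrow> \<bar>g x s l\<bar> \<le> 1 * \<bar>s\<bar> powr (p - 1)"
    using g_small_bound[OF zero_less_one] by blast
  define Q where "Q = {0..T} \<times> {- R..R} \<times> {- \<Lambda>..\<Lambda>}"
  have "bounded ((\<lambda>(x, s, l). g x s l) ` Q)"
    unfolding Q_def
    by (intro compact_imp_bounded compact_continuous_image compact_Times continuous_on_subset[OF g_cont]) auto
  then obtain B where B: "\<forall>z\<in>Q. \<bar>(\<lambda>(x, s, l). g x s l) z\<bar> \<le> B"
    unfolding bounded_iff by auto
  define C where "C = max 1 (\<bar>B\<bar> / \<delta> powr (p - 1))"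
  show ?thesis
  proof (rule that)
    show "C \<ge> 0"
      by (simp add: C_def)
    fix x s l assume x: "x \<in> {0..T}" and l: "\<bar>l\<bar> \<le> \<Lambda>" and s: "\<bar>s\<bar> \<le> R"
    show "\<bar>g x s l\<bar> \<le> C * \<bar>s\<bar> powr (p - 1)"
    proof (cases "\<bar>s\<bar> < \<delta>")
      case True
      have "1 * \<bar>s\<bar> powr (p - 1) \<le> C * \<bar>s\<bar> powr (p - 1)"
        by (intro mult_right_mono) (auto simp: C_def)
      then show ?thesis
        using \<delta>(2)[OF x l True] by linarith
    next
      case False
      have "\<bar>g x s l\<bar> \<le> \<bar>B\<bar>"
      proof -
        have "(x, s, l) \<in> Q"
          using x l s by (auto simp: Q_def)
        with B have "\<bar>g x s l\<bar> \<le> B"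
          by fastforce
        then show ?thesis
          by linarith
      qed
      also have "\<dots> = \<bar>B\<bar> / \<delta> powr (p - 1) * \<delta> powr (p - 1)"
        using \<delta>(1) by simp
      also have "\<dots> \<le> C * \<bar>s\<bar> powr (p - 1)"
        using False \<delta>(1) p_gt_1 by (intro mult_mono powr_mono2) (auto simp: C_def)
      finally show ?thesis .
    qed
  qed
qed

end

lemma psys_scale:
  assumes "p > 1" "c > 0" and S: "psys T p h u V"
  shows "psys T p (\<lambda>x. h x / phi p c) (\<lambda>x. u x / c) (\<lambda>x. V x / phi p c)"
  using psysD[OF S] assms
  by (auto simp: psys_def phi_divide intro!: DERIV_cdivide)

lemma open_interval_DERIV_0_const:
  fixes f :: "real \<Rightarrow> real"
  assumes "\<And>x. x \<in> {a<..<b} \<Longrightarrow> (f has_real_derivative 0) (at x)" "x \<in> {a<..<b}" "y \<in> {a<..<b}"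
  shows "f x = f y"
proof -
  have "\<exists>c. \<forall>x\<in>{a<..<b}. f x = c"
    by (rule has_field_derivative_zero_constant) (use assms(1) in \<open>auto intro: DERIV_subset\<close>)
  then show ?thesis
    using assms by auto
qed

lemma continuous_on_eq_closure_interval:
  fixes f g :: "real \<Rightarrow> real"
  assumes "a < b" "continuous_on {a..b} f" "continuous_on {a..b} g" "\<And>x. x \<in> {a<..<b} \<Longrightarrow> f x = g x" "x \<in> {a..b}"
  shows "f x = g x"
proof -
  have "f x - g x = 0"
    by (rule continuous_constant_on_closure[of "{a<..<b}" "\<lambda>x. f x - g x" 0 x])
      (use assms in \<open>auto intro!: continuous_intros\<close>)
  then show ?thesis
    by simp
qed

lemma has_real_derivative_unique_Icc:
  assumes "a < b" "x \<in> {a..b}" "(f has_real_derivative D) (at x within {a..b})"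
    "(f has_real_derivative D') (at x within {a..b})"
  shows "D = D'"
  using vector_derivative_unique_within_closed_interval[of a b x f D D'] assms
  by (simp add: has_real_derivative_iff_has_vector_derivative)

context bifurcation_problem
begin

abbreviation "sols \<equiv> solutions T p q m g"

section \<open>Solutions as first-order systems: regularity and compactness\<close>

definition rhs :: "real \<Rightarrow> (real \<Rightarrow> real) \<Rightarrow> real \<Rightarrow> real" where
  "rhs l u x = (q x - l * m x) * phi p (u x) - g x (u x) l"

lemma continuous_on_rhs_triple:
  "continuous_on ({0..T} \<times> UNIV \<times> UNIV) (\<lambda>(x, s, l). (q x - l * m x) * phi p s - g x s l)"
  unfolding split_beta using p_gt_1 g_cont[unfolded split_beta]
  by (intro continuous_intros continuous_on_compose2[OF m_cont] continuous_on_compose2[OF q_cont]) auto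

lemma continuous_on_rhs:
  assumes "continuous_on {0..T} u"
  shows "continuous_on {0..T} (rhs l u)"
proof -
  have "continuous_on {0..T} (\<lambda>x. (x, u x, l))"
    by (intro continuous_intros assms)
  moreover have "(\<lambda>x. (x, u x, l)) ` {0..T} \<subseteq> {0..T} \<times> UNIV \<times> UNIV"
    by auto
  ultimately show ?thesis
    using continuous_on_compose2[OF continuous_on_rhs_triple, of "{0..T}" "\<lambda>x. (x, u x, l)"]
    by (simp add: rhs_def[abs_def])
qed

lemma rhs_power_bound:
  obtains C where "C \<ge> 0"
    "\<And>x l u. x \<in> {0..T} \<Longrightarrow> \<bar>l\<bar> \<le> \<Lambda> \<Longrightarrow> \<bar>u x\<bar> \<le> R \<Longrightarrow> \<bar>rhs l u x\<bar> \<le> C * \<bar>u x\<bar> powr (p - 1)"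
proof -
  obtain A where A: "\<And>x s l. x \<in> {0..T} \<Longrightarrow> \<bar>l\<bar> \<le> \<Lambda> \<Longrightarrow> \<bar>(q x - l * m x) * phi p s\<bar> \<le> A * \<bar>s\<bar> powr (p - 1)"
    using linear_bound by blast
  obtain B where B: "B \<ge> 0" "\<And>x s l. x \<in> {0..T} \<Longrightarrow> \<bar>l\<bar> \<le> \<Lambda> \<Longrightarrow> \<bar>s\<bar> \<le> R \<Longrightarrow> \<bar>g x s l\<bar> \<le> B * \<bar>s\<bar> powr (p - 1)"
    using g_power_bound by blast
  show ?thesis
  proof (rule that)
    show "\<bar>A\<bar> + B \<ge> 0"
      using B(1) by simp
    fix x l and u :: "real \<Rightarrow> real" assume x: "x \<in> {0..T}" "\<bar>l\<bar> \<le> \<Lambda>" "\<bar>u x\<bar> \<le> R"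
    have "\<bar>rhs l u x\<bar> \<le> A * \<bar>u x\<bar> powr (p - 1) + B * \<bar>u x\<bar> powr (p - 1)"
      unfolding rhs_def using A[OF x(1,2), of "u x"] B(2)[OF x] by linarith
    also have "\<dots> \<le> (\<bar>A\<bar> + B) * \<bar>u x\<bar> powr (p - 1)"
      unfolding distrib_right[symmetric] by (intro mult_right_mono) auto
    finally show "\<bar>rhs l u x\<bar> \<le> (\<bar>A\<bar> + B) * \<bar>u x\<bar> powr (p - 1)" .
  qed
qed

text \<open>A solution is of class \<open>C\<^sup>1\<close> up to the end points, although the definition only asks for
  one-sided derivatives of \<open>u\<close> there.\<close>

lemma solutions_iff:
  "(l, u) \<in> sols \<longleftrightarrow> (\<exists>V. psys T p (rhs l u) u V) \<and> (\<forall>x. x \<notin> {0..T} \<longrightarrow> u x = 0)"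
proof
  assume R: "(\<exists>V. psys T p (rhs l u) u V) \<and> (\<forall>x. x \<notin> {0..T} \<longrightarrow> u x = 0)"
  then obtain V where S: "psys T p (rhs l u) u V"
    by blast
  note P = psysD[OF S]
  have cv: "continuous_on {0..T} (\<lambda>x. phi (conj_exp p) (V x))"
    using p_gt_1 P(6) by (intro continuous_intros conj_exp_gt_1)
  have "u \<in> X_space T p"
    using X_norm_classical(1)[OF P(1) cv] R P(3) by (simp add: X_space_def)
  moreover have "\<exists>D. ((\<lambda>y. phi p (phi (conj_exp p) (V y))) has_real_derivative D) (at x) \<and>
      - D + q x * phi p (u x) = l * m x * phi p (u x) + g x (u x) l" if "x \<in> {0<..<T}" for x
    using P(2)[of x] that p_gt_1
    by (intro exI[of _ "rhs l u x"]) (auto simp: at_within_Icc_at rhs_def algebra_simps)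
  ultimately show "(l, u) \<in> sols"
    using P(1,3,4) unfolding solutions_def by (auto intro!: exI[of _ "\<lambda>x. phi (conj_exp p) (V x)"])
next
  assume "(l, u) \<in> sols"
  then have uX: "u \<in> X_space T p" and "\<exists>v. (\<forall>x\<in>{0..T}. (u has_real_derivative v x) (at x within {0..T})) \<and>
      u 0 = u T \<and> v 0 = v T \<and> (\<forall>x\<in>{0<..<T}. \<exists>D. ((\<lambda>y. phi p (v y)) has_real_derivative D) (at x) \<and>
        - D + q x * phi p (u x) = l * m x * phi p (u x) + g x (u x) l)"
    unfolding solutions_def by simp_all
  then obtain v where v: "\<And>x. x \<in> {0..T} \<Longrightarrow> (u has_real_derivative v x) (at x within {0..T})"
    and per: "u 0 = u T" "v 0 = v T"
    and eq: "\<And>x. x \<in> {0<..<T} \<Longrightarrow> \<exists>D. ((\<lambda>y. phi p (v y)) has_real_derivative D) (at x) \<and>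
             - D + q x * phi p (u x) = l * m x * phi p (u x) + g x (u x) l"
    by blast
  have cu: "continuous_on {0..T} u"
    using DERIV_continuous_on[OF v] .
  note ch = continuous_on_rhs[OF cu, of l]
  have dV: "((\<lambda>y. phi p (v y)) has_real_derivative rhs l u x) (at x)" if x: "x \<in> {0<..<T}" for x
  proof -
    obtain D where D: "((\<lambda>y. phi p (v y)) has_real_derivative D) (at x)"
      "- D + q x * phi p (u x) = l * m x * phi p (u x) + g x (u x) l"
      using eq[OF x] by blast
    then have "D = rhs l u x"
      by (simp add: rhs_def algebra_simps)
    then show ?thesis
      using D(1) by simp
  qed
  define c where "c = T / 2"
  have c: "c \<in> {0<..<T}"
    using T_pos by (auto simp: c_def)
  \<comment> \<open>\<open>solutions\<close> asks for no regularity of \<open>phi p (v x)\<close> at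
    the end points. Its continuation is the primitive \<open>V\<close> of the right-hand side,
    anchored at an interior point; integrating once more recovers \<open>u\<close> on the closed
    interval, and uniqueness of one-sided derivatives then identifies \<open>v\<close> at the
    ends.\<close>
  define V where "V x = phi p (v c) + (integral {0..x} (rhs l u) - integral {0..c} (rhs l u))" for x
  have V: "(V has_real_derivative rhs l u x) (at x within {0..T})" if "x \<in> {0..T}" for x
    unfolding V_def[abs_def] using integral_has_real_derivative[OF ch that]
    by (auto intro!: derivative_eq_intros)
  have V_eq: "phi p (v x) = V x" if "x \<in> {0<..<T}" for x
  proof -
    have "phi p (v x) - V x = phi p (v c) - V c"
    proof (rule open_interval_DERIV_0_const[OF _ that c])
      fix y assume y: "y \<in> {0<..<T}"
      show "((\<lambda>x. phi p (v x) - V x) has_real_derivative 0) (at y)"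
        using DERIV_diff[OF dV[OF y], of V "rhs l u y"] V[of y] y by (auto simp: at_within_Icc_at)
    qed
    then show ?thesis
      by (simp add: V_def)
  qed
  let ?w = "\<lambda>x. phi (conj_exp p) (V x)"
  have cw: "continuous_on {0..T} ?w"
    using DERIV_continuous_on[OF V] p_gt_1 by (intro continuous_intros conj_exp_gt_1)
  have v_eq: "v x = ?w x" if "x \<in> {0<..<T}" for x
    using V_eq[OF that, symmetric] p_gt_1 by simp
  define U where "U x = u c + (integral {0..x} ?w - integral {0..c} ?w)" for x
  have U: "(U has_real_derivative ?w x) (at x within {0..T})" if "x \<in> {0..T}" for x
    unfolding U_def[abs_def] using integral_has_real_derivative[OF cw that]
    by (auto intro!: derivative_eq_intros)
  have "u x = U x" if "x \<in> {0<..<T}" for x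
  proof -
    have "u x - U x = u c - U c"
    proof (rule open_interval_DERIV_0_const[OF _ that c])
      fix y assume y: "y \<in> {0<..<T}"
      show "((\<lambda>x. u x - U x) has_real_derivative 0) (at y)"
        using DERIV_diff[of u "v y" y UNIV U "?w y"] U[of y] v[of y] y v_eq[OF y] by (auto simp: at_within_Icc_at)
    qed
    then show ?thesis
      by (simp add: U_def)
  qed
  then have u_eq: "u x = U x" if "x \<in> {0..T}" for x
    using continuous_on_eq_closure_interval[OF T_pos cu DERIV_continuous_on[OF U] _ that] by blast
  have u': "(u has_real_derivative ?w x) (at x within {0..T})" if "x \<in> {0..T}" for x
    by (rule has_field_derivative_transform[OF that U[OF that]]) (rule u_eq)
  have v_w: "v x = ?w x" if "x \<in> {0..T}" for x
    using has_real_derivative_unique_Icc[OF T_pos that v[OF that] u'[OF that]] .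
  have "phi p (?w 0) = phi p (?w T)"
    using v_w[of 0] v_w[of T] per(2) T_pos by simp
  then have "V 0 = V T"
    using p_gt_1 by simp
  then have "psys T p (rhs l u) u V"
    using u' V per(1) by (simp add: psys_def)
  moreover have "\<forall>x. x \<notin> {0..T} \<longrightarrow> u x = 0"
    using uX W1pD(2)[of u T p] by (auto simp: X_space_def)
  ultimately show "(\<exists>V. psys T p (rhs l u) u V) \<and> (\<forall>x. x \<notin> {0..T} \<longrightarrow> u x = 0)"
    by blast
qed

lemma solutions_subset_X: "(l, u) \<in> sols \<Longrightarrow> u \<in> X_space T p"
  by (simp add: solutions_def)

lemma uniform_limit_rhs:
  assumes "\<And>n. \<bar>ls n\<bar> \<le> \<Lambda>" "ls \<longlonglongrightarrow> l" "continuous_on {0..T} u" "uniform_limit {0..T} us u sequentially"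
  shows "uniform_limit {0..T} (\<lambda>n. rhs (ls n) (us n)) (rhs l u) sequentially"
proof -
  have "ls n \<in> {- \<Lambda>..\<Lambda>}" for n
    using assms(1)[of n] by (simp add: abs_le_iff)
  from uniform_limit_Nemytskii[OF continuous_on_subset[OF continuous_on_rhs_triple] compact_Icc this assms(2-4)]
  show ?thesis
    by (simp add: rhs_def[abs_def] subset_iff)
qed

lemma X_norm_diff_LIMSEQ:
  assumes u: "\<And>n x. x \<in> {0..T} \<Longrightarrow> (us n has_real_derivative vs n x) (at x within {0..T})"
    "\<And>n. continuous_on {0..T} (vs n)" "\<And>n x. x \<notin> {0..T} \<Longrightarrow> us n x = 0"
    and u': "\<And>x. x \<in> {0..T} \<Longrightarrow> (u has_real_derivative v x) (at x within {0..T})"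
    "continuous_on {0..T} v" "\<And>x. x \<notin> {0..T} \<Longrightarrow> u x = 0"
    and lim: "uniform_limit {0..T} us u sequentially" "uniform_limit {0..T} vs v sequentially"
  shows "(\<lambda>n. X_norm T p q (\<lambda>x. us n x - u x)) \<longlonglongrightarrow> 0"
proof -
  have "bounded (q ` {0..T})"
    using q_cont by (auto intro!: compact_imp_bounded compact_continuous_image)
  then obtain Q where Q: "\<forall>x\<in>{0..T}. \<bar>q x\<bar> \<le> Q"
    unfolding bounded_iff by auto
  then have "Q \<ge> 0"
    using T_pos by fastforce
  define K where "K = ((1 + Q) * T) powr (1 / p)"
  have bound: "X_norm T p q (\<lambda>x. us n x - u x) \<le> K * d"
    if "d > 0" "\<forall>x\<in>{0..T}. \<bar>us n x - u x\<bar> < d" "\<forall>x\<in>{0..T}. \<bar>vs n x - v x\<bar> < d" for n d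
  proof -
    have E: "X_norm T p q (\<lambda>x. us n x - u x) = energy (\<lambda>x. us n x - u x) (\<lambda>x. vs n x - v x) powr (1 / p)"
      by (rule X_norm_classical(2)) (auto intro!: DERIV_diff continuous_intros u u' simp: u(3) u'(3))
    have cu: "continuous_on {0..T} (us n)" "continuous_on {0..T} u"
      using DERIV_continuous_on[OF u(1)] DERIV_continuous_on[OF u'(1)] by auto
    have "energy (\<lambda>x. us n x - u x) (\<lambda>x. vs n x - v x) \<le> integral {0..T} (\<lambda>x. (1 + Q) * d powr p)"
      unfolding energy_def
    proof (rule integral_le)
      show "(\<lambda>x. \<bar>vs n x - v x\<bar> powr p + q x * \<bar>us n x - u x\<bar> powr p) integrable_on {0..T}"
        using p_gt_1 by (intro integrable_continuous_real continuous_intros q_cont u u' cu) auto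
      fix x assume x: "x \<in> {0..T}"
      have "\<bar>vs n x - v x\<bar> powr p \<le> d powr p" "\<bar>us n x - u x\<bar> powr p \<le> d powr p"
        using that x p_gt_1 by (auto intro!: powr_mono2 simp: less_imp_le)
      moreover from this have "q x * \<bar>us n x - u x\<bar> powr p \<le> Q * d powr p"
        using Q x q_nonneg[OF x] by (intro mult_mono) (auto simp: abs_le_iff)
      ultimately show "\<bar>vs n x - v x\<bar> powr p + q x * \<bar>us n x - u x\<bar> powr p \<le> (1 + Q) * d powr p"
        by (simp add: distrib_right)
    qed auto
    also have "\<dots> = (1 + Q) * T * d powr p"
      using T_pos by simp
    finally have "energy (\<lambda>x. us n x - u x) (\<lambda>x. vs n x - v x) powr (1 / p) \<le> ((1 + Q) * T * d powr p) powr (1 / p)"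
    proof (rule powr_mono2[rotated 2])
      show "0 \<le> energy (\<lambda>x. us n x - u x) (\<lambda>x. vs n x - v x)"
        unfolding energy_def
        by (rule Henstock_Kurzweil_Integration.integral_nonneg)
          (use p_gt_1 in \<open>auto intro!: integrable_continuous_real continuous_intros q_cont u u' cu
            add_nonneg_nonneg mult_nonneg_nonneg q_nonneg\<close>)
    qed (use p_gt_1 in auto)
    also have "\<dots> = K * d"
      using \<open>Q \<ge> 0\<close> T_pos \<open>d > 0\<close> p_gt_1 by (simp add: K_def powr_mult powr_powr)
    finally show ?thesis
      using E by simp
  qed
  have "K > 0"
    using \<open>Q \<ge> 0\<close> T_pos by (simp add: K_def)
  show ?thesis
  proof (rule LIMSEQ_I)
    fix e :: real assume "e > 0"
    define d where "d = e / (2 * K)"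
    have "d > 0"
      using \<open>e > 0\<close> \<open>K > 0\<close> by (simp add: d_def)
    have "\<forall>\<^sub>F n in sequentially. X_norm T p q (\<lambda>x. us n x - u x) \<le> K * d"
      using uniform_limitD[OF lim(1) \<open>d > 0\<close>] uniform_limitD[OF lim(2) \<open>d > 0\<close>]
      by eventually_elim (use bound[OF \<open>d > 0\<close>] in \<open>auto simp: dist_real_def\<close>)
    moreover have "K * d < e"
      using \<open>e > 0\<close> \<open>K > 0\<close> by (simp add: d_def)
    ultimately show "\<exists>N. \<forall>n\<ge>N. norm (X_norm T p q (\<lambda>x. us n x - u x) - 0) < e"
      using X_norm_nonneg by (auto simp: eventually_sequentially intro: le_less_trans)
  qed
qed

text \<open>A uniform bound on the functions bounds the right-hand sides, hence gives Lipschitz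
  bounds for the functions and their fluxes. The derivatives therefore converge uniformly along a
  subsequence too, which implies convergence in the norm of \<open>X\<close>.\<close>

lemma solutions_subsequence:
  assumes S: "\<And>n. (ls n, us n) \<in> sols" and ls: "\<And>n. \<bar>ls n\<bar> \<le> \<Lambda>"
    and us: "\<And>n x. x \<in> {0..T} \<Longrightarrow> \<bar>us n x\<bar> \<le> B"
  obtains r l u where "strict_mono (r :: nat \<Rightarrow> nat)" "(\<lambda>n. ls (r n)) \<longlonglongrightarrow> l" "(l, u) \<in> sols"
    "uniform_limit {0..T} (\<lambda>n. us (r n)) u sequentially"
    "(\<lambda>n. X_norm T p q (\<lambda>x. us (r n) x - u x)) \<longlonglongrightarrow> 0"
proof -
  obtain Vs where Vs: "\<And>n. psys T p (rhs (ls n) (us n)) (us n) (Vs n)" and out: "\<And>n x. x \<notin> {0..T} \<Longrightarrow> us n x = 0"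
    using S unfolding solutions_iff by metis
  obtain C where C: "C \<ge> 0"
    "\<And>x l u. x \<in> {0..T} \<Longrightarrow> \<bar>l\<bar> \<le> \<Lambda> \<Longrightarrow> \<bar>u x\<bar> \<le> B \<Longrightarrow> \<bar>rhs l u x\<bar> \<le> C * \<bar>u x\<bar> powr (p - 1)"
    using rhs_power_bound by blast
  have hB: "\<bar>rhs (ls n) (us n) x\<bar> \<le> C * B powr (p - 1)" if "x \<in> {0..T}" for n x
  proof -
    have "\<bar>rhs (ls n) (us n) x\<bar> \<le> C * \<bar>us n x\<bar> powr (p - 1)"
      using C(2) that ls us by blast
    also have "\<dots> \<le> C * B powr (p - 1)"
      using C(1) us[OF that] p_gt_1 by (intro mult_left_mono powr_mono2) auto
    finally show ?thesis .
  qed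
  have "ls n \<in> {- \<Lambda>..\<Lambda>}" for n
    using ls[of n] by (simp add: abs_le_iff)
  then obtain l r0 where r0: "strict_mono (r0 :: nat \<Rightarrow> nat)" "(ls \<circ> r0) \<longlonglongrightarrow> l"
    using compact_imp_seq_compact[OF compact_Icc] unfolding seq_compact_def by metis
  obtain u V r1 where r1: "strict_mono (r1 :: nat \<Rightarrow> nat)" "continuous_on {0..T} u"
    "uniform_limit {0..T} (\<lambda>n. us (r0 (r1 n))) u sequentially" "continuous_on {0..T} V"
    "uniform_limit {0..T} (\<lambda>n. Vs (r0 (r1 n))) V sequentially"
    using psys_subsequence[OF p_gt_1 T_pos Vs hB us, of "r0"] by metis
  define r where "r = r0 \<circ> r1"
  have lsr: "(\<lambda>n. ls (r n)) \<longlonglongrightarrow> l"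
    using LIMSEQ_subseq_LIMSEQ[OF r0(2) r1(1)] by (simp add: r_def o_def)
  have usr: "uniform_limit {0..T} (\<lambda>n. us (r n)) u sequentially" and Vsr: "uniform_limit {0..T} (\<lambda>n. Vs (r n)) V sequentially"
    using r1 by (simp_all add: r_def)
  have P: "psys T p (rhs l u) u V"
    by (rule psys_limit[OF p_gt_1 Vs usr Vsr uniform_limit_rhs[OF ls lsr r1(2) usr]]) (use T_pos in simp)
  \<comment> \<open>The uniform limit is determined on \<open>{0..T}\<close> only; membership in
    \<open>X_space\<close> asks for the representative that is 0 outside.\<close>
  define u' where "u' x = (if x \<in> {0..T} then u x else 0)" for x
  have uu': "u' x = u x" if "x \<in> {0..T}" for x
    using that by (simp add: u'_def)
  have out': "u' x = 0" if "x \<notin> {0..T}" for x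
    unfolding u'_def using that by (rule if_not_P)
  have P': "psys T p (rhs l u') u' V"
    unfolding psys_def
  proof (intro conjI ballI)
    fix x assume x: "x \<in> {0..T}"
    show "(u' has_real_derivative phi (conj_exp p) (V x)) (at x within {0..T})"
      by (rule has_field_derivative_transform[OF x psysD(1)[OF P x] uu'])
    show "(V has_real_derivative rhs l u' x) (at x within {0..T})"
      using psysD(2)[OF P x] uu'[OF x] by (simp add: rhs_def)
  qed (use psysD(3,4)[OF P] uu'[of 0] uu'[of T] T_pos in auto)
  have lim': "uniform_limit {0..T} (\<lambda>n. us (r n)) u' sequentially"
    using usr uniform_limit_cong'[of "{0..T}" "\<lambda>n. us (r n)" "\<lambda>n. us (r n)" u' u] uu' by auto
  have cpsi: "continuous_on {0..T} (\<lambda>x. phi (conj_exp p) (W x))" if "continuous_on {0..T} W" for W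
    using that p_gt_1 by (intro continuous_intros conj_exp_gt_1)
  have "(\<lambda>n. X_norm T p q (\<lambda>x. us (r n) x - u' x)) \<longlonglongrightarrow> 0"
    by (rule X_norm_diff_LIMSEQ[OF psysD(1)[OF Vs] cpsi[OF psysD(6)[OF Vs]] out psysD(1)[OF P'] cpsi[OF r1(4)] out' lim'
        uniform_limit_phi[OF conj_exp_gt_1[OF p_gt_1] Vsr r1(4)]])
  moreover have "(l, u') \<in> sols"
    unfolding solutions_iff using P' out' by blast
  moreover have "strict_mono r"
    unfolding r_def using r0 r1 strict_mono_o by blast
  ultimately show ?thesis
    using that lsr lim' by blast
qed

lemma solution_at_0:
  assumes "(0, u) \<in> sols"
  shows "u = (\<lambda>_. 0)"
proof
  fix x
  obtain V where V: "psys T p (rhs 0 u) u V" and out: "x \<notin> {0..T} \<Longrightarrow> u x = 0"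
    using assms unfolding solutions_iff by blast
  have "eigen 0 u V"
    unfolding eigen_def by (rule psys_cong[OF V]) (simp add: rhs_def g_at_0)
  then show "u x = 0"
    using eigen_at_0 out by blast
qed

lemma solution_nonneg_dichotomy:
  assumes "(l, u) \<in> sols" "\<And>x. x \<in> {0..T} \<Longrightarrow> u x \<ge> 0"
  shows "(\<forall>x\<in>{0..T}. u x > 0) \<or> u = (\<lambda>_. 0)"
proof -
  obtain V where V: "psys T p (rhs l u) u V" and out: "\<And>x. x \<notin> {0..T} \<Longrightarrow> u x = 0"
    using assms unfolding solutions_iff by blast
  have "bounded (u ` {0..T})"
    using psysD(5)[OF V] by (auto intro!: compact_imp_bounded compact_continuous_image)
  then obtain R where R: "\<forall>x\<in>{0..T}. \<bar>u x\<bar> \<le> R"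
    unfolding bounded_iff by auto
  obtain C where C: "\<And>x k v. x \<in> {0..T} \<Longrightarrow> \<bar>k\<bar> \<le> \<bar>l\<bar> \<Longrightarrow> \<bar>v x\<bar> \<le> R \<Longrightarrow> \<bar>rhs k v x\<bar> \<le> C * \<bar>v x\<bar> powr (p - 1)"
    using rhs_power_bound[of "\<bar>l\<bar>" R] by metis
  have "(\<forall>x\<in>{0..T}. u x > 0) \<or> (\<forall>x\<in>{0..T}. u x = 0)"
    by (rule psys_nonneg_dichotomy[OF p_gt_1 T_pos V C]) (use R assms(2) in auto)
  then show ?thesis
    using out by (metis ext)
qed

text \<open>The functions are divided by their maxima \<open>M n\<close> and the fluxes by
  \<open>phi p (M n)\<close>. The scaled \<open>g\<close> term tends to 0 by the smallness
  hypothesis, so the limit solves the homogeneous problem; it is nonzero because all scaled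
  functions have maximum modulus 1.\<close>

lemma normalized_limit:
  assumes S: "\<And>n. (ls n, us n) \<in> sols" and nz: "\<And>n. us n \<noteq> (\<lambda>_. 0)" and l: "ls \<longlonglongrightarrow> l"
    and lim: "uniform_limit {0..T} us (\<lambda>_. 0) sequentially"
  obtains r M w W where "strict_mono (r :: nat \<Rightarrow> nat)" "\<And>n. M n > (0::real)" "eigen l w W"
    "\<exists>x\<in>{0..T}. w x \<noteq> 0" "uniform_limit {0..T} (\<lambda>n x. us (r n) x / M n) w sequentially"
proof -
  obtain \<Lambda> where \<Lambda>: "\<And>n. \<bar>ls n\<bar> \<le> \<Lambda>"
    using convergent_imp_bounded[OF l] by (auto simp: bounded_iff)
  obtain Vs where Vs: "\<And>n. psys T p (rhs (ls n) (us n)) (us n) (Vs n)" and out: "\<And>n x. x \<notin> {0..T} \<Longrightarrow> us n x = 0"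
    using S unfolding solutions_iff by metis
  have cus: "continuous_on {0..T} (us n)" for n
    using psysD(5)[OF Vs] .
  have "\<exists>y\<in>{0..T}. \<forall>x\<in>{0..T}. \<bar>us n x\<bar> \<le> \<bar>us n y\<bar>" for n
    using T_pos by (intro continuous_attains_sup continuous_on_rabs cus) auto
  then obtain y where y: "\<And>n. y n \<in> {0..T}" "\<And>n x. x \<in> {0..T} \<Longrightarrow> \<bar>us n x\<bar> \<le> \<bar>us n (y n)\<bar>"
    by metis
  define M where "M n = \<bar>us n (y n)\<bar>" for n
  have M: "M n > 0" for n
  proof (rule ccontr)
    assume "\<not> M n > 0"
    then have "us n x = 0" for x
      using y(2)[of x n] out[of x n] by (cases "x \<in> {0..T}") (auto simp: M_def)
    then show False
      using nz[of n] by auto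
  qed
  have M_lim: "M \<longlonglongrightarrow> 0"
  proof (rule LIMSEQ_I)
    fix e :: real assume "e > 0"
    have "\<forall>\<^sub>F n in sequentially. norm (M n - 0) < e"
      using uniform_limitD[OF lim \<open>e > 0\<close>] by eventually_elim (use y(1) in \<open>auto simp: M_def\<close>)
    then show "\<exists>N. \<forall>n\<ge>N. norm (M n - 0) < e"
      by (simp add: eventually_sequentially)
  qed
  define z where "z n x = us n x / M n" for n x
  define G where "G n x = g x (us n x) (ls n) / phi p (M n)" for n x
  define h where "h n x = (q x - ls n * m x) * phi p (z n x) - G n x" for n x
  have zS: "psys T p (h n) (z n) (\<lambda>x. Vs n x / phi p (M n))" for n
    unfolding z_def[abs_def]
    by (rule psys_cong[OF psys_scale[OF p_gt_1 M Vs]])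
      (simp add: h_def z_def G_def rhs_def phi_divide diff_divide_distrib)
  have z1: "\<bar>z n x\<bar> \<le> 1" if "x \<in> {0..T}" for n x
    using y(2)[OF that] M[of n] by (simp add: z_def abs_divide M_def)
  have ratio: "\<bar>us n x\<bar> powr (p - 1) / phi p (M n) \<le> 1" if "x \<in> {0..T}" for n x
  proof -
    have "\<bar>us n x\<bar> powr (p - 1) \<le> M n powr (p - 1)"
      using y(2)[OF that] p_gt_1 by (intro powr_mono2) (auto simp: M_def)
    then show ?thesis
      using M[of n] by (simp add: phi_nonneg_eq)
  qed
  have G_le: "\<bar>G n x\<bar> \<le> c" if "x \<in> {0..T}" "\<bar>g x (us n x) (ls n)\<bar> \<le> c * \<bar>us n x\<bar> powr (p - 1)" "c \<ge> 0" for n x c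
  proof -
    have "\<bar>G n x\<bar> \<le> c * \<bar>us n x\<bar> powr (p - 1) / phi p (M n)"
      unfolding G_def abs_divide using that(2) M[of n] by (simp add: divide_right_mono)
    also have "\<dots> = c * (\<bar>us n x\<bar> powr (p - 1) / phi p (M n))"
      by simp
    also have "\<dots> \<le> c * 1"
      using that(3) by (intro mult_left_mono ratio that(1))
    finally show ?thesis by simp
  qed
  have "bounded (range M)"
    using convergent_imp_bounded[OF M_lim] .
  then obtain R where R: "\<And>n. M n \<le> R"
    unfolding bounded_iff by (metis abs_le_D1 rangeI real_norm_def)
  obtain C where C: "C \<ge> 0" "\<And>x s l. x \<in> {0..T} \<Longrightarrow> \<bar>l\<bar> \<le> \<Lambda> \<Longrightarrow> \<bar>s\<bar> \<le> R \<Longrightarrow> \<bar>g x s l\<bar> \<le> C * \<bar>s\<bar> powr (p - 1)"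
    using g_power_bound by blast
  obtain A where A: "\<And>x s l. x \<in> {0..T} \<Longrightarrow> \<bar>l\<bar> \<le> \<Lambda> \<Longrightarrow> \<bar>(q x - l * m x) * phi p s\<bar> \<le> A * \<bar>s\<bar> powr (p - 1)"
    using linear_bound by blast
  have hB: "\<bar>h n x\<bar> \<le> \<bar>A\<bar> + C" if x: "x \<in> {0..T}" for n x
  proof -
    have "\<bar>(q x - ls n * m x) * phi p (z n x)\<bar> \<le> A * \<bar>z n x\<bar> powr (p - 1)"
      using A x \<Lambda> by blast
    also have "\<dots> \<le> \<bar>A\<bar> * 1"
      using z1[OF x] p_gt_1 by (intro mult_mono powr_le1) auto
    finally have 1: "\<bar>(q x - ls n * m x) * phi p (z n x)\<bar> \<le> \<bar>A\<bar>"
      by simp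
    have "\<bar>us n x\<bar> \<le> R"
      using y(2)[OF x, of n] R[of n] by (simp add: M_def)
    then have "\<bar>G n x\<bar> \<le> C"
      using C x \<Lambda> by (intro G_le) auto
    with 1 show ?thesis
      unfolding h_def by linarith
  qed
  obtain w W r where r: "strict_mono (r :: nat \<Rightarrow> nat)" "continuous_on {0..T} w"
    "uniform_limit {0..T} (\<lambda>n. z (r n)) w sequentially" "continuous_on {0..T} W"
    "uniform_limit {0..T} (\<lambda>n x. Vs (r n) x / phi p (M (r n))) W sequentially"
    by (rule psys_subsequence[OF p_gt_1 T_pos zS hB z1])
  have G0: "uniform_limit {0..T} G (\<lambda>_. 0) sequentially"
  proof (rule uniform_limitI)
    fix e :: real assume "e > 0"
    then obtain \<delta> where \<delta>: "\<delta> > 0"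
      "\<And>x s l. x \<in> {0..T} \<Longrightarrow> \<bar>l\<bar> \<le> \<Lambda> \<Longrightarrow> \<bar>s\<bar> < \<delta> \<Longrightarrow> \<bar>g x s l\<bar> \<le> e / 2 * \<bar>s\<bar> powr (p - 1)"
      using g_small_bound[of "e / 2"] by (metis half_gt_zero)
    show "\<forall>\<^sub>F n in sequentially. \<forall>x\<in>{0..T}. dist (G n x) 0 < e"
      using uniform_limitD[OF lim \<delta>(1)]
    proof eventually_elim
      case (elim n)
      show ?case
      proof
        fix x assume x: "x \<in> {0..T}"
        have "\<bar>us n x\<bar> < \<delta>"
          using elim x by simp
        then have "\<bar>G n x\<bar> \<le> e / 2"
          using \<delta>(2)[OF x \<Lambda>] \<open>e > 0\<close> x by (intro G_le) auto
        then show "dist (G n x) 0 < e"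
          using \<open>e > 0\<close> by simp
      qed
    qed
  qed
  have lr: "(\<lambda>n. ls (r n)) \<longlonglongrightarrow> l"
    using LIMSEQ_subseq_LIMSEQ[OF l r(1)] by (simp add: o_def)
  have Gr: "uniform_limit {0..T} (\<lambda>n. G (r n)) (\<lambda>_. 0) sequentially"
    using filterlim_compose[OF G0 filterlim_subseq[OF r(1)]] .
  have ls_in: "ls n \<in> {- \<Lambda>..\<Lambda>}" for n
    using \<Lambda>[of n] by (simp add: abs_le_iff)
  have cN: "continuous_on ({0..T} \<times> UNIV \<times> {- \<Lambda>..\<Lambda>}) (\<lambda>(x, s, l). (q x - l * m x) * phi p s)"
    unfolding split_beta using p_gt_1
    by (intro continuous_intros continuous_on_compose2[OF m_cont] continuous_on_compose2[OF q_cont]) auto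
  have "uniform_limit {0..T} (\<lambda>n. h (r n)) (\<lambda>x. (q x - l * m x) * phi p (w x) - 0) sequentially"
    unfolding h_def[abs_def]
    by (intro uniform_limit_minus Gr uniform_limit_Nemytskii[OF cN compact_Icc ls_in lr r(2,3)])
  then have "psys T p (\<lambda>x. (q x - l * m x) * phi p (w x) - 0) w W"
    by (rule psys_limit[OF p_gt_1 zS r(3,5)]) (use T_pos in simp)
  then have "eigen l w W"
    by (simp add: eigen_def)
  moreover have "\<exists>x\<in>{0..T}. w x \<noteq> 0"
  proof (rule ccontr)
    assume "\<not> ?thesis"
    then have w0: "\<forall>x\<in>{0..T}. w x = 0"
      by blast
    obtain n where "\<forall>x\<in>{0..T}. dist (z (r n) x) (w x) < 1"
      using eventually_happens[OF uniform_limitD[OF r(3) zero_less_one]] by auto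
    then have "\<bar>z (r n) (y (r n))\<bar> < 1"
      using y(1) w0 by (simp add: dist_real_def)
    then show False
      using M[of "r n"] by (simp add: z_def M_def abs_divide)
  qed
  ultimately show ?thesis
    using that[of r "\<lambda>n. M (r n)" w W] r M by (simp add: z_def[abs_def])
qed

end

section \<open>The branch of positive solutions\<close>

context weighted_problem
begin

section \<open>The product metric of the parameter line and \<open>X\<close>\<close>

lemma Metric_space12_RX: "Metric_space12 (UNIV :: real set) dist (X_space T p) (X_dist T p q)"
  unfolding Metric_space12_def using Metric_space_X Met_TC.Metric_space_axioms by auto

sublocale RX: Metric_space "RX_space T p" "RX_dist T p q"
  using Metric_space12.prod_metric[OF Metric_space12_RX] .

lemma RX_topology_eq: "RX_topology T p q = RX.mtopology"
  and RX_bounded_eq: "RX_bounded T p q = RX.mbounded"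
  by (simp_all add: RX_topology_def RX_bounded_def)

lemma RX_dist_eq: "RX_dist T p q y z = sqrt ((fst y - fst z)\<^sup>2 + (X_norm T p q (\<lambda>x. snd y x - snd z x))\<^sup>2)"
  by (cases y; cases z) (simp add: prod_dist_def X_dist_def dist_real_def)

lemma RX_dist_bounds:
  "\<bar>fst y - fst z\<bar> \<le> RX_dist T p q y z"
  "X_norm T p q (\<lambda>x. snd y x - snd z x) \<le> RX_dist T p q y z"
  "RX_dist T p q y z \<le> \<bar>fst y - fst z\<bar> + X_norm T p q (\<lambda>x. snd y x - snd z x)"
proof -
  show "\<bar>fst y - fst z\<bar> \<le> RX_dist T p q y z"
    unfolding RX_dist_eq by (rule real_sqrt_ge_abs1)
  have "\<bar>X_norm T p q (\<lambda>x. snd y x - snd z x)\<bar> \<le> RX_dist T p q y z"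
    unfolding RX_dist_eq by (rule real_sqrt_ge_abs2)
  then show "X_norm T p q (\<lambda>x. snd y x - snd z x) \<le> RX_dist T p q y z"
    by simp
  show "RX_dist T p q y z \<le> \<bar>fst y - fst z\<bar> + X_norm T p q (\<lambda>x. snd y x - snd z x)"
    unfolding RX_dist_eq
    using sqrt_sum_squares_le_sum_abs[of "fst y - fst z" "X_norm T p q (\<lambda>x. snd y x - snd z x)"] X_norm_nonneg
    by simp
qed

lemma RX_limitinI:
  assumes "\<And>n. \<sigma> n \<in> RX_space T p" "z \<in> RX_space T p" "(\<lambda>n. fst (\<sigma> n)) \<longlonglongrightarrow> fst z"
    "(\<lambda>n. X_norm T p q (\<lambda>x. snd (\<sigma> n) x - snd z x)) \<longlonglongrightarrow> 0"
  shows "limitin RX.mtopology \<sigma> z sequentially"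
proof -
  have "(\<lambda>n. RX_dist T p q (\<sigma> n) z) \<longlonglongrightarrow> 0"
  proof (rule tendsto_sandwich[where f = "\<lambda>_. 0"])
    show "(\<lambda>n. \<bar>fst (\<sigma> n) - fst z\<bar> + X_norm T p q (\<lambda>x. snd (\<sigma> n) x - snd z x)) \<longlonglongrightarrow> 0"
      using tendsto_add[OF tendsto_rabs[OF tendsto_diff[OF assms(3) tendsto_const[of "fst z"]]] assms(4)] by simp
  qed (auto intro!: always_eventually RX_dist_bounds(3) RX.nonneg)
  then show ?thesis
    using assms(1,2) by (simp add: RX.limitin_metric_dist_null)
qed

lemma RX_limitinD:
  assumes lim: "limitin RX.mtopology \<sigma> z sequentially" and \<sigma>: "\<And>n. \<sigma> n \<in> RX_space T p"
  shows "z \<in> RX_space T p" "(\<lambda>n. fst (\<sigma> n)) \<longlonglongrightarrow> fst z" "(\<lambda>n. X_norm T p q (\<lambda>x. snd (\<sigma> n) x - snd z x)) \<longlonglongrightarrow> 0"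
    "uniform_limit {0..T} (\<lambda>n. snd (\<sigma> n)) (snd z) sequentially"
proof -
  have d: "(\<lambda>n. RX_dist T p q (\<sigma> n) z) \<longlonglongrightarrow> 0" and z: "z \<in> RX_space T p"
    using lim by (auto simp: RX.limitin_metric_dist_null)
  show "z \<in> RX_space T p" by fact
  have "(\<lambda>n. \<bar>fst (\<sigma> n) - fst z\<bar>) \<longlonglongrightarrow> 0"
    by (rule tendsto_sandwich[where f = "\<lambda>_. 0", OF _ _ _ d]) (auto intro!: always_eventually RX_dist_bounds(1))
  from LIM_zero_cancel[OF tendsto_rabs_zero_cancel[OF this]]
  show "(\<lambda>n. fst (\<sigma> n)) \<longlonglongrightarrow> fst z" .
  show X0: "(\<lambda>n. X_norm T p q (\<lambda>x. snd (\<sigma> n) x - snd z x)) \<longlonglongrightarrow> 0"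
    by (rule tendsto_sandwich[where f = "\<lambda>_. 0", OF _ _ _ d])
      (auto intro!: always_eventually RX_dist_bounds(2) X_norm_nonneg)
  obtain C where C: "C > 0" "\<And>u x. u \<in> W1p T p \<Longrightarrow> x \<in> {0..T} \<Longrightarrow> \<bar>u x\<bar> \<le> C * X_norm T p q u"
    using X_norm_bounds_sup by blast
  show "uniform_limit {0..T} (\<lambda>n. snd (\<sigma> n)) (snd z) sequentially"
  proof (rule uniform_limitI)
    fix e :: real assume "e > 0"
    then have "e / C > 0"
      using C(1) by simp
    from order_tendstoD(2)[OF X0 this]
    show "\<forall>\<^sub>F n in sequentially. \<forall>x\<in>{0..T}. dist (snd (\<sigma> n) x) (snd z x) < e"
    proof eventually_elim
      case (elim n)
      have "(\<lambda>x. snd (\<sigma> n) x - snd z x) \<in> W1p T p"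
        using X_space_diff[OF p_gt_1 T_pos, of "snd (\<sigma> n)" "snd z"] \<sigma>[of n] z by (auto simp: X_space_def)
      then have "\<bar>snd (\<sigma> n) x - snd z x\<bar> \<le> C * X_norm T p q (\<lambda>x. snd (\<sigma> n) x - snd z x)" if "x \<in> {0..T}" for x
        using C(2) that by blast
      moreover have "C * X_norm T p q (\<lambda>x. snd (\<sigma> n) x - snd z x) < e"
        using elim C(1) by (simp add: pos_less_divide_eq mult.commute)
      ultimately show ?case
        unfolding dist_real_def using le_less_trans by blast
    qed
  qed
qed

lemma zero_in_RX: "(l, \<lambda>_. 0) \<in> RX_space T p"
  using zero_in_X_space[OF p_gt_1 T_pos] by simp

lemma mbounded_RX_sup:
  assumes "RX.mbounded S"
  shows "\<exists>B>0. \<forall>z\<in>S. \<bar>fst z\<bar> \<le> B \<and> (\<forall>x\<in>{0..T}. \<bar>snd z x\<bar> \<le> B)"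
proof -
  let ?o = "(0 :: real, \<lambda>_ :: real. 0 :: real)"
  have "RX.mbounded (insert ?o S)"
    using assms zero_in_RX by (simp add: RX.mbounded_insert)
  then obtain B where B: "\<And>z. z \<in> S \<Longrightarrow> RX_dist T p q z ?o \<le> B" and S: "S \<subseteq> RX_space T p"
    unfolding RX.mbounded_alt by auto
  obtain C where C: "C > 0" "\<And>u x. u \<in> W1p T p \<Longrightarrow> x \<in> {0..T} \<Longrightarrow> \<bar>u x\<bar> \<le> C * X_norm T p q u"
    using X_norm_bounds_sup by blast
  show ?thesis
  proof (intro exI[of _ "\<bar>B\<bar> + C * \<bar>B\<bar> + 1"] conjI ballI)
    show "\<bar>B\<bar> + C * \<bar>B\<bar> + 1 > 0"
      using C(1) by (intro add_nonneg_pos add_nonneg_nonneg) auto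
    fix z assume z: "z \<in> S"
    have CB: "C * \<bar>B\<bar> \<ge> 0"
      using C(1) by simp
    show "\<bar>fst z\<bar> \<le> \<bar>B\<bar> + C * \<bar>B\<bar> + 1"
      using RX_dist_bounds(1)[of z ?o] B[OF z] CB unfolding fst_conv by linarith
    fix x assume x: "x \<in> {0..T}"
    have "X_norm T p q (snd z) \<le> \<bar>B\<bar>"
      using RX_dist_bounds(2)[of z ?o] B[OF z] by simp
    then have "C * X_norm T p q (snd z) \<le> C * \<bar>B\<bar>"
      using C(1) by (intro mult_left_mono) auto
    moreover have "snd z \<in> W1p T p"
      using S z by (auto simp: X_space_def)
    ultimately show "\<bar>snd z x\<bar> \<le> \<bar>B\<bar> + C * \<bar>B\<bar> + 1"
      using C(2)[of "snd z" x] x by force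
  qed
qed

end

locale principal_bifurcation = bifurcation_problem +
  fixes \<mu> :: real and w W :: "real \<Rightarrow> real"
  assumes w: "eigen \<mu> w W" "x \<in> {0..T} \<Longrightarrow> w x > 0" and \<mu>_pos: "\<mu> > 0"
begin

section \<open>Closedness of the set of positive solutions\<close>

lemma sols_RX: "z \<in> sols \<Longrightarrow> z \<in> RX_space T p"
  using solutions_subset_X by (cases z) auto

lemma sols_limitin_subsequence:
  assumes "\<And>n. \<sigma> n \<in> sols" "\<And>n. \<bar>fst (\<sigma> n)\<bar> \<le> \<Lambda>" "\<And>n x. x \<in> {0..T} \<Longrightarrow> \<bar>snd (\<sigma> n) x\<bar> \<le> B"
  obtains r z where "strict_mono (r :: nat \<Rightarrow> nat)" "z \<in> sols" "limitin RX.mtopology (\<sigma> \<circ> r) z sequentially"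
proof -
  have "(fst (\<sigma> n), snd (\<sigma> n)) \<in> sols" for n
    using assms(1) by simp
  then obtain r l u where r: "strict_mono (r :: nat \<Rightarrow> nat)" "(\<lambda>n. fst (\<sigma> (r n))) \<longlonglongrightarrow> l" "(l, u) \<in> sols"
    "(\<lambda>n. X_norm T p q (\<lambda>x. snd (\<sigma> (r n)) x - u x)) \<longlonglongrightarrow> 0"
    by (rule solutions_subsequence[OF _ assms(2,3)])
  have "limitin RX.mtopology (\<sigma> \<circ> r) (l, u) sequentially"
    using r assms(1) sols_RX by (intro RX_limitinI) (auto simp: o_def)
  then show ?thesis
    using that r by blast
qed

text \<open>A convergent sequence is bounded, so a subsequence converges to a member of
  \<open>sols\<close>, and limits are unique.\<close>

lemma closedin_sols: "closedin RX.mtopology sols"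
  unfolding RX.metric_closedin_iff_sequentially_closed
proof (intro conjI allI impI; (elim conjE)?)
  fix \<sigma> z assume \<sigma>: "range \<sigma> \<subseteq> sols" and lim: "limitin RX.mtopology \<sigma> z sequentially"
  have \<sigma>': "\<sigma> n \<in> sols" for n
    using \<sigma> by blast
  note L = RX_limitinD[OF lim sols_RX[OF \<sigma>']]
  have "RX.mbounded (range \<sigma>)"
    using RX.MCauchy_imp_mbounded[OF RX.convergent_imp_MCauchy[OF _ lim]] \<sigma> sols_RX by blast
  from mbounded_RX_sup[OF this]
  obtain B where "\<forall>z\<in>range \<sigma>. \<bar>fst z\<bar> \<le> B \<and> (\<forall>x\<in>{0..T}. \<bar>snd z x\<bar> \<le> B)"
    by blast
  then have B: "\<bar>fst (\<sigma> n)\<bar> \<le> B" "x \<in> {0..T} \<Longrightarrow> \<bar>snd (\<sigma> n) x\<bar> \<le> B" for n x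
    by auto
  obtain r z' where r: "strict_mono (r :: nat \<Rightarrow> nat)" "z' \<in> sols" "limitin RX.mtopology (\<sigma> \<circ> r) z' sequentially"
    by (rule sols_limitin_subsequence[OF \<sigma>' B])
  have "limitin RX.mtopology (\<sigma> \<circ> r) z sequentially"
    using limitin_subsequence[OF r(1) lim] .
  then have "z = z'"
    using limitin_Hausdorff_unique[OF _ r(3) _ RX.Hausdorff_space_mtopology] by simp
  then show "z \<in> sols"
    using r(2) by simp
qed (use sols_RX in auto)

lemma zero_sols: "(l, \<lambda>_. 0) \<in> sols"
  unfolding solutions_iff
  by (auto simp: psys_def rhs_def g_zero intro!: exI[of _ "\<lambda>_. 0"])

text \<open>\<open>sols\<close> contains the whole line of trivial solutions; only the bifurcation
  point is adjoined, so that this line connects nothing.\<close>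

definition pos_branch :: "(real \<times> (real \<Rightarrow> real)) set" where
  "pos_branch = insert (\<mu>, \<lambda>_. 0) {(l, u). (l, u) \<in> sols \<and> l > 0 \<and> (\<forall>x\<in>{0..T}. u x > 0)}"

lemma pos_branch_sols: "pos_branch \<subseteq> sols"
  using zero_sols by (auto simp: pos_branch_def)

lemma pos_branch_zero_iff: "(l, \<lambda>_. 0) \<in> pos_branch \<longleftrightarrow> l = \<mu>"
  using T_pos by (auto simp: pos_branch_def)

text \<open>The normalised limit is a nonnegative nonzero eigenfunction, hence positive by the
  dichotomy. The value 0 is excluded by \<open>eigen_at_0\<close>, and comparison with
  \<open>w\<close> in both directions leaves only \<open>\<mu>\<close>.\<close>

lemma nonneg_limit_eigenvalue:
  assumes S: "\<And>n. (ls n, us n) \<in> sols" and pos: "\<And>n x. x \<in> {0..T} \<Longrightarrow> us n x > 0"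
    and l: "ls \<longlonglongrightarrow> l" "l \<ge> 0" and lim: "uniform_limit {0..T} us (\<lambda>_. 0) sequentially"
  shows "l = \<mu>"
proof -
  have nz: "us n \<noteq> (\<lambda>_. 0)" for n
    using pos[of 0 n] T_pos by auto
  obtain r M v V where "strict_mono (r :: nat \<Rightarrow> nat)" and r: "\<And>n. M n > (0::real)" "eigen l v V" "\<exists>x\<in>{0..T}. v x \<noteq> 0"
    "uniform_limit {0..T} (\<lambda>n x. us (r n) x / M n) v sequentially"
    by (rule normalized_limit[OF S nz l(1) lim]) blast
  have v0: "v x \<ge> 0" if "x \<in> {0..T}" for x
  proof (rule LIMSEQ_le_const[OF tendsto_uniform_limitI[OF r(4) that]])
    show "\<exists>N. \<forall>n\<ge>N. 0 \<le> us (r n) x / M n"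
      using pos[OF that] r(1) less_imp_le by (intro exI[of _ 0] allI impI divide_nonneg_nonneg) blast+
  qed
  obtain C where C: "\<And>x s k. x \<in> {0..T} \<Longrightarrow> \<bar>k\<bar> \<le> \<bar>l\<bar> \<Longrightarrow> \<bar>(q x - k * m x) * phi p s\<bar> \<le> C * \<bar>s\<bar> powr (p - 1)"
    using linear_bound[of "\<bar>l\<bar>"] by metis
  have "(\<forall>x\<in>{0..T}. v x > 0) \<or> (\<forall>x\<in>{0..T}. v x = 0)"
    by (rule psys_nonneg_dichotomy[OF p_gt_1 T_pos r(2)[unfolded eigen_def] C v0]) auto
  then have vpos: "v x > 0" if "x \<in> {0..T}" for x
    using r(3) that by blast
  have "l \<noteq> 0"
    using eigen_at_0[of v V] r(2,3) by blast
  then have "l > 0"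
    using l(2) by simp
  then show ?thesis
    using eigenvalue_le[OF r(2) vpos w \<mu>_pos] eigenvalue_le[OF w r(2) vpos] by force
qed

text \<open>In the limit the strict inequalities may degenerate in two ways only:
  \<open>l = 0\<close>, which admits no nonzero solution, or \<open>u = 0\<close>, which
  \<open>nonneg_limit_eigenvalue\<close> allows at \<open>\<mu>\<close> alone.\<close>

lemma closedin_pos_branch: "closedin RX.mtopology pos_branch"
  unfolding RX.metric_closedin_iff_sequentially_closed
proof (intro conjI allI impI; (elim conjE)?)
  fix \<sigma> z assume \<sigma>: "range \<sigma> \<subseteq> pos_branch" and lim: "limitin RX.mtopology \<sigma> z sequentially"
  have \<sigma>': "\<sigma> n \<in> pos_branch" for n
    using \<sigma> by blast
  have \<sigma>s: "\<sigma> n \<in> sols" for n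
    using \<sigma>' pos_branch_sols by blast
  note L = RX_limitinD[OF lim sols_RX[OF \<sigma>s]]
  obtain l u where z: "z = (l, u)"
    by (cases z)
  have zs: "(l, u) \<in> sols"
    using limitin_closedin[OF lim closedin_sols] \<sigma>s z by simp
  have \<sigma>nn: "fst (\<sigma> n) \<ge> 0" "x \<in> {0..T} \<Longrightarrow> snd (\<sigma> n) x \<ge> 0" for n x
    using \<sigma>'[of n] \<mu>_pos by (auto simp: pos_branch_def less_imp_le)
  have "l \<ge> 0"
    using LIMSEQ_le_const[OF L(2)] \<sigma>nn(1) z by auto
  have "u x \<ge> 0" if "x \<in> {0..T}" for x
    using LIMSEQ_le_const[OF tendsto_uniform_limitI[OF L(4) that]] \<sigma>nn(2)[OF that] z by auto
  with solution_nonneg_dichotomy[OF zs] consider "\<forall>x\<in>{0..T}. u x > 0" | "u = (\<lambda>_. 0)"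
    by blast
  then show "z \<in> pos_branch"
  proof cases
    case 1
    have "l \<noteq> 0"
      using solution_at_0[of u] zs 1 T_pos by force
    then show ?thesis
      using 1 zs z \<open>l \<ge> 0\<close> by (simp add: pos_branch_def)
  next
    case 2
    have "l = \<mu>"
    proof (rule ccontr)
      assume "l \<noteq> \<mu>"
      then have "\<forall>\<^sub>F n in sequentially. dist (fst (\<sigma> n)) l < dist l \<mu>"
        using L(2) z by (intro tendstoD) auto
      then obtain N where N: "\<And>n. n \<ge> N \<Longrightarrow> dist (fst (\<sigma> n)) l < dist l \<mu>"
        by (auto simp: eventually_sequentially)
      \<comment> \<open>As \<open>l\<close> differs from \<open>\<mu>\<close>, the tail avoids the
        bifurcation point and so consists of positive solutions.\<close>
      have tail: "strict_mono (\<lambda>n. n + N)"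
        by (simp add: strict_mono_def)
      have pos: "snd (\<sigma> (n + N)) x > 0" if "x \<in> {0..T}" for n x
        using N[of "n + N"] \<sigma>'[of "n + N"] that by (auto simp: pos_branch_def dist_commute)
      have 1: "(\<lambda>n. fst (\<sigma> (n + N))) \<longlonglongrightarrow> l"
        using LIMSEQ_subseq_LIMSEQ[OF L(2) tail] z by (simp add: o_def)
      have 3: "uniform_limit {0..T} (\<lambda>n. snd (\<sigma> (n + N))) (\<lambda>_. 0) sequentially"
        using filterlim_compose[OF L(4) filterlim_subseq[OF tail]] z 2 by simp
      have "l = \<mu>"
        by (rule nonneg_limit_eigenvalue[OF _ pos 1 \<open>l \<ge> 0\<close> 3]) (use \<sigma>s in auto)
      then show False
        using \<open>l \<noteq> \<mu>\<close> by simp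
    qed
    then show ?thesis
      using 2 z by (simp add: pos_branch_def)
  qed
qed (use sols_RX pos_branch_sols in blast)

section \<open>No compact piece of the branch can be split off\<close>

lemma sols_out: "(l, u) \<in> sols \<Longrightarrow> x \<notin> {0..T} \<Longrightarrow> u x = 0"
  unfolding solutions_iff by blast

lemma sols_continuous: "(l, u) \<in> sols \<Longrightarrow> continuous_on {0..T} u"
  unfolding solutions_iff using psysD(5) by blast

text \<open>Moves pairs into a metric space that is a type, where \<open>\<tau>\<close> and the
  fixed point theorem live.\<close>

definition emb :: "real \<times> (real \<Rightarrow> real) \<Rightarrow> real \<times> (real \<Rightarrow>\<^sub>C real)" where
  "emb z = (fst z, ext T (snd z))"

lemma ext_apply_sols: "(l, u) \<in> sols \<Longrightarrow> x \<in> {0..T} \<Longrightarrow> ext T u x = u x"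
  using ext_apply_in[OF less_imp_le[OF T_pos] sols_continuous] by blast

lemma emb_inj:
  assumes "y \<in> sols" "z \<in> sols" "emb y = emb z"
  shows "y = z"
proof -
  have "snd y x = snd z x" for x
  proof (cases "x \<in> {0..T}")
    case True
    have "snd y x = ext T (snd y) x"
      using ext_apply_sols[of "fst y" "snd y" x] True assms(1) by simp
    also have "ext T (snd y) = ext T (snd z)"
      using assms(3) by (simp add: emb_def)
    also have "ext T (snd z) x = snd z x"
      using ext_apply_sols[of "fst z" "snd z" x] True assms(2) by simp
    finally show ?thesis .
  next
    case False
    then show ?thesis
      using assms(1,2) sols_out[of "fst y" "snd y" x] sols_out[of "fst z" "snd z" x] by simp
  qed
  then show ?thesis
    using assms(3) by (auto simp: emb_def prod_eq_iff)
qed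

text \<open>On sets of solutions the topology of \<open>X\<close> and the uniform topology agree.\<close>

lemma closed_emb:
  assumes Q: "closedin RX.mtopology Q" "Q \<subseteq> sols"
  shows "closed (emb ` Q)"
  unfolding closed_sequential_limits
proof (intro allI impI; elim conjE)
  fix \<xi> :: "nat \<Rightarrow> real \<times> (real \<Rightarrow>\<^sub>C real)" and y
  assume \<xi>: "\<forall>n. \<xi> n \<in> emb ` Q" and lim: "\<xi> \<longlonglongrightarrow> y"
  obtain \<sigma> where \<sigma>: "\<And>n. \<sigma> n \<in> Q" "\<And>n. \<xi> n = emb (\<sigma> n)"
  proof -
    have "\<forall>n. \<exists>z. z \<in> Q \<and> \<xi> n = emb z"
      using \<xi> by blast
    then show ?thesis
      using that by metis
  qed
  have \<sigma>s: "\<sigma> n \<in> sols" for n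
    using \<sigma>(1) Q(2) by blast
  have "bounded (range \<xi>)"
    using convergent_imp_bounded[OF lim] .
  then obtain B where B: "\<And>n. norm (\<xi> n) \<le> B"
    by (auto simp: bounded_iff)
  have 1: "\<bar>fst (\<sigma> n)\<bar> \<le> B" for n
    using B[of n] norm_fst_le[of "fst (\<xi> n)" "snd (\<xi> n)"] by (simp add: \<sigma>(2) emb_def)
  have 2: "\<bar>snd (\<sigma> n) x\<bar> \<le> B" if "x \<in> {0..T}" for n x
  proof -
    have "\<bar>snd (\<sigma> n) x\<bar> = norm (ext T (snd (\<sigma> n)) x)"
      using ext_apply_sols[of "fst (\<sigma> n)" "snd (\<sigma> n)" x] \<sigma>s[of n] that by simp
    also have "\<dots> \<le> norm (ext T (snd (\<sigma> n)))"
      by (rule norm_bounded)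
    also have "\<dots> \<le> norm (\<xi> n)"
      using norm_snd_le[of "snd (\<xi> n)" "fst (\<xi> n)"] by (simp add: \<sigma>(2) emb_def)
    finally show ?thesis
      using B[of n] by linarith
  qed
  obtain r z where r: "strict_mono (r :: nat \<Rightarrow> nat)" "z \<in> sols" "limitin RX.mtopology (\<sigma> \<circ> r) z sequentially"
    by (rule sols_limitin_subsequence[OF \<sigma>s 1 2])
  have "z \<in> Q"
    using limitin_closedin[OF r(3) Q(1)] \<sigma>(1) by simp
  have \<sigma>r: "(\<sigma> \<circ> r) n \<in> RX_space T p" for n
    using sols_RX[OF \<sigma>s] by simp
  note L = RX_limitinD[OF r(3) \<sigma>r]
  have c: "continuous_on {0..T} (snd ((\<sigma> \<circ> r) n))" "continuous_on {0..T} (snd z)" for n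
    using sols_continuous[of "fst (\<sigma> (r n))" "snd (\<sigma> (r n))"] sols_continuous[of "fst z" "snd z"] \<sigma>s r(2) by auto
  have "(\<lambda>n. (fst ((\<sigma> \<circ> r) n), ext T (snd ((\<sigma> \<circ> r) n)))) \<longlonglongrightarrow> (fst z, ext T (snd z))"
    by (intro tendsto_Pair L(2) ext_LIMSEQ c L(4)) (use T_pos in simp)
  then have "(\<xi> \<circ> r) \<longlonglongrightarrow> emb z"
    by (simp add: o_def \<sigma>(2) emb_def)
  then have "y = emb z"
    using LIMSEQ_subseq_LIMSEQ[OF lim r(1)] LIMSEQ_unique by blast
  then show "y \<in> emb ` Q"
    using \<open>z \<in> Q\<close> by blast
qed

lemma compactin_sols:
  assumes "closedin RX.mtopology Y" "Y \<subseteq> sols" "RX.mbounded Y"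
  shows "compactin RX.mtopology Y"
  unfolding RX.compactin_sequentially
proof (intro conjI allI impI)
  show "Y \<subseteq> RX_space T p"
    using assms(2) sols_RX by blast
  fix \<sigma> :: "nat \<Rightarrow> real \<times> (real \<Rightarrow> real)" assume \<sigma>: "range \<sigma> \<subseteq> Y"
  obtain B where B: "\<forall>z\<in>Y. \<bar>fst z\<bar> \<le> B \<and> (\<forall>x\<in>{0..T}. \<bar>snd z x\<bar> \<le> B)"
    using mbounded_RX_sup[OF assms(3)] by blast
  have \<sigma>B: "\<sigma> n \<in> sols" "\<bar>fst (\<sigma> n)\<bar> \<le> B" "x \<in> {0..T} \<Longrightarrow> \<bar>snd (\<sigma> n) x\<bar> \<le> B" for n x
    using \<sigma> B assms(2) by (auto simp: image_subset_iff)
  obtain r z where r: "strict_mono (r :: nat \<Rightarrow> nat)" "z \<in> sols" "limitin RX.mtopology (\<sigma> \<circ> r) z sequentially"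
    by (rule sols_limitin_subsequence[OF \<sigma>B])
  have "z \<in> Y"
    using limitin_closedin[OF r(3) assms(1)] \<sigma> by (auto simp: image_subset_iff)
  then show "\<exists>l r. l \<in> Y \<and> strict_mono r \<and> limitin RX.mtopology (\<sigma> \<circ> r) l sequentially"
    using r by blast
qed

text \<open>Urysohn's function made of the two distances, scaled to height
  \<open>\<Lambda>\<close>.\<close>

lemma clip_01_infdist:
  fixes A B :: "'a::metric_space set"
  assumes "closed A" "closed B" "A \<noteq> {}" "B \<noteq> {}" "A \<inter> B = {}" "\<Lambda> \<ge> 0"
  obtains \<tau> :: "'a \<Rightarrow> real" where "continuous_on UNIV \<tau>" "\<And>z. \<tau> z \<in> {0..\<Lambda>}"
    "\<And>z. z \<in> A \<Longrightarrow> \<tau> z = \<Lambda>" "\<And>z. z \<in> B \<Longrightarrow> \<tau> z = 0"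
proof -
  have pos: "infdist z A + infdist z B > 0" for z
  proof -
    have "infdist z A > 0 \<or> infdist z B > 0"
      using in_closed_iff_infdist_zero[OF assms(1,3), of z] in_closed_iff_infdist_zero[OF assms(2,4), of z]
        assms(5) infdist_nonneg[of z A] infdist_nonneg[of z B] by fastforce
    then show ?thesis
      using infdist_nonneg[of z A] infdist_nonneg[of z B] by linarith
  qed
  show ?thesis
  proof (rule that[of "\<lambda>z. \<Lambda> * (infdist z B / (infdist z A + infdist z B))"])
    show "continuous_on UNIV (\<lambda>z. \<Lambda> * (infdist z B / (infdist z A + infdist z B)))"
      using pos by (intro continuous_intros) (auto simp: less_imp_neq[THEN not_sym])
    fix z
    have "infdist z B / (infdist z A + infdist z B) \<in> {0..1}"
      using pos[of z] infdist_nonneg[of z A] infdist_nonneg[of z B] by auto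
    moreover have "\<Lambda> * c \<in> {0..\<Lambda>}" if "c \<in> {0..1}" for c
      using that assms(6) by (simp add: mult_left_le)
    ultimately show "\<Lambda> * (infdist z B / (infdist z A + infdist z B)) \<in> {0..\<Lambda>}"
      by blast
    show "\<Lambda> * (infdist z B / (infdist z A + infdist z B)) = \<Lambda>" if "z \<in> A"
      using that pos[of z] by simp
    show "\<Lambda> * (infdist z B / (infdist z A + infdist z B)) = 0" if "z \<in> B"
      using that by simp
  qed
qed

text \<open>If the branch had a bounded component, one could separate off a compact piece \<open>A\<close>. The function
  \<open>\<tau>\<close>, equal to \<open>\<Lambda>\<close> on \<open>A\<close> and on the trivial solutions up to \<open>\<mu>\<close> and to \<open>0\<close> on the rest, would then
  yield a solution with \<open>l = \<tau> (l, u)\<close>, which exists by Schauder's theorem but lies in neither piece.\<close>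

lemma no_compact_piece:
  assumes AB: "closedin RX.mtopology A" "closedin RX.mtopology B" "pos_branch = A \<union> B" "A \<inter> B = {}"
    and pt: "(\<mu>, \<lambda>_. 0) \<in> A" and bd: "RX.mbounded A"
  shows False
proof -
  obtain K where "K > 0" and K0: "\<forall>z\<in>A. \<bar>fst z\<bar> \<le> K \<and> (\<forall>x\<in>{0..T}. \<bar>snd z x\<bar> \<le> K)"
    using mbounded_RX_sup[OF bd] by blast
  have K: "K > 0" "z \<in> A \<Longrightarrow> \<bar>fst z\<bar> \<le> K" "z \<in> A \<Longrightarrow> x \<in> {0..T} \<Longrightarrow> \<bar>snd z x\<bar> \<le> K" for z x
    using \<open>K > 0\<close> K0 by auto
  \<comment> \<open>Above every parameter value in \<open>A\<close> and above \<open>\<mu>\<close>: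
    reaching \<open>l = \<Lambda>\<close> must be impossible both on \<open>A\<close> and at
    \<open>u = 0\<close>.\<close>
  define \<Lambda> where "\<Lambda> = max K \<mu> + 1"
  define R where "R = K + 1"
  have \<Lambda>: "\<Lambda> > 0" "\<Lambda> > \<mu>" "\<Lambda> > K" and R: "R > 0" "R > K"
    using K(1) \<mu>_pos by (auto simp: \<Lambda>_def R_def)
  have sub: "A \<subseteq> sols" "B \<subseteq> sols"
    using AB(3) pos_branch_sols by auto
  have norm_emb: "norm (ext T (snd z)) \<le> K" if "z \<in> A" for z
  proof (rule norm_bound)
    fix x
    have "continuous_on {0..T} (snd z)"
      using sols_continuous[of "fst z" "snd z"] that sub by auto
    then show "norm (ext T (snd z) x) \<le> K"
      using K(3)[OF that, of "clp T x"] clp_in[of T x] T_pos by (simp add: ext_apply)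
  qed
  \<comment> \<open>The segment is included because the limit may vanish identically, and then only
    \<open>l \<le> \<mu>\<close> is known. The functions of norm at least \<open>R\<close> go into
    \<open>B0\<close>, so that large limits have \<open>l = 0\<close>; this excludes them and makes
    the truncation at \<open>R\<close> inactive.\<close>
  define A0 :: "(real \<times> (real \<Rightarrow>\<^sub>C real)) set" where "A0 = emb ` A \<union> {0..\<mu>} \<times> {0}"
  define B0 :: "(real \<times> (real \<Rightarrow>\<^sub>C real)) set" where "B0 = emb ` B \<union> {z. norm (snd z) \<ge> R}"
  have "closed A0"
    unfolding A0_def by (intro closed_Un closed_emb AB sub closed_Times) auto
  moreover have "closed B0"
    unfolding B0_def by (intro closed_Un closed_emb AB sub closed_Collect_le continuous_intros)
  moreover have "A0 \<noteq> {}"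
    using pt by (auto simp: A0_def)
  moreover have "B0 \<noteq> {}"
  proof -
    have "R \<le> norm (const_bcontfun R :: real \<Rightarrow>\<^sub>C real)"
      using norm_bounded[of "const_bcontfun R :: real \<Rightarrow>\<^sub>C real" 0] R by simp
    then have "(0, const_bcontfun R) \<in> B0"
      by (simp add: B0_def)
    then show ?thesis by blast
  qed
  moreover have "A0 \<inter> B0 = {}"
  proof -
    have 1: "emb y \<notin> B0" if y: "y \<in> A" for y
    proof -
      have "emb y \<noteq> emb z" if "z \<in> B" for z
        using emb_inj[of y z] y that sub AB(4) by blast
      moreover have "norm (snd (emb y)) < R"
        using norm_emb[OF y] R by (simp add: emb_def)
      ultimately show ?thesis
        by (auto simp: B0_def)
    qed
    \<comment> \<open>The only trivial solution in the branch is the bifurcation point, and that one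
      lies in \<open>A\<close>.\<close>
    have 2: "(l, 0) \<notin> B0" for l
    proof
      assume "(l, 0) \<in> B0"
      then obtain z where z: "z \<in> B" "emb z = (l, 0)"
        using R(1) by (auto simp: B0_def)
      have "ext T (\<lambda>_. 0) = 0"
        using T_pos by (intro bcontfun_eqI) (simp add: ext_apply)
      then have "emb z = emb (l, \<lambda>_. 0)"
        using z(2) by (simp add: emb_def)
      then have "z = (l, \<lambda>_. 0)"
        using emb_inj[OF _ zero_sols] z(1) sub(2) by blast
      then have "z = (\<mu>, \<lambda>_. 0)"
        using z(1) AB(3) pos_branch_zero_iff by blast
      then show False
        using pt AB(4) z(1) by blast
    qed
    show ?thesis
      using 1 2 by (auto simp: A0_def)
  qed
  ultimately obtain \<tau> :: "real \<times> (real \<Rightarrow>\<^sub>C real) \<Rightarrow> real" where \<tau>: "continuous_on UNIV \<tau>" "\<And>z. \<tau> z \<in> {0..\<Lambda>}"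
    "\<And>z. z \<in> A0 \<Longrightarrow> \<tau> z = \<Lambda>" "\<And>z. z \<in> B0 \<Longrightarrow> \<tau> z = 0"
    using clip_01_infdist[of A0 B0 \<Lambda>] \<Lambda>(1) by auto
  define F where "F x s l = - ((q x - l * m x) * phi p s - g x s l)" for x s l
  have cF: "continuous_on ({0..T} \<times> UNIV \<times> UNIV) (\<lambda>(x, s, l). F x s l)"
    using continuous_on_minus[OF continuous_on_rhs_triple] by (simp add: F_def split_beta)
  obtain C l u V ls us Vs es where C: "C > 0" and es: "\<And>n::nat. es n > 0" "es \<longlonglongrightarrow> 0"
    and ls: "\<And>n. ls n \<in> {0..\<Lambda>}" "ls \<longlonglongrightarrow> l" "l \<in> {0..\<Lambda>}" and l: "l = \<tau> (l, ext T u)"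
    and Sn: "\<And>n. psys T p (\<lambda>x. C * excess R (us n x) - F x (clp R (us n x)) (ls n) - es n) (us n) (Vs n)"
    and pos: "\<And>n x. x \<in> {0..T} \<Longrightarrow> us n x > 0" and lim: "uniform_limit {0..T} us u sequentially"
    and S: "psys T p (\<lambda>x. C * excess R (u x) - F x (clp R (u x)) l) u V"
    and nonneg: "\<And>x. x \<in> {0..T} \<Longrightarrow> u x \<ge> 0"
    by (rule perturbed_problem_limit[OF p_gt_1 T_pos less_imp_le[OF \<Lambda>(1)] R(1) cF _ \<tau>(1,2)])
      (simp add: F_def g_zero, blast)
  have cu: "continuous_on {0..T} u"
    using psysD(5)[OF S] .
  have T0: "0 \<le> T"
    using T_pos by simp
  have "norm (ext T u) < R"
  proof (rule ccontr)
    assume *: "\<not> norm (ext T u) < R"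
    then have "l = 0"
      using l \<tau>(4) by (simp add: B0_def)
    have S0: "psys T p (\<lambda>x. C * excess R (u x) + q x * phi p (clp R (u x))) u V"
      by (rule psys_cong[OF S]) (simp add: F_def \<open>l = 0\<close> g_at_0)
    have "norm (ext T u) \<le> 0"
      using truncated_solution_at_0[OF S0 C R(1) nonneg] clp_in[OF T0]
      by (intro norm_bound) (simp add: ext_apply[OF T0 cu])
    then show False
      using * R(1) by simp
  qed
  moreover have "u x \<le> norm (ext T u)" if "x \<in> {0..T}" for x
    using norm_bounded[of "ext T u" x] ext_apply_in[OF T0 cu that] by simp
  ultimately have uR: "u x < R" if "x \<in> {0..T}" for x
    using that by (meson le_less_trans)
  define u0 where "u0 x = (if x \<in> {0..T} then u x else 0)" for x
  have u0: "u0 x = u x" if "x \<in> {0..T}" for x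
    using that by (simp add: u0_def)
  have out: "u0 x = 0" if "x \<notin> {0..T}" for x
    unfolding u0_def using that by (rule if_not_P)
  have "psys T p (rhs l u0) u0 V"
    unfolding psys_def
  proof (intro conjI ballI)
    fix x assume x: "x \<in> {0..T}"
    show "(u0 has_real_derivative phi (conj_exp p) (V x)) (at x within {0..T})"
      by (rule has_field_derivative_transform[OF x psysD(1)[OF S x] u0])
    show "(V has_real_derivative rhs l u0 x) (at x within {0..T})"
      using psysD(2)[OF S x] u0[OF x] uR[OF x] nonneg[OF x]
      by (simp add: rhs_def F_def excess_eq_0 clp_id)
  qed (use psysD(3,4)[OF S] u0[of 0] u0[of T] T_pos in auto)
  then have zs: "(l, u0) \<in> sols"
    unfolding solutions_iff using out by blast
  have emb_u0: "emb (l, u0) = (l, ext T u)"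
    using ext_cong[OF T0 u0] by (simp add: emb_def)
  consider "\<forall>x\<in>{0..T}. u0 x > 0" | "u0 = (\<lambda>_. 0)"
    using solution_nonneg_dichotomy[OF zs] nonneg u0 by auto
  then show False
  proof cases
    case 1
    have "l \<noteq> 0"
      using solution_at_0[of u0] zs 1 T_pos by force
    then have "(l, u0) \<in> A \<union> B"
      using AB(3) ls(3) zs 1 by (auto simp: pos_branch_def)
    moreover have "(l, u0) \<notin> B"
      using \<tau>(4)[of "(l, ext T u)"] l \<open>l \<noteq> 0\<close> emb_u0 unfolding B0_def by force
    moreover have "(l, u0) \<notin> A"
    proof
      assume A: "(l, u0) \<in> A"
      then have "l = \<Lambda>"
        using \<tau>(3)[of "(l, ext T u)"] l emb_u0 unfolding A0_def by force
      then show False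
        using K(2)[OF A] \<Lambda>(3) by simp
    qed
    ultimately show ?thesis
      by blast
  next
    case 2
    then have u_0: "u x = 0" if "x \<in> {0..T}" for x
      using u0[OF that] by simp
    have "(l - \<mu>) * mass w \<le> \<eta> * integral {0..T} (\<lambda>x. \<bar>w x\<bar> powr p)" if \<eta>: "\<eta> > 0" for \<eta>
    proof -
      obtain \<delta> where \<delta>: "\<delta> > 0"
        "\<And>x s l. x \<in> {0..T} \<Longrightarrow> \<bar>l\<bar> \<le> \<Lambda> \<Longrightarrow> \<bar>s\<bar> < \<delta> \<Longrightarrow> \<bar>g x s l\<bar> \<le> \<eta> * \<bar>s\<bar> powr (p - 1)"
        using g_small_bound[OF \<eta>] by blast
      have "\<forall>\<^sub>F n in sequentially. \<forall>x\<in>{0..T}. dist (us n x) (u x) < min \<delta> R"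
        using \<delta>(1) R(1) by (intro uniform_limitD[OF lim]) auto
      then have ev: "\<forall>\<^sub>F n in sequentially. (ls n - \<mu>) * mass w \<le> \<eta> * integral {0..T} (\<lambda>x. \<bar>w x\<bar> powr p)"
      proof eventually_elim
        case (elim n)
        have small: "us n x < \<delta>" "us n x < R" if "x \<in> {0..T}" for x
        proof -
          have "dist (us n x) (u x) < min \<delta> R"
            using elim that by blast
          then show "us n x < \<delta>" "us n x < R"
            using u_0[OF that] pos[OF that, of n] by (auto simp: dist_real_def)
        qed
        have cn: "continuous_on {0..T} (us n)"
          using psysD(5)[OF Sn] .
        have "continuous_on {0..T} (\<lambda>x. (x, us n x, ls n))"
          by (intro continuous_intros cn)
        moreover have "(\<lambda>x. (x, us n x, ls n)) ` {0..T} \<subseteq> {0..T} \<times> UNIV \<times> UNIV"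
          by auto
        ultimately have cG: "continuous_on {0..T} (\<lambda>x. g x (us n x) (ls n))"
          using continuous_on_compose2[OF g_cont, of "{0..T}" "\<lambda>x. (x, us n x, ls n)"] by simp
        have Sn': "psys T p (\<lambda>x. (q x - ls n * m x) * phi p (us n x) - g x (us n x) (ls n) - es n) (us n) (Vs n)"
        proof (rule psys_cong[OF Sn])
          fix x assume x: "x \<in> {0..T}"
          have "us n x \<in> {0..R}"
            using small(2)[OF x] pos[OF x, of n] by simp
          then show "C * excess R (us n x) - F x (clp R (us n x)) (ls n) - es n
              = (q x - ls n * m x) * phi p (us n x) - g x (us n x) (ls n) - es n"
            by (simp add: F_def excess_eq_0 clp_id)
        qed
        have Gn: "\<bar>g x (us n x) (ls n)\<bar> \<le> \<eta> * phi p (us n x)" if x: "x \<in> {0..T}" for x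
          using \<delta>(2)[OF x, of "ls n" "us n x"] ls(1)[of n] small(1)[OF x] pos[OF x, of n]
          by (simp add: phi_nonneg_eq)
        show ?case
          by (rule perturbed_upper_bound[OF w Sn' pos less_imp_le[OF es(1)] cG Gn])
      qed
      have "(\<lambda>n. (ls n - \<mu>) * mass w) \<longlonglongrightarrow> (l - \<mu>) * mass w"
        by (intro tendsto_intros ls(2))
      then show ?thesis
        using ev by (rule tendsto_upperbound) simp
    qed
    note bound = this
    have "mass w > 0"
      using eigen_mass_pos[OF w \<mu>_pos] .
    define I where "I = integral {0..T} (\<lambda>x. \<bar>w x\<bar> powr p)"
    have "(l - \<mu>) * mass w \<le> 0 + e" if "e > 0" for e
    proof -
      have "(l - \<mu>) * mass w \<le> e / (\<bar>I\<bar> + 1) * I"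
        unfolding I_def by (rule bound) (use that in auto)
      also have "\<dots> \<le> e / (\<bar>I\<bar> + 1) * (\<bar>I\<bar> + 1)"
        using that by (intro mult_left_mono) auto
      finally show ?thesis
        by simp
    qed
    then have "(l - \<mu>) * mass w \<le> 0"
      by (rule field_le_epsilon)
    then have "l \<le> \<mu>"
      using \<open>mass w > 0\<close> by (simp add: mult_le_0_iff)
    moreover have "ext T u = 0"
      using u_0 clp_in[OF T0] by (intro bcontfun_eqI) (simp add: ext_apply[OF T0 cu])
    ultimately have "(l, ext T u) \<in> A0"
      using ls(3) by (simp add: A0_def)
    then have "l = \<Lambda>"
      using \<tau>(3) l by simp
    then show False
      using \<open>l \<le> \<mu>\<close> \<Lambda>(2) by simp
  qed
qed

end

section \<open>The unbounded components of either sign\<close>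

context principal_bifurcation
begin

section \<open>Unboundedness of the positive component\<close>

definition pos_component :: "(real \<times> (real \<Rightarrow> real)) set" where
  "pos_component = connected_component_of_set (subtopology RX.mtopology pos_branch) (\<mu>, \<lambda>_. 0)"

lemma pos_branch_RX: "pos_branch \<subseteq> RX_space T p"
  using pos_branch_sols sols_RX by blast

lemma pos_component:
  shows "connectedin RX.mtopology pos_component" "pos_component \<subseteq> pos_branch" "(\<mu>, \<lambda>_. 0) \<in> pos_component"
    "\<And>D. connectedin RX.mtopology D \<Longrightarrow> D \<subseteq> pos_branch \<Longrightarrow> (\<mu>, \<lambda>_. 0) \<in> D \<Longrightarrow> D \<subseteq> pos_component"
proof -
  have "connectedin (subtopology RX.mtopology pos_branch) pos_component"
    unfolding pos_component_def by (rule connectedin_connected_component_of)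
  then show "connectedin RX.mtopology pos_component" "pos_component \<subseteq> pos_branch"
    by (auto simp: connectedin_subtopology)
  have "(\<mu>, \<lambda>_. 0) \<in> pos_branch"
    by (simp add: pos_branch_def)
  then show "(\<mu>, \<lambda>_. 0) \<in> pos_component"
    unfolding pos_component_def mem_Collect_eq connected_component_of_refl
    using zero_in_RX by simp
  show "D \<subseteq> pos_component"
    if "connectedin RX.mtopology D" "D \<subseteq> pos_branch" "(\<mu>, \<lambda>_. 0) \<in> D" for D
    unfolding pos_component_def
    using that by (intro connected_component_of_maximal) (auto simp: connectedin_subtopology)
qed

text \<open>A bounded component lies strictly inside some ball. In the part of the branch within
  that ball, which is compact, the cut-wire fence theorem separates the bifurcation point from the
  sphere, and the clopen set around the point contradicts \<open>no_compact_piece\<close>.\<close>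

lemma pos_component_unbounded: "\<not> RX.mbounded pos_component"
proof
  assume bd: "RX.mbounded pos_component"
  let ?o = "(0 :: real, \<lambda>_ :: real. 0 :: real)"
  have "RX.mbounded (insert ?o pos_component)"
    using bd zero_in_RX by (simp add: RX.mbounded_insert)
  then obtain \<rho>0 where \<rho>0: "\<And>z. z \<in> pos_component \<Longrightarrow> RX_dist T p q ?o z \<le> \<rho>0"
    unfolding RX.mbounded_alt by auto
  \<comment> \<open>One unit of room keeps the component away from the set \<open>E\<close> below,
    the branch points at distance exactly \<open>\<rho>\<close>.\<close>
  define \<rho> where "\<rho> = \<rho>0 + 1"
  define Y where "Y = pos_branch \<inter> RX.mcball ?o \<rho>"
  have Y: "closedin RX.mtopology Y" "Y \<subseteq> sols" "RX.mbounded Y" "Y \<subseteq> RX_space T p"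
    using closedin_pos_branch pos_branch_sols pos_branch_RX
    by (auto simp: Y_def intro: RX.mbounded_subset[OF RX.mbounded_mcball])
  let ?X = "subtopology RX.mtopology Y"
  have topY: "topspace ?X = Y"
    using Y(4) by auto
  define E where "E = Y - RX.mball ?o \<rho>"
  have pt: "(\<mu>, \<lambda>_. 0) \<in> Y"
    using pos_component(2,3) \<rho>0[OF pos_component(3)] zero_in_RX by (auto simp: Y_def \<rho>_def)
  have "separated_between ?X {(\<mu>, \<lambda>_. 0)} E"
  proof (rule cut_wire_fence_theorem_gen)
    show "compact_space ?X"
      using compactin_sols[OF Y(1-3)] by (simp add: compact_space_subtopology)
    show "Hausdorff_space ?X \<or> regular_space ?X \<or> normal_space ?X"
      by (simp add: Hausdorff_space_subtopology RX.Hausdorff_space_mtopology)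
    show "compactin ?X {(\<mu>, \<lambda>_. 0)}"
      using pt zero_in_X_space[OF p_gt_1 T_pos] by (simp add: compactin_subtopology)
    have "closedin RX.mtopology E"
      unfolding E_def using Y(1) by (intro closedin_diff) auto
    then show "closedin ?X E"
      by (rule closedin_subset_topspace) (simp add: E_def)
    fix D assume D: "connectedin ?X D"
    show "disjnt D {(\<mu>, \<lambda>_. 0)} \<or> disjnt D E"
    proof (rule ccontr)
      assume *: "\<not> (disjnt D {(\<mu>, \<lambda>_. 0)} \<or> disjnt D E)"
      then have "(\<mu>, \<lambda>_. 0) \<in> D"
        by (auto simp: disjnt_def)
      then have "D \<subseteq> pos_component"
        using D by (intro pos_component(4)) (auto simp: connectedin_subtopology Y_def)
      moreover obtain z where z: "z \<in> D" "z \<in> E"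
        using * by (auto simp: disjnt_def)
      ultimately have "RX_dist T p q ?o z \<le> \<rho>0"
        using \<rho>0 by blast
      then show False
        using z(2) Y(4) zero_in_RX by (auto simp: E_def \<rho>_def)
    qed
  qed
  then obtain A where A: "closedin ?X A" "openin ?X A" "(\<mu>, \<lambda>_. 0) \<in> A" "E \<subseteq> Y - A"
    unfolding separated_between topY by auto
  \<comment> \<open>Everything beyond the ball joins the side of the sphere. Both parts are closed,
    and \<open>A\<close> misses the second one because their common points could only lie in
    \<open>E\<close>.\<close>
  define B where "B = (Y - A) \<union> (pos_branch - RX.mball ?o \<rho>)"
  have AY: "A \<subseteq> Y"
    using closedin_subset[OF A(1)] topY by simp
  have "closedin ?X (Y - A)"
    using closedin_diff[OF closedin_topspace A(2)] topY by simp
  from closedin_trans_full[OF this Y(1)]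
  have "closedin RX.mtopology B"
    unfolding B_def by (rule closedin_Un[OF _ closedin_diff[OF closedin_pos_branch RX.openin_mball]])
  moreover have "closedin RX.mtopology A"
    by (rule closedin_trans_full[OF A(1) Y(1)])
  moreover have "pos_branch = A \<union> B"
  proof
    show "A \<union> B \<subseteq> pos_branch"
      using AY by (auto simp: B_def Y_def)
    show "pos_branch \<subseteq> A \<union> B"
    proof
      fix z assume z: "z \<in> pos_branch"
      then have "z \<in> Y \<or> z \<notin> RX.mball ?o \<rho>"
        using pos_branch_RX RX.mball_subset_mcball by (auto simp: Y_def)
      then show "z \<in> A \<union> B"
        using z by (auto simp: B_def)
    qed
  qed
  moreover have "A \<inter> B = {}"
    using A(4) AY by (auto simp: B_def E_def)
  moreover have "RX.mbounded A"
    using RX.mbounded_subset[OF Y(3) AY] .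
  ultimately show False
    using no_compact_piece[of A B] A(3) by blast
qed

text \<open>Otherwise the bifurcation point would be isolated in its own component, which would then
  be a single point and bounded. The branch is a component of the closure of the nontrivial
  solutions, so this puts its base point into that space.\<close>

lemma point_in_closure: "(\<mu>, \<lambda>_. 0) \<in> RX.mtopology closure_of (pos_branch - {(\<mu>, \<lambda>_. 0)})"
proof (rule ccontr)
  let ?pt = "(\<mu>, \<lambda>_ :: real. 0 :: real)"
  let ?Q = "RX.mtopology closure_of (pos_branch - {?pt})"
  assume *: "?pt \<notin> ?Q"
  have "pos_branch - {?pt} \<subseteq> ?Q"
    using pos_branch_RX by (intro closure_of_subset) auto
  then have "pos_component \<subseteq> {?pt} \<union> ?Q"
    using pos_component(2) by blast
  moreover have "closedin RX.mtopology {?pt}"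
    using closedin_t1_singleton[OF Hausdorff_imp_t1_space[OF RX.Hausdorff_space_mtopology]] zero_in_RX by simp
  moreover have "closedin RX.mtopology ?Q"
    by simp
  ultimately have "?Q \<inter> pos_component = {}"
    using pos_component(1,3) * unfolding connectedin_closedin by blast
  then have "pos_component \<subseteq> {?pt}"
    using \<open>pos_component \<subseteq> {?pt} \<union> ?Q\<close> by blast
  then have "RX.mbounded pos_component"
    using zero_in_RX by (auto intro: RX.mbounded_subset[of "{?pt}"] simp: RX.mbounded_insert)
  then show False
    using pos_component_unbounded by simp
qed

end

text \<open>A separation of the part in \<open>P\<close> extends to one of \<open>C\<close>: all of
  \<open>Q\<close> is added to the side that contains \<open>a\<close>. The sides remain disjoint
  because \<open>a\<close> is the only point where \<open>P\<close> and \<open>Q\<close> can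
  meet.\<close>

lemma connectedin_Int_piece:
  assumes C: "connectedin X C" and PQ: "closedin X P" "closedin X Q" "C \<subseteq> P \<union> Q" "P \<inter> Q \<subseteq> {a}" "a \<in> C" "a \<in> P"
  shows "connectedin X (C \<inter> P)"
  unfolding connectedin_closedin
proof (intro conjI notI)
  show "C \<inter> P \<subseteq> topspace X"
    using connectedin_subset_topspace[OF C] by blast
  have sep: False
    if E: "closedin X E1" "closedin X E2" "C \<inter> P \<subseteq> E1 \<union> E2" "E1 \<inter> E2 \<inter> (C \<inter> P) = {}" "a \<in> E1"
      "E2 \<inter> (C \<inter> P) \<noteq> {}" for E1 E2
  proof -
    have "closedin X ((E1 \<inter> P) \<union> Q)" "closedin X (E2 \<inter> P)"
      using E PQ by (auto intro: closedin_Un closedin_Int)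
    moreover have "C \<subseteq> ((E1 \<inter> P) \<union> Q) \<union> (E2 \<inter> P)"
      using E(3) PQ(3) by blast
    moreover have "((E1 \<inter> P) \<union> Q) \<inter> (E2 \<inter> P) \<inter> C = {}"
      using E(4,5) PQ(4,5,6) by blast
    moreover have "((E1 \<inter> P) \<union> Q) \<inter> C \<noteq> {}" "(E2 \<inter> P) \<inter> C \<noteq> {}"
      using E(5,6) PQ(5,6) by blast+
    ultimately show False
      using C unfolding connectedin_closedin by blast
  qed
  assume "\<exists>E1 E2. closedin X E1 \<and> closedin X E2 \<and> C \<inter> P \<subseteq> E1 \<union> E2 \<and> E1 \<inter> E2 \<inter> (C \<inter> P) = {} \<and>
      E1 \<inter> (C \<inter> P) \<noteq> {} \<and> E2 \<inter> (C \<inter> P) \<noteq> {}"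
  then obtain E1 E2 where E: "closedin X E1" "closedin X E2" "C \<inter> P \<subseteq> E1 \<union> E2" "E1 \<inter> E2 \<inter> (C \<inter> P) = {}"
      "E1 \<inter> (C \<inter> P) \<noteq> {}" "E2 \<inter> (C \<inter> P) \<noteq> {}"
    by blast
  then have "a \<in> E1 \<or> a \<in> E2"
    using PQ(5,6) by blast
  then show False
    using sep[of E1 E2] sep[of E2 E1] E by (auto simp: Un_commute Int_commute)
qed

text \<open>Serves both symmetries, the change of sign of \<open>u\<close> and that of
  \<open>l\<close>.\<close>

lemma (in Metric_space) isometric_involution:
  assumes h: "\<And>z. z \<in> M \<Longrightarrow> h z \<in> M" "\<And>z. z \<in> M \<Longrightarrow> h (h z) = z" "\<And>y z. y \<in> M \<Longrightarrow> z \<in> M \<Longrightarrow> d (h y) (h z) = d y z"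
  shows "homeomorphic_maps mtopology mtopology h h"
    "S \<subseteq> M \<Longrightarrow> mbounded (h ` S) \<longleftrightarrow> mbounded S"
proof -
  have "continuous_map mtopology mtopology h"
    unfolding metric_continuous_map[OF Metric_space_axioms] using h by (auto intro!: exI)
  then show "homeomorphic_maps mtopology mtopology h h"
    using h by (simp add: homeomorphic_maps_def)
  have *: "mbounded (h ` S)" if "mbounded S" "S \<subseteq> M" for S
  proof -
    obtain B where B: "\<And>x y. x \<in> S \<Longrightarrow> y \<in> S \<Longrightarrow> d x y \<le> B"
      using \<open>mbounded S\<close> unfolding mbounded_alt by blast
    have "d a b \<le> B" if "a \<in> h ` S" "b \<in> h ` S" for a b
      using that B h(3) \<open>S \<subseteq> M\<close> by (auto simp: subset_iff)
    moreover have "h ` S \<subseteq> M"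
      using h(1) \<open>S \<subseteq> M\<close> by blast
    ultimately show ?thesis
      unfolding mbounded_alt by blast
  qed
  show "mbounded (h ` S) \<longleftrightarrow> mbounded S" if S: "S \<subseteq> M"
  proof -
    have "h ` h ` S = S"
      using h(2) S by (force simp: image_iff)
    moreover have "h ` S \<subseteq> M"
      using h(1) S by blast
    ultimately show ?thesis
      using *[of S] *[of "h ` S"] S by auto
  qed
qed

lemma uniform_limit_eventually_pos:
  fixes f :: "nat \<Rightarrow> real \<Rightarrow> real"
  assumes "uniform_limit {a..b} f h sequentially" "continuous_on {a..b} h" "a \<le> b" "\<And>x. x \<in> {a..b} \<Longrightarrow> h x > 0"
  shows "\<forall>\<^sub>F n in sequentially. \<forall>x\<in>{a..b}. f n x > 0"
proof -
  obtain y where y: "y \<in> {a..b}" "\<And>x. x \<in> {a..b} \<Longrightarrow> h y \<le> h x"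
    using continuous_attains_inf[of "{a..b}" h] assms(2,3) by auto
  from uniform_limitD[OF assms(1) assms(4)[OF y(1)]] show ?thesis
  proof eventually_elim
    case (elim n)
    show ?case
    proof
      fix x assume x: "x \<in> {a..b}"
      have "dist (f n x) (h x) < h y"
        using elim x by blast
      then show "f n x > 0"
        using y(2)[OF x] by (auto simp: dist_real_def)
    qed
  qed
qed

section \<open>Negative solutions and the separation of the unsigned ones\<close>

definition flip :: "real \<times> (real \<Rightarrow> real) \<Rightarrow> real \<times> (real \<Rightarrow> real)" where
  "flip z = (fst z, \<lambda>x. - snd z x)"

lemma flip_flip [simp]: "flip (flip z) = z"
  by (simp add: flip_def)

context weighted_problem
begin

lemma X_space_minus: "u \<in> X_space T p \<Longrightarrow> (\<lambda>x. - u x) \<in> X_space T p"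
  using X_space_linear[OF p_gt_1 T_pos, of u u "-1" 0] by simp

lemma flip_isometry:
  shows "homeomorphic_maps RX.mtopology RX.mtopology flip flip"
    "S \<subseteq> RX_space T p \<Longrightarrow> RX.mbounded (flip ` S) \<longleftrightarrow> RX.mbounded S"
proof -
  have *: "flip z \<in> RX_space T p" if "z \<in> RX_space T p" for z
    using that X_space_minus by (auto simp: flip_def)
  have **: "RX_dist T p q (flip y) (flip z) = RX_dist T p q y z" for y z
    unfolding RX_dist_eq using X_norm_minus[of "\<lambda>x. snd y x - snd z x"] by (simp add: flip_def)
  show "homeomorphic_maps RX.mtopology RX.mtopology flip flip"
    "S \<subseteq> RX_space T p \<Longrightarrow> RX.mbounded (flip ` S) \<longleftrightarrow> RX.mbounded S"
    using RX.isometric_involution[of flip] * ** by auto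
qed

end

context principal_bifurcation
begin

definition neg_branch :: "(real \<times> (real \<Rightarrow> real)) set" where
  "neg_branch = insert (\<mu>, \<lambda>_. 0) {(l, u). (l, u) \<in> sols \<and> l > 0 \<and> (\<forall>x\<in>{0..T}. u x < 0)}"

text \<open>The linear part of the equation is odd in \<open>u\<close>, so the change of sign alters
  only \<open>g\<close>, while \<open>\<mu>\<close> and \<open>w\<close> carry over.\<close>

lemma flipped_problem: "principal_bifurcation T p q m (\<lambda>x s l. - g x (- s) l) \<mu> w W"
proof unfold_locales
  have "continuous_on ({0..T} \<times> UNIV \<times> UNIV) (\<lambda>z :: real \<times> real \<times> real. (fst z, - fst (snd z), snd (snd z)))"
    by (intro continuous_intros)
  moreover have "(\<lambda>z. (fst z, - fst (snd z), snd (snd z))) ` ({0..T} \<times> UNIV \<times> UNIV) \<subseteq> {0..T} \<times> UNIV \<times> UNIV"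
    by auto
  ultimately have "continuous_on ({0..T} \<times> UNIV \<times> UNIV) (\<lambda>z. g (fst z) (- fst (snd z)) (snd (snd z)))"
    using continuous_on_compose2[OF g_cont] by fastforce
  then show "continuous_on ({0..T} \<times> UNIV \<times> UNIV) (\<lambda>(x, s, l). - g x (- s) l)"
    by (simp add: split_beta continuous_on_minus)
  show "- g x (- s) 0 = 0" if "x \<in> {0..T}" for x s
    using g_at_0[OF that] by simp
  fix L :: "real set" assume "bounded L"
  show "uniform_limit ({0..T} \<times> L) (\<lambda>s (x, l). - g x (- s) l / \<bar>s\<bar> powr (p - 1)) (\<lambda>_. 0) (at 0)"
    unfolding uniform_limit_iff
  proof (intro allI impI)
    fix e :: real assume "e > 0"
    obtain d where d: "d > 0" "\<And>s. s \<noteq> 0 \<Longrightarrow> dist s 0 < d \<Longrightarrow>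
        \<forall>z\<in>{0..T} \<times> L. dist (case z of (x, l) \<Rightarrow> g x s l / \<bar>s\<bar> powr (p - 1)) 0 < e"
      using uniform_limitD[OF g_small[OF \<open>bounded L\<close>] \<open>e > 0\<close>] unfolding eventually_at by auto
    have "\<forall>z\<in>{0..T} \<times> L. dist (case z of (x, l) \<Rightarrow> - g x (- s) l / \<bar>s\<bar> powr (p - 1)) 0 < e"
      if "s \<noteq> 0" "dist s 0 < d" for s
      using d(2)[of "- s"] that by (auto simp: split_beta)
    then show "\<forall>\<^sub>F s in at 0. \<forall>z\<in>{0..T} \<times> L. dist (case z of (x, l) \<Rightarrow> - g x (- s) l / \<bar>s\<bar> powr (p - 1)) 0 < e"
      unfolding eventually_at using d(1) by auto
  qed
qed (use w \<mu>_pos in auto)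

lemma flip_sols:
  assumes "z \<in> sols"
  shows "flip z \<in> solutions T p q m (\<lambda>x s l. - g x (- s) l)"
proof -
  interpret F: principal_bifurcation T p q m "\<lambda>x s l. - g x (- s) l" \<mu> w W
    by (rule flipped_problem)
  obtain l u where z: "z = (l, u)"
    by (cases z)
  obtain V where V: "psys T p (rhs l u) u V" and out: "\<And>x. x \<notin> {0..T} \<Longrightarrow> u x = 0"
    using assms unfolding z solutions_iff by blast
  have "psys T p (F.rhs l (\<lambda>x. - u x)) (\<lambda>x. - u x) (\<lambda>x. - V x)"
    unfolding psys_def
  proof (intro conjI ballI)
    fix x assume x: "x \<in> {0..T}"
    show "((\<lambda>x. - u x) has_real_derivative phi (conj_exp p) (- V x)) (at x within {0..T})"
      using DERIV_minus[OF psysD(1)[OF V x]] by simp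
    have "F.rhs l (\<lambda>x. - u x) x = - rhs l u x"
      by (simp add: rhs_def F.rhs_def)
    then show "((\<lambda>x. - V x) has_real_derivative F.rhs l (\<lambda>x. - u x) x) (at x within {0..T})"
      using DERIV_minus[OF psysD(2)[OF V x]] by simp
  qed (use psysD(3,4)[OF V] in auto)
  then show ?thesis
    unfolding flip_def z fst_conv snd_conv F.solutions_iff using out by auto
qed

lemma nontrivial_eq: "nontrivial_solutions T p q m g = {z \<in> sols. snd z \<noteq> (\<lambda>_. 0)}"
  by (auto simp: nontrivial_solutions_def)

lemma neg_branch_sols: "neg_branch \<subseteq> sols"
  using zero_sols by (auto simp: neg_branch_def)

lemma pos_neg_Int: "pos_branch \<inter> neg_branch = {(\<mu>, \<lambda>_. 0)}"
  using T_pos by (force simp: pos_branch_def neg_branch_def)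

lemma pos_nontrivial: "pos_branch - {(\<mu>, \<lambda>_. 0)} \<subseteq> nontrivial_solutions T p q m g"
  using T_pos by (force simp: nontrivial_eq pos_branch_def)

lemma neg_nontrivial: "neg_branch - {(\<mu>, \<lambda>_. 0)} \<subseteq> nontrivial_solutions T p q m g"
  using T_pos by (force simp: nontrivial_eq neg_branch_def)

text \<open>Nontrivial solutions near \<open>(\<mu>, 0)\<close> have a sign, since the rescaled solutions converge to a
  multiple of the positive eigenfunction.\<close>

lemma unsigned_solutions_separated:
  assumes z: "z \<in> pos_branch \<union> neg_branch"
  shows "z \<notin> RX.mtopology closure_of (nontrivial_solutions T p q m g - (pos_branch \<union> neg_branch))"
proof
  assume "z \<in> RX.mtopology closure_of (nontrivial_solutions T p q m g - (pos_branch \<union> neg_branch))"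
  then obtain \<sigma> where \<sigma>: "range \<sigma> \<subseteq> nontrivial_solutions T p q m g - (pos_branch \<union> neg_branch)"
    and lim: "limitin RX.mtopology \<sigma> z sequentially"
    unfolding RX.closure_of_sequentially by auto
  have \<sigma>s: "\<sigma> n \<in> sols" "snd (\<sigma> n) \<noteq> (\<lambda>_. 0)" "\<sigma> n \<notin> pos_branch" "\<sigma> n \<notin> neg_branch" for n
    using \<sigma> by (auto simp: nontrivial_eq)
  note L = RX_limitinD[OF lim sols_RX[OF \<sigma>s(1)]]
  have T0: "0 \<le> T"
    using T_pos by simp
  have "fst z > 0"
    using z \<mu>_pos by (auto simp: pos_branch_def neg_branch_def)
  then have evl: "\<forall>\<^sub>F n in sequentially. fst (\<sigma> n) > 0"
    using L(2) by (intro order_tendstoD)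
  have no_pos: "\<not> (fst (\<sigma> n) > 0 \<and> (\<forall>x\<in>{0..T}. snd (\<sigma> n) x > 0))"
    and no_neg: "\<not> (fst (\<sigma> n) > 0 \<and> (\<forall>x\<in>{0..T}. - snd (\<sigma> n) x > 0))" for n
    using \<sigma>s[of n] by (cases "\<sigma> n"; force simp: pos_branch_def neg_branch_def)+
  have "z \<in> sols"
    using z pos_branch_sols neg_branch_sols by blast
  then have cz: "continuous_on {0..T} (snd z)"
    using sols_continuous[of "fst z" "snd z"] by simp
  consider "\<forall>x\<in>{0..T}. snd z x > 0" | "\<forall>x\<in>{0..T}. - snd z x > 0" | "z = (\<mu>, \<lambda>_. 0)"
    using z by (auto simp: pos_branch_def neg_branch_def)
  then show False
  proof cases
    case 1
    have "\<forall>\<^sub>F n in sequentially. \<forall>x\<in>{0..T}. snd (\<sigma> n) x > 0"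
      using uniform_limit_eventually_pos[OF L(4) cz T0] 1 by blast
    with evl have "\<forall>\<^sub>F n in sequentially. False"
      by eventually_elim (use no_pos in blast)
    then show False by simp
  next
    case 2
    have "\<forall>\<^sub>F n in sequentially. \<forall>x\<in>{0..T}. - snd (\<sigma> n) x > 0"
      using uniform_limit_eventually_pos[OF uniform_limit_uminus[OF L(4)] continuous_on_minus[OF cz] T0] 2 by blast
    with evl have "\<forall>\<^sub>F n in sequentially. False"
      by eventually_elim (use no_neg in blast)
    then show False by simp
  next
    case 3
    have 1: "(\<lambda>n. fst (\<sigma> n)) \<longlonglongrightarrow> \<mu>" and 2: "uniform_limit {0..T} (\<lambda>n. snd (\<sigma> n)) (\<lambda>_. 0) sequentially"
      using L(2,4) 3 by auto
    have S: "(fst (\<sigma> n), snd (\<sigma> n)) \<in> sols" for n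
      using \<sigma>s(1) by simp
    obtain r M v V where r: "strict_mono (r :: nat \<Rightarrow> nat)" and M: "\<And>n. M n > (0::real)" and E: "eigen \<mu> v V"
      and nz: "\<exists>x\<in>{0..T}. v x \<noteq> 0" and vlim: "uniform_limit {0..T} (\<lambda>n x. snd (\<sigma> (r n)) x / M n) v sequentially"
      by (rule normalized_limit[OF S \<sigma>s(2) 1 2]) blast
    obtain c where c: "\<And>x. x \<in> {0..T} \<Longrightarrow> v x = c * w x"
      using eigen_simple[OF w E] by blast
    have evr: "\<forall>\<^sub>F n in sequentially. fst (\<sigma> (r n)) > 0"
      using eventually_subseq[OF r evl] .
    have "c \<noteq> 0"
      using nz c by auto
    then consider "c > 0" | "c < 0"
      by linarith
    then show False
    proof cases
      case 1
      have "\<forall>\<^sub>F n in sequentially. \<forall>x\<in>{0..T}. snd (\<sigma> (r n)) x / M n > 0"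
        by (rule uniform_limit_eventually_pos[OF vlim eigen_continuous(1)[OF E] T0])
          (use 1 c w(2) in simp)
      from this evr have "\<forall>\<^sub>F n in sequentially. False"
      proof eventually_elim
        case (elim n)
        have "snd (\<sigma> (r n)) x > 0" if "x \<in> {0..T}" for x
          using bspec[OF elim(1) that] M[of n] by (simp add: zero_less_divide_iff)
        then show ?case
          using no_pos[of "r n"] elim(2) by blast
      qed
      then show False by simp
    next
      case 2
      have "\<forall>\<^sub>F n in sequentially. \<forall>x\<in>{0..T}. - (snd (\<sigma> (r n)) x / M n) > 0"
        by (rule uniform_limit_eventually_pos[OF uniform_limit_uminus[OF vlim]
              continuous_on_minus[OF eigen_continuous(1)[OF E]] T0])
          (use 2 c w(2) in \<open>simp add: mult_less_0_iff\<close>)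
      from this evr have "\<forall>\<^sub>F n in sequentially. False"
      proof eventually_elim
        case (elim n)
        have "- snd (\<sigma> (r n)) x > 0" if "x \<in> {0..T}" for x
          using bspec[OF elim(1) that] M[of n] by (simp add: divide_less_0_iff)
        then show ?case
          using no_neg[of "r n"] elim(2) by blast
      qed
      then show False by simp
    qed
  qed
qed

text \<open>The results for positive solutions of the flipped problem are carried back by the
  isometry \<open>flip\<close>. They are collected in one statement because the flipped problem is
  interpreted only inside the proof.\<close>

lemma negative_component:
  obtains D where "connectedin RX.mtopology D" "D \<subseteq> neg_branch" "(\<mu>, \<lambda>_. 0) \<in> D" "\<not> RX.mbounded D"
    "closedin RX.mtopology neg_branch"
    "neg_branch \<subseteq> RX.mtopology closure_of nontrivial_solutions T p q m g"
proof -
  interpret F: principal_bifurcation T p q m "\<lambda>x s l. - g x (- s) l" \<mu> w W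
    by (rule flipped_problem)
  have flip_F_sols: "flip z \<in> sols" if "z \<in> F.sols" for z
    using F.flip_sols[OF that] by simp
  have neg_eq: "neg_branch = flip ` F.pos_branch"
  proof
    show "flip ` F.pos_branch \<subseteq> neg_branch"
    proof
      fix y assume "y \<in> flip ` F.pos_branch"
      then obtain z where z: "z \<in> F.pos_branch" "y = flip z"
        by blast
      then show "y \<in> neg_branch"
        using flip_F_sols[of z] by (cases z) (auto simp: F.pos_branch_def neg_branch_def flip_def)
    qed
    show "neg_branch \<subseteq> flip ` F.pos_branch"
    proof
      fix y assume y: "y \<in> neg_branch"
      then have "flip y \<in> F.pos_branch"
        using flip_sols[of y] by (cases y) (auto simp: F.pos_branch_def neg_branch_def flip_def)
      then show "y \<in> flip ` F.pos_branch"
        by (metis flip_flip imageI)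
    qed
  qed
  have hom: "homeomorphic_map RX.mtopology RX.mtopology flip"
    using flip_isometry(1) by (auto simp: homeomorphic_map_maps)
  have compRX: "F.pos_component \<subseteq> RX_space T p"
    using F.pos_component(2) F.pos_branch_RX by blast
  let ?pt = "(\<mu>, \<lambda>_ :: real. 0 :: real)"
  have flip_pt: "flip ?pt = ?pt"
    by (simp add: flip_def)
  show ?thesis
  proof (rule that)
    show "connectedin RX.mtopology (flip ` F.pos_component)"
      using homeomorphic_map_connectedness[OF hom] compRX F.pos_component(1) by simp
    show "flip ` F.pos_component \<subseteq> neg_branch"
      using F.pos_component(2) neg_eq by blast
    show "?pt \<in> flip ` F.pos_component"
      using F.pos_component(3) flip_pt by (metis imageI)
    show "\<not> RX.mbounded (flip ` F.pos_component)"
      using F.pos_component_unbounded flip_isometry(2)[OF compRX] by simp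
    show "closedin RX.mtopology neg_branch"
      unfolding neg_eq using homeomorphic_map_closedness[OF hom] F.pos_branch_RX F.closedin_pos_branch by simp
    have "?pt \<in> flip ` (RX.mtopology closure_of (F.pos_branch - {?pt}))"
      using F.point_in_closure flip_pt by (metis imageI)
    also have "\<dots> = RX.mtopology closure_of (flip ` (F.pos_branch - {?pt}))"
      using homeomorphic_map_closure_of[OF hom, of "F.pos_branch - {?pt}"] F.pos_branch_RX by auto
    also have "\<dots> \<subseteq> RX.mtopology closure_of nontrivial_solutions T p q m g"
    proof (rule closure_of_mono)
      show "flip ` (F.pos_branch - {?pt}) \<subseteq> nontrivial_solutions T p q m g"
      proof
        fix y assume "y \<in> flip ` (F.pos_branch - {?pt})"
        then obtain z where z: "z \<in> F.pos_branch" "z \<noteq> ?pt" "y = flip z"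
          by blast
        then have "y \<in> neg_branch" "y \<noteq> ?pt"
          using neg_eq flip_pt flip_flip by (blast, metis)
        then show "y \<in> nontrivial_solutions T p q m g"
          using neg_nontrivial by blast
      qed
    qed
    finally have "?pt \<in> RX.mtopology closure_of nontrivial_solutions T p q m g" .
    moreover note neg_nontrivial
    moreover have "nontrivial_solutions T p q m g \<subseteq> RX.mtopology closure_of nontrivial_solutions T p q m g"
      using sols_RX by (intro closure_of_subset) (auto simp: nontrivial_eq)
    ultimately show "neg_branch \<subseteq> RX.mtopology closure_of nontrivial_solutions T p q m g"
      by blast
  qed
qed

end

context principal_bifurcation
begin

section \<open>The structure of the branch at the positive eigenvalue\<close>

lemma lambda0_Plus: "lambda0 T p q m Plus = \<mu>"
  by (rule lambda0_eq(1)[OF w \<mu>_pos])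

lemma branch_Plus_structure:
  "\<exists>C. C Plus \<noteq> C Minus \<and>
    (\<forall>\<sigma>. continuum T p q (C \<sigma>) \<and> \<not> RX_bounded T p q (C \<sigma>) \<and> C \<sigma> \<subseteq> sols) \<and>
    branch T p q m g Plus = C Plus \<union> C Minus \<and>
    (\<forall>\<sigma>. C \<sigma> \<subseteq> K_cone T p \<sigma> \<union> {(lambda0 T p q m Plus, \<lambda>_. 0)})"
proof -
  let ?pt = "(\<mu>, \<lambda>_ :: real. 0 :: real)"
  let ?N = "nontrivial_solutions T p q m g"
  let ?S = "RX.mtopology closure_of ?N"
  obtain D where D: "connectedin RX.mtopology D" "D \<subseteq> neg_branch" "?pt \<in> D" "\<not> RX.mbounded D"
    and neg: "closedin RX.mtopology neg_branch" "neg_branch \<subseteq> ?S"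
    by (rule negative_component)
  have pt_S: "?pt \<in> ?S"
    using neg(2) by (auto simp: neg_branch_def)
  have "?N \<subseteq> ?S"
    using sols_RX by (intro closure_of_subset) (auto simp: nontrivial_eq)
  then have pos_S: "pos_branch \<subseteq> ?S"
    using pos_nontrivial pt_S by blast
  define Cb where "Cb = connected_component_of_set (subtopology RX.mtopology ?S) ?pt"
  have branch: "branch T p q m g Plus = Cb"
    unfolding branch_def Cb_def RX_topology_eq lambda0_Plus ..
  have "connectedin (subtopology RX.mtopology ?S) Cb"
    unfolding Cb_def by (rule connectedin_connected_component_of)
  then have Cb: "connectedin RX.mtopology Cb" "Cb \<subseteq> ?S"
    by (auto simp: connectedin_subtopology)
  have max: "E \<subseteq> Cb" if "connectedin RX.mtopology E" "E \<subseteq> ?S" "?pt \<in> E" for E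
    unfolding Cb_def using that by (intro connected_component_of_maximal) (auto simp: connectedin_subtopology)
  have closed_Cb: "closedin RX.mtopology Cb"
    using closedin_trans_full[OF closedin_connected_component_of closedin_closure_of] by (simp add: Cb_def)
  have Pos: "pos_component \<subseteq> Cb \<inter> pos_branch"
    using max[OF pos_component(1) _ pos_component(3)] pos_component(2) pos_S by blast
  have Neg: "D \<subseteq> Cb \<inter> neg_branch"
    using max[OF D(1) _ D(3)] D(2) neg(2) by blast
  have pt_Cb: "?pt \<in> Cb"
    using Pos pos_component(3) by blast
  \<comment> \<open>The closure is covered by the signed part \<open>?E\<close> and the closure
    \<open>?R\<close> of the remaining nontrivial solutions, two disjoint closed sets. A connected
    set that meets \<open>?E\<close> stays in it.\<close>
  let ?E = "pos_branch \<union> neg_branch"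
  let ?R = "RX.mtopology closure_of (?N - ?E)"
  have closed_E: "closedin RX.mtopology ?E"
    by (intro closedin_Un closedin_pos_branch neg(1))
  have "?S \<subseteq> RX.mtopology closure_of (?E \<union> (?N - ?E))"
    by (intro closure_of_mono) blast
  then have "?S \<subseteq> ?E \<union> ?R"
    by (simp only: closure_of_Un closure_of_eq[THEN iffD2, OF closedin_pos_branch] closure_of_eq[THEN iffD2, OF neg(1)])
  then have "Cb \<subseteq> ?E \<union> ?R"
    using Cb(2) by blast
  moreover have "?E \<inter> ?R = {}"
    using unsigned_solutions_separated by blast
  moreover have "?E \<inter> Cb \<noteq> {}"
    using Pos pos_component(3) by blast
  ultimately have "?R \<inter> Cb = {}"
    using Cb(1) closed_E closedin_closure_of[of RX.mtopology "?N - ?E"] unfolding connectedin_closedin by blast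
  then have Cb_E: "Cb \<subseteq> pos_branch \<union> neg_branch"
    using \<open>Cb \<subseteq> ?E \<union> ?R\<close> by blast
  \<comment> \<open>Traces of the branch rather than components of the signed parts: the union is
    then the branch at once, and \<open>connectedin_Int_piece\<close> supplies connectedness. The
    unbounded sets \<open>pos_component\<close> and \<open>D\<close> are contained in these
    traces.\<close>
  define C where "C \<sigma> = (case \<sigma> of Plus \<Rightarrow> Cb \<inter> pos_branch | Minus \<Rightarrow> Cb \<inter> neg_branch)" for \<sigma>
  have C: "C Plus = Cb \<inter> pos_branch" "C Minus = Cb \<inter> neg_branch"
    by (simp_all add: C_def)
  have unb: "\<not> RX.mbounded (C \<sigma>)" for \<sigma>
    using pos_component_unbounded D(4) RX.mbounded_subset[OF _ Pos] RX.mbounded_subset[OF _ Neg]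
    by (cases \<sigma>) (auto simp only: C)
  have cont: "continuum T p q (C \<sigma>)" for \<sigma>
  proof (cases \<sigma>)
    case Plus
    have "connectedin RX.mtopology (Cb \<inter> pos_branch)"
      by (rule connectedin_Int_piece[OF Cb(1) closedin_pos_branch neg(1) Cb_E _ pt_Cb])
        (simp add: pos_neg_Int, simp add: pos_branch_def)
    then show ?thesis
      using Plus C closed_Cb closedin_pos_branch by (simp add: continuum_def RX_topology_eq closedin_Int)
  next
    case Minus
    have "connectedin RX.mtopology (Cb \<inter> neg_branch)"
      by (rule connectedin_Int_piece[OF Cb(1) neg(1) closedin_pos_branch _ _ pt_Cb])
        (use Cb_E in blast, use pos_neg_Int in blast, simp add: neg_branch_def)
    then show ?thesis
      using Minus C closed_Cb neg(1) by (simp add: continuum_def RX_topology_eq closedin_Int)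
  qed
  have ne: "C Plus \<noteq> C Minus"
  proof
    assume "C Plus = C Minus"
    then have "C Plus \<subseteq> {?pt}"
      using pos_neg_Int C by blast
    moreover have "RX.mbounded {?pt}"
      using zero_in_RX by (simp add: RX.mbounded_insert)
    ultimately show False
      using unb[of Plus] RX.mbounded_subset by blast
  qed
  have cone_pos: "z \<in> K_cone T p Plus \<union> {?pt}" if "z \<in> pos_branch" for z
    using that sols_RX[of z] by (auto simp: pos_branch_def K_cone_def positive_functions_def)
  have cone_neg: "z \<in> K_cone T p Minus \<union> {?pt}" if z_neg: "z \<in> neg_branch" for z
  proof (cases "z = ?pt")
    case False
    then obtain l u where z: "z = (l, u)" "(l, u) \<in> sols" "\<And>x. x \<in> {0..T} \<Longrightarrow> u x < 0"
      using z_neg by (auto simp: neg_branch_def)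
    have "u \<in> X_space T p"
      using sols_RX[OF z(2)] by simp
    then have "(\<lambda>x. - u x) \<in> positive_functions T p"
      using X_space_minus z(3) by (simp add: positive_functions_def)
    then have "u \<in> P_cone T p Minus"
      by (simp, intro exI[of _ "\<lambda>x. - u x"]) simp
    then show ?thesis
      using z(1) by (simp add: K_cone_def)
  qed simp
  have "C \<sigma> \<subseteq> K_cone T p \<sigma> \<union> {?pt}" for \<sigma>
    using cone_pos cone_neg by (cases \<sigma>) (auto simp only: C Int_iff)
  moreover have "C \<sigma> \<subseteq> sols" for \<sigma>
    using pos_branch_sols neg_branch_sols by (cases \<sigma>) (auto simp only: C Int_iff)
  moreover have "Cb = C Plus \<union> C Minus"
    using Cb_E C by blast
  ultimately show ?thesis
    unfolding branch RX_bounded_eq lambda0_Plus using ne cont unb by (intro exI[of _ C]) simp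
qed

end

section \<open>The negative eigenvalue by reflection of the parameter\<close>

definition reflect :: "real \<times> (real \<Rightarrow> real) \<Rightarrow> real \<times> (real \<Rightarrow> real)" where
  "reflect z = (- fst z, snd z)"

lemma reflect_reflect [simp]: "reflect (reflect z) = z"
  by (simp add: reflect_def)

lemma inj_reflect: "inj reflect"
  by (rule inj_on_inverseI[of _ reflect]) simp

lemma reflect_image_iff: "(l, u) \<in> reflect ` S \<longleftrightarrow> (- l, u) \<in> S"
proof -
  have "(l, u) \<in> reflect ` S \<longleftrightarrow> reflect (l, u) \<in> S"
    by (metis imageE imageI reflect_reflect)
  then show ?thesis
    by (simp add: reflect_def)
qed

lemma solutions_reflect:
  "solutions T p q m g = reflect ` solutions T p q (\<lambda>x. - m x) (\<lambda>x s l. g x s (- l))"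
  by (simp add: set_eq_iff reflect_image_iff solutions_def add.commute)

lemma nontrivial_solutions_reflect:
  "nontrivial_solutions T p q m g = reflect ` nontrivial_solutions T p q (\<lambda>x. - m x) (\<lambda>x s l. g x s (- l))"
  using solutions_reflect[of T p q m g]
  by (simp add: set_eq_iff reflect_image_iff nontrivial_solutions_def)

lemma K_cone_reflect: "reflect ` K_cone T p \<sigma> = K_cone T p \<sigma>"
  by (simp add: set_eq_iff reflect_image_iff K_cone_def)

context weighted_problem
begin

lemma reflect_isometry:
  shows "homeomorphic_map RX.mtopology RX.mtopology reflect"
    "S \<subseteq> RX_space T p \<Longrightarrow> RX.mbounded (reflect ` S) \<longleftrightarrow> RX.mbounded S"
proof -
  have *: "reflect z \<in> RX_space T p" if "z \<in> RX_space T p" for z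
    using that by (auto simp: reflect_def)
  have **: "RX_dist T p q (reflect y) (reflect z) = RX_dist T p q y z" for y z
    unfolding RX_dist_eq by (simp add: reflect_def power2_commute)
  show "homeomorphic_map RX.mtopology RX.mtopology reflect"
    using RX.isometric_involution(1)[of reflect] * ** homeomorphic_map_maps by (metis reflect_reflect)
  show "S \<subseteq> RX_space T p \<Longrightarrow> RX.mbounded (reflect ` S) \<longleftrightarrow> RX.mbounded S"
    using RX.isometric_involution(2)[of reflect] * ** by auto
qed

text \<open>The least energy is attained by \<open>lambda0_eq\<close>, so its negative is a greatest
  element and not merely a supremum.\<close>

lemma lambda0_Minus_eq:
  assumes w: "eigen \<mu> w W" "\<And>x. x \<in> {0..T} \<Longrightarrow> w x > 0" and "\<mu> > 0"
  shows "lambda0 T p q (\<lambda>x. - m x) Minus = - \<mu>"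
proof -
  have eq: "(LINT x|lebesgue_on {0..T}. - (- m x) * \<bar>u x\<bar> powr p) = mass u" if "u \<in> X_space T p" for u
    using that W1pD(1) LINT_mass by (auto simp: X_space_def)
  show ?thesis
    unfolding lambda0.simps
  proof (rule Greatest_equality)
    show "- \<mu> \<in> {- (X_norm T p q u powr p) |u. u \<in> X_space T p \<and>
        (LINT x|lebesgue_on {0..T}. - (- m x) * \<bar>u x\<bar> powr p) = 1}"
      using lambda0_eq(2)[OF assms] eq by force
    fix y assume "y \<in> {- (X_norm T p q u powr p) |u. u \<in> X_space T p \<and>
        (LINT x|lebesgue_on {0..T}. - (- m x) * \<bar>u x\<bar> powr p) = 1}"
    then show "y \<le> - \<mu>"
      using lambda0_eq(3)[OF assms] eq by auto
  qed
qed

end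

lemma homeomorphic_map_component_in_closure:
  assumes "homeomorphic_map X X h" "N \<subseteq> topspace X" "a \<in> topspace X" "a \<in> X closure_of N"
  shows "connected_component_of_set (subtopology X (X closure_of (h ` N))) (h a)
    = h ` connected_component_of_set (subtopology X (X closure_of N)) a"
proof -
  have "homeomorphic_map (subtopology X (X closure_of N)) (subtopology X (X closure_of (h ` N))) h"
    using closure_of_subset_topspace[of X N] closure_of_subset_topspace[of X "h ` N"]
      homeomorphic_map_closure_of[OF assms(1,2)]
    by (intro homeomorphic_map_subtopologies[OF assms(1)]) (simp add: Int_absorb1)
  then show ?thesis
    using homeomorphic_map_connected_component_of assms(3,4) by fastforce
qed

theorem theorem4p3:
  fixes T p :: real
    and q m :: "real \<Rightarrow> real"
    and g :: "real \<Rightarrow> real \<Rightarrow> real \<Rightarrow> real"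
    and \<nu> :: sign
  assumes "T > 0" and "p > 1"
    and "continuous_on {0..T} q" and "\<forall>x \<in> {0..T}. q x \<ge> 0" and "\<exists>x \<in> {0..T}. q x \<noteq> 0"
    and "continuous_on {0..T} m" and "\<exists>x \<in> {0..T}. m x > 0" and "\<exists>x \<in> {0..T}. m x < 0"
    and "continuous_on ({0..T} \<times> UNIV \<times> UNIV) (\<lambda>(x, s, l). g x s l)"
    and "\<forall>x \<in> {0..T}. \<forall>s. g x s 0 = 0"
    and "\<And>L. bounded L \<Longrightarrow>
      uniform_limit ({0..T} \<times> L) (\<lambda>s (x, l). g x s l / \<bar>s\<bar> powr (p - 1)) (\<lambda>_. 0) (at 0)"
  shows "\<exists>C :: sign \<Rightarrow> (real \<times> (real \<Rightarrow> real)) set.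
    C Plus \<noteq> C Minus \<and>
    (\<forall>\<sigma>. continuum T p q (C \<sigma>) \<and> \<not> RX_bounded T p q (C \<sigma>) \<and> C \<sigma> \<subseteq> solutions T p q m g) \<and>
    branch T p q m g \<nu> = C Plus \<union> C Minus \<and>
    (\<forall>\<sigma>. C \<sigma> \<subseteq> K_cone T p \<sigma> \<union> {(lambda0 T p q m \<nu>, \<lambda>_. 0)})"
proof (cases \<nu>)
  case Plus
  interpret bifurcation_problem T p q m g
    using assms by unfold_locales auto
  obtain \<mu> w W where eig: "\<mu> > 0" "eigen \<mu> w W" "\<And>x. x \<in> {0..T} \<Longrightarrow> w x > 0"
    by (rule principal_eigen_exists) blast
  interpret principal_bifurcation T p q m g \<mu> w W
    using eig by unfold_locales auto
  show ?thesis
    using branch_Plus_structure unfolding Plus .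
next
  case Minus
  \<comment> \<open>The locale asks for a point where the weight is positive; for \<open>- m\<close>
    this is a point where \<open>m\<close> is negative.\<close>
  let ?m = "\<lambda>x. - m x" and ?g = "\<lambda>x s l. g x s (- l)"
  interpret bifurcation_problem T p q ?m ?g
  proof unfold_locales
    have "continuous_on ({0..T} \<times> UNIV \<times> UNIV) (\<lambda>z :: real \<times> real \<times> real. (fst z, fst (snd z), - snd (snd z)))"
      by (intro continuous_intros)
    moreover have "(\<lambda>z. (fst z, fst (snd z), - snd (snd z))) ` ({0..T} \<times> UNIV \<times> UNIV) \<subseteq> {0..T} \<times> UNIV \<times> UNIV"
      by auto
    ultimately show "continuous_on ({0..T} \<times> UNIV \<times> UNIV) (\<lambda>(x, s, l). g x s (- l))"
      using continuous_on_compose2[OF assms(9)] by (fastforce simp: split_beta)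
    fix L :: "real set" assume "bounded L"
    then have "bounded (uminus ` L)"
      by simp
    note lim = assms(11)[OF this]
    show "uniform_limit ({0..T} \<times> L) (\<lambda>s (x, l). g x s (- l) / \<bar>s\<bar> powr (p - 1)) (\<lambda>_. 0) (at 0)"
    proof (rule uniform_limitI)
      fix e :: real assume "e > 0"
      from uniform_limitD[OF lim this]
      show "\<forall>\<^sub>F s in at 0. \<forall>z\<in>{0..T} \<times> L. dist (case z of (x, l) \<Rightarrow> g x s (- l) / \<bar>s\<bar> powr (p - 1)) 0 < e"
        by eventually_elim auto
    qed
  qed (use assms in \<open>auto intro: continuous_on_minus\<close>)
  obtain \<mu> w W where eig: "\<mu> > 0" "eigen \<mu> w W" "\<And>x. x \<in> {0..T} \<Longrightarrow> w x > 0"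
    by (rule principal_eigen_exists) blast
  interpret principal_bifurcation T p q ?m ?g \<mu> w W
    using eig by unfold_locales auto
  let ?pt = "(\<mu>, \<lambda>_ :: real. 0 :: real)"
  let ?N = "nontrivial_solutions T p q ?m ?g"
  note hom = reflect_isometry(1)
  have \<mu>: "lambda0 T p q m Minus = - \<mu>"
    using lambda0_Minus_eq[OF eig(2,3,1)] by simp
  have pt: "reflect ?pt = (- \<mu>, \<lambda>_. 0)"
    by (simp add: reflect_def)
  have "?pt \<in> RX.mtopology closure_of ?N"
    using point_in_closure closure_of_mono[OF pos_nontrivial] by blast
  moreover have "?N \<subseteq> RX_space T p"
    using sols_RX by (auto simp: nontrivial_eq)
  ultimately have "connected_component_of_set (subtopology RX.mtopology (RX.mtopology closure_of (reflect ` ?N))) (reflect ?pt)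
      = reflect ` connected_component_of_set (subtopology RX.mtopology (RX.mtopology closure_of ?N)) ?pt"
    using zero_in_RX by (intro homeomorphic_map_component_in_closure[OF hom]) simp_all
  then have branch: "branch T p q m g Minus = reflect ` branch T p q ?m ?g Plus"
    unfolding branch_def RX_topology_eq \<mu> lambda0_Plus nontrivial_solutions_reflect[of T p q m g] pt .
  obtain C where *: "C Plus \<noteq> C Minus \<and>
    (\<forall>\<sigma>. continuum T p q (C \<sigma>) \<and> \<not> RX_bounded T p q (C \<sigma>) \<and> C \<sigma> \<subseteq> sols) \<and>
    branch T p q ?m ?g Plus = C Plus \<union> C Minus \<and>
    (\<forall>\<sigma>. C \<sigma> \<subseteq> K_cone T p \<sigma> \<union> {(lambda0 T p q ?m Plus, \<lambda>_. 0)})"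
    by (rule exE[OF branch_Plus_structure])
  then have C: "C Plus \<noteq> C Minus" "\<And>\<sigma>. continuum T p q (C \<sigma>)" "\<And>\<sigma>. \<not> RX.mbounded (C \<sigma>)" "\<And>\<sigma>. C \<sigma> \<subseteq> sols"
    "branch T p q ?m ?g Plus = C Plus \<union> C Minus" "\<And>\<sigma>. C \<sigma> \<subseteq> K_cone T p \<sigma> \<union> {?pt}"
    unfolding RX_bounded_eq lambda0_Plus by simp_all
  have C_RX: "C \<sigma> \<subseteq> RX_space T p" for \<sigma>
    using C(4)[of \<sigma>] sols_RX by blast
  show ?thesis
  proof (intro exI[of _ "\<lambda>\<sigma>. reflect ` C \<sigma>"] conjI allI)
    show "reflect ` C Plus \<noteq> reflect ` C Minus"
      using C(1) by (simp add: inj_image_eq_iff inj_reflect)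
    fix \<sigma>
    show "continuum T p q (reflect ` C \<sigma>)"
      using C(2)[of \<sigma>] homeomorphic_map_closedness[OF hom] homeomorphic_map_connectedness[OF hom] C_RX[of \<sigma>]
      by (simp add: continuum_def RX_topology_eq)
    show "\<not> RX_bounded T p q (reflect ` C \<sigma>)"
      using C(3)[of \<sigma>] reflect_isometry(2)[OF C_RX] by (simp add: RX_bounded_eq)
    show "reflect ` C \<sigma> \<subseteq> solutions T p q m g"
      unfolding solutions_reflect[of T p q m g] by (rule image_mono[OF C(4)])
    show "reflect ` C \<sigma> \<subseteq> K_cone T p \<sigma> \<union> {(lambda0 T p q m \<nu>, \<lambda>_. 0)}"
      unfolding Minus \<mu> using image_mono[OF C(6)[of \<sigma>], of reflect] by (simp add: image_Un K_cone_reflect pt)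
  next
    show "branch T p q m g \<nu> = reflect ` C Plus \<union> reflect ` C Minus"
      using branch C(5) by (simp add: Minus image_Un)
  qed
qed

end
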